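(* Fix $\gamma\in(-1,1)$ and an integer $m\ge2$. Then any tensor field $f\in L^2_\gamma(\mathbb{D};S^m(T^*\mathbb{D}))$ decomposes uniquely in the form $$f=d^{-\gamma}\,\mathrm{d}^sq+L\lambda+\tilde f,$$ where $q\in H^{1,-\gamma}_0(\mathbb{D};S^{m-1}(T^*\mathbb{D}))\cap\ker\operatorname{tr}$, $\lambda\in L^2_\gamma(\mathbb{D};S^{m-2}(T^*\mathbb{D}))$ and $\tilde f\in L^2_\gamma(\mathbb{D};S^m_{\mathrm{tt}}(T^*\mathbb{D}))$.
   Context: $\mathbb{D}=\{z=x+iy\in\mathbb{C}:|z|\le 1\}$ with Euclidean metric $g=\mathrm{d}x^2+\mathrm{d}y^2$, $d(z)=1-|z|^2$; functions and tensors are complex-valued. $L^2_\gamma(\mathbb{D})=L^2(\mathbb{D},d^\gamma\,\mathrm{d}x\,\mathrm{d}y)$. $H^{1,\gamma}_0(\mathbb{D})$ is the completion of $C_c^\infty(\mathbb{D}^\circ)$ for $\|u\|^2=\|u\|^2_{L^2_\gamma}+\|\nabla u\|^2_{L^2_\gamma}$. $L^2_\gamma(\mathbb{D};S^m(T^*\mathbb{D}))$, $H^{1,\gamma}_0(\mathbb{D};S^m(T^*\mathbb{D}))$ are the symmetric covariant $m$-tensor fields with all components in $L^2_\gamma(\mathbb{D})$, resp. $H^{1,\gamma}_0(\mathbb{D})$ ($S^0$ means functions). $\mathrm{d}^s=\sigma\circ\nabla$ ($\nabla$ total covariant derivative, $\sigma$ symmetrization), extended to a bounded operator from $H^{1,-\gamma}_0(\mathbb{D};S^{m-1}(T^*\mathbb{D}))$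 to $L^2_{-\gamma}(\mathbb{D};S^m(T^*\mathbb{D}))$. $Lv=\sigma(g\otimes v)$ maps $m$-tensors to $(m+2)$-tensors. $\operatorname{tr}$ is the metric trace in two indices, on tensors of order $\ge2$; for tensors of order $1$ the condition of lying in $\ker\operatorname{tr}$ is vacuous. With $\partial=\frac12(\partial_x-i\partial_y)$, $\bar\partial=\frac12(\partial_x+i\partial_y)$, $$L^2_\gamma(\mathbb{D};S^m_{\mathrm{tt}}(T^*\mathbb{D}))=\{f_m\,\mathrm{d}z^m+f_{-m}\,\mathrm{d}\bar z^m:\ f_m\in L^2_\gamma(\mathbb{D})\cap\ker\bar\partial,\ f_{-m}\in L^2_\gamma(\mathbb{D})\cap\ker\partial\},$$ where the kernels consist of analytic, resp. antianalytic, functions on $\mathbb{D}^\circ$. *)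

theory Defs
  imports "HOL-Analysis.Analysis" "HOL-Combinatorics.Permutations"
begin

text \<open>The plane is the type \<^typ>\<open>complex\<close>. Functions on the disk are total functions on the plane
  whose values off the disk are irrelevant; elements of the weighted spaces are represented by
  functions, and equality in these spaces is equality almost everywhere.\<close>

definition disk :: "complex set" where
  "disk = cball 0 1"

definition dfun :: "complex \<Rightarrow> real" where
  "dfun z = 1 - (cmod z)\<^sup>2"

definition disk_measure :: "real \<Rightarrow> complex measure" where
  "disk_measure \<gamma> = density (lebesgue_on disk) (\<lambda>z. ennreal (dfun z powr \<gamma>))"

definition L2 :: "real \<Rightarrow> (complex \<Rightarrow> complex) set" where
  "L2 \<gamma> = {u. u \<in> borel_measurable (disk_measure \<gamma>) \<and>
               integrable (disk_measure \<gamma>) (\<lambda>z. (cmod (u z))\<^sup>2)}"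

text \<open>Only meaningful on \<^term>\<open>L2 \<gamma>\<close>, since the Bochner integral of a non-integrable function is 0.\<close>

definition L2norm :: "real \<Rightarrow> (complex \<Rightarrow> complex) \<Rightarrow> real" where
  "L2norm \<gamma> u = sqrt (\<integral>z. (cmod (u z))\<^sup>2 \<partial>disk_measure \<gamma>)"

datatype coord = CX | CY

fun coord_vec :: "coord \<Rightarrow> complex" where
  "coord_vec CX = 1"
| "coord_vec CY = \<i>"

definition partial :: "coord \<Rightarrow> (complex \<Rightarrow> complex) \<Rightarrow> complex \<Rightarrow> complex" where
  "partial i u z = frechet_derivative u (at z) (coord_vec i)"

fun iter_partial :: "coord list \<Rightarrow> (complex \<Rightarrow> complex) \<Rightarrow> complex \<Rightarrow> complex" where
  "iter_partial [] u = u"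
| "iter_partial (i # I) u = partial i (iter_partial I u)"

text \<open>Real differentiability of all iterated partial derivatives; this includes their continuity.\<close>

definition smooth :: "(complex \<Rightarrow> complex) \<Rightarrow> bool" where
  "smooth u \<longleftrightarrow> (\<forall>I z. iter_partial I u differentiable (at z))"

definition test_functions :: "(complex \<Rightarrow> complex) set" where
  "test_functions = {u. smooth u \<and> compact (closure {z. u z \<noteq> 0}) \<and>
                        closure {z. u z \<noteq> 0} \<subseteq> ball 0 1}"

definition H1norm :: "real \<Rightarrow> (complex \<Rightarrow> complex) \<Rightarrow> real" where
  "H1norm \<gamma> u = sqrt ((L2norm \<gamma> u)\<^sup>2 + (L2norm \<gamma> (partial CX u))\<^sup>2 + (L2norm \<gamma> (partial CY u))\<^sup>2)"

text \<open>The completion of the test functions in the norm \<^const>\<open>H1norm\<close>, realised inside \<^const>\<open>L2\<close>: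
  a Cauchy sequence is identified with its limit in \<^const>\<open>L2\<close>. The map from the abstract completion
  is injective, because the weight is bounded above and below on compact subsets of the open disk
  and hence the gradient is a closable operator.\<close>

definition H10_approx :: "real \<Rightarrow> (nat \<Rightarrow> complex \<Rightarrow> complex) \<Rightarrow> (complex \<Rightarrow> complex) \<Rightarrow> bool" where
  "H10_approx \<gamma> \<phi> u \<longleftrightarrow>
     (\<forall>n. \<phi> n \<in> test_functions) \<and>
     (\<forall>e>0. \<exists>N. \<forall>j\<ge>N. \<forall>k\<ge>N. H1norm \<gamma> (\<lambda>z. \<phi> j z - \<phi> k z) < e) \<and>
     (\<lambda>n. L2norm \<gamma> (\<lambda>z. \<phi> n z - u z)) \<longlonglongrightarrow> 0"

definition H10 :: "real \<Rightarrow> (complex \<Rightarrow> complex) set" where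
  "H10 \<gamma> = {u \<in> L2 \<gamma>. \<exists>\<phi>. H10_approx \<gamma> \<phi> u}"

text \<open>The continuous extension of the partial derivatives from test functions to \<^const>\<open>H10\<close>, with
  values in \<^const>\<open>L2\<close>. The limit exists by completeness and is unique up to null sets by
  closability; the choice operator picks a representative.\<close>

definition ext_partial :: "real \<Rightarrow> coord \<Rightarrow> (complex \<Rightarrow> complex) \<Rightarrow> complex \<Rightarrow> complex" where
  "ext_partial \<gamma> i u =
     (SOME v. v \<in> L2 \<gamma> \<and>
        (\<exists>\<phi>. H10_approx \<gamma> \<phi> u \<and> (\<lambda>n. L2norm \<gamma> (\<lambda>z. partial i (\<phi> n) z - v z)) \<longlonglongrightarrow> 0))"

text \<open>A complex-valued covariant \<open>m\<close>-tensor at a point is given by its components in the coordinates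
  \<open>(x, y)\<close>, indexed by the words of length \<open>m\<close> over \<^typ>\<open>coord\<close>. Components at words of any other
  length carry no information and are set to 0 in \<open>sym_tensors\<close>.\<close>

type_synonym tensor = "coord list \<Rightarrow> complex"

definition sym_tensors :: "nat \<Rightarrow> tensor set" where
  "sym_tensors m = {T. (\<forall>I. length I \<noteq> m \<longrightarrow> T I = 0) \<and>
     (\<forall>I p. length I = m \<and> p permutes {..<m} \<longrightarrow> T (permute_list p I) = T I)}"

definition symmetrize :: "tensor \<Rightarrow> tensor" where
  "symmetrize T I =
     (\<Sum>p\<in>{p. p permutes {..<length I}}. T (permute_list p I)) / fact (length I)"

definition metric_tensor :: tensor where
  "metric_tensor I = (if I = [CX, CX] \<or> I = [CY, CY] then 1 else 0)"

text \<open>The first argument is the order of the left factor.\<close>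

definition tensor_prod :: "nat \<Rightarrow> tensor \<Rightarrow> tensor \<Rightarrow> tensor" where
  "tensor_prod k S T I = S (take k I) * T (drop k I)"

definition Lop :: "tensor \<Rightarrow> tensor" where
  "Lop v = symmetrize (tensor_prod 2 metric_tensor v)"

definition tr :: "tensor \<Rightarrow> tensor" where
  "tr T I = T (CX # CX # I) + T (CY # CY # I)"

fun dz :: "coord \<Rightarrow> complex" where
  "dz CX = 1"
| "dz CY = \<i>"

fun dzbar :: "coord \<Rightarrow> complex" where
  "dzbar CX = 1"
| "dzbar CY = - \<i>"

definition covector_power :: "nat \<Rightarrow> (coord \<Rightarrow> complex) \<Rightarrow> tensor" where
  "covector_power m \<omega> I = (if length I = m then \<Prod>i\<leftarrow>I. \<omega> i else 0)"

type_synonym tensor_field = "complex \<Rightarrow> tensor"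

definition L2_sym :: "real \<Rightarrow> nat \<Rightarrow> tensor_field set" where
  "L2_sym \<gamma> m = {f. (\<forall>z\<in>disk. f z \<in> sym_tensors m) \<and>
                    (\<forall>I. length I = m \<longrightarrow> (\<lambda>z. f z I) \<in> L2 \<gamma>)}"

definition H10_sym :: "real \<Rightarrow> nat \<Rightarrow> tensor_field set" where
  "H10_sym \<gamma> m = {f. (\<forall>z\<in>disk. f z \<in> sym_tensors m) \<and>
                     (\<forall>I. length I = m \<longrightarrow> (\<lambda>z. f z I) \<in> H10 \<gamma>)}"

definition ker_tr :: "nat \<Rightarrow> tensor_field set" where
  "ker_tr k = {f. k \<ge> 2 \<longrightarrow> (AE z in lebesgue_on disk. \<forall>I. length I = k - 2 \<longrightarrow> tr (f z) I = 0)}"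

text \<open>The metric is flat, so the covariant derivative in the coordinates \<open>(x, y)\<close> is the array of
  partial derivatives of the components; the new index comes first.\<close>

definition nabla :: "real \<Rightarrow> tensor_field \<Rightarrow> tensor_field" where
  "nabla \<gamma> q z I = (case I of [] \<Rightarrow> 0 | i # J \<Rightarrow> ext_partial \<gamma> i (\<lambda>w. q w J) z)"

definition ds :: "real \<Rightarrow> tensor_field \<Rightarrow> tensor_field" where
  "ds \<gamma> q z = symmetrize (nabla \<gamma> q z)"

definition L2_tt :: "real \<Rightarrow> nat \<Rightarrow> tensor_field set" where
  "L2_tt \<gamma> m = {f. \<exists>a b.
      a \<in> L2 \<gamma> \<and> a holomorphic_on ball 0 1 \<and>
      b \<in> L2 \<gamma> \<and> (\<lambda>z. cnj (b z)) holomorphic_on ball 0 1 \<and>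
      f = (\<lambda>z I. a z * covector_power m dz I + b z * covector_power m dzbar I)}"

definition tt_decomposition ::
  "real \<Rightarrow> nat \<Rightarrow> tensor_field \<Rightarrow> tensor_field \<Rightarrow> tensor_field \<Rightarrow> tensor_field \<Rightarrow> bool" where
  "tt_decomposition \<gamma> m f q l h \<longleftrightarrow>
     q \<in> H10_sym (-\<gamma>) (m - 1) \<inter> ker_tr (m - 1) \<and>
     l \<in> L2_sym \<gamma> (m - 2) \<and>
     h \<in> L2_tt \<gamma> m \<and>
     (AE z in lebesgue_on disk. \<forall>I. length I = m \<longrightarrow>
        f z I = of_real (dfun z powr (-\<gamma>)) * ds (-\<gamma>) q z I + Lop (l z) I + h z I)"

end

theory Submission
  imports Defs "HOL-Complex_Analysis.Cauchy_Integral_Formula"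
begin

text \<open>Write \<open>\<partial>\<close> and \<open>\<partial>'\<close> for the Wirtinger derivatives, \<open>\<partial> = (\<partial>\<^sub>x - i \<partial>\<^sub>y)/2\<close> and
  \<open>\<partial>' = (\<partial>\<^sub>x + i \<partial>\<^sub>y)/2\<close>, also regarded as complex vectors, and \<open>d = 1 - |z|\<^sup>2\<close>.

  The tensor problem reduces to a scalar one by algebra. A symmetric tensor of order \<open>m\<close> is determined by its
  coefficients \<open>c\<^sub>k\<close>, its values on \<open>m - k\<close> copies of \<open>\<partial>\<close> and \<open>k\<close> copies of \<open>\<partial>'\<close>, or equivalently by the polynomial
  \<open>\<Sum>k. binomial(m,k) c\<^sub>k t^k\<close>, its value on \<open>m\<close> copies of \<open>\<partial> + t \<partial>'\<close>. In this picture \<open>L\<close> is multiplication by \<open>t\<close>, because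
  \<open>g(\<partial> + t \<partial>', \<partial> + t \<partial>') = t\<close>. A trace-free \<open>q\<close> of order \<open>m - 1\<close> has only the two extreme coefficients,
  \<open>q = u dz^(m-1) + v dzbar^(m-1)\<close>, and \<open>d\<^sup>s q\<close> has the polynomial \<open>(\<partial> + t \<partial>')(u + t^(m-1) v)\<close>. Comparing
  coefficients (\<open>decomposition_iff_coefs\<close>), the equation for \<open>f\<close> becomes \<open>f\<^sub>0 = d^(-\<gamma>) \<partial>u + a\<close> at \<open>k = 0\<close> and
  \<open>f\<^sub>m = d^(-\<gamma>) \<partial>'v + b\<close> at \<open>k = m\<close>, with \<open>a\<close> holomorphic and \<open>b\<close> antiholomorphic; each \<open>k\<close> in between
  determines one coefficient of \<open>\<lambda>\<close>, which enters with the nonzero factor \<open>k (m - k) / (m (m - 1))\<close>.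

  The scalar problem is to write a function in \<open>L2 \<gamma>\<close> uniquely as \<open>d^(-\<gamma>) \<partial>u + a\<close> with \<open>u\<close> in \<open>H10 (- \<gamma>)\<close> and
  \<open>a\<close> holomorphic; complex conjugation turns the equation for \<open>v\<close> and \<open>b\<close> into this one. Project orthogonally onto the
  closure of the functions \<open>d^(-\<gamma>) \<partial>\<phi>\<close> with \<open>\<phi>\<close> a test function. The weights cancel in the pairing, so the
  residual is annihilated by every \<open>\<partial>'\<phi>\<close> and is holomorphic by Weyl's lemma (\<open>weyl_lemma\<close>). The projection itself
  has the form \<open>d^(-\<gamma>) \<partial>u\<close> because, with \<open>s = - \<gamma> < 1\<close>, the norm of \<open>\<phi>\<close> in \<open>H10 s\<close> is at most a constant times the norm of
  \<open>\<partial>\<phi>\<close> in \<open>L2 s\<close> (\<open>a_priori_estimate\<close>): a sequence \<open>\<phi>\<^sub>n\<close> whose images converge is a Cauchy sequence. The same estimate gives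
  uniqueness, as holomorphic functions are orthogonal to all \<open>d^(-\<gamma>) \<partial>\<phi>\<close>.

  The estimate comes from two integrations by parts, which express the difference of the norms of
  \<open>\<partial>'\<phi>\<close> and \<open>\<partial>\<phi>\<close> through terms of order zero; the sign of \<open>s\<close> decides how these are absorbed. Weyl's lemma is
  proved by mollifying with \<open>\<tau>\<^sup>2 \<rho>(\<tau> w)\<close>, where \<open>\<rho>\<close> is a radial bump. The derivative of this kernel in the scale \<open>\<tau>\<close> is \<open>\<partial>'\<close>
  of a test function, so the mollification of a weakly holomorphic function does not change with the scale; letting
  \<open>\<tau>\<close> tend to infinity identifies it with the function.\<close>

section \<open>Square-integrable functions and orthogonal projection\<close>

definition sq_integrable :: "'a measure \<Rightarrow> ('a \<Rightarrow> complex) set" where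
  "sq_integrable M = {u \<in> borel_measurable M. integrable M (\<lambda>x. (cmod (u x))\<^sup>2)}"

definition sqnorm :: "'a measure \<Rightarrow> ('a \<Rightarrow> complex) \<Rightarrow> real" where
  "sqnorm M u = (\<integral>x. (cmod (u x))\<^sup>2 \<partial>M)"

lemma sq_integrableD: "u \<in> sq_integrable M \<Longrightarrow> u \<in> borel_measurable M" "u \<in> sq_integrable M \<Longrightarrow> integrable M (\<lambda>x. (cmod (u x))\<^sup>2)"
  by (auto simp: sq_integrable_def)

lemma sqnorm_nonneg [simp]: "0 \<le> sqnorm M u"
  by (simp add: sqnorm_def)

lemma cmod_add_sq_le: "(cmod (a + b))\<^sup>2 \<le> 2 * (cmod a)\<^sup>2 + 2 * (cmod b)\<^sup>2"
proof -
  have "(cmod (a + b))\<^sup>2 \<le> (cmod a + cmod b)\<^sup>2"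
    by (intro power_mono norm_triangle_ineq) auto
  also have "\<dots> \<le> 2 * (cmod a)\<^sup>2 + 2 * (cmod b)\<^sup>2"
    using sum_squares_bound[of "cmod a" "cmod b"] by (simp add: power2_sum)
  finally show ?thesis .
qed

lemma sq_integrable_add: assumes "u \<in> sq_integrable M" "v \<in> sq_integrable M" shows "(\<lambda>x. u x + v x) \<in> sq_integrable M"
proof -
  note [measurable] = sq_integrableD(1)[OF assms(1)] sq_integrableD(1)[OF assms(2)]
  have "integrable M (\<lambda>x. 2 * (cmod (u x))\<^sup>2 + 2 * (cmod (v x))\<^sup>2)"
    using assms by (auto simp: sq_integrable_def)
  then have "integrable M (\<lambda>x. (cmod (u x + v x))\<^sup>2)"
    by (rule Bochner_Integration.integrable_bound) (auto intro!: AE_I2 order_trans[OF cmod_add_sq_le])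
  then show ?thesis by (simp add: sq_integrable_def)
qed

lemma sq_integrable_cmult: assumes "u \<in> sq_integrable M" shows "(\<lambda>x. c * u x) \<in> sq_integrable M"
  using assms by (auto simp: sq_integrable_def norm_mult power_mult_distrib)

lemma sq_integrable_diff: assumes "u \<in> sq_integrable M" "v \<in> sq_integrable M" shows "(\<lambda>x. u x - v x) \<in> sq_integrable M"
  using sq_integrable_add[OF assms(1) sq_integrable_cmult[OF assms(2), of "-1"]] by simp

lemma sq_integrable_cnj: assumes "u \<in> sq_integrable M" shows "(\<lambda>x. cnj (u x)) \<in> sq_integrable M"
  using assms measurable_compose[OF sq_integrableD(1)[OF assms] borel_measurable_continuous_onI[of cnj]]
  by (auto simp: sq_integrable_def intro: continuous_intros)

lemma sq_integrable_zero: "(\<lambda>x. 0) \<in> sq_integrable M"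
  by (auto simp: sq_integrable_def)

lemma sq_integrable_cong_AE:
  assumes "u \<in> sq_integrable M" "AE x in M. u x = v x" "v \<in> borel_measurable M" shows "v \<in> sq_integrable M"
proof -
  note [measurable] = sq_integrableD(1)[OF assms(1)] assms(3)
  have "integrable M (\<lambda>x. (cmod (v x))\<^sup>2)"
    by (rule integrable_cong_AE_imp[OF sq_integrableD(2)[OF assms(1)]]) (use assms(2) in auto)
  then show ?thesis using assms(3) by (simp add: sq_integrable_def)
qed

lemma sq_integrable_mult_integrable:
  assumes "u \<in> sq_integrable M" "v \<in> sq_integrable M" shows "integrable M (\<lambda>x. u x * v x)"
proof -
  note [measurable] = sq_integrableD(1)[OF assms(1)] sq_integrableD(1)[OF assms(2)]
  have "integrable M (\<lambda>x. (cmod (u x))\<^sup>2 + (cmod (v x))\<^sup>2)"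
    using assms by (auto simp: sq_integrable_def)
  then show ?thesis
  proof (rule Bochner_Integration.integrable_bound)
    show "AE x in M. cmod (u x * v x) \<le> norm ((cmod (u x))\<^sup>2 + (cmod (v x))\<^sup>2)"
    proof (rule AE_I2)
      fix x
      show "cmod (u x * v x) \<le> norm ((cmod (u x))\<^sup>2 + (cmod (v x))\<^sup>2)"
        using sum_squares_bound[of "cmod (u x)" "cmod (v x)"]
          mult_nonneg_nonneg[of "cmod (u x)" "cmod (v x)"]
        unfolding norm_mult mult.assoc real_norm_def by linarith
    qed
  qed auto
qed

text \<open>For squared norms the triangle inequality holds up to a factor 2, already pointwise. No
  convergence argument below needs the sharp inequality.\<close>

lemma sqnorm_add_le:
  assumes "u \<in> sq_integrable M" "v \<in> sq_integrable M"
  shows "sqnorm M (\<lambda>x. u x + v x) \<le> 2 * sqnorm M u + 2 * sqnorm M v"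
proof -
  have "sqnorm M (\<lambda>x. u x + v x) \<le> (\<integral>x. 2 * (cmod (u x))\<^sup>2 + 2 * (cmod (v x))\<^sup>2 \<partial>M)"
    unfolding sqnorm_def
    by (rule integral_mono) (use assms sq_integrable_add[OF assms] cmod_add_sq_le in \<open>auto simp: sq_integrable_def\<close>)
  also have "\<dots> = 2 * sqnorm M u + 2 * sqnorm M v"
    using assms by (simp add: sqnorm_def sq_integrable_def)
  finally show ?thesis .
qed

lemma sqnorm_cmult: "sqnorm M (\<lambda>x. c * u x) = (cmod c)\<^sup>2 * sqnorm M u"
  by (simp add: sqnorm_def norm_mult power_mult_distrib)

lemma sqnorm_diff_le:
  assumes "u \<in> sq_integrable M" "v \<in> sq_integrable M"
  shows "sqnorm M (\<lambda>x. u x - v x) \<le> 2 * sqnorm M u + 2 * sqnorm M v"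
  using sqnorm_add_le[OF assms(1) sq_integrable_cmult[OF assms(2), of "-1"]] sqnorm_cmult[of M "-1" v] by simp

lemma sqnorm_diff_commute: "sqnorm M (\<lambda>x. u x - v x) = sqnorm M (\<lambda>x. v x - u x)"
  by (simp add: sqnorm_def norm_minus_commute)

text \<open>Integrate \<open>2 |u v| \<le> t |u|\<^sup>2 + |v|\<^sup>2 / t\<close> and take the optimal \<open>t\<close>; when the norm of \<open>u\<close>
  vanishes, a large \<open>t\<close> rules out a nonzero integral.\<close>

lemma sq_integrable_cauchy_schwarz:
  assumes "u \<in> sq_integrable M" "v \<in> sq_integrable M"
  shows "cmod (\<integral>x. u x * v x \<partial>M) \<le> sqrt (sqnorm M u) * sqrt (sqnorm M v)"
proof -
  note [measurable] = sq_integrableD(1)[OF assms(1)] sq_integrableD(1)[OF assms(2)]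
  have *: "2 * cmod (\<integral>x. u x * v x \<partial>M) \<le> t * sqnorm M u + sqnorm M v / t" if "t > 0" for t
  proof -
    have "2 * cmod (\<integral>x. u x * v x \<partial>M) \<le> 2 * (\<integral>x. cmod (u x * v x) \<partial>M)"
      by simp
    also have "\<dots> = (\<integral>x. 2 * cmod (u x * v x) \<partial>M)"
      by simp
    also have "\<dots> \<le> (\<integral>x. t * (cmod (u x))\<^sup>2 + (cmod (v x))\<^sup>2 / t \<partial>M)"
    proof (rule integral_mono)
      show "integrable M (\<lambda>x. 2 * cmod (u x * v x))"
        using sq_integrable_mult_integrable[OF assms] by auto
      show "integrable M (\<lambda>x. t * (cmod (u x))\<^sup>2 + (cmod (v x))\<^sup>2 / t)"
        using assms by (auto simp: sq_integrable_def)
      fix x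
      have "2 * (t * cmod (u x)) * cmod (v x) \<le> (t * cmod (u x))\<^sup>2 + (cmod (v x))\<^sup>2"
        by (rule sum_squares_bound)
      then show "2 * cmod (u x * v x) \<le> t * (cmod (u x))\<^sup>2 + (cmod (v x))\<^sup>2 / t"
        using that by (simp add: norm_mult field_simps power2_eq_square)
    qed
    also have "\<dots> = t * sqnorm M u + sqnorm M v / t"
      using assms by (simp add: sqnorm_def sq_integrable_def)
    finally show ?thesis .
  qed
  define C where "C = cmod (\<integral>x. u x * v x \<partial>M)"
  have C0: "C \<ge> 0" by (simp add: C_def)
  have "C\<^sup>2 \<le> sqnorm M u * sqnorm M v"
  proof (cases "sqnorm M u = 0")
    case True
    have "C \<le> 0"
    proof (rule ccontr)
      assume "\<not> C \<le> 0"
      then have c: "C > 0" by simp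
      have "2 * C \<le> sqnorm M v / ((sqnorm M v + 1) / C)"
        using *[of "(sqnorm M v + 1) / C"] True divide_pos_pos[OF add_nonneg_pos[OF sqnorm_nonneg[of M v] zero_less_one] c]
        unfolding C_def[symmetric] by (simp only: mult_zero_right add_0_left)
      also have "\<dots> = C * (sqnorm M v / (sqnorm M v + 1))" by simp
      also have "\<dots> \<le> C * 1" using c sqnorm_nonneg[of M v] by (intro mult_left_mono) (auto simp: divide_le_eq_1 add_nonneg_pos not_less add_nonneg_nonneg)
      finally show False using c by simp
    qed
    then show ?thesis using C0 True by simp
  next
    case False
    then have U: "sqnorm M u > 0" using sqnorm_nonneg[of M u] by linarith
    show ?thesis
    proof (cases "C = 0")
      case False
      then have c: "C > 0" using C0 by simp
      have "2 * C \<le> (C / sqnorm M u) * sqnorm M u + sqnorm M v / (C / sqnorm M u)"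
        using *[of "C / sqnorm M u"] c U unfolding C_def[symmetric] by simp
      then show ?thesis using c U by (simp add: field_simps power2_eq_square)
    qed auto
  qed
  then have "C \<le> sqrt (sqnorm M u * sqnorm M v)" using C0 real_le_rsqrt by blast
  then show ?thesis by (simp add: C_def real_sqrt_mult)
qed

lemma sq_integrable_tendsto_integral_mult:
  assumes "\<And>n. u n \<in> sq_integrable M" "v \<in> sq_integrable M" "w \<in> sq_integrable M"
    and "(\<lambda>n. sqnorm M (\<lambda>x. u n x - v x)) \<longlonglongrightarrow> 0"
  shows "(\<lambda>n. \<integral>x. u n x * w x \<partial>M) \<longlonglongrightarrow> (\<integral>x. v x * w x \<partial>M)"
proof -
  have "(\<lambda>n. (\<integral>x. u n x * w x \<partial>M) - (\<integral>x. v x * w x \<partial>M)) \<longlonglongrightarrow> 0"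
  proof (rule Lim_null_comparison)
    have "(\<integral>x. u n x * w x \<partial>M) - (\<integral>x. v x * w x \<partial>M) = (\<integral>x. (u n x - v x) * w x \<partial>M)" for n
      using sq_integrable_mult_integrable[OF assms(1,3)] sq_integrable_mult_integrable[OF assms(2,3)]
      by (simp add: left_diff_distrib)
    then show "\<forall>\<^sub>F n in sequentially. cmod ((\<integral>x. u n x * w x \<partial>M) - (\<integral>x. v x * w x \<partial>M))
        \<le> sqrt (sqnorm M (\<lambda>x. u n x - v x)) * sqrt (sqnorm M w)"
      using sq_integrable_cauchy_schwarz[OF sq_integrable_diff[OF assms(1,2)] assms(3)] by auto
    show "(\<lambda>n. sqrt (sqnorm M (\<lambda>x. u n x - v x)) * sqrt (sqnorm M w)) \<longlonglongrightarrow> 0"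
      using tendsto_mult_left_zero[OF tendsto_real_sqrt[OF assms(4), simplified]] by simp
  qed
  then show ?thesis by (simp add: LIM_zero_iff)
qed

lemma sqnorm_expand:
  assumes "u \<in> sq_integrable M" "v \<in> sq_integrable M"
  shows "sqnorm M (\<lambda>x. u x + v x) = sqnorm M u + sqnorm M v + 2 * Re (\<integral>x. u x * cnj (v x) \<partial>M)"
proof -
  have i: "integrable M (\<lambda>x. u x * cnj (v x))"
    by (rule sq_integrable_mult_integrable[OF assms(1) sq_integrable_cnj[OF assms(2)]])
  have eq: "(cmod (a + b))\<^sup>2 = (cmod a)\<^sup>2 + (cmod b)\<^sup>2 + 2 * Re (a * cnj b)" for a b
    unfolding cmod_power2 by (simp add: power2_eq_square algebra_simps)
  have "integrable M (\<lambda>x. (cmod (u x))\<^sup>2 + (cmod (v x))\<^sup>2)"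
    using assms by (simp add: sq_integrable_def)
  moreover have "integrable M (\<lambda>x. 2 * Re (u x * cnj (v x)))"
    using integrable_Re[OF i] by (rule integrable_mult_right)
  ultimately have "(\<integral>x. ((cmod (u x))\<^sup>2 + (cmod (v x))\<^sup>2) + 2 * Re (u x * cnj (v x)) \<partial>M)
      = (\<integral>x. (cmod (u x))\<^sup>2 + (cmod (v x))\<^sup>2 \<partial>M) + (\<integral>x. 2 * Re (u x * cnj (v x)) \<partial>M)"
    by (rule Bochner_Integration.integral_add)
  also have "(\<integral>x. (cmod (u x))\<^sup>2 + (cmod (v x))\<^sup>2 \<partial>M) = sqnorm M u + sqnorm M v"
    using assms by (simp add: sqnorm_def sq_integrable_def)
  also have "(\<integral>x. 2 * Re (u x * cnj (v x)) \<partial>M) = 2 * Re (\<integral>x. u x * cnj (v x) \<partial>M)"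
    unfolding integral_mult_right_zero integral_Re[OF i] ..
  finally show ?thesis unfolding sqnorm_def eq .
qed

lemma sqnorm_tendsto:
  assumes "\<And>n. u n \<in> sq_integrable M" "v \<in> sq_integrable M" "(\<lambda>n. sqnorm M (\<lambda>x. u n x - v x)) \<longlonglongrightarrow> 0"
  shows "(\<lambda>n. sqnorm M (u n)) \<longlonglongrightarrow> sqnorm M v"
proof -
  have "sqnorm M (u n) = sqnorm M v + sqnorm M (\<lambda>x. u n x - v x)
      + 2 * Re (\<integral>x. v x * cnj (u n x - v x) \<partial>M)" for n
    using sqnorm_expand[OF assms(2) sq_integrable_diff[OF assms(1) assms(2)], of n] by simp
  moreover have "(\<lambda>n. (\<integral>x. v x * cnj (u n x - v x) \<partial>M)) \<longlonglongrightarrow> 0"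
  proof -
    have "(\<lambda>n. (\<integral>x. cnj (u n x - v x) * v x \<partial>M)) \<longlonglongrightarrow> (\<integral>x. 0 * v x \<partial>M)"
      by (rule sq_integrable_tendsto_integral_mult)
        (use assms sq_integrable_cnj[OF sq_integrable_diff[OF assms(1) assms(2)]] sq_integrable_zero in \<open>auto simp: sqnorm_def simp flip: complex_cnj_diff\<close>)
    then show ?thesis by (simp add: mult.commute)
  qed
  ultimately show ?thesis
    using assms(3) by (auto intro!: tendsto_eq_intros)
qed

lemma sqnorm_eq_0_AE: assumes "u \<in> sq_integrable M" "sqnorm M u = 0" shows "AE x in M. u x = 0"
  using integral_nonneg_eq_0_iff_AE[of M "\<lambda>x. (cmod (u x))\<^sup>2"] assms by (auto simp: sq_integrable_def sqnorm_def)

lemma sq_integrable_limit_unique: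
  assumes "\<And>n. u n \<in> sq_integrable M" "v \<in> sq_integrable M" "w \<in> sq_integrable M"
    and "(\<lambda>n. sqnorm M (\<lambda>x. u n x - v x)) \<longlonglongrightarrow> 0" "(\<lambda>n. sqnorm M (\<lambda>x. u n x - w x)) \<longlonglongrightarrow> 0"
  shows "AE x in M. v x = w x"
proof -
  have "sqnorm M (\<lambda>x. v x - w x) \<le> 2 * sqnorm M (\<lambda>x. u n x - w x) + 2 * sqnorm M (\<lambda>x. u n x - v x)" for n
    using sqnorm_diff_le[OF sq_integrable_diff[OF assms(1)[of n] assms(3)] sq_integrable_diff[OF assms(1)[of n] assms(2)]] by simp
  moreover have "(\<lambda>n. 2 * sqnorm M (\<lambda>x. u n x - w x) + 2 * sqnorm M (\<lambda>x. u n x - v x)) \<longlonglongrightarrow> 0"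
    using assms(4,5) by (auto intro!: tendsto_eq_intros)
  ultimately have "sqnorm M (\<lambda>x. v x - w x) \<le> 0"
    by (intro LIMSEQ_le_const) auto
  then have "AE x in M. v x - w x = 0"
    by (intro sqnorm_eq_0_AE sq_integrable_diff assms) (simp add: order_antisym)
  then show ?thesis by auto
qed

text \<open>Along a subsequence whose increments have squared norms at most \<open>4^(-k)\<close>, the function
  \<open>\<Sum>k. 2^k |increment k|\<^sup>2\<close> is integrable, hence finite almost everywhere. By \<open>x \<le> 2^(-k) + 2^k x\<^sup>2\<close> the increments are
  absolutely summable at such points, and Fatou's lemma turns the pointwise limit into a limit in norm.\<close>

lemma sq_integrable_complete:
  assumes u: "\<And>n. u n \<in> sq_integrable M"
    and cau: "\<And>e. e > 0 \<Longrightarrow> \<exists>N. \<forall>j\<ge>N. \<forall>k\<ge>N. sqnorm M (\<lambda>x. u j x - u k x) < e"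
  obtains v where "v \<in> sq_integrable M" "(\<lambda>n. sqnorm M (\<lambda>x. u n x - v x)) \<longlonglongrightarrow> 0"
proof -
  note [measurable] = sq_integrableD(1)[OF u]
  have "\<exists>N. \<forall>k. (\<forall>i\<ge>N k. \<forall>j\<ge>N k. sqnorm M (\<lambda>x. u i x - u j x) < (1/4::real)^k) \<and> N k < N (Suc k)"
  proof (rule dependent_nat_choice)
    show "\<exists>x. \<forall>i\<ge>x. \<forall>j\<ge>x. sqnorm M (\<lambda>x. u i x - u j x) < (1/4)^0"
      using cau[of 1] by simp
    fix x :: nat and n
    obtain K where "\<forall>i\<ge>K. \<forall>j\<ge>K. sqnorm M (\<lambda>x. u i x - u j x) < (1/4)^(Suc n)"
      using cau[of "(1/4)^(Suc n)"] by auto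
    then show "\<exists>y. (\<forall>i\<ge>y. \<forall>j\<ge>y. sqnorm M (\<lambda>x. u i x - u j x) < (1/4)^(Suc n)) \<and> x < y"
      by (intro exI[of _ "max K (Suc x)"]) auto
  qed
  then obtain r where r: "\<And>k i j. i \<ge> r k \<Longrightarrow> j \<ge> r k \<Longrightarrow> sqnorm M (\<lambda>x. u i x - u j x) < (1/4::real)^k"
    and rS: "\<And>k. r k < r (Suc k)" by blast
  have sr: "strict_mono r" using rS by (simp add: strict_mono_Suc_iff)
  define D where "D k x = u (r (Suc k)) x - u (r k) x" for k x
  have Dm [measurable]: "D k \<in> borel_measurable M" for k unfolding D_def[abs_def] by measurable
  have DS: "D k \<in> sq_integrable M" for k unfolding D_def[abs_def] by (intro sq_integrable_diff u)
  have Dn: "sqnorm M (D k) \<le> (1/4)^k" for k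
    unfolding D_def[abs_def] using r[of k "r (Suc k)" "r k"] rS[of k] by (simp add: less_imp_le)
  have AEs: "AE x in M. summable (\<lambda>k. 2^k * (cmod (D k x))\<^sup>2)"
  proof -
    have "(\<integral>\<^sup>+x. (\<Sum>k. ennreal (2^k * (cmod (D k x))\<^sup>2)) \<partial>M) = (\<Sum>k. \<integral>\<^sup>+x. ennreal (2^k * (cmod (D k x))\<^sup>2) \<partial>M)"
      by (rule nn_integral_suminf) measurable
    also have "\<dots> = (\<Sum>k. ennreal (2^k * sqnorm M (D k)))"
      unfolding sqnorm_def
      by (subst nn_integral_eq_integral) (use sq_integrableD(2)[OF DS] in auto)
    also have "\<dots> \<le> (\<Sum>k. ennreal ((1/2)^k))"
    proof (intro suminf_le ennreal_leI)
      show "2 ^ k * sqnorm M (D k) \<le> (1/2)^k" for k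
      proof -
        have "2 ^ k * sqnorm M (D k) \<le> 2^k * (1/4)^k" by (intro mult_left_mono Dn) auto
        also have "\<dots> = (1/2::real)^k" by (simp flip: power_mult_distrib)
        finally show ?thesis .
      qed
    qed auto
    also have "\<dots> = ennreal (\<Sum>k. (1/2)^k)" by (rule suminf_ennreal2) (auto intro: summable_geometric)
    also have "\<dots> < \<infinity>" by simp
    finally have "AE x in M. (\<Sum>k. ennreal (2^k * (cmod (D k x))\<^sup>2)) \<noteq> \<infinity>"
      by (intro nn_integral_PInf_AE) auto
    then show ?thesis
      by eventually_elim (rule summable_suminf_not_top, auto)
  qed
  have AEc: "AE x in M. convergent (\<lambda>k. u (r k) x)"
    using AEs
  proof eventually_elim
    case (elim x)
    have "summable (\<lambda>k. (1/2)^k + 2^k * (cmod (D k x))\<^sup>2)"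
      by (intro summable_add elim summable_geometric) auto
    then have "summable (\<lambda>k. D k x)"
    proof (rule summable_comparison_test[rotated], intro exI allI impI)
      fix k :: nat
      have "2 * 1 * (2^k * cmod (D k x)) \<le> 1\<^sup>2 + (2^k * cmod (D k x))\<^sup>2" by (rule sum_squares_bound)
      then have "2^k * cmod (D k x) \<le> 1 + (2^k * cmod (D k x))\<^sup>2"
        using mult_nonneg_nonneg[of "2^k" "cmod (D k x)"] unfolding power_one mult_1_right
        by (smt (verit) norm_ge_zero zero_le_power)
      then have "2^k * cmod (D k x) \<le> 2^k * ((1/2)^k + 2^k * (cmod (D k x))\<^sup>2)"
        by (simp add: power2_eq_square algebra_simps power_divide)
      then show "cmod (D k x) \<le> (1/2)^k + 2^k * (cmod (D k x))\<^sup>2"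
        by (rule mult_left_le_imp_le) simp
    qed
    then have "convergent (\<lambda>n. \<Sum>k<n. D k x)" by (simp add: summable_iff_convergent)
    moreover have "(\<Sum>k<n. D k x) = u (r n) x - u (r 0) x" for n
      unfolding D_def by (rule sum_lessThan_telescope)
    ultimately have "convergent (\<lambda>n. (u (r n) x - u (r 0) x) + u (r 0) x)"
      by (intro convergent_add convergent_const) simp
    then show ?case by simp
  qed
  define v where "v x = lim (\<lambda>k. u (r k) x)" for x
  have vm [measurable]: "v \<in> borel_measurable M"
    unfolding v_def[abs_def] by (rule borel_measurable_lim_metric) auto
  have fat: "(\<integral>\<^sup>+x. ennreal ((cmod (u n x - v x))\<^sup>2) \<partial>M) \<le> ennreal e"
    if e: "\<And>k. k \<ge> K \<Longrightarrow> sqnorm M (\<lambda>x. u n x - u (r k) x) \<le> e" for n e K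
  proof -
    have "(\<integral>\<^sup>+x. ennreal ((cmod (u n x - v x))\<^sup>2) \<partial>M)
        = (\<integral>\<^sup>+x. liminf (\<lambda>k. ennreal ((cmod (u n x - u (r k) x))\<^sup>2)) \<partial>M)"
    proof (rule nn_integral_cong_AE)
      show "AE x in M. ennreal ((cmod (u n x - v x))\<^sup>2) = liminf (\<lambda>k. ennreal ((cmod (u n x - u (r k) x))\<^sup>2))"
        using AEc
      proof eventually_elim
        case (elim x)
        then have "(\<lambda>k. u (r k) x) \<longlonglongrightarrow> v x" by (simp add: v_def convergent_LIMSEQ_iff)
        then have "(\<lambda>k. ennreal ((cmod (u n x - u (r k) x))\<^sup>2)) \<longlonglongrightarrow> ennreal ((cmod (u n x - v x))\<^sup>2)"
          by (intro tendsto_intros)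
        then show ?case by (intro lim_imp_Liminf[symmetric]) auto
      qed
    qed
    also have "\<dots> \<le> liminf (\<lambda>k. \<integral>\<^sup>+x. ennreal ((cmod (u n x - u (r k) x))\<^sup>2) \<partial>M)"
      by (rule nn_integral_liminf) measurable
    also have "\<dots> = liminf (\<lambda>k. ennreal (sqnorm M (\<lambda>x. u n x - u (r k) x)))"
      unfolding sqnorm_def
      by (subst nn_integral_eq_integral) (use sq_integrableD(2)[OF sq_integrable_diff[OF u u]] in auto)
    also have "\<dots> \<le> liminf (\<lambda>k. ennreal e)"
      by (intro Liminf_mono) (use e in \<open>auto simp: eventually_sequentially intro!: exI[of _ K] ennreal_leI\<close>)
    also have "\<dots> = ennreal e" by (simp add: Liminf_const)
    finally show ?thesis .
  qed
  have diffS: "(\<lambda>x. u (r 0) x - v x) \<in> sq_integrable M"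
  proof -
    have "(\<integral>\<^sup>+x. ennreal ((cmod (u (r 0) x - v x))\<^sup>2) \<partial>M) \<le> ennreal 1"
      by (rule fat[of 0]) (use r[of 0 "r 0"] strict_mono_less_eq[OF sr] in \<open>auto intro!: less_imp_le\<close>)
    then have "integrable M (\<lambda>x. (cmod (u (r 0) x - v x))\<^sup>2)"
      by (intro integrableI_bounded) (auto simp: le_less_trans)
    then show ?thesis by (simp add: sq_integrable_def)
  qed
  have vS: "v \<in> sq_integrable M" using sq_integrable_diff[OF u[of "r 0"] diffS] by simp
  have lim: "(\<lambda>n. sqnorm M (\<lambda>x. u n x - v x)) \<longlonglongrightarrow> 0"
  proof (rule LIMSEQ_I)
    fix e :: real assume e: "e > 0"
    obtain N where N: "\<And>j k. j \<ge> N \<Longrightarrow> k \<ge> N \<Longrightarrow> sqnorm M (\<lambda>x. u j x - u k x) < e/2"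
      using cau[of "e/2"] e by auto
    have "sqnorm M (\<lambda>x. u n x - v x) \<le> e/2" if n: "n \<ge> N" for n
    proof -
      have "(\<integral>\<^sup>+x. ennreal ((cmod (u n x - v x))\<^sup>2) \<partial>M) \<le> ennreal (e/2)"
        by (rule fat[of N])
          (use N[OF n] seq_suble[OF sr] in \<open>meson less_imp_le order_trans\<close>)
      then have "ennreal (sqnorm M (\<lambda>x. u n x - v x)) \<le> ennreal (e/2)"
        unfolding sqnorm_def
        by (subst (asm) nn_integral_eq_integral) (use sq_integrableD(2)[OF sq_integrable_diff[OF u vS]] in auto)
      then show ?thesis using e by (simp add: ennreal_le_iff)
    qed
    then show "\<exists>no. \<forall>n\<ge>no. norm (sqnorm M (\<lambda>x. u n x - v x) - 0) < e"
      using e by (intro exI[of _ N]) fastforce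
  qed
  show ?thesis using that[OF vS lim] .
qed

text \<open>The function \<open>p\<close> is the orthogonal projection of \<open>f\<close> onto the closure of \<open>V\<close>: a minimizing sequence is a
  Cauchy sequence by the parallelogram law, and the residual is orthogonal to \<open>V\<close> because no perturbation of \<open>p\<close>
  along \<open>V\<close> decreases the distance.\<close>

lemma sq_integrable_projection:
  assumes f: "f \<in> sq_integrable M" and V: "V \<subseteq> sq_integrable M" "V \<noteq> {}"
    and add: "\<And>u v. u \<in> V \<Longrightarrow> v \<in> V \<Longrightarrow> (\<lambda>x. u x + v x) \<in> V"
    and scl: "\<And>c u. u \<in> V \<Longrightarrow> (\<lambda>x. c * u x) \<in> V"
  obtains g p where "\<And>n::nat. g n \<in> V" "p \<in> sq_integrable M" "(\<lambda>n. sqnorm M (\<lambda>x. g n x - p x)) \<longlonglongrightarrow> 0"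
    "\<And>w. w \<in> V \<Longrightarrow> (\<integral>x. (f x - p x) * cnj (w x) \<partial>M) = 0"
proof -
  define I where "I = (INF w\<in>V. sqnorm M (\<lambda>x. f x - w x))"
  have bdd: "bdd_below ((\<lambda>w. sqnorm M (\<lambda>x. f x - w x)) ` V)"
    by (rule bdd_belowI[of _ 0]) auto
  have I: "I \<le> sqnorm M (\<lambda>x. f x - w x)" if "w \<in> V" for w
    unfolding I_def by (rule cINF_lower[OF bdd that])
  have "\<exists>w\<in>V. sqnorm M (\<lambda>x. f x - w x) < I + 1 / real (Suc n)" for n
  proof -
    have "I < I + 1 / real (Suc n)" by simp
    then show ?thesis unfolding I_def by (subst (asm) cINF_less_iff[OF V(2) bdd]) auto
  qed
  then obtain g where g: "\<And>n. g n \<in> V" "\<And>n. sqnorm M (\<lambda>x. f x - g n x) < I + 1 / real (Suc n)"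
    by metis
  have gS: "g n \<in> sq_integrable M" for n using g(1) V by auto
  have par: "sqnorm M (\<lambda>x. a x - b x) = 2 * sqnorm M (\<lambda>x. f x - a x) + 2 * sqnorm M (\<lambda>x. f x - b x)
      - 4 * sqnorm M (\<lambda>x. f x - (1/2) * (a x + b x))" if a: "a \<in> sq_integrable M" and b: "b \<in> sq_integrable M" for a b
  proof -
    have eq: "(cmod (a x - b x))\<^sup>2 = 2 * (cmod (f x - a x))\<^sup>2 + 2 * (cmod (f x - b x))\<^sup>2
      - 4 * (cmod (f x - (1/2) * (a x + b x)))\<^sup>2" for x
      unfolding cmod_power2 by (simp add: power2_eq_square field_simps)
    show ?thesis unfolding sqnorm_def eq
      using sq_integrableD(2)[OF sq_integrable_diff[OF f a]] sq_integrableD(2)[OF sq_integrable_diff[OF f b]]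
        sq_integrableD(2)[OF sq_integrable_diff[OF f sq_integrable_cmult[OF sq_integrable_add[OF a b], of "1/2"]]]
      by simp
  qed
  have cl: "sqnorm M (\<lambda>x. g j x - g k x) \<le> 2 / real (Suc j) + 2 / real (Suc k)" for j k
  proof -
    have "I \<le> sqnorm M (\<lambda>x. f x - (1/2) * (g j x + g k x))"
      by (rule I[OF scl[OF add[OF g(1) g(1)]]])
    then show ?thesis using par[OF gS gS, of j k] g(2)[of j] g(2)[of k] by simp
  qed
  obtain p where p: "p \<in> sq_integrable M" "(\<lambda>n. sqnorm M (\<lambda>x. g n x - p x)) \<longlonglongrightarrow> 0"
  proof (rule sq_integrable_complete[of g M])
    fix e :: real assume "e > 0"
    then obtain N where N: "inverse (real (Suc N)) < e / 4" using reals_Archimedean[of "e/4"] by auto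
    have small: "2 / real (Suc j) < e / 2" if "j \<ge> N" for j
    proof -
      have "2 / real (Suc j) \<le> 2 * inverse (real (Suc N))"
        using that by (simp add: divide_simps)
      then show ?thesis using N by linarith
    qed
    then have "sqnorm M (\<lambda>x. g j x - g k x) < e" if "j \<ge> N" "k \<ge> N" for j k
      using small[OF that(1)] small[OF that(2)] cl[of j k] by linarith
    then show "\<exists>N. \<forall>j\<ge>N. \<forall>k\<ge>N. sqnorm M (\<lambda>x. g j x - g k x) < e" by blast
  qed (auto intro: gS)
  have fp: "(\<lambda>x. f x - p x) \<in> sq_integrable M" by (rule sq_integrable_diff[OF f p(1)])
  have conv: "(\<lambda>n. sqnorm M (\<lambda>x. f x - (g n x + w x))) \<longlonglongrightarrow> sqnorm M (\<lambda>x. f x - (p x + w x))"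
    if w: "w \<in> sq_integrable M" for w
    by (rule sqnorm_tendsto)
      (use w gS p f in \<open>auto intro!: sq_integrable_diff sq_integrable_add simp: sqnorm_diff_commute[of M p] algebra_simps\<close>)
  have Ip: "sqnorm M (\<lambda>x. f x - p x) \<le> I"
  proof -
    have 1: "(\<lambda>n. sqnorm M (\<lambda>x. f x - g n x)) \<longlonglongrightarrow> sqnorm M (\<lambda>x. f x - p x)"
      using conv[OF sq_integrable_zero] by simp
    have 2: "(\<lambda>n. I + 1 / real (Suc n)) \<longlonglongrightarrow> I + 0"
      by (intro tendsto_add tendsto_const) (use LIMSEQ_inverse_real_of_nat in \<open>simp add: field_simps\<close>)
    show ?thesis using LIMSEQ_le[OF 1 2] g(2) by (auto intro: less_imp_le)
  qed
  have orth: "(\<integral>x. (f x - p x) * cnj (w x) \<partial>M) = 0" if w: "w \<in> V" for w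
  proof -
    define c where "c = (\<integral>x. (f x - p x) * cnj (w x) \<partial>M)"
    define W where "W = sqnorm M w"
    define s where "s = 1 / (W + 1)"
    have W0: "W \<ge> 0" by (simp add: W_def)
    have wS: "w \<in> sq_integrable M" using w V by auto
    \<comment> \<open>Moving by this multiple of \<open>w\<close>, the first-order gain outweighs the second-order loss unless \<open>c = 0\<close>.\<close>
    define t where "t = of_real s * c"
    have tw: "(\<lambda>x. t * w x) \<in> sq_integrable M" by (rule sq_integrable_cmult[OF wS])
    have "I \<le> sqnorm M (\<lambda>x. f x - (g n x + t * w x))" for n
      by (rule I[OF add[OF g(1) scl[OF w]]])
    then have "I \<le> sqnorm M (\<lambda>x. f x - (p x + t * w x))"
      using conv[OF tw] by (intro LIMSEQ_le_const) auto
    also have "(\<lambda>x. f x - (p x + t * w x)) = (\<lambda>x. (f x - p x) + (- t) * w x)" by (auto simp: algebra_simps)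
    also have "sqnorm M \<dots> = sqnorm M (\<lambda>x. f x - p x) + (cmod t)\<^sup>2 * W
        + 2 * Re (\<integral>x. (f x - p x) * cnj (- t * w x) \<partial>M)"
      by (subst sqnorm_expand[OF fp sq_integrable_cmult[OF wS]]) (simp add: sqnorm_cmult[of M t] W_def sqnorm_def norm_mult power_mult_distrib)
    also have "(\<integral>x. (f x - p x) * cnj (- t * w x) \<partial>M) = (\<integral>x. (- cnj t) * ((f x - p x) * cnj (w x)) \<partial>M)"
      by (intro Bochner_Integration.integral_cong) auto
    also have "\<dots> = - cnj t * c" unfolding c_def by (rule integral_mult_right_zero)
    finally have "0 \<le> (cmod t)\<^sup>2 * W - 2 * Re (cnj t * c)" using Ip by simp
    also have "Re (cnj t * c) = s * (cmod c)\<^sup>2"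
      unfolding t_def cmod_power2 by (simp add: power2_eq_square algebra_simps)
    also have "(cmod t)\<^sup>2 = s\<^sup>2 * (cmod c)\<^sup>2"
      unfolding t_def by (simp add: norm_mult power_mult_distrib)
    finally have "0 \<le> s * (cmod c)\<^sup>2 * (s * W - 2)"
      by (simp add: algebra_simps power2_eq_square)
    moreover have "s * W - 2 < 0" "s > 0" unfolding s_def using W0 by (auto simp: field_simps)
    ultimately have "(cmod c)\<^sup>2 \<le> 0" by (smt (verit) mult_pos_neg mult_pos_pos)
    then show ?thesis unfolding c_def by simp
  qed
  show ?thesis using that[OF g(1) p orth] .
qed

section \<open>Symmetric tensors in complex coordinates\<close>

text \<open>In terms of the Wirtinger vectors, \<open>e\<^sub>x = \<partial> + \<partial>'\<close> and \<open>e\<^sub>y = i (\<partial> - \<partial>')\<close>. If \<open>c\<close> lists the values of a symmetric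
  tensor on \<open>m - k\<close> copies of \<open>\<partial>\<close> and \<open>k\<close> copies of \<open>\<partial>'\<close>, then the result lists those of the tensor of order \<open>m - 1\<close>
  obtained by inserting a coordinate vector in one slot.\<close>

fun contract_coefs :: "coord \<Rightarrow> (nat \<Rightarrow> complex) \<Rightarrow> nat \<Rightarrow> complex" where
  "contract_coefs CX c = (\<lambda>k. c k + c (Suc k))"
| "contract_coefs CY c = (\<lambda>k. \<i> * (c k - c (Suc k)))"

text \<open>The symmetric tensor with coefficients \<open>c 0, \<dots>, c m\<close>, evaluated on coordinate vectors by filling one slot
  after the other.\<close>

definition tensor_of_coefs :: "nat \<Rightarrow> (nat \<Rightarrow> complex) \<Rightarrow> tensor" where
  "tensor_of_coefs m c I = (if length I = m then fold contract_coefs I c 0 else 0)"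

text \<open>The converse change of basis. If \<open>t\<close> lists the values of a symmetric tensor on \<open>m - j\<close> copies of \<open>e\<^sub>x\<close> and \<open>j\<close>
  copies of \<open>e\<^sub>y\<close>, this inserts \<open>\<partial> = (e\<^sub>x - i e\<^sub>y) / 2\<close> in one slot (for \<open>CX\<close>) or \<open>\<partial>' = (e\<^sub>x + i e\<^sub>y) / 2\<close>
  (for \<open>CY\<close>).\<close>

fun contract_wirtinger :: "coord \<Rightarrow> (nat \<Rightarrow> complex) \<Rightarrow> nat \<Rightarrow> complex" where
  "contract_wirtinger CX t = (\<lambda>j. (t j - \<i> * t (Suc j)) / 2)"
| "contract_wirtinger CY t = (\<lambda>j. (t j + \<i> * t (Suc j)) / 2)"

definition coefs_of_tensor :: "nat \<Rightarrow> tensor \<Rightarrow> nat \<Rightarrow> complex" where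
  "coefs_of_tensor m T k =
     (contract_wirtinger CX ^^ (m - k)) ((contract_wirtinger CY ^^ k) (\<lambda>j. T (replicate (m - j) CX @ replicate j CY))) 0"

text \<open>The components of the vector \<open>\<partial> + t \<partial>'\<close>.\<close>

definition probe_vector :: "complex \<Rightarrow> coord \<Rightarrow> complex" where
  "probe_vector t i = (case i of CX \<Rightarrow> (1 + t) / 2 | CY \<Rightarrow> - \<i> * (1 - t) / 2)"

text \<open>The value of a tensor on \<open>m\<close> copies of \<open>\<partial> + t \<partial>'\<close>. It ignores symmetrization and determines symmetric
  tensors, so identities between symmetrized tensors can be checked on these polynomials.\<close>

definition tensor_poly :: "nat \<Rightarrow> tensor \<Rightarrow> complex \<Rightarrow> complex" where
  "tensor_poly m T t = (\<Sum>I | length I = m. T I * prod_list (map (probe_vector t) I))"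

lemma UNIV_coord: "(UNIV :: coord set) = {CX, CY}"
  using coord.exhaust by auto

lemma finite_coord: "finite (UNIV :: coord set)"
  by (simp add: UNIV_coord)

lemma finite_words [simp]: "finite {I :: coord list. length I = m}"
  using finite_lists_length_eq[of "UNIV :: coord set" m] by (simp only: finite_coord subset_UNIV simp_thms)

lemma sum_words_Suc:
  "(\<Sum>I | length I = Suc m. f I) = (\<Sum>J | length J = m. f (CX # J)) + (\<Sum>J | length J = m. f (CY # J))"
proof -
  have eq: "{I. length I = Suc m} = (#) CX ` {J. length J = m} \<union> (#) CY ` {J. length J = m}"
    using coord.exhaust by (auto simp: length_Suc_conv image_iff)
  have "(\<Sum>I | length I = Suc m. f I)
      = (\<Sum>I\<in>(#) CX ` {J. length J = m}. f I) + (\<Sum>I\<in>(#) CY ` {J. length J = m}. f I)"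
    unfolding eq by (rule sum.union_disjoint) auto
  then show ?thesis by (simp add: sum.reindex)
qed

lemma sym_tensors_mset:
  assumes "T \<in> sym_tensors m" "length I = m" "mset I = mset J" shows "T I = T J"
proof -
  obtain p where p: "p permutes {..<length I}" "permute_list p I = J"
    using mset_eq_permutation[of J I] assms(3) by metis
  then show ?thesis using assms by (auto simp: sym_tensors_def)
qed

lemma sym_tensorsI:
  assumes "\<And>I. length I \<noteq> m \<Longrightarrow> T I = 0" "\<And>I J. length I = m \<Longrightarrow> mset I = mset J \<Longrightarrow> T I = T J"
  shows "T \<in> sym_tensors m"
  unfolding sym_tensors_def
proof (intro CollectI conjI allI impI; (elim conjE)?)
  fix I :: "coord list" and p :: "nat \<Rightarrow> nat" assume "length I = m" "p permutes {..<m}"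
  then show "T (permute_list p I) = T I"
    using assms(2)[of "permute_list p I" I] by simp
qed (rule assms(1))

lemma contract_coefs_commute: "contract_coefs i \<circ> contract_coefs j = contract_coefs j \<circ> contract_coefs i"
  by (cases i; cases j) (auto simp: fun_eq_iff algebra_simps)

lemma tensor_of_coefs_sym: "tensor_of_coefs m c \<in> sym_tensors m"
proof (rule sym_tensorsI)
  fix I J :: "coord list" assume "length I = m" "mset I = mset J"
  moreover from this(2) have "fold contract_coefs I = fold contract_coefs J"
    by (intro fold_multiset_equiv contract_coefs_commute)
  ultimately show "tensor_of_coefs m c I = tensor_of_coefs m c J"
    using mset_eq_length[of I J] by (simp add: tensor_of_coefs_def)
qed (simp add: tensor_of_coefs_def)

lemma tensor_of_coefs_Cons: "tensor_of_coefs (Suc m) c (i # I) = tensor_of_coefs m (contract_coefs i c) I"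
  by (simp add: tensor_of_coefs_def)

lemma tensor_of_coefs_cong: assumes "\<And>k. k \<le> m \<Longrightarrow> c k = d k" shows "tensor_of_coefs m c = tensor_of_coefs m d"
proof
  fix I show "tensor_of_coefs m c I = tensor_of_coefs m d I"
    using assms
  proof (induction I arbitrary: m c d)
    case Nil then show ?case by (simp add: tensor_of_coefs_def)
  next
    case (Cons i I)
    show ?case
    proof (cases m)
      case (Suc n)
      have "contract_coefs i c k = contract_coefs i d k" if "k \<le> n" for k
        using Cons.prems[of k] Cons.prems[of "Suc k"] that Suc by (cases i) auto
      then show ?thesis using Cons.IH[of n "contract_coefs i c" "contract_coefs i d"] by (simp add: Suc tensor_of_coefs_Cons)
    qed (simp add: tensor_of_coefs_def)
  qed
qed

text \<open>Inserting \<open>e\<^sub>x\<close> and \<open>e\<^sub>y\<close> in the first slot determines, by induction, all sums and all differences of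
  consecutive coefficients.\<close>

lemma tensor_of_coefs_inj:
  assumes "\<And>I. length I = m \<Longrightarrow> tensor_of_coefs m c I = tensor_of_coefs m d I" "k \<le> m" shows "c k = d k"
  using assms
proof (induction m arbitrary: c d k)
  case 0 then show ?case using "0.prems"(1)[of "[]"] by (simp add: tensor_of_coefs_def)
next
  case (Suc m)
  have "contract_coefs i c j = contract_coefs i d j" if "j \<le> m" for i j
  proof (rule Suc.IH[OF _ that])
    fix I :: "coord list" assume "length I = m"
    then show "tensor_of_coefs m (contract_coefs i c) I = tensor_of_coefs m (contract_coefs i d) I"
      using Suc.prems(1)[of "i # I"] by (simp add: tensor_of_coefs_Cons)
  qed
  from this[of _ CX] this[of _ CY]
  have *: "c j + c (Suc j) = d j + d (Suc j)" "c j - c (Suc j) = d j - d (Suc j)" if "j \<le> m" for j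
    using that by auto
  have j: "c j = d j \<and> c (Suc j) = d (Suc j)" if "j \<le> m" for j
  proof -
    have "2 * c j = 2 * d j" using arg_cong2[OF *[OF that], of "(+)"] by simp
    then show ?thesis using *(1)[OF that] by simp
  qed
  show ?case using j[of k] j[of "k - 1"] Suc.prems(2) by (cases k) auto
qed

lemma contract_wirtinger_commute: "contract_wirtinger i (contract_wirtinger j t) = contract_wirtinger j (contract_wirtinger i t)"
  by (cases i; cases j) (auto simp: fun_eq_iff field_simps)

lemma contract_wirtinger_pow_commute: "(contract_wirtinger i ^^ a) (contract_wirtinger j t) = contract_wirtinger j ((contract_wirtinger i ^^ a) t)"
  by (induction a) (auto simp: contract_wirtinger_commute[of i j])

lemma contract_wirtinger_add: "contract_wirtinger i (\<lambda>j. s j + t j) = (\<lambda>j. contract_wirtinger i s j + contract_wirtinger i t j)"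
  by (cases i) (auto simp: fun_eq_iff field_simps)

lemma contract_wirtinger_scale: "contract_wirtinger i (\<lambda>j. a * t j) = (\<lambda>j. a * contract_wirtinger i t j)"
  by (cases i) (auto simp: fun_eq_iff field_simps)

lemma contract_wirtinger_pow_add: "(contract_wirtinger i ^^ a) (\<lambda>j. s j + t j) = (\<lambda>j. (contract_wirtinger i ^^ a) s j + (contract_wirtinger i ^^ a) t j)"
  by (induction a) (auto simp: contract_wirtinger_add)

lemma contract_wirtinger_pow_scale: "(contract_wirtinger i ^^ a) (\<lambda>j. b * t j) = (\<lambda>j. b * (contract_wirtinger i ^^ a) t j)"
  by (induction a) (auto simp: contract_wirtinger_scale)

text \<open>Inserting the Wirtinger vectors and expanding the coordinate vectors in them are inverse operations. Each
  letter of the word undoes one insertion: \<open>\<partial> + \<partial>' = e\<^sub>x\<close> and \<open>i (\<partial> - \<partial>') = e\<^sub>y\<close>.\<close>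

lemma tensor_of_coefs_contract_wirtinger:
  "tensor_of_coefs (length I) (\<lambda>k. (contract_wirtinger CX ^^ (length I - k)) ((contract_wirtinger CY ^^ k) t) 0) I = t (count (mset I) CY)"
proof (induction I arbitrary: t)
  case Nil then show ?case by (simp add: tensor_of_coefs_def)
next
  case (Cons i I)
  define n where "n = length I"
  define E where "E a b t = (contract_wirtinger CX ^^ a) ((contract_wirtinger CY ^^ b) t)" for a b t
  have E_add: "E a b (\<lambda>j. s j + t j) = (\<lambda>j. E a b s j + E a b t j)" for a b s t
    unfolding E_def contract_wirtinger_pow_add ..
  have E_scale: "E a b (\<lambda>j. x * t j) = (\<lambda>j. x * E a b t j)" for a b x t
    unfolding E_def contract_wirtinger_pow_scale ..
  have E1: "E (Suc a) b t = E a b (contract_wirtinger CX t)" for a b t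
    unfolding E_def by (simp add: contract_wirtinger_pow_commute del: contract_wirtinger.simps)
  have E2: "E a (Suc b) t = E a b (contract_wirtinger CY t)" for a b t
    unfolding E_def by (simp add: contract_wirtinger_pow_commute del: contract_wirtinger.simps)
  have sx: "(\<lambda>j. contract_wirtinger CX t j + contract_wirtinger CY t j) = t" by (auto simp: fun_eq_iff field_simps)
  have sy: "(\<lambda>j. \<i> * (contract_wirtinger CX t j + (-1) * contract_wirtinger CY t j)) = (\<lambda>j. t (Suc j))"
    by (auto simp: fun_eq_iff field_simps)
  define s where "s = (case i of CX \<Rightarrow> t | CY \<Rightarrow> (\<lambda>j. t (Suc j)))"
  have "contract_coefs i (\<lambda>k. E (Suc n - k) k t 0) k = E (n - k) k s 0" if k: "k \<le> n" for k
  proof -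
    have sk: "Suc n - k = Suc (n - k)" using k by simp
    show ?thesis
    proof (cases i)
      case CX
      show ?thesis unfolding CX s_def coord.case
        apply (subst (2) sx[symmetric])
        apply (simp only: contract_coefs.simps sk E1 E2 diff_Suc_Suc E_add)
        done
    next
      case CY
      show ?thesis unfolding CY s_def coord.case
        apply (subst sy[symmetric])
        apply (simp only: contract_coefs.simps sk E1 E2 diff_Suc_Suc E_add E_scale)
        apply simp
        done
    qed
  qed
  then have "tensor_of_coefs n (contract_coefs i (\<lambda>k. E (Suc n - k) k t 0)) = tensor_of_coefs n (\<lambda>k. E (n - k) k s 0)"
    by (rule tensor_of_coefs_cong)
  then have "tensor_of_coefs (Suc n) (\<lambda>k. E (Suc n - k) k t 0) (i # I) = s (count (mset I) CY)"
    using Cons.IH[of s] unfolding E_def n_def by (simp add: tensor_of_coefs_Cons del: contract_wirtinger.simps)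
  also have "\<dots> = t (count (mset (i # I)) CY)" by (cases i) (auto simp: s_def)
  finally show ?case unfolding E_def n_def by (simp del: contract_wirtinger.simps)
qed

lemma sym_eq_tensor_of_coefs: assumes "T \<in> sym_tensors m" shows "T = tensor_of_coefs m (coefs_of_tensor m T)"
proof
  fix I :: "coord list" show "T I = tensor_of_coefs m (coefs_of_tensor m T) I"
  proof (cases "length I = m")
    case True
    define k where "k = count (mset I) CY"
    define J where "J = replicate (m - k) CX @ replicate k CY"
    have n: "m = count (mset I) CX + count (mset I) CY"
    proof -
      have "size (mset I) = (\<Sum>x\<in>{CX, CY}. count (mset I) x)"
        unfolding size_multiset_overloaded_eq
        by (rule sum.mono_neutral_left) (auto simp flip: UNIV_coord simp: not_in_iff finite_coord)
      then show ?thesis using True by simp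
    qed
    have "mset I = mset J"
    proof (rule multiset_eqI)
      fix x show "count (mset I) x = count (mset J) x"
        using n by (cases x) (auto simp: J_def k_def)
    qed
    then have "T I = T J" by (rule sym_tensors_mset[OF assms True])
    also have "\<dots> = tensor_of_coefs m (coefs_of_tensor m T) I"
      using tensor_of_coefs_contract_wirtinger[of I "\<lambda>j. T (replicate (m - j) CX @ replicate j CY)"] True
      unfolding coefs_of_tensor_def by (simp add: J_def k_def)
    finally show ?thesis .
  next
    case False then show ?thesis using assms by (simp add: sym_tensors_def tensor_of_coefs_def)
  qed
qed

lemma tensor_poly_add: "tensor_poly m (\<lambda>I. S I + T I) t = tensor_poly m S t + tensor_poly m T t"
  by (simp add: tensor_poly_def sum.distrib algebra_simps)

lemma tensor_poly_scale: "tensor_poly m (\<lambda>I. a * T I) t = a * tensor_poly m T t"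
  by (simp add: tensor_poly_def sum_distrib_left algebra_simps)

lemma tensor_poly_cong: "(\<And>I. length I = m \<Longrightarrow> S I = T I) \<Longrightarrow> tensor_poly m S t = tensor_poly m T t"
  by (simp add: tensor_poly_def)

lemma tensor_poly_0: "tensor_poly 0 T t = T []"
  by (simp add: tensor_poly_def)

lemma tensor_poly_Suc: "tensor_poly (Suc m) T t = probe_vector t CX * tensor_poly m (\<lambda>J. T (CX # J)) t + probe_vector t CY * tensor_poly m (\<lambda>J. T (CY # J)) t"
  by (simp add: tensor_poly_def sum_words_Suc sum_distrib_left algebra_simps)

lemma tensor_of_coefs_lin: "tensor_of_coefs m (\<lambda>k. a * c k + b * d k) I = a * tensor_of_coefs m c I + b * tensor_of_coefs m d I"
proof (induction I arbitrary: m c d)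
  case Nil then show ?case by (simp add: tensor_of_coefs_def)
next
  case (Cons i I)
  have *: "contract_coefs i (\<lambda>k. a * c k + b * d k) = (\<lambda>k. a * contract_coefs i c k + b * contract_coefs i d k)"
    by (cases i) (auto simp: fun_eq_iff algebra_simps)
  show ?case by (cases m) (simp_all add: tensor_of_coefs_Cons * Cons.IH, simp add: tensor_of_coefs_def)
qed

lemma tensor_poly_tensor_of_coefs: "tensor_poly m (tensor_of_coefs m c) t = (\<Sum>k\<le>m. of_nat (m choose k) * c k * t ^ k)"
proof (induction m arbitrary: c)
  case 0 then show ?case by (simp add: tensor_poly_0 tensor_of_coefs_def)
next
  case (Suc m)
  have "tensor_poly (Suc m) (tensor_of_coefs (Suc m) c) t
      = tensor_poly m (\<lambda>J. probe_vector t CX * tensor_of_coefs m (contract_coefs CX c) J + probe_vector t CY * tensor_of_coefs m (contract_coefs CY c) J) t"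
    by (simp only: tensor_poly_Suc tensor_of_coefs_Cons tensor_poly_add tensor_poly_scale)
  also have "(\<lambda>J. probe_vector t CX * tensor_of_coefs m (contract_coefs CX c) J + probe_vector t CY * tensor_of_coefs m (contract_coefs CY c) J)
      = tensor_of_coefs m (\<lambda>k. probe_vector t CX * contract_coefs CX c k + probe_vector t CY * contract_coefs CY c k)"
    by (rule ext) (simp only: tensor_of_coefs_lin)
  also have "(\<lambda>k. probe_vector t CX * contract_coefs CX c k + probe_vector t CY * contract_coefs CY c k) = (\<lambda>k. c k + t * c (Suc k))"
    by (auto simp: fun_eq_iff probe_vector_def field_simps)
  also have "tensor_poly m (tensor_of_coefs m \<dots>) t = (\<Sum>k\<le>m. of_nat (m choose k) * (c k + t * c (Suc k)) * t ^ k)"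
    by (rule Suc.IH)
  also have "\<dots> = (\<Sum>k\<le>m. of_nat (m choose k) * c k * t ^ k)
      + (\<Sum>k\<le>m. of_nat (m choose k) * c (Suc k) * t ^ Suc k)"
    by (simp add: sum.distrib algebra_simps)
  also have "(\<Sum>k\<le>m. of_nat (m choose k) * c k * t ^ k) = (\<Sum>k\<le>Suc m. of_nat (m choose k) * c k * t ^ k)"
    by simp
  also have "\<dots> = c 0 + (\<Sum>k\<le>m. of_nat (m choose Suc k) * c (Suc k) * t ^ Suc k)"
    by (subst sum.atMost_Suc_shift) simp
  finally have "tensor_poly (Suc m) (tensor_of_coefs (Suc m) c) t = c 0 + ((\<Sum>k\<le>m. of_nat (m choose Suc k) * c (Suc k) * t ^ Suc k)
      + (\<Sum>k\<le>m. of_nat (m choose k) * c (Suc k) * t ^ Suc k))"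
    by (simp add: algebra_simps)
  also have "\<dots> = c 0 + (\<Sum>k\<le>m. of_nat (Suc m choose Suc k) * c (Suc k) * t ^ Suc k)"
    by (simp add: sum.distrib[symmetric] algebra_simps)
  also have "\<dots> = (\<Sum>k\<le>Suc m. of_nat (Suc m choose k) * c k * t ^ k)"
    by (subst sum.atMost_Suc_shift) simp
  finally show ?case .
qed

lemma tensor_of_coefs_eqI_tensor_poly:
  assumes "\<And>t. tensor_poly m (tensor_of_coefs m c) t = tensor_poly m (tensor_of_coefs m d) t" "k \<le> m" shows "c k = d k"
proof -
  have "\<forall>t. (\<Sum>k\<le>m. (of_nat (m choose k) * c k) * t ^ k) = (\<Sum>k\<le>m. (of_nat (m choose k) * d k) * t ^ k)"
    using assms(1) unfolding tensor_poly_tensor_of_coefs by simp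
  then have "of_nat (m choose k) * c k = of_nat (m choose k) * d k"
    using assms(2) unfolding polyfun_eq_coeffs by blast
  then show ?thesis using assms(2) by simp
qed

text \<open>All slots receive the same vector, so a permutation of the slots only reindexes the sum over words.\<close>

lemma tensor_poly_symmetrize: "tensor_poly m (symmetrize T) t = tensor_poly m T t"
proof -
  define P where "P = {p. p permutes {..<m}}"
  define w where "w I = prod_list (map (probe_vector t) I)" for I
  have wp: "w (permute_list p I) = w I" if "p \<in> P" "length I = m" for p I
    unfolding w_def using that
    by (intro prod_mset_prod_list[symmetric, THEN trans] trans[OF _ prod_mset_prod_list]) 
       (auto simp: P_def prod_mset_prod_list[symmetric])
  have inner: "(\<Sum>I | length I = m. T (permute_list p I) * w I) = tensor_poly m T t" if p: "p \<in> P" for p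
  proof -
    have bij: "bij_betw (permute_list p) {I. length I = m} {I::coord list. length I = m}"
    proof (rule bij_betwI[where g = "permute_list (inv p)"])
      have pp: "p permutes {..<m}" using p by (simp add: P_def)
      show "permute_list (inv p) (permute_list p I) = I" if "I \<in> {I. length I = m}" for I :: "coord list"
        using that permute_list_compose[of "inv p" I p] permutes_inv[OF pp] permutes_inv_o[OF pp] by simp
      show "permute_list p (permute_list (inv p) I) = I" if "I \<in> {I. length I = m}" for I :: "coord list"
        using that permute_list_compose[of p I "inv p"] pp permutes_inv_o[OF pp] by simp
    qed auto
    have "tensor_poly m T t = (\<Sum>I | length I = m. T (permute_list p I) * w (permute_list p I))"
      unfolding tensor_poly_def w_def[symmetric]
      using sum.reindex_bij_betw[OF bij, of "\<lambda>I. T I * w I"] by simp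
    also have "\<dots> = (\<Sum>I | length I = m. T (permute_list p I) * w I)"
      using wp[OF p] by simp
    finally show ?thesis ..
  qed
  have "tensor_poly m (symmetrize T) t = (\<Sum>I | length I = m. (\<Sum>p\<in>P. T (permute_list p I) * w I)) / fact m"
    unfolding tensor_poly_def symmetrize_def P_def w_def[symmetric]
    by (simp add: sum_distrib_right sum_divide_distrib)
  also have "\<dots> = (\<Sum>p\<in>P. (\<Sum>I | length I = m. T (permute_list p I) * w I)) / fact m"
    by (subst sum.swap) simp
  also have "\<dots> = (\<Sum>p\<in>P. tensor_poly m T t) / fact m"
    using inner by simp
  also have "\<dots> = tensor_poly m T t"
    by (simp add: P_def card_permutations)
  finally show ?thesis .
qed

lemma symmetrize_sym: "(\<lambda>I. if length I = m then symmetrize T I else 0) \<in> sym_tensors m"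
proof -
  have "symmetrize T (permute_list q I) = symmetrize T I" if q: "q permutes {..<length I}" for q and I
  proof -
    have "(\<Sum>p | p permutes {..<length I}. T (permute_list p (permute_list q I)))
        = (\<Sum>p | p permutes {..<length I}. T (permute_list (q \<circ> p) I))"
      by (intro sum.cong) (auto simp: permute_list_compose)
    also have "\<dots> = (\<Sum>p | p permutes {..<length I}. T (permute_list p I))"
      using sum.reindex_bij_betw[of "(\<circ>) q", OF bij_betwI[where g = "(\<circ>) (inv q)" and ?A = "{p. p permutes {..<length I}}"
            and ?B = "{p. p permutes {..<length I}}"], of "\<lambda>p. T (permute_list p I)"]
        permutes_compose[OF _ q] permutes_compose[OF _ permutes_inv[OF q]]
        permutes_inv_o[OF q] by (simp add: o_assoc[symmetric] comp_assoc[symmetric] Pi_iff)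
    finally show ?thesis by (simp add: symmetrize_def)
  qed
  then show ?thesis by (auto simp: sym_tensors_def)
qed

text \<open>The reason is \<open>g(\<partial> + t \<partial>', \<partial> + t \<partial>') = t\<close>.\<close>

lemma tensor_poly_metric_prod: "tensor_poly (Suc (Suc m)) (tensor_prod 2 metric_tensor v) t = t * tensor_poly m v t"
proof -
  have *: "tensor_prod 2 metric_tensor v (a # b # J) = (if a = b then v J else 0)" for a b J
    by (cases a; cases b) (auto simp: tensor_prod_def metric_tensor_def numeral_2_eq_2)
  have z: "tensor_poly m (\<lambda>J. 0) t = 0" by (simp add: tensor_poly_def)
  have "tensor_poly (Suc (Suc m)) (tensor_prod 2 metric_tensor v) t = (probe_vector t CX * probe_vector t CX + probe_vector t CY * probe_vector t CY) * tensor_poly m v t"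
    unfolding tensor_poly_Suc * by (simp add: z algebra_simps)
  also have "probe_vector t CX * probe_vector t CX + probe_vector t CY * probe_vector t CY = t"
    by (simp add: probe_vector_def field_simps)
  finally show ?thesis .
qed

lemma covector_power_dz: "covector_power m dz = tensor_of_coefs m (\<lambda>k. if k = 0 then 1 else 0)"
proof
  fix I show "covector_power m dz I = tensor_of_coefs m (\<lambda>k. if k = 0 then 1 else 0) I"
  proof (induction I arbitrary: m)
    case Nil then show ?case by (simp add: tensor_of_coefs_def covector_power_def)
  next
    case (Cons i I)
    show ?case
    proof (cases m)
      case (Suc n)
      have "contract_coefs i (\<lambda>k. if k = 0 then 1 else 0) = (\<lambda>k. dz i * (if k = 0 then 1 else 0) + 0 * (if k = 0 then 1 else 0))"
        by (cases i) auto
      then show ?thesis unfolding Suc tensor_of_coefs_Cons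
        by (simp only: tensor_of_coefs_lin Cons.IH[symmetric]) (simp add: covector_power_def)
    qed (simp add: tensor_of_coefs_def covector_power_def)
  qed
qed

lemma covector_power_dzbar: "covector_power m dzbar = tensor_of_coefs m (\<lambda>k. if k = m then 1 else 0)"
proof
  fix I show "covector_power m dzbar I = tensor_of_coefs m (\<lambda>k. if k = m then 1 else 0) I"
  proof (induction I arbitrary: m)
    case Nil then show ?case by (simp add: tensor_of_coefs_def covector_power_def)
  next
    case (Cons i I)
    show ?case
    proof (cases m)
      case (Suc n)
      have "tensor_of_coefs n (contract_coefs i (\<lambda>k. if k = Suc n then 1 else 0))
          = tensor_of_coefs n (\<lambda>k. dzbar i * (if k = n then 1 else 0) + 0 * (if k = n then 1 else 0))"
        by (rule tensor_of_coefs_cong) (cases i, auto)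
      then show ?thesis unfolding Suc tensor_of_coefs_Cons
        by (simp only: tensor_of_coefs_lin Cons.IH[symmetric]) (simp add: covector_power_def)
    qed (simp add: tensor_of_coefs_def covector_power_def)
  qed
qed

text \<open>Multiplication by \<open>t\<close> in terms of the coefficients, which are normalized by binomials:
  \<open>binomial(n, k - 1) / binomial(n + 2, k) = k (n + 2 - k) / ((n + 2) (n + 1))\<close>.\<close>

lemma sum_binomial_metric_shift:
  fixes c :: "nat \<Rightarrow> complex"
  shows "(\<Sum>k\<le>Suc (Suc n). of_nat (Suc (Suc n) choose k)
      * (of_nat (k * (Suc (Suc n) - k)) / of_nat (Suc (Suc n) * Suc n) * c (k - 1)) * t ^ k)
    = t * (\<Sum>k\<le>n. of_nat (n choose k) * c k * t ^ k)"
proof -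
  have b: "of_nat (Suc (Suc n) choose Suc j) * (of_nat (Suc j * (Suc n - j)) / of_nat (Suc (Suc n) * Suc n))
      = (of_nat (n choose j) :: complex)" if "j \<le> n" for j
  proof -
    have "(Suc (Suc n) choose Suc j) * (Suc j * (Suc n - j)) = (Suc j * (Suc (Suc n) choose Suc j)) * (Suc n - j)"
      by (simp only: ac_simps)
    also have "\<dots> = Suc (Suc n) * ((Suc n - j) * (Suc n choose j))"
      unfolding Suc_times_binomial by (simp only: ac_simps)
    also have "\<dots> = (Suc (Suc n) * Suc n) * (n choose j)"
      by (simp only: binomial_absorb_comp[of "Suc n" j] diff_Suc_1 mult.assoc)
    finally have "(of_nat ((Suc (Suc n) choose Suc j) * (Suc j * (Suc n - j))) :: complex)
        = of_nat ((Suc (Suc n) * Suc n) * (n choose j))" by (rule arg_cong)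
    then show ?thesis
      unfolding of_nat_mult by (simp add: field_simps del: of_nat_Suc binomial_Suc_Suc)
  qed
  have "(\<Sum>k\<le>Suc (Suc n). of_nat (Suc (Suc n) choose k)
      * (of_nat (k * (Suc (Suc n) - k)) / of_nat (Suc (Suc n) * Suc n) * c (k - 1)) * t ^ k)
    = (\<Sum>j\<le>Suc n. of_nat (Suc (Suc n) choose Suc j)
      * (of_nat (Suc j * (Suc n - j)) / of_nat (Suc (Suc n) * Suc n) * c j) * t ^ Suc j)"
    by (subst sum.atMost_Suc_shift) (simp del: binomial_Suc_Suc)
  also have "\<dots> = (\<Sum>j\<le>n. of_nat (Suc (Suc n) choose Suc j)
      * (of_nat (Suc j * (Suc n - j)) / of_nat (Suc (Suc n) * Suc n) * c j) * t ^ Suc j)"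
    by simp
  also have "\<dots> = (\<Sum>j\<le>n. t * (of_nat (n choose j) * c j * t ^ j))"
    by (intro sum.cong refl) (simp add: b[symmetric] mult.assoc mult.left_commute del: of_nat_Suc binomial_Suc_Suc of_nat_mult)
  finally show ?thesis by (simp add: sum_distrib_left)
qed

lemma sum_binomial_single:
  fixes x :: complex
  assumes "j \<le> m"
  shows "(\<Sum>k\<le>m. of_nat (m choose k) * (if k = j then x else 0) * t ^ k) = of_nat (m choose j) * x * t ^ j"
proof -
  have "(\<Sum>k\<le>m. of_nat (m choose k) * (if k = j then x else 0) * t ^ k)
     = (\<Sum>k\<le>m. if k = j then of_nat (m choose k) * x * t ^ k else 0)"
    by (intro sum.cong) auto
  then show ?thesis using assms by simp
qed

text \<open>The coefficient number \<open>k\<close> of \<open>\<delta> d\<^sup>s q + L \<lambda> + a dz^m + b dzbar^m\<close>, where \<open>A\<close> and \<open>B\<close> are the gradients of the two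
  components of the trace-free \<open>q\<close> and \<open>c\<close> lists the coefficients of \<open>\<lambda>\<close>. The third and fourth summand are the mixed derivatives,
  at \<open>t\<close> and \<open>t^(m-1)\<close>, divided by \<open>binomial(m, 1) = m\<close>; they share a position when \<open>m = 2\<close>.\<close>

definition decomposition_coef where
  "decomposition_coef m \<delta> A B a b c k = 
    (if k = 0 then \<delta> * ((A CX - \<i> * A CY) / 2) + a else 0)
    + (if k = m then \<delta> * ((B CX + \<i> * B CY) / 2) + b else 0)
    + (if k = 1 then \<delta> * ((A CX + \<i> * A CY) / 2) / of_nat m else 0)
    + (if k = m - 1 then \<delta> * ((B CX - \<i> * B CY) / 2) / of_nat m else 0)
    + of_nat (k * (m - k)) / of_nat (m * (m - 1)) * c (k - 1)"

text \<open>On words of length \<open>m\<close> both sides are symmetric tensors, so they agree exactly if their polynomials do.\<close>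

lemma decomposition_iff_coefs:
  fixes A B :: "coord \<Rightarrow> complex" and \<delta> a b :: complex
  assumes m: "m \<ge> 2" and F: "F \<in> sym_tensors m"
    and S: "\<And>i J. length J = m - 1 \<Longrightarrow> S (i # J) = A i * covector_power (m - 1) dz J + B i * covector_power (m - 1) dzbar J"
  shows "(\<forall>I. length I = m \<longrightarrow> F I = \<delta> * symmetrize S I + Lop (tensor_of_coefs (m - 2) c) I
            + (a * covector_power m dz I + b * covector_power m dzbar I))
     \<longleftrightarrow> (\<forall>k\<le>m. coefs_of_tensor m F k = decomposition_coef m \<delta> A B a b c k)"
proof -
  obtain n where n: "m = Suc (Suc n)" using m by (metis add_2_eq_Suc le_Suc_ex)
  define R where "R I = (if length I = m then \<delta> * symmetrize S I + Lop (tensor_of_coefs (m - 2) c) I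
            + (a * covector_power m dz I + b * covector_power m dzbar I) else 0)" for I
  have R: "R \<in> sym_tensors m"
  proof (rule sym_tensorsI)
    fix I J :: "coord list" assume I: "length I = m" and IJ: "mset I = mset J"
    have J: "length J = m" using I mset_eq_length[OF IJ] by simp
    have 1: "symmetrize T I = symmetrize T J" for T
      using sym_tensors_mset[OF symmetrize_sym I IJ, of T] I J by simp
    have 2: "covector_power m dz I = covector_power m dz J" "covector_power m dzbar I = covector_power m dzbar J"
      unfolding covector_power_dz covector_power_dzbar by (rule sym_tensors_mset[OF tensor_of_coefs_sym I IJ])+
    show "R I = R J" unfolding R_def Lop_def 2 using I J 1[of S] 1[of "tensor_prod 2 metric_tensor (tensor_of_coefs (m - 2) c)"] by simp
  qed (simp add: R_def)
  have polS: "tensor_poly m S t = (A CX - \<i> * A CY) / 2 + t * ((A CX + \<i> * A CY) / 2)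
      + t ^ (m - 1) * ((B CX - \<i> * B CY) / 2) + t ^ m * ((B CX + \<i> * B CY) / 2)" for t
  proof -
    have p: "tensor_poly (Suc n) (\<lambda>J. S (i # J)) t = A i + B i * t ^ Suc n" for i
    proof -
      have "tensor_poly (Suc n) (\<lambda>J. S (i # J)) t
          = tensor_poly (Suc n) (\<lambda>J. A i * covector_power (Suc n) dz J + B i * covector_power (Suc n) dzbar J) t"
        by (rule tensor_poly_cong) (use S n in auto)
      also have "\<dots> = A i + B i * t ^ Suc n"
        unfolding tensor_poly_add tensor_poly_scale covector_power_dz covector_power_dzbar tensor_poly_tensor_of_coefs
        by (subst (1 2) sum_binomial_single) auto
      finally show ?thesis .
    qed
    show ?thesis unfolding n tensor_poly_Suc[of "Suc n"] p by (simp add: probe_vector_def field_simps)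
  qed
  have polR: "tensor_poly m R t = (\<Sum>k\<le>m. of_nat (m choose k) * decomposition_coef m \<delta> A B a b c k * t ^ k)" for t
  proof -
    have "tensor_poly m R t = \<delta> * tensor_poly m S t + t * (\<Sum>k\<le>n. of_nat (n choose k) * c k * t ^ k) + (a + b * t ^ m)"
    proof -
      have "tensor_poly m R t = tensor_poly m (\<lambda>I. \<delta> * symmetrize S I + Lop (tensor_of_coefs (m - 2) c) I
            + (a * covector_power m dz I + b * covector_power m dzbar I)) t"
        by (rule tensor_poly_cong) (simp add: R_def)
      also have "\<dots> = \<delta> * tensor_poly m S t + t * tensor_poly n (tensor_of_coefs n c) t
          + (a * tensor_poly m (covector_power m dz) t + b * tensor_poly m (covector_power m dzbar) t)"
        unfolding tensor_poly_add tensor_poly_scale tensor_poly_symmetrize Lop_def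
        by (simp add: n tensor_poly_metric_prod)
      also have "tensor_poly m (covector_power m dz) t = 1"
        unfolding covector_power_dz tensor_poly_tensor_of_coefs by (subst sum_binomial_single) auto
      also have "tensor_poly m (covector_power m dzbar) t = t ^ m"
        unfolding covector_power_dzbar tensor_poly_tensor_of_coefs by (subst sum_binomial_single) auto
      finally show ?thesis by (simp add: tensor_poly_tensor_of_coefs)
    qed
    also have "\<dots> = of_nat (m choose 0) * (\<delta> * ((A CX - \<i> * A CY) / 2) + a) * t ^ 0
        + of_nat (m choose m) * (\<delta> * ((B CX + \<i> * B CY) / 2) + b) * t ^ m
        + of_nat (m choose 1) * (\<delta> * ((A CX + \<i> * A CY) / 2) / of_nat m) * t ^ 1
        + of_nat (m choose (m - 1)) * (\<delta> * ((B CX - \<i> * B CY) / 2) / of_nat m) * t ^ (m - 1)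
        + t * (\<Sum>k\<le>n. of_nat (n choose k) * c k * t ^ k)"
    proof -
      have c1: "of_nat (m choose 1) * (x / of_nat m) = x" for x :: complex using m by simp
      have c2: "of_nat (m choose (m - 1)) * (x / of_nat m) = x" for x :: complex
        using m binomial_symmetric[of 1 m] by simp
      show ?thesis unfolding polS c1 c2 by (simp add: algebra_simps)
    qed
    also have "\<dots> = (\<Sum>k\<le>m. of_nat (m choose k) * decomposition_coef m \<delta> A B a b c k * t ^ k)"
    proof -
      have s: "(\<Sum>k\<le>m. of_nat (m choose k) * (of_nat (k * (m - k)) / of_nat (m * (m - 1)) * c (k - 1)) * t ^ k)
        = t * (\<Sum>k\<le>n. of_nat (n choose k) * c k * t ^ k)"
        using sum_binomial_metric_shift[of n c t] unfolding n diff_Suc_1 .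
      show ?thesis
        unfolding decomposition_coef_def ring_distribs(1,2) sum.distrib s
        by (subst (1 2 3 4) sum_binomial_single) (use m in \<open>auto simp: algebra_simps\<close>)
    qed
    finally show ?thesis .
  qed
  have "(\<forall>I. length I = m \<longrightarrow> F I = \<delta> * symmetrize S I + Lop (tensor_of_coefs (m - 2) c) I
            + (a * covector_power m dz I + b * covector_power m dzbar I)) \<longleftrightarrow> (\<forall>I. length I = m \<longrightarrow> F I = R I)"
    by (auto simp: R_def)
  also have "\<dots> \<longleftrightarrow> (\<forall>k\<le>m. coefs_of_tensor m F k = decomposition_coef m \<delta> A B a b c k)"
  proof -
    have Rz: "coefs_of_tensor m R k = decomposition_coef m \<delta> A B a b c k" if "k \<le> m" for k
      by (rule tensor_of_coefs_eqI_tensor_poly[OF _ that]) (simp only: sym_eq_tensor_of_coefs[OF R, symmetric] polR tensor_poly_tensor_of_coefs)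
    show ?thesis
    proof
      assume "\<forall>I. length I = m \<longrightarrow> F I = R I"
      then have "tensor_of_coefs m (coefs_of_tensor m F) I = tensor_of_coefs m (coefs_of_tensor m R) I" if "length I = m" for I
        using that sym_eq_tensor_of_coefs[OF F] sym_eq_tensor_of_coefs[OF R] by metis
      then show "\<forall>k\<le>m. coefs_of_tensor m F k = decomposition_coef m \<delta> A B a b c k"
        using Rz tensor_of_coefs_inj[of m "coefs_of_tensor m F" "coefs_of_tensor m R"] by auto
    next
      assume "\<forall>k\<le>m. coefs_of_tensor m F k = decomposition_coef m \<delta> A B a b c k"
      then have "tensor_of_coefs m (coefs_of_tensor m F) = tensor_of_coefs m (coefs_of_tensor m R)" by (intro tensor_of_coefs_cong) (simp add: Rz)
      then show "\<forall>I. length I = m \<longrightarrow> F I = R I" using sym_eq_tensor_of_coefs[OF F] sym_eq_tensor_of_coefs[OF R] by metis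
    qed
  qed
  finally show ?thesis .
qed

text \<open>In terms of coefficients the trace is \<open>(1 + S)\<^sup>2 - (1 - S)\<^sup>2 = 4 S\<close>, where \<open>S\<close> is the shift.\<close>

lemma ker_tr_iff:
  assumes "m \<ge> 2"
  shows "(\<forall>I. length I = m - 2 \<longrightarrow> tr (tensor_of_coefs m c) I = 0) \<longleftrightarrow> (\<forall>k. 1 \<le> k \<and> k < m \<longrightarrow> c k = 0)"
proof -
  obtain n where n: "m = Suc (Suc n)" using assms by (metis add_2_eq_Suc le_Suc_ex)
  have t: "tr (tensor_of_coefs m c) I = tensor_of_coefs n (\<lambda>k. 4 * c (Suc k)) I" for I
  proof -
    have "tr (tensor_of_coefs m c) I = 1 * tensor_of_coefs n (contract_coefs CX (contract_coefs CX c)) I + 1 * tensor_of_coefs n (contract_coefs CY (contract_coefs CY c)) I"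
      by (simp only: tr_def n tensor_of_coefs_Cons mult_1)
    also have "\<dots> = tensor_of_coefs n (\<lambda>k. 1 * contract_coefs CX (contract_coefs CX c) k + 1 * contract_coefs CY (contract_coefs CY c) k) I"
      by (rule tensor_of_coefs_lin[symmetric])
    also have "(\<lambda>k. 1 * contract_coefs CX (contract_coefs CX c) k + 1 * contract_coefs CY (contract_coefs CY c) k) = (\<lambda>k. 4 * c (Suc k))"
      by (auto simp: fun_eq_iff algebra_simps)
    finally show ?thesis .
  qed
  have z: "tensor_of_coefs n (\<lambda>k. 0) I = 0" for I
    using tensor_of_coefs_lin[of n 0 "\<lambda>k. 0" 0 "\<lambda>k. 0" I] by simp
  show ?thesis
  proof
    assume L: "\<forall>I. length I = m - 2 \<longrightarrow> tr (tensor_of_coefs m c) I = 0"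
    show "\<forall>k. 1 \<le> k \<and> k < m \<longrightarrow> c k = 0"
    proof (intro allI impI)
      fix k assume k: "1 \<le> k \<and> k < m"
      have "(\<lambda>k. 4 * c (Suc k)) (k - 1) = (\<lambda>k. 0) (k - 1)"
        by (rule tensor_of_coefs_inj[of n]) (use L t z n k in auto)
      then show "c k = 0" using k by simp
    qed
  next
    assume R: "\<forall>k. 1 \<le> k \<and> k < m \<longrightarrow> c k = 0"
    have "tensor_of_coefs n (\<lambda>k. 4 * c (Suc k)) = tensor_of_coefs n (\<lambda>k. 0)" by (rule tensor_of_coefs_cong) (use R n in auto)
    then show "\<forall>I. length I = m - 2 \<longrightarrow> tr (tensor_of_coefs m c) I = 0" by (simp add: t z)
  qed
qed

lemma coefs_of_tensor_closed:
  fixes W :: "('z \<Rightarrow> complex) set"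
  assumes add: "\<And>u v. u \<in> W \<Longrightarrow> v \<in> W \<Longrightarrow> (\<lambda>z. u z + v z) \<in> W"
    and scl: "\<And>a u. u \<in> W \<Longrightarrow> (\<lambda>z. a * u z) \<in> W"
    and f: "\<And>I. length I = m \<Longrightarrow> (\<lambda>z. f z I) \<in> W" and k: "k \<le> m"
  shows "(\<lambda>z. coefs_of_tensor m (f z) k) \<in> W"
proof -
  have step: "(\<lambda>z. contract_wirtinger i (t z) j) \<in> W" if "(\<lambda>z. t z j) \<in> W" "(\<lambda>z. t z (Suc j)) \<in> W" for i t j
  proof (cases i)
    case CX
    show ?thesis using add[OF scl[OF that(1), of "1/2"] scl[OF that(2), of "- \<i> / 2"]] CX by (simp add: diff_divide_distrib)
  next
    case CY
    show ?thesis using add[OF scl[OF that(1), of "1/2"] scl[OF that(2), of "\<i> / 2"]] CY by (simp add: add_divide_distrib)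
  qed
  have iter: "(\<lambda>z. (contract_wirtinger i ^^ a) (t z) j) \<in> W" if "\<And>j. j \<le> N \<Longrightarrow> (\<lambda>z. t z j) \<in> W" "j + a \<le> N" for i a t j N
    using that(2)
  proof (induction a arbitrary: j)
    case 0 then show ?case using that(1) by simp
  next
    case (Suc a)
    show ?case using step[OF Suc.IH[of j] Suc.IH[of "Suc j"]] Suc.prems by (simp del: contract_wirtinger.simps)
  qed
  show ?thesis unfolding coefs_of_tensor_def
    by (rule iter[where N = "m - k"], rule iter[where N = m]) (use f k in auto)
qed

lemma tensor_of_coefs_closed:
  fixes W :: "('z \<Rightarrow> complex) set"
  assumes add: "\<And>u v. u \<in> W \<Longrightarrow> v \<in> W \<Longrightarrow> (\<lambda>z. u z + v z) \<in> W"
    and scl: "\<And>a u. u \<in> W \<Longrightarrow> (\<lambda>z. a * u z) \<in> W"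
    and c: "\<And>k. k \<le> length I \<Longrightarrow> (\<lambda>z. c z k) \<in> W"
  shows "(\<lambda>z. tensor_of_coefs (length I) (c z) I) \<in> W"
  using c
proof (induction I arbitrary: c)
  case Nil then show ?case by (simp add: tensor_of_coefs_def)
next
  case (Cons i I)
  have "(\<lambda>z. contract_coefs i (c z) k) \<in> W" if "k \<le> length I" for k
  proof (cases i)
    case CX then show ?thesis using add[OF Cons.prems[of k] Cons.prems[of "Suc k"]] that by simp
  next
    case CY then show ?thesis
      using scl[OF add[OF Cons.prems[of k] scl[OF Cons.prems[of "Suc k"], of "-1"]], of \<i>] that by simp
  qed
  then show ?case using Cons.IH[of "\<lambda>z. contract_coefs i (c z)"] by (simp add: tensor_of_coefs_Cons)
qed

section \<open>Test functions and bump functions\<close>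

text \<open>The real derivative is written out as a linear map, so that the rules of differentiation below yield
  the two partial derivatives explicitly.\<close>

definition has_partials :: "(complex \<Rightarrow> complex) \<Rightarrow> complex \<Rightarrow> complex \<Rightarrow> complex \<Rightarrow> bool" where
  "has_partials u a b z \<longleftrightarrow> (u has_derivative (\<lambda>h. of_real (Re h) * a + of_real (Im h) * b)) (at z)"

lemma has_partials_partial:
  assumes "has_partials u a b z" shows "partial CX u z = a" "partial CY u z = b"
  unfolding partial_def frechet_derivative_at[OF assms[unfolded has_partials_def], symmetric] by simp_all

lemma differentiable_has_partials:
  assumes "u differentiable (at z)" shows "has_partials u (partial CX u z) (partial CY u z) z"
proof -
  let ?D = "frechet_derivative u (at z)"
  have D: "(u has_derivative ?D) (at z)" using assms frechet_derivative_works by blast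
  interpret D: bounded_linear ?D using D by (rule has_derivative_bounded_linear)
  have "?D h = of_real (Re h) * ?D 1 + of_real (Im h) * ?D \<i>" for h
  proof -
    have "h = Re h *\<^sub>R 1 + Im h *\<^sub>R \<i>" by (simp add: complex_eq_iff)
    then have "?D h = ?D (Re h *\<^sub>R 1 + Im h *\<^sub>R \<i>)" by simp
    also have "\<dots> = Re h *\<^sub>R ?D 1 + Im h *\<^sub>R ?D \<i>" unfolding D.add D.scaleR ..
    finally show ?thesis by (simp add: scaleR_conv_of_real)
  qed
  then have "?D = (\<lambda>h. of_real (Re h) * ?D 1 + of_real (Im h) * ?D \<i>)" by (rule ext)
  then show ?thesis using D unfolding has_partials_def partial_def by simp
qed

lemma has_partials_imp_differentiable: "has_partials u a b z \<Longrightarrow> u differentiable (at z)"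
  unfolding has_partials_def differentiable_def by blast

lemma has_partials_const: "has_partials (\<lambda>z. c) 0 0 z"
  unfolding has_partials_def by (auto intro!: derivative_eq_intros)

lemma has_partials_add:
  assumes "has_partials u a b z" "has_partials v c d z" shows "has_partials (\<lambda>z. u z + v z) (a + c) (b + d) z"
  using has_derivative_add[OF assms[unfolded has_partials_def]]
  unfolding has_partials_def by (simp add: algebra_simps)

lemma has_partials_mult:
  assumes "has_partials u a b z" "has_partials v c d z"
  shows "has_partials (\<lambda>z. u z * v z) (a * v z + u z * c) (b * v z + u z * d) z"
  using has_derivative_mult[OF assms[unfolded has_partials_def]]
  unfolding has_partials_def by (simp add: algebra_simps)

lemma has_partials_cmult:
  assumes "has_partials u a b z" shows "has_partials (\<lambda>z. k * u z) (k * a) (k * b) z"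
  using has_partials_mult[OF has_partials_const[of k] assms] by simp

lemma has_partials_cnj:
  assumes "has_partials u a b z" shows "has_partials (\<lambda>z. cnj (u z)) (cnj a) (cnj b) z"
  using bounded_linear.has_derivative[OF bounded_linear_cnj assms[unfolded has_partials_def]]
  unfolding has_partials_def by simp

lemma has_partials_id: "has_partials (\<lambda>z. z) 1 \<i> z"
  unfolding has_partials_def
  by (rule has_derivative_eq_rhs[OF has_derivative_ident]) (auto simp: complex_eq_iff)

lemma has_partials_real_compose:
  assumes "(\<phi> has_real_derivative d) (at (g z))" "(g has_derivative (\<lambda>h. Re h * a + Im h * b)) (at z)"
  shows "has_partials (\<lambda>z. of_real (\<phi> (g z))) (of_real (d * a)) (of_real (d * b)) z"
proof -
  have "((\<lambda>z. \<phi> (g z)) has_derivative (\<lambda>h. d * (Re h * a + Im h * b))) (at z)"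
    using has_derivative_compose[OF assms(2) assms(1)[unfolded has_field_derivative_def]] .
  from has_derivative_of_real[OF this]
  show ?thesis unfolding has_partials_def by (simp add: algebra_simps)
qed

lemma cmod_sq_has_derivative:
  "((\<lambda>w. (cmod (w - z0))\<^sup>2) has_derivative (\<lambda>h. Re h * (2 * Re (w - z0)) + Im h * (2 * Im (w - z0)))) (at w)"
  unfolding cmod_power2
  by (auto intro!: derivative_eq_intros simp: fun_eq_iff algebra_simps)

lemma has_partials_cmod_sq:
  assumes "(\<phi> has_real_derivative d) (at (1 - s * (cmod (w - z0))\<^sup>2))"
  shows "has_partials (\<lambda>w. of_real (\<phi> (1 - s * (cmod (w - z0))\<^sup>2)))
    (of_real (d * (- 2 * s * Re (w - z0)))) (of_real (d * (- 2 * s * Im (w - z0)))) w"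
proof -
  have "((\<lambda>w. 1 - s * (cmod (w - z0))\<^sup>2) has_derivative
      (\<lambda>h. 0 - s * (Re h * (2 * Re (w - z0)) + Im h * (2 * Im (w - z0))))) (at w)"
    by (intro has_derivative_diff has_derivative_const has_derivative_mult_right cmod_sq_has_derivative)
  also have "(\<lambda>h. 0 - s * (Re h * (2 * Re (w - z0)) + Im h * (2 * Im (w - z0))))
      = (\<lambda>h. Re h * (- 2 * s * Re (w - z0)) + Im h * (- 2 * s * Im (w - z0)))"
    by (auto simp: fun_eq_iff algebra_simps)
  finally show ?thesis
    by (rule has_partials_real_compose[where g = "\<lambda>w. 1 - s * (cmod (w - z0))\<^sup>2", OF assms])
qed

lemma has_partials_transform:
  assumes "has_partials u a b z" "open S" "z \<in> S" "\<And>w. w \<in> S \<Longrightarrow> u w = v w"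
  shows "has_partials v a b z"
  using has_derivative_transform_within_open[OF assms(1)[unfolded has_partials_def] assms(2,3)] assms(4)
  unfolding has_partials_def by blast

lemma iter_partial_append: "iter_partial I (partial i u) = iter_partial (I @ [i]) u"
  by (induction I) auto

lemma smooth_partial: "smooth u \<Longrightarrow> smooth (partial i u)"
  unfolding smooth_def by (simp add: iter_partial_append)

lemma smooth_has_partials: "smooth u \<Longrightarrow> has_partials u (partial CX u z) (partial CY u z) z"
  by (rule differentiable_has_partials) (metis smooth_def iter_partial.simps(1))

lemma smooth_continuous: assumes "smooth u" shows "continuous_on S u"
  using smooth_has_partials[OF assms] has_derivative_continuous
  unfolding has_partials_def by (blast intro: continuous_at_imp_continuous_on)

text \<open>A class of differentiable functions that is closed under partial derivatives consists of smooth
  functions.\<close>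

lemma smooth_coinduct:
  assumes "C u"
    and step: "\<And>u. C u \<Longrightarrow> \<exists>v w. C v \<and> C w \<and> (\<forall>z. has_partials u (v z) (w z) z)"
  shows "smooth u"
proof -
  have "C (iter_partial I u)" for I
  proof (induction I)
    case Nil then show ?case using assms(1) by simp
  next
    case (Cons i I)
    obtain v w where vw: "C v" "C w" "\<And>z. has_partials (iter_partial I u) (v z) (w z) z"
      using step[OF Cons.IH] by blast
    have "partial CX (iter_partial I u) = v" "partial CY (iter_partial I u) = w"
      using has_partials_partial[OF vw(3)] by auto
    then show ?case using vw by (cases i) auto
  qed
  then show ?thesis unfolding smooth_def using step has_partials_imp_differentiable by metis
qed

lemma smooth_add: assumes "smooth u" "smooth v" shows "smooth (\<lambda>z. u z + v z)"
proof (rule smooth_coinduct[where C = "\<lambda>f. \<exists>u v. smooth u \<and> smooth v \<and> f = (\<lambda>z. u z + v z)"])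
  fix f assume "\<exists>u v. smooth u \<and> smooth v \<and> f = (\<lambda>z. u z + v z)"
  then obtain u v where uv: "smooth u" "smooth v" "f = (\<lambda>z. u z + v z)" by blast
  show "\<exists>a b. (\<exists>u v. smooth u \<and> smooth v \<and> a = (\<lambda>z. u z + v z)) \<and>
     (\<exists>u v. smooth u \<and> smooth v \<and> b = (\<lambda>z. u z + v z)) \<and> (\<forall>z. has_partials f (a z) (b z) z)"
    by (rule exI[of _ "\<lambda>z. partial CX u z + partial CX v z"], rule exI[of _ "\<lambda>z. partial CY u z + partial CY v z"])
      (use uv in \<open>blast intro: smooth_partial has_partials_add smooth_has_partials\<close>)
qed (use assms in blast)

lemma smooth_cmult: assumes "smooth u" shows "smooth (\<lambda>z. k * u z)"
proof (rule smooth_coinduct[where C = "\<lambda>f. \<exists>u. smooth u \<and> f = (\<lambda>z. k * u z)"])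
  fix f assume "\<exists>u. smooth u \<and> f = (\<lambda>z. k * u z)"
  then obtain u where uv: "smooth u" "f = (\<lambda>z. k * u z)" by blast
  show "\<exists>a b. (\<exists>u. smooth u \<and> a = (\<lambda>z. k * u z)) \<and>
     (\<exists>u. smooth u \<and> b = (\<lambda>z. k * u z)) \<and> (\<forall>z. has_partials f (a z) (b z) z)"
    by (rule exI[of _ "\<lambda>z. k * partial CX u z"], rule exI[of _ "\<lambda>z. k * partial CY u z"])
      (use uv in \<open>blast intro: smooth_partial has_partials_cmult smooth_has_partials\<close>)
qed (use assms in blast)

lemma smooth_cnj: assumes "smooth u" shows "smooth (\<lambda>z. cnj (u z))"
proof (rule smooth_coinduct[where C = "\<lambda>f. \<exists>u. smooth u \<and> f = (\<lambda>z. cnj (u z))"])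
  fix f assume "\<exists>u. smooth u \<and> f = (\<lambda>z. cnj (u z))"
  then obtain u where uv: "smooth u" "f = (\<lambda>z. cnj (u z))" by blast
  show "\<exists>a b. (\<exists>u. smooth u \<and> a = (\<lambda>z. cnj (u z))) \<and>
     (\<exists>u. smooth u \<and> b = (\<lambda>z. cnj (u z))) \<and> (\<forall>z. has_partials f (a z) (b z) z)"
    by (rule exI[of _ "\<lambda>z. cnj (partial CX u z)"], rule exI[of _ "\<lambda>z. cnj (partial CY u z)"])
      (use uv in \<open>blast intro: smooth_partial has_partials_cnj smooth_has_partials\<close>)
qed (use assms in blast)

lemma test_functions_iff:
  "u \<in> test_functions \<longleftrightarrow> smooth u \<and> (\<exists>r. 0 < r \<and> r < 1 \<and> (\<forall>z. r \<le> cmod z \<longrightarrow> u z = 0))"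
proof
  assume u: "u \<in> test_functions"
  define K where "K = closure {z. u z \<noteq> 0}"
  have K: "compact K" "K \<subseteq> ball 0 1" "smooth u" using u unfolding test_functions_def K_def by simp_all
  have "\<exists>r. 0 < r \<and> r < 1 \<and> (\<forall>z. r \<le> cmod z \<longrightarrow> u z = 0)"
  proof (cases "K = {}")
    case True
    then have "u z = 0" for z unfolding K_def closure_eq_empty by blast
    then show ?thesis by (intro exI[of _ "1/2"]) simp
  next
    case False
    obtain x where x: "x \<in> K" "\<forall>y\<in>K. cmod y \<le> cmod x"
      using continuous_attains_sup[OF K(1) False continuous_on_norm[OF continuous_on_id]] by blast
    have x1: "cmod x < 1" using subsetD[OF K(2) x(1)] by simp
    have z0: "u z = 0" if "(cmod x + 1) / 2 \<le> cmod z" for z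
    proof (rule ccontr)
      assume "u z \<noteq> 0"
      then have "z \<in> K" unfolding K_def by (intro subsetD[OF closure_subset]) simp
      then have "cmod z \<le> cmod x" using x(2) by blast
      then show False using x1 that by (simp add: field_simps)
    qed
    have "0 < (cmod x + 1) / 2" "(cmod x + 1) / 2 < 1"
      using x1 norm_ge_zero[of x] by (simp_all add: add_nonneg_pos)
    then show ?thesis using z0 by (intro exI[of _ "(cmod x + 1) / 2"] conjI allI impI)
  qed
  then show "smooth u \<and> (\<exists>r. 0 < r \<and> r < 1 \<and> (\<forall>z. r \<le> cmod z \<longrightarrow> u z = 0))" using K(3) by simp
next
  assume "smooth u \<and> (\<exists>r. 0 < r \<and> r < 1 \<and> (\<forall>z. r \<le> cmod z \<longrightarrow> u z = 0))"
  then obtain r where r: "smooth u" "r < 1" "\<And>z. r \<le> cmod z \<Longrightarrow> u z = 0" by blast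
  have "closure {z. u z \<noteq> 0} \<subseteq> cball 0 r"
  proof (rule closure_minimal)
    show "{z. u z \<noteq> 0} \<subseteq> cball 0 r"
    proof
      fix z assume "z \<in> {z. u z \<noteq> 0}"
      then have "\<not> r \<le> cmod z" using r(3) by blast
      then show "z \<in> cball 0 r" by simp
    qed
  qed simp
  moreover from this have "compact (closure {z. u z \<noteq> 0})"
    unfolding compact_eq_bounded_closed using bounded_subset[OF bounded_cball] by blast
  moreover have "cball 0 r \<subseteq> ball (0::complex) 1" using r(2) by auto
  ultimately show "u \<in> test_functions" unfolding test_functions_def using r(1) by blast
qed

lemma test_functionsE:
  assumes "u \<in> test_functions"
  obtains r where "smooth u" "0 < r" "r < 1" "\<And>z. r \<le> cmod z \<Longrightarrow> u z = 0"
  using assms test_functions_iff by metis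

lemma test_functions_cmult: "u \<in> test_functions \<Longrightarrow> (\<lambda>z. k * u z) \<in> test_functions"
  unfolding test_functions_iff using smooth_cmult mult_zero_right by metis

lemma test_functions_cnj: "u \<in> test_functions \<Longrightarrow> (\<lambda>z. cnj (u z)) \<in> test_functions"
  unfolding test_functions_iff using smooth_cnj complex_cnj_zero by metis

lemma test_functions_add:
  assumes "u \<in> test_functions" "v \<in> test_functions" shows "(\<lambda>z. u z + v z) \<in> test_functions"
proof -
  obtain r where r: "smooth u" "0 < r" "r < 1" "\<And>z. r \<le> cmod z \<Longrightarrow> u z = 0"
    using assms(1) test_functionsE by blast
  obtain s where s: "smooth v" "0 < s" "s < 1" "\<And>z. s \<le> cmod z \<Longrightarrow> v z = 0"
    using assms(2) test_functionsE by blast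
  show ?thesis unfolding test_functions_iff
    using smooth_add[OF r(1) s(1)] r s by (intro conjI exI[of _ "max r s"]) auto
qed

lemma test_functions_diff:
  assumes "u \<in> test_functions" "v \<in> test_functions" shows "(\<lambda>z. u z - v z) \<in> test_functions"
  using test_functions_add[OF assms(1) test_functions_cmult[OF assms(2), of "-1"]] by simp

lemma test_functions_zero: "(\<lambda>z. 0) \<in> test_functions"
proof -
  have "smooth (\<lambda>z. 0)"
    by (rule smooth_coinduct[where C = "\<lambda>f. f = (\<lambda>z. 0)"]) (auto intro: has_partials_const)
  then show ?thesis unfolding test_functions_iff by (auto intro: exI[of _ "1/2"])
qed

lemma test_functions_has_partials:
  "u \<in> test_functions \<Longrightarrow> has_partials u (partial CX u z) (partial CY u z) z"
  by (auto simp: test_functions_iff intro: smooth_has_partials)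

lemma test_functions_partial: assumes "u \<in> test_functions" shows "partial i u \<in> test_functions"
proof -
  obtain r where r: "smooth u" "0 < r" "r < 1" "\<And>z. r \<le> cmod z \<Longrightarrow> u z = 0"
    using assms test_functionsE by blast
  have "partial i u z = 0" if "(r + 1) / 2 \<le> cmod z" for z
  proof -
    have "has_partials u 0 0 z"
    proof (rule has_partials_transform[OF has_partials_const])
      show "open (- cball 0 r :: complex set)" by auto
      show "z \<in> - cball 0 r" using that r by auto
    qed (use r in auto)
    then show ?thesis using has_partials_partial by (cases i) auto
  qed
  then show ?thesis unfolding test_functions_iff using r smooth_partial
    by (intro conjI exI[of _ "(r + 1) / 2"]) auto
qed

lemma partial_add_test:
  assumes "u \<in> test_functions" "v \<in> test_functions"
  shows "partial i (\<lambda>z. u z + v z) z = partial i u z + partial i v z"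
  using has_partials_partial[OF has_partials_add[OF assms[THEN test_functions_has_partials]]] by (cases i) auto

lemma partial_cmult_test:
  assumes "u \<in> test_functions" shows "partial i (\<lambda>z. k * u z) z = k * partial i u z"
  using has_partials_partial[OF has_partials_cmult[OF assms[THEN test_functions_has_partials]]] by (cases i) auto

lemma partial_diff_test:
  assumes "u \<in> test_functions" "v \<in> test_functions"
  shows "partial i (\<lambda>z. u z - v z) z = partial i u z - partial i v z"
  using partial_add_test[OF assms(1) test_functions_cmult[OF assms(2), of "-1"]]
    partial_cmult_test[OF assms(2), of i "-1"] by simp

lemma partial_cnj_test:
  assumes "u \<in> test_functions" shows "partial i (\<lambda>z. cnj (u z)) z = cnj (partial i u z)"
  using has_partials_partial[OF has_partials_cnj[OF assms[THEN test_functions_has_partials]]] by (cases i) auto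

definition dhol :: "(complex \<Rightarrow> complex) \<Rightarrow> complex \<Rightarrow> complex" where
  "dhol u z = (partial CX u z - \<i> * partial CY u z) / 2"

definition dbar :: "(complex \<Rightarrow> complex) \<Rightarrow> complex \<Rightarrow> complex" where
  "dbar u z = (partial CX u z + \<i> * partial CY u z) / 2"

lemma dhol_test: assumes "u \<in> test_functions" shows "dhol u \<in> test_functions"
  using test_functions_cmult[OF test_functions_diff[OF test_functions_partial[OF assms]
     test_functions_cmult[OF test_functions_partial[OF assms], of \<i>]], of "1/2" CX CY]
  by (simp add: dhol_def[abs_def])

lemma dbar_test: assumes "u \<in> test_functions" shows "dbar u \<in> test_functions"
  using test_functions_cmult[OF test_functions_add[OF test_functions_partial[OF assms]
     test_functions_cmult[OF test_functions_partial[OF assms], of \<i>]], of "1/2" CX CY]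
  by (simp add: dbar_def[abs_def])

lemma dbar_cnj: assumes "u \<in> test_functions" shows "dbar (\<lambda>z. cnj (u z)) z = cnj (dhol u z)"
  by (simp add: dbar_def dhol_def partial_cnj_test[OF assms])

text \<open>The smooth function \<open>exp(-1/t)\<close> on the positive half-line, continued by 0. The additional powers of \<open>1/t\<close>
  make the family closed under differentiation.\<close>

definition flat_exp :: "nat \<Rightarrow> real \<Rightarrow> real" where
  "flat_exp n t = (if t \<le> 0 then 0 else exp (- (1 / t)) / t ^ n)"

lemma flat_exp_nonneg: "0 \<le> flat_exp n t" by (simp add: flat_exp_def)

lemma flat_exp_pos: "0 < t \<Longrightarrow> 0 < flat_exp n t" by (simp add: flat_exp_def)

text \<open>The exponential \<open>exp(1/t)\<close> dominates every power of \<open>1/t\<close>. The case \<open>k = 2\<close> gives differentiability at 0, the case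
  \<open>k = 0\<close> a global bound.\<close>

lemma flat_exp_le_power: assumes "0 \<le> t" shows "flat_exp n t \<le> fact (n + k) * t ^ k"
proof (cases "t = 0")
  case False
  then have t: "t > 0" using assms by simp
  have "(1 / t) ^ (n + k) / fact (n + k) \<le> exp (1 / t)"
    using sum_le_suminf[OF summable_exp_generic[of "1/t::real"], of "{n + k}"] t
    by (simp add: exp_def scaleR_conv_of_real divide_inverse mult.commute)
  then have "exp (- (1 / t)) \<le> fact (n + k) * t ^ (n + k)"
    using t by (simp add: exp_minus field_simps)
  then show ?thesis using t by (simp add: flat_exp_def field_simps power_add)
qed (simp add: flat_exp_def)

lemma flat_exp_le: "flat_exp n t \<le> fact n"
  using flat_exp_le_power[of t n 0] by (cases "0 \<le> t") (auto simp: flat_exp_def)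

lemma flat_exp_deriv:
  "(flat_exp n has_real_derivative (flat_exp (n + 2) t - real n * flat_exp (n + 1) t)) (at t)"
proof -
  consider "t < 0" | "t > 0" | "t = 0" by linarith
  then show ?thesis
  proof cases
    case 1
    have "((\<lambda>t. 0) has_real_derivative 0) (at t)" by simp
    then have "(flat_exp n has_real_derivative 0) (at t)"
      by (rule has_field_derivative_transform_within_open[where S = "{..<0}"]) (use 1 in \<open>auto simp: flat_exp_def\<close>)
    then show ?thesis using 1 by (simp add: flat_exp_def)
  next
    case 2
    have "((\<lambda>t. exp (- (1 / t)) / t ^ n) has_real_derivative (flat_exp (n + 2) t - real n * flat_exp (n + 1) t)) (at t)"
    proof -
      have e: "((\<lambda>t::real. exp (- (1 / t))) has_real_derivative exp (- (1 / t)) * (1 / t\<^sup>2)) (at t)"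
        using 2 by (auto intro!: derivative_eq_intros simp: power2_eq_square)
      have p: "((\<lambda>t::real. t ^ n) has_real_derivative real n * t ^ (n - 1)) (at t)"
        using DERIV_pow[of n t] by simp
      have "((\<lambda>t. exp (- (1 / t)) / t ^ n) has_real_derivative
          (exp (- (1 / t)) * (1 / t\<^sup>2) * t ^ n - exp (- (1 / t)) * (real n * t ^ (n - 1))) / (t ^ n * t ^ n)) (at t)"
        by (rule DERIV_divide[OF e p]) (use 2 in simp)
      also have "(exp (- (1 / t)) * (1 / t\<^sup>2) * t ^ n - exp (- (1 / t)) * (real n * t ^ (n - 1))) / (t ^ n * t ^ n)
        = flat_exp (n + 2) t - real n * flat_exp (n + 1) t"
      proof -
        have "real n * t ^ (n - 1) * t = real n * t ^ n" by (cases n) auto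
        then show ?thesis using 2
          by (simp add: flat_exp_def divide_simps power_add power2_eq_square) (auto simp: algebra_simps)
      qed
      finally show ?thesis .
    qed
    then show ?thesis
      by (rule has_field_derivative_transform_within_open[where S = "{0<..}"]) (use 2 in \<open>auto simp: flat_exp_def\<close>)
  next
    case 3
    have "((\<lambda>h. (flat_exp n (0 + h) - flat_exp n 0) / h) \<longlongrightarrow> 0) (at 0)"
    proof (rule Lim_null_comparison)
      have "\<bar>flat_exp n h\<bar> \<le> fact (n + 2) * \<bar>h\<bar> * \<bar>h\<bar>" for h
        using flat_exp_le_power[of h n 2] flat_exp_nonneg[of n h]
        by (cases "0 \<le> h") (auto simp: flat_exp_def power2_eq_square mult.assoc)
      then show "\<forall>\<^sub>F h in at 0. norm ((flat_exp n (0 + h) - flat_exp n 0) / h) \<le> fact (n + 2) * \<bar>h\<bar>"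
        by (auto simp: eventually_at divide_simps flat_exp_def[of n 0] intro!: exI[of _ 1])
      show "((\<lambda>h::real. fact (n + 2) * \<bar>h\<bar>) \<longlongrightarrow> 0) (at 0)"
        by (auto intro!: tendsto_eq_intros)
    qed
    then show ?thesis using 3 by (simp add: DERIV_def flat_exp_def)
  qed
qed

lemma flat_exp0_lipschitz: "\<bar>flat_exp 0 s - flat_exp 0 t\<bar> \<le> 2 * \<bar>s - t\<bar>"
proof -
  have "norm (flat_exp 0 s - flat_exp 0 t) \<le> 2 * norm (s - t)"
  proof (rule field_differentiable_bound[of UNIV "flat_exp 0" "flat_exp 2"])
    fix z :: real
    show "(flat_exp 0 has_field_derivative flat_exp 2 z) (at z within UNIV)" using flat_exp_deriv[of 0 z] by (simp add: numeral_2_eq_2)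
    show "norm (flat_exp 2 z) \<le> 2" using flat_exp_le[of 2 z] flat_exp_nonneg[of 2 z] by simp
  qed auto
  then show ?thesis by simp
qed

lemma continuous_on_flat_exp: "continuous_on S (flat_exp n)"
  using flat_exp_deriv DERIV_isCont continuous_at_imp_continuous_on by blast

abbreviation bump :: "nat \<Rightarrow> real \<Rightarrow> complex \<Rightarrow> complex \<Rightarrow> real" where
  "bump n s z w \<equiv> flat_exp n (1 - s * (cmod (w - z))\<^sup>2)"

text \<open>The algebra generated by the coordinates and the radial functions around \<open>z0\<close> built from \<open>flat_exp\<close>. It is
  closed under partial derivatives, so it consists of smooth functions, and it contains all bump functions
  used below.\<close>

inductive bump_class :: "real \<Rightarrow> complex \<Rightarrow> (complex \<Rightarrow> complex) \<Rightarrow> bool" for s z0 where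
  const: "bump_class s z0 (\<lambda>w. c)"
| coord_Re: "bump_class s z0 (\<lambda>w. of_real (Re w))"
| coord_Im: "bump_class s z0 (\<lambda>w. of_real (Im w))"
| flat_exp: "bump_class s z0 (\<lambda>w. of_real (bump n s z0 w))"
| add: "bump_class s z0 u \<Longrightarrow> bump_class s z0 v \<Longrightarrow> bump_class s z0 (\<lambda>w. u w + v w)"
| mult: "bump_class s z0 u \<Longrightarrow> bump_class s z0 v \<Longrightarrow> bump_class s z0 (\<lambda>w. u w * v w)"

lemma bump_class_smooth: assumes "bump_class s z0 u" shows "smooth u"
proof (rule smooth_coinduct[where C = "bump_class s z0", OF assms])
  fix u assume "bump_class s z0 u"
  then show "\<exists>v w. bump_class s z0 v \<and> bump_class s z0 w \<and> (\<forall>z. has_partials u (v z) (w z) z)"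
  proof induction
    case (const c)
    show ?case by (intro exI[of _ "\<lambda>_. 0"] conjI allI has_partials_const bump_class.const)
  next
    case coord_Re
    show ?case
    proof (rule exI[of _ "\<lambda>_. 1"], rule exI[of _ "\<lambda>_. 0"], intro conjI allI bump_class.const)
      show "has_partials (\<lambda>w. of_real (Re w)) 1 0 w" for w
        using bounded_linear_imp_has_derivative[OF bounded_linear_compose[OF bounded_linear_of_real bounded_linear_Re]]
        by (simp add: has_partials_def)
    qed
  next
    case coord_Im
    show ?case
    proof (rule exI[of _ "\<lambda>_. 0"], rule exI[of _ "\<lambda>_. 1"], intro conjI allI bump_class.const)
      show "has_partials (\<lambda>w. of_real (Im w)) 0 1 w" for w
        using bounded_linear_imp_has_derivative[OF bounded_linear_compose[OF bounded_linear_of_real bounded_linear_Im]]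
        by (simp add: has_partials_def)
    qed
  next
    case (flat_exp n)
    define d where "d t = flat_exp (n + 2) t - real n * flat_exp (n + 1) t" for t
    have dC: "bump_class s z0 (\<lambda>w. of_real (d (1 - s * (cmod (w - z0))\<^sup>2)))"
      using bump_class.add[OF bump_class.flat_exp bump_class.mult[OF bump_class.const[where c = "- of_nat n"] bump_class.flat_exp],
          of s z0 "n + 2" "n + 1"]
      by (simp add: d_def)
    have l: "bump_class s z0 (\<lambda>w. - 2 * of_real s * (of_real (Re w) + - of_real (Re z0)))"
      "bump_class s z0 (\<lambda>w. - 2 * of_real s * (of_real (Im w) + - of_real (Im z0)))"
      by (rule bump_class.mult[OF bump_class.const bump_class.add[OF bump_class.coord_Re bump_class.const]],
          rule bump_class.mult[OF bump_class.const bump_class.add[OF bump_class.coord_Im bump_class.const]])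
    show ?case
    proof (intro exI conjI allI)
      show "bump_class s z0 (\<lambda>w. of_real (d (1 - s * (cmod (w - z0))\<^sup>2)) * (- 2 * of_real s * (of_real (Re w) + - of_real (Re z0))))"
        "bump_class s z0 (\<lambda>w. of_real (d (1 - s * (cmod (w - z0))\<^sup>2)) * (- 2 * of_real s * (of_real (Im w) + - of_real (Im z0))))"
        by (rule bump_class.mult[OF dC l(1)], rule bump_class.mult[OF dC l(2)])
      show "has_partials (\<lambda>w. of_real (bump n s z0 w))
        (of_real (d (1 - s * (cmod (w - z0))\<^sup>2)) * (- 2 * of_real s * (of_real (Re w) + - of_real (Re z0))))
        (of_real (d (1 - s * (cmod (w - z0))\<^sup>2)) * (- 2 * of_real s * (of_real (Im w) + - of_real (Im z0)))) w" for w
        using has_partials_cmod_sq[OF flat_exp_deriv, of n s z0 w] by (simp add: d_def)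
    qed
  next
    case (add u v)
    then obtain a b c d where *: "bump_class s z0 a" "bump_class s z0 b" "\<And>z. has_partials u (a z) (b z) z"
      "bump_class s z0 c" "bump_class s z0 d" "\<And>z. has_partials v (c z) (d z) z" by blast
    show ?case
      by (rule exI[of _ "\<lambda>z. a z + c z"], rule exI[of _ "\<lambda>z. b z + d z"])
        (intro conjI allI bump_class.add[OF *(1,4)] bump_class.add[OF *(2,5)] has_partials_add[OF *(3,6)])
  next
    case (mult u v)
    then obtain a b c d where *: "bump_class s z0 a" "bump_class s z0 b" "\<And>z. has_partials u (a z) (b z) z"
      "bump_class s z0 c" "bump_class s z0 d" "\<And>z. has_partials v (c z) (d z) z" by blast
    show ?case
      by (rule exI[of _ "\<lambda>z. a z * v z + u z * c z"], rule exI[of _ "\<lambda>z. b z * v z + u z * d z"])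
        (intro conjI allI has_partials_mult[OF *(3,6)]
          bump_class.add[OF bump_class.mult[OF *(1) mult(2)] bump_class.mult[OF mult(1) *(4)]]
          bump_class.add[OF bump_class.mult[OF *(2) mult(2)] bump_class.mult[OF mult(1) *(5)]])
  qed
qed

section \<open>Weyl's lemma\<close>

text \<open>Dominated convergence for the difference quotients; the Lipschitz constant of the kernel in the parameter
  provides the majorant, and it also bounds the derivative of the kernel.\<close>

lemma has_derivative_integral_param:
  fixes k :: "'p::real_normed_vector \<Rightarrow> 'a \<Rightarrow> complex" and g :: "'a \<Rightarrow> complex"
  assumes g: "integrable M g"
    and km [measurable]: "\<And>p. k p \<in> borel_measurable M"
    and k'm [measurable]: "\<And>h. (\<lambda>w. k' w h) \<in> borel_measurable M"
    and der: "\<And>w. ((\<lambda>p. k p w) has_derivative k' w) (at p0)"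
    and bd: "\<And>w. cmod (k p0 w) \<le> B"
    and lip: "0 < \<delta>" "\<And>p w. g w \<noteq> 0 \<Longrightarrow> dist p p0 < \<delta> \<Longrightarrow> cmod (k p w - k p0 w) \<le> L * norm (p - p0)"
  shows "((\<lambda>p. \<integral>w. g w * k p w \<partial>M) has_derivative (\<lambda>h. \<integral>w. g w * k' w h \<partial>M)) (at p0)"
proof -
  have gm [measurable]: "g \<in> borel_measurable M" using g by auto
  have k'b: "cmod (k' w h) \<le> L * norm h" if gw: "g w \<noteq> 0" for w h
  proof (cases "h = 0")
    case True
    then show ?thesis using has_derivative_bounded_linear[OF der[of w]] by (simp add: bounded_linear.linear linear_0)
  next
    case False
    interpret bounded_linear "k' w" by (rule has_derivative_bounded_linear[OF der])
    have "((\<lambda>t::real. p0 + t *\<^sub>R h) has_derivative (\<lambda>t. t *\<^sub>R h)) (at 0)"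
      by (auto intro!: derivative_eq_intros)
    then have "((\<lambda>t. k (p0 + t *\<^sub>R h) w) has_derivative (\<lambda>t. k' w (t *\<^sub>R h))) (at 0)"
      by (rule has_derivative_compose) (use der in simp)
    then have "((\<lambda>t. k (p0 + t *\<^sub>R h) w) has_vector_derivative k' w h) (at 0)"
      unfolding has_vector_derivative_def scaleR .
    then have "(\<lambda>t. (k (p0 + t *\<^sub>R h) w - k p0 w) /\<^sub>R t) \<midarrow>0\<rightarrow> k' w h"
    proof -
      assume "((\<lambda>t. k (p0 + t *\<^sub>R h) w) has_vector_derivative k' w h) (at 0)"
      then have "(\<lambda>t. cmod (k (p0 + t *\<^sub>R h) w - k p0 w - t *\<^sub>R k' w h) / norm t) \<midarrow>0\<rightarrow> 0"
        unfolding has_vector_derivative_def has_derivative_at by simp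
      moreover have "\<forall>\<^sub>F t in at 0. cmod (k (p0 + t *\<^sub>R h) w - k p0 w - t *\<^sub>R k' w h) / norm t
          = cmod ((k (p0 + t *\<^sub>R h) w - k p0 w) /\<^sub>R t - k' w h)"
        unfolding eventually_at
      proof (intro exI[of _ 1] conjI ballI impI zero_less_one)
        fix t :: real assume "t \<noteq> 0 \<and> dist t 0 < 1"
        then have "(k (p0 + t *\<^sub>R h) w - k p0 w) /\<^sub>R t - k' w h
            = (k (p0 + t *\<^sub>R h) w - k p0 w - t *\<^sub>R k' w h) /\<^sub>R t" by (simp add: algebra_simps)
        then show "cmod (k (p0 + t *\<^sub>R h) w - k p0 w - t *\<^sub>R k' w h) / norm t
          = cmod ((k (p0 + t *\<^sub>R h) w - k p0 w) /\<^sub>R t - k' w h)"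
          by (simp add: divide_inverse mult.commute)
      qed
      ultimately have "(\<lambda>t. cmod ((k (p0 + t *\<^sub>R h) w - k p0 w) /\<^sub>R t - k' w h)) \<midarrow>0\<rightarrow> 0"
        by (rule Lim_transform_eventually)
      then show ?thesis unfolding tendsto_norm_zero_iff by (rule LIM_zero_cancel)
    qed
    then have t: "((\<lambda>t. cmod ((k (p0 + t *\<^sub>R h) w - k p0 w) /\<^sub>R t)) \<longlongrightarrow> cmod (k' w h)) (at 0)"
      by (rule tendsto_norm)
    show ?thesis
    proof (rule tendsto_upperbound[OF t])
      have d: "0 < \<delta> / norm h" using lip(1) False by simp
      show "\<forall>\<^sub>F t in at 0. cmod ((k (p0 + t *\<^sub>R h) w - k p0 w) /\<^sub>R t) \<le> L * norm h"
        unfolding eventually_at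
      proof (intro exI[of _ "\<delta> / norm h"] conjI ballI impI d)
        fix t :: real assume "t \<noteq> 0 \<and> dist t 0 < \<delta> / norm h"
        then have "t \<noteq> 0" "dist (p0 + t *\<^sub>R h) p0 < \<delta>"
          using False by (auto simp: dist_norm pos_less_divide_eq)
        then show "cmod ((k (p0 + t *\<^sub>R h) w - k p0 w) /\<^sub>R t) \<le> L * norm h"
          using lip(2)[OF gw, of "p0 + t *\<^sub>R h"]
          unfolding norm_scaleR abs_inverse divide_inverse_commute[symmetric]
          by (simp add: pos_divide_le_eq mult.commute mult.left_commute)
      qed
    qed auto
  qed
  have ik0: "integrable M (\<lambda>w. g w * k p0 w)"
  proof (rule Bochner_Integration.integrable_bound)
    show "integrable M (\<lambda>w. B * cmod (g w))" using g by auto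
    show "AE w in M. cmod (g w * k p0 w) \<le> norm (B * cmod (g w))"
    proof (rule AE_I2)
      fix w
      have "cmod (k p0 w) \<le> \<bar>B\<bar>" using bd by (rule order_trans) simp
      from mult_left_mono[OF this, of "cmod (g w)"] show "cmod (g w * k p0 w) \<le> norm (B * cmod (g w))"
        by (simp add: norm_mult abs_mult mult.commute)
    qed
  qed auto
  have ik: "integrable M (\<lambda>w. g w * k p w)" if "dist p p0 < \<delta>" for p
  proof -
    have "integrable M (\<lambda>w. g w * (k p w - k p0 w))"
    proof (rule Bochner_Integration.integrable_bound)
      show "integrable M (\<lambda>w. (L * norm (p - p0)) * cmod (g w))" using g by auto
      show "AE w in M. cmod (g w * (k p w - k p0 w)) \<le> norm ((L * norm (p - p0)) * cmod (g w))"
      proof (rule AE_I2)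
        fix w
        show "cmod (g w * (k p w - k p0 w)) \<le> norm ((L * norm (p - p0)) * cmod (g w))"
        proof (cases "g w = 0")
          case False
          have "cmod (k p w - k p0 w) \<le> \<bar>L * norm (p - p0)\<bar>"
            using lip(2)[OF False that] by linarith
          then show ?thesis by (simp add: norm_mult abs_mult mult.commute mult_left_mono)
        qed simp
      qed
    qed auto
    from Bochner_Integration.integrable_add[OF this ik0] show ?thesis by (simp add: algebra_simps)
  qed
  have ik': "integrable M (\<lambda>w. g w * k' w h)" for h
  proof (rule Bochner_Integration.integrable_bound)
    show "integrable M (\<lambda>w. (L * norm h) * cmod (g w))" using g by auto
    show "AE w in M. cmod (g w * k' w h) \<le> norm ((L * norm h) * cmod (g w))"
    proof (rule AE_I2)
      fix w
      show "cmod (g w * k' w h) \<le> norm ((L * norm h) * cmod (g w))"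
      proof (cases "g w = 0")
        case False
        have "cmod (k' w h) \<le> \<bar>L * norm h\<bar>" using k'b[OF False] by (rule order_trans) simp
        then show ?thesis by (simp add: norm_mult abs_mult mult.commute mult_left_mono)
      qed simp
    qed
  qed auto
  define C where "C = (\<integral>w. \<bar>L\<bar> * cmod (g w) \<partial>M)"
  have lin: "bounded_linear (\<lambda>h. \<integral>w. g w * k' w h \<partial>M)"
  proof (rule bounded_linear_intro[where K = C])
    have L: "bounded_linear (k' w)" for w by (rule has_derivative_bounded_linear[OF der])
    show "(\<integral>w. g w * k' w (x + y) \<partial>M) = (\<integral>w. g w * k' w x \<partial>M) + (\<integral>w. g w * k' w y \<partial>M)" for x y
      using ik' by (simp add: linear_add[OF bounded_linear.linear[OF L]] ring_distribs)
    show "(\<integral>w. g w * k' w (r *\<^sub>R x) \<partial>M) = r *\<^sub>R (\<integral>w. g w * k' w x \<partial>M)" for r x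
      by (simp add: linear_scale[OF bounded_linear.linear[OF L]])
    show "cmod (\<integral>w. g w * k' w x \<partial>M) \<le> norm x * C" for x
    proof -
      have "cmod (\<integral>w. g w * k' w x \<partial>M) \<le> (\<integral>w. cmod (g w * k' w x) \<partial>M)" by (rule integral_norm_bound)
      also have "\<dots> \<le> (\<integral>w. norm x * (\<bar>L\<bar> * cmod (g w)) \<partial>M)"
      proof (rule integral_mono)
        show "integrable M (\<lambda>w. cmod (g w * k' w x))" using ik' by auto
        show "integrable M (\<lambda>w. norm x * (\<bar>L\<bar> * cmod (g w)))" using g by auto
        fix w show "cmod (g w * k' w x) \<le> norm x * (\<bar>L\<bar> * cmod (g w))"
        proof (cases "g w = 0")
          case False
          have "cmod (k' w x) \<le> \<bar>L\<bar> * norm x" using k'b[OF False] by (rule order_trans) (simp add: mult_right_mono)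
          then have "cmod (g w) * cmod (k' w x) \<le> cmod (g w) * (\<bar>L\<bar> * norm x)" by (rule mult_left_mono) simp
          then show ?thesis by (simp add: norm_mult algebra_simps)
        qed simp
      qed
      also have "\<dots> = norm x * C" by (simp add: C_def)
      finally show ?thesis .
    qed
  qed
  show ?thesis
    unfolding has_derivative_at_within
  proof (intro conjI lin)
    show "((\<lambda>y. ((\<integral>w. g w * k y w \<partial>M) - (\<integral>w. g w * k p0 w \<partial>M) - (\<integral>w. g w * k' w (y - p0) \<partial>M)) /\<^sub>R norm (y - p0)) \<longlongrightarrow> 0) (at p0)"
      unfolding tendsto_at_iff_sequentially comp_def
    proof (intro allI impI)
      fix X assume X: "\<forall>i. X i \<in> UNIV - {p0}" "X \<longlonglongrightarrow> p0"
      define q where "q n w = (k (X n) w - k p0 w - k' w (X n - p0)) /\<^sub>R norm (X n - p0)" for n w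
      obtain N where N: "\<And>n. n \<ge> N \<Longrightarrow> dist (X n) p0 < \<delta>"
        using metric_LIMSEQ_D[OF X(2) lip(1)] by blast
      have "(\<lambda>n. \<integral>w. g w * q (n + N) w \<partial>M) \<longlonglongrightarrow> (\<integral>w. 0 \<partial>M)"
      proof (rule integral_dominated_convergence)
        show "integrable M (\<lambda>w. (2 * \<bar>L\<bar>) * cmod (g w))" using g by auto
        show "(\<lambda>w. g w * q (n + N) w) \<in> borel_measurable M" for n unfolding q_def by measurable
        show "AE w in M. (\<lambda>n. g w * q (n + N) w) \<longlonglongrightarrow> 0"
        proof (rule AE_I2)
          fix w
          have "((\<lambda>y. (k y w - k p0 w - k' w (y - p0)) /\<^sub>R norm (y - p0)) \<longlongrightarrow> 0) (at p0)"
            using der[of w] unfolding has_derivative_at_within by blast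
          then have "(\<lambda>n. q n w) \<longlonglongrightarrow> 0"
            using X unfolding tendsto_at_iff_sequentially comp_def q_def by blast
          then have "(\<lambda>n. q (n + N) w) \<longlonglongrightarrow> 0" by (rule LIMSEQ_ignore_initial_segment)
          from tendsto_mult_right_zero[OF this] show "(\<lambda>n. g w * q (n + N) w) \<longlonglongrightarrow> 0" .
        qed
        show "AE w in M. norm (g w * q (n + N) w) \<le> (2 * \<bar>L\<bar>) * cmod (g w)" for n
        proof (rule AE_I2)
          fix w show "norm (g w * q (n + N) w) \<le> (2 * \<bar>L\<bar>) * cmod (g w)"
          proof (cases "g w = 0")
            case False
            define y where "y = X (n + N)"
            have y: "dist y p0 < \<delta>" "y \<noteq> p0" unfolding y_def using N X(1) by auto
            have "cmod (k y w - k p0 w - k' w (y - p0)) \<le> L * norm (y - p0) + L * norm (y - p0)"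
              by (rule order_trans[OF norm_triangle_ineq4 add_mono[OF lip(2)[OF False y(1)] k'b[OF False]]])
            also have "\<dots> \<le> (2 * \<bar>L\<bar>) * norm (y - p0)"
              using mult_right_mono[OF abs_ge_self[of L], of "norm (y - p0)"] by simp
            finally have "cmod (q (n + N) w) \<le> 2 * \<bar>L\<bar>"
              using y unfolding q_def y_def[symmetric] norm_scaleR abs_inverse divide_inverse_commute[symmetric]
              by (simp add: pos_divide_le_eq)
            then show ?thesis by (simp add: norm_mult mult.commute mult_left_mono)
          qed simp
        qed
      qed auto
      then have "(\<lambda>n. \<integral>w. g w * q n w \<partial>M) \<longlonglongrightarrow> 0"
        by (subst LIMSEQ_offset[of _ N]) auto
      moreover have "\<forall>\<^sub>F n in sequentially. (\<integral>w. g w * q n w \<partial>M)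
          = ((\<integral>w. g w * k (X n) w \<partial>M) - (\<integral>w. g w * k p0 w \<partial>M) - (\<integral>w. g w * k' w (X n - p0) \<partial>M)) /\<^sub>R norm (X n - p0)"
        unfolding eventually_sequentially
      proof (intro exI[of _ N] allI impI)
        fix n assume "N \<le> n"
        then have d: "dist (X n) p0 < \<delta>" by (rule N)
        have "(\<integral>w. g w * q n w \<partial>M) = (\<integral>w. (g w * k (X n) w - g w * k p0 w - g w * k' w (X n - p0)) /\<^sub>R norm (X n - p0) \<partial>M)"
          unfolding q_def by (intro Bochner_Integration.integral_cong) (auto simp: algebra_simps)
        also have "\<dots> = (\<integral>w. (g w * k (X n) w - g w * k p0 w - g w * k' w (X n - p0)) \<partial>M) /\<^sub>R norm (X n - p0)"
          by simp
        also have "(\<integral>w. (g w * k (X n) w - g w * k p0 w - g w * k' w (X n - p0)) \<partial>M)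
          = (\<integral>w. g w * k (X n) w \<partial>M) - (\<integral>w. g w * k p0 w \<partial>M) - (\<integral>w. g w * k' w (X n - p0) \<partial>M)"
          using ik[OF d] ik0 ik' by simp
        finally show "(\<integral>w. g w * q n w \<partial>M)
          = ((\<integral>w. g w * k (X n) w \<partial>M) - (\<integral>w. g w * k p0 w \<partial>M) - (\<integral>w. g w * k' w (X n - p0) \<partial>M)) /\<^sub>R norm (X n - p0)" .
      qed
      ultimately show "(\<lambda>n. ((\<integral>w. g w * k (X n) w \<partial>M) - (\<integral>w. g w * k p0 w \<partial>M) - (\<integral>w. g w * k' w (X n - p0) \<partial>M)) /\<^sub>R norm (X n - p0)) \<longlonglongrightarrow> 0"
        using tendsto_cong by force
    qed
  qed
qed

text \<open>Measurable functions are limits almost everywhere of continuous ones. Applied to the conjugate sign of \<open>c\<close>,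
  truncated to modulus 1 and multiplied by the cutoff \<open>X\<close>, this turns the hypothesis into a vanishing integral of \<open>|c| X\<close>.\<close>

lemma AE_zero_if_integral_continuous_zero:
  fixes c :: "complex \<Rightarrow> complex"
  assumes c [measurable]: "c \<in> borel_measurable borel"
    and int: "integrable lborel (\<lambda>z. indicator (cball 0 r) z *\<^sub>R c z)"
    and zero: "\<And>\<psi>. continuous_on UNIV \<psi> \<Longrightarrow> (\<And>z. r \<le> cmod z \<Longrightarrow> \<psi> z = 0) \<Longrightarrow> (\<integral>z. c z * \<psi> z \<partial>lborel) = 0"
  shows "AE z in lborel. cmod z < r \<longrightarrow> c z = 0"
proof -
  define s where "s z = cnj (sgn (c z))" for z
  have "sgn \<in> borel_measurable (borel :: complex measure)" by measurable
  then have sm: "s \<in> borel_measurable borel"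
    unfolding s_def using measurable_compose[OF measurable_compose[OF c \<open>sgn \<in> _\<close>] borel_measurable_continuous_onI[of cnj]]
    by (auto intro: continuous_intros)
  then have "s \<in> borel_measurable lebesgue" by (intro measurable_completion) simp
  then have "s measurable_on UNIV" by (rule lebesgue_measurable_imp_measurable_on) simp
  then obtain N g where N: "negligible N" and g: "\<And>n. continuous_on UNIV (g n)"
    and lim: "\<And>x. x \<notin> N \<Longrightarrow> (\<lambda>n. g n x) \<longlonglongrightarrow> s x"
    unfolding measurable_on_def by auto
  have AEN: "AE z in lborel. z \<notin> N"
    using N negligible_iff_null_sets AE_not_in AE_completion_iff by blast
  define G where "G n z = g n z / of_real (max 1 (cmod (g n z)))" for n z
  define X where "X z = max 0 (r - cmod z)" for z :: complex
  have Gb: "cmod (G n z) \<le> 1" for n z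
    unfolding G_def by (simp add: norm_divide divide_le_eq)
  have Gc: "continuous_on UNIV (\<lambda>z. G n z * of_real (X z))" for n
    unfolding G_def X_def
    by (intro continuous_intros g ballI) (auto simp: max_def)
  have 0: "(\<integral>z. c z * (G n z * of_real (X z)) \<partial>lborel) = 0" for n
    by (rule zero[OF Gc]) (auto simp: X_def)
  have "(\<lambda>n. \<integral>z. c z * (G n z * of_real (X z)) \<partial>lborel) \<longlonglongrightarrow> (\<integral>z. of_real (cmod (c z) * X z) \<partial>lborel)"
  proof (rule integral_dominated_convergence)
    show "integrable lborel (\<lambda>z. \<bar>r\<bar> * norm (indicator (cball 0 r) z *\<^sub>R c z))"
      using int by (intro integrable_mult_right integrable_norm)
    show "(\<lambda>z. c z * (G n z * of_real (X z))) \<in> borel_measurable lborel" for n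
      using borel_measurable_continuous_onI[OF Gc[of n]] by simp
    show "(\<lambda>z. complex_of_real (cmod (c z) * X z)) \<in> borel_measurable lborel"
      unfolding X_def by measurable
    show "AE z in lborel. (\<lambda>n. c z * (G n z * of_real (X z))) \<longlonglongrightarrow> of_real (cmod (c z) * X z)"
      using AEN
    proof eventually_elim
      case (elim z)
      have "(\<lambda>n. G n z) \<longlonglongrightarrow> s z / of_real (max 1 (cmod (s z)))"
        unfolding G_def by (intro tendsto_intros lim elim) (auto simp: max_def)
      moreover have "cmod (s z) \<le> 1" by (simp add: s_def norm_sgn)
      ultimately have "(\<lambda>n. c z * (G n z * of_real (X z))) \<longlonglongrightarrow> c z * (s z * of_real (X z))"
        by (intro tendsto_intros) simp
      also have "c z * (s z * of_real (X z)) = of_real (cmod (c z) * X z)"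
      proof (cases "c z = 0")
        case False
        then have "c z * s z = of_real (cmod (c z))"
          using complex_norm_square[of "c z"]
          by (simp add: s_def sgn_div_norm scaleR_conv_of_real field_simps power2_eq_square)
        then show ?thesis by (simp add: mult.assoc[symmetric])
      qed simp
      finally show ?case .
    qed
    show "AE z in lborel. norm (c z * (G n z * of_real (X z))) \<le> \<bar>r\<bar> * norm (indicator (cball 0 r) z *\<^sub>R c z)" for n
    proof (rule AE_I2)
      fix z
      show "norm (c z * (G n z * of_real (X z))) \<le> \<bar>r\<bar> * norm (indicator (cball 0 r) z *\<^sub>R c z)"
      proof (cases "cmod z \<le> r")
        case True
        have "cmod (G n z) * X z \<le> 1 * \<bar>r\<bar>"
        proof (intro mult_mono Gb)
          show "X z \<le> \<bar>r\<bar>" using norm_ge_zero[of z] unfolding X_def by linarith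
        qed (auto simp: X_def)
        then have "cmod (c z) * (cmod (G n z) * \<bar>X z\<bar>) \<le> cmod (c z) * \<bar>r\<bar>"
          by (intro mult_left_mono) (auto simp: X_def)
        then show ?thesis using True by (simp add: norm_mult mult.commute)
      qed (simp add: X_def)
    qed
  qed
  then have "(\<integral>z. complex_of_real (cmod (c z) * X z) \<partial>lborel) = 0"
    unfolding 0 by (rule LIMSEQ_unique[OF _ tendsto_const])
  then have "complex_of_real (\<integral>z. cmod (c z) * X z \<partial>lborel) = 0"
    by (simp only: integral_complex_of_real)
  then have i0: "(\<integral>z. cmod (c z) * X z \<partial>lborel) = 0" by simp
  have ii: "integrable lborel (\<lambda>z. cmod (c z) * X z)"
  proof (rule Bochner_Integration.integrable_bound)
    show "integrable lborel (\<lambda>z. \<bar>r\<bar> * norm (indicator (cball 0 r) z *\<^sub>R c z))"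
      using int by (intro integrable_mult_right integrable_norm)
    show "AE z in lborel. norm (cmod (c z) * X z) \<le> norm (\<bar>r\<bar> * norm (indicator (cball 0 r) z *\<^sub>R c z))"
    proof (rule AE_I2)
      fix z show "norm (cmod (c z) * X z) \<le> norm (\<bar>r\<bar> * norm (indicator (cball 0 r) z *\<^sub>R c z))"
      proof (cases "cmod z \<le> r")
        case True
        have "X z \<le> \<bar>r\<bar>" using norm_ge_zero[of z] unfolding X_def by linarith
        moreover have "0 \<le> X z" by (simp add: X_def)
        ultimately show ?thesis using True mult_left_mono[of "X z" "\<bar>r\<bar>" "cmod (c z)"]
          by (simp add: abs_mult mult.commute)
      qed (simp add: X_def)
    qed
    show "(\<lambda>z. cmod (c z) * X z) \<in> borel_measurable lborel" unfolding X_def by measurable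
  qed
  have "AE z in lborel. cmod (c z) * X z = 0"
    using integral_nonneg_eq_0_iff_AE[OF ii] i0 by (auto simp: X_def)
  then show ?thesis by eventually_elim (auto simp: X_def)
qed

lemma flat_exp_measurable [measurable]: "flat_exp n \<in> borel_measurable borel"
  by (rule borel_measurable_continuous_onI[OF continuous_on_flat_exp])

lemma bump_eq_0: assumes "0 < \<tau>" "1 / \<tau> \<le> cmod (w - z)" shows "bump n (\<tau>\<^sup>2) z w = 0"
proof -
  have "1 \<le> \<tau> * cmod (w - z)" using assms by (simp add: field_simps)
  then have "1 \<le> (\<tau> * cmod (w - z))\<^sup>2" by simp
  then show ?thesis by (simp add: flat_exp_def power_mult_distrib)
qed

lemma test_function_bump:
  assumes "0 < \<tau>" "cmod z + 1 / \<tau> < 1" "bump_class (\<tau>\<^sup>2) z v"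
  shows "(\<lambda>w. v w * of_real (bump n (\<tau>\<^sup>2) z w)) \<in> test_functions"
  unfolding test_functions_iff
proof (intro conjI exI[of _ "cmod z + 1 / \<tau>"] allI impI)
  show "smooth (\<lambda>w. v w * of_real (bump n (\<tau>\<^sup>2) z w))"
    by (rule bump_class_smooth[OF bump_class.mult[OF assms(3) bump_class.flat_exp]])
  show "0 < cmod z + 1 / \<tau>" using assms(1) by (simp add: add_nonneg_pos)
  show "cmod z + 1 / \<tau> < 1" by fact
  fix w assume "cmod z + 1 / \<tau> \<le> cmod w"
  then have "1 / \<tau> \<le> cmod (w - z)" using norm_triangle_sub[of w z] by linarith
  then show "v w * of_real (bump n (\<tau>\<^sup>2) z w) = 0"
    using bump_eq_0[OF assms(1)] by simp
qed

text \<open>Convolution with \<open>\<tau>\<^sup>2 \<rho>(\<tau> w)\<close> for the radial bump \<open>\<rho>(w) = exp(-1 / (1 - |w|\<^sup>2))\<close> with support in the closed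
  unit disk. The kernel is not normalized; its mass is \<open>bump_mass\<close>.\<close>

definition mollify :: "(complex \<Rightarrow> complex) \<Rightarrow> real \<Rightarrow> complex \<Rightarrow> complex" where
  "mollify b \<tau> z = (\<integral>w. b w * of_real (\<tau>\<^sup>2 * bump 0 (\<tau>\<^sup>2) z w) \<partial>lborel)"

lemma mollify_localize:
  assumes "0 < \<tau>" "cmod z + 1 / \<tau> \<le> r"
  shows "mollify b \<tau> z = (\<integral>w. (indicator (cball 0 r) w *\<^sub>R b w) * of_real (\<tau>\<^sup>2 * bump 0 (\<tau>\<^sup>2) z w) \<partial>lborel)"
  unfolding mollify_def
proof (rule Bochner_Integration.integral_cong[OF refl])
  fix w
  show "b w * of_real (\<tau>\<^sup>2 * bump 0 (\<tau>\<^sup>2) z w)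
    = (indicator (cball 0 r) w *\<^sub>R b w) * of_real (\<tau>\<^sup>2 * bump 0 (\<tau>\<^sup>2) z w)"
  proof (cases "cmod w \<le> r")
    case False
    then have "1 / \<tau> \<le> cmod (w - z)" using norm_triangle_sub[of w z] assms(2) by linarith
    then show ?thesis using bump_eq_0[OF assms(1)] by simp
  qed simp
qed

lemma abs_sq_diff_le: "\<bar>(cmod a)\<^sup>2 - (cmod b)\<^sup>2\<bar> \<le> cmod (a - b) * (cmod a + cmod b)"
proof -
  have "(cmod a)\<^sup>2 - (cmod b)\<^sup>2 = (cmod a - cmod b) * (cmod a + cmod b)"
    by (simp add: power2_eq_square algebra_simps)
  then show ?thesis using norm_triangle_ineq3[of a b] by (simp add: abs_mult mult_right_mono)
qed

lemma dbar_bump: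
  "dbar (\<lambda>w. 1 * of_real (bump 0 s z w)) w
    = - of_real (s * bump 2 s z w) * (w - z)"
proof -
  have d: "(flat_exp 0 has_real_derivative flat_exp 2 t) (at t)" for t
    using flat_exp_deriv[of 0 t] by (simp add: numeral_2_eq_2)
  note p = has_partials_partial[OF has_partials_cmod_sq[OF d, of s z w]]
  show ?thesis unfolding dbar_def mult_1 p
    by (simp add: complex_eq_iff)
qed

lemma dbar_cnj_bump:
  "dbar (\<lambda>w. cnj (w - z) * of_real (bump 0 s z w)) w
    = of_real (bump 0 s z w - s * (cmod (w - z))\<^sup>2 * bump 2 s z w)"
proof -
  define t where "t = 1 - s * (cmod (w - z))\<^sup>2"
  have d: "(flat_exp 0 has_real_derivative flat_exp 2 t) (at t)" for t
    using flat_exp_deriv[of 0 t] by (simp add: numeral_2_eq_2)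
  have "has_partials (\<lambda>w. cnj (w + - z)) (cnj (1 + 0)) (cnj (\<i> + 0)) w"
    by (intro has_partials_cnj has_partials_add has_partials_id has_partials_const)
  then have c: "has_partials (\<lambda>w. cnj (w - z)) 1 (- \<i>) w" by simp
  note p = has_partials_partial[OF has_partials_mult[OF c has_partials_cmod_sq[OF d, of s z w]]]
  have q: "(w - z) * cnj (w - z) = of_real ((cmod (w - z))\<^sup>2)" by (rule complex_norm_square[symmetric])
  have e: "of_real (Re (w - z)) + \<i> * of_real (Im (w - z)) = w - z" by (simp add: complex_eq_iff)
  have "dbar (\<lambda>w. cnj (w - z) * of_real (bump 0 s z w)) w
     = of_real (flat_exp 0 t) - of_real s * of_real (flat_exp 2 t) * (cnj (w - z) * (of_real (Re (w - z)) + \<i> * of_real (Im (w - z))))"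
    unfolding dbar_def p t_def[symmetric] by (simp add: field_simps)
  also have "\<dots> = of_real (flat_exp 0 t) - of_real s * of_real (flat_exp 2 t) * ((w - z) * cnj (w - z))"
    unfolding e by (simp add: mult.commute)
  also have "\<dots> = of_real (flat_exp 0 t - s * (cmod (w - z))\<^sup>2 * flat_exp 2 t)"
    unfolding q by simp
  finally show ?thesis unfolding t_def .
qed

lemma bump_lipschitz:
  assumes "cmod (w - z) \<le> 2" "cmod (w - z') \<le> 2"
  shows "\<bar>bump 0 s z w - flat_exp 0 (1 - s * (cmod (w - z'))\<^sup>2)\<bar> \<le> 8 * \<bar>s\<bar> * cmod (z - z')"
proof -
  have "\<bar>bump 0 s z w - flat_exp 0 (1 - s * (cmod (w - z'))\<^sup>2)\<bar>
     \<le> 2 * \<bar>(1 - s * (cmod (w - z))\<^sup>2) - (1 - s * (cmod (w - z'))\<^sup>2)\<bar>" by (rule flat_exp0_lipschitz)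
  also have "(1 - s * (cmod (w - z))\<^sup>2) - (1 - s * (cmod (w - z'))\<^sup>2) = s * ((cmod (w - z'))\<^sup>2 - (cmod (w - z))\<^sup>2)"
    by (simp add: algebra_simps)
  also have "\<bar>\<dots>\<bar> \<le> \<bar>s\<bar> * (cmod ((w - z') - (w - z)) * (cmod (w - z') + cmod (w - z)))"
    unfolding abs_mult by (intro mult_left_mono abs_sq_diff_le) simp
  also have "\<dots> \<le> \<bar>s\<bar> * (cmod (z - z') * 4)"
    using assms by (intro mult_left_mono mult_mono) auto
  finally show ?thesis by simp
qed

context
  fixes b :: "complex \<Rightarrow> complex"
  assumes bm [measurable]: "b \<in> borel_measurable borel"
    and bi: "\<And>r. r < 1 \<Longrightarrow> integrable lborel (\<lambda>z. indicator (cball 0 r) z *\<^sub>R b z)"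
    and weak: "\<And>\<phi>. \<phi> \<in> test_functions \<Longrightarrow> (\<integral>z. b z * dbar \<phi> z \<partial>lborel) = 0"
begin

text \<open>Differentiate under the integral. The coefficient of \<open>cnj h\<close> in the derivative is an integral of \<open>b\<close> against
  \<open>\<partial>'\<close> of a test function, the kernel as a function of \<open>w\<close>, so it vanishes.\<close>

lemma mollify_holomorphic:
  assumes "0 < \<tau>" "cmod z0 + 1 / \<tau> < 1"
  shows "\<exists>D. (mollify b \<tau> has_field_derivative D) (at z0)"
proof -
  define \<delta> where "\<delta> = (1 - cmod z0 - 1 / \<tau>) / 2"
  define r where "r = cmod z0 + 1 / \<tau> + \<delta>"
  have \<delta>: "0 < \<delta>" using assms by (simp add: \<delta>_def)
  have "a + x + (1 - a - x) / 2 < 1" if "a + x < 1" for a x :: real using that by (simp add: field_simps)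
  then have r1: "r < 1" using assms(2) unfolding r_def \<delta>_def .
  have itau: "0 < 1 / \<tau>" using assms(1) by simp
  define g where "g w = indicator (cball 0 r) w *\<^sub>R b w" for w
  define k where "k z w = complex_of_real (\<tau>\<^sup>2 * bump 0 (\<tau>\<^sup>2) z w)" for z w
  define c where "c w = \<tau>\<^sup>2 * \<tau>\<^sup>2 * bump 2 (\<tau>\<^sup>2) z0 w" for w
  define k' where "k' w h = of_real (c w) * cnj (w - z0) * h + (of_real (c w) * (w - z0)) * cnj h" for w h
  have gi: "integrable lborel g" unfolding g_def by (rule bi[OF r1])
  have z0in: "cmod z0 < 1" using assms itau by linarith
  have gsupp: "cmod w \<le> r" if "g w \<noteq> 0" for w using that unfolding g_def by (cases "cmod w \<le> r") auto
  have d: "(flat_exp 0 has_real_derivative flat_exp 2 t) (at t)" for t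
    using flat_exp_deriv[of 0 t] by (simp add: numeral_2_eq_2)
  have D: "((\<lambda>z. \<integral>w. g w * k z w \<partial>lborel) has_derivative (\<lambda>h. \<integral>w. g w * k' w h \<partial>lborel)) (at z0)"
  proof (rule has_derivative_integral_param[OF gi])
    show "k p \<in> borel_measurable lborel" for p unfolding k_def by measurable
    show "(\<lambda>w. k' w h) \<in> borel_measurable lborel" for h
    proof -
      have [measurable]: "(\<lambda>w::complex. cnj (w - z0)) \<in> borel_measurable borel"
        by (intro borel_measurable_continuous_onI continuous_intros)
      show ?thesis unfolding k'_def c_def by measurable
    qed
    show "((\<lambda>p. k p w) has_derivative k' w) (at z0)" for w
    proof -
      have "has_partials (\<lambda>z. of_real (\<tau>\<^sup>2) * of_real (bump 0 (\<tau>\<^sup>2) w z))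
         (of_real (\<tau>\<^sup>2) * of_real (bump 2 (\<tau>\<^sup>2) w z0 * (- 2 * \<tau>\<^sup>2 * Re (z0 - w))))
         (of_real (\<tau>\<^sup>2) * of_real (bump 2 (\<tau>\<^sup>2) w z0 * (- 2 * \<tau>\<^sup>2 * Im (z0 - w)))) z0"
        by (intro has_partials_cmult has_partials_cmod_sq d)
      moreover have "(\<lambda>h. of_real (Re h) * (of_real (\<tau>\<^sup>2) * of_real (bump 2 (\<tau>\<^sup>2) w z0 * (- 2 * \<tau>\<^sup>2 * Re (z0 - w))))
        + of_real (Im h) * (of_real (\<tau>\<^sup>2) * of_real (bump 2 (\<tau>\<^sup>2) w z0 * (- 2 * \<tau>\<^sup>2 * Im (z0 - w))))) = k' w"
        unfolding k'_def c_def norm_minus_commute[of z0 w]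
        by (auto simp: fun_eq_iff complex_eq_iff algebra_simps)
      ultimately show ?thesis unfolding has_partials_def k_def by (simp add: norm_minus_commute)
    qed
    show "cmod (k z0 w) \<le> \<tau>\<^sup>2" for w
      using flat_exp_le[of 0 "1 - \<tau>\<^sup>2 * (cmod (w - z0))\<^sup>2"] flat_exp_nonneg[of 0 "1 - \<tau>\<^sup>2 * (cmod (w - z0))\<^sup>2"]
      unfolding k_def norm_of_real by (simp add: abs_mult mult_left_le)
    show "0 < \<delta>" by (rule \<delta>)
    show "cmod (k p w - k z0 w) \<le> (\<tau>\<^sup>2 * (8 * \<tau>\<^sup>2)) * cmod (p - z0)" if gw: "g w \<noteq> 0" and p: "dist p z0 < \<delta>" for p w
    proof -
      have "cmod p < 1" using p norm_triangle_sub[of p z0] r1 itau unfolding r_def dist_norm by linarith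
      then have "cmod (w - p) \<le> 2" "cmod (w - z0) \<le> 2"
        using gsupp[OF gw] r1 z0in norm_triangle_ineq4[of w p] norm_triangle_ineq4[of w z0] by linarith+
      from bump_lipschitz[OF this, of "\<tau>\<^sup>2"]
      have "\<tau>\<^sup>2 * \<bar>bump 0 (\<tau>\<^sup>2) p w - bump 0 (\<tau>\<^sup>2) z0 w\<bar>
          \<le> \<tau>\<^sup>2 * (8 * \<tau>\<^sup>2 * cmod (p - z0))" by (intro mult_left_mono) simp_all
      moreover have "cmod (k p w - k z0 w)
          = \<tau>\<^sup>2 * \<bar>bump 0 (\<tau>\<^sup>2) p w - bump 0 (\<tau>\<^sup>2) z0 w\<bar>"
        unfolding k_def of_real_diff[symmetric] norm_of_real right_diff_distrib[symmetric] abs_mult by simp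
      ultimately show ?thesis by (simp add: mult.assoc)
    qed
  qed
  have c_test: "(\<lambda>w. 1 * of_real (bump 0 (\<tau>\<^sup>2) z0 w)) \<in> test_functions"
    by (rule test_function_bump[OF assms bump_class.const])
  have gb: "g w * of_real (c w) = b w * of_real (c w)" for w
  proof (cases "cmod w \<le> r")
    case False
    then have "1 / \<tau> \<le> cmod (w - z0)" using norm_triangle_sub[of w z0] \<delta> unfolding r_def by linarith
    then show ?thesis using bump_eq_0[OF assms(1)] by (simp add: c_def)
  qed (simp add: g_def)
  have "(\<integral>w. g w * (of_real (c w) * (w - z0)) \<partial>lborel) = (\<integral>w. (- of_real (\<tau>\<^sup>2)) * (b w * dbar (\<lambda>w. 1 * of_real (bump 0 (\<tau>\<^sup>2) z0 w)) w) \<partial>lborel)"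
    unfolding dbar_bump mult.assoc[symmetric] gb by (simp add: c_def mult.assoc mult.left_commute)
  also have "\<dots> = 0" unfolding integral_mult_right_zero weak[OF c_test] by simp
  finally have z: "(\<integral>w. g w * (of_real (c w) * (w - z0)) \<partial>lborel) = 0" .
  have bnd: "\<bar>c w\<bar> \<le> \<tau>\<^sup>2 * \<tau>\<^sup>2 * 2" for w
    using flat_exp_le[of 2 "1 - \<tau>\<^sup>2 * (cmod (w - z0))\<^sup>2"] flat_exp_nonneg[of 2 "1 - \<tau>\<^sup>2 * (cmod (w - z0))\<^sup>2"]
    unfolding c_def by (simp add: abs_mult mult_left_mono)
  have i: "integrable lborel (\<lambda>w. g w * (of_real (c w) * v w))"
    if v: "v \<in> borel_measurable borel" "\<And>w. cmod (v w) = cmod (w - z0)" for v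
  proof (rule Bochner_Integration.integrable_bound)
    show "integrable lborel (\<lambda>w. (\<tau>\<^sup>2 * \<tau>\<^sup>2 * 2 * 2) * norm (g w))" using gi by auto
    show "(\<lambda>w. g w * (of_real (c w) * v w)) \<in> borel_measurable lborel"
    proof -
      have [measurable]: "g \<in> borel_measurable borel" using borel_measurable_integrable[OF gi] by simp
      note [measurable] = v(1)
      show ?thesis unfolding c_def by measurable
    qed
    show "AE w in lborel. norm (g w * (of_real (c w) * v w)) \<le> norm ((\<tau>\<^sup>2 * \<tau>\<^sup>2 * 2 * 2) * norm (g w))"
    proof (rule AE_I2)
      fix w
      show "norm (g w * (of_real (c w) * v w)) \<le> norm ((\<tau>\<^sup>2 * \<tau>\<^sup>2 * 2 * 2) * norm (g w))"
      proof (cases "g w = 0")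
        case False
        have "cmod (v w) \<le> 2" unfolding v(2)
          using gsupp[OF False] r1 z0in norm_triangle_ineq4[of w z0] by linarith
        then have "\<bar>c w\<bar> * cmod (v w) \<le> (\<tau>\<^sup>2 * \<tau>\<^sup>2 * 2) * 2"
          by (intro mult_mono bnd) auto
        from mult_left_mono[OF this, of "cmod (g w)"] show ?thesis
          by (simp add: norm_mult mult.commute abs_mult)
      qed simp
    qed
  qed
  have cm: "(\<lambda>w::complex. cnj (w - z0)) \<in> borel_measurable borel"
    by (intro borel_measurable_continuous_onI continuous_intros)
  define A where "A = (\<integral>w. g w * (of_real (c w) * cnj (w - z0)) \<partial>lborel)"
  have "(\<integral>w. g w * k' w h \<partial>lborel) = A * h" for h
  proof -
    have "(\<integral>w. g w * k' w h \<partial>lborel) = (\<integral>w. (g w * (of_real (c w) * cnj (w - z0))) * h + (g w * (of_real (c w) * (w - z0))) * cnj h \<partial>lborel)"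
      by (intro Bochner_Integration.integral_cong) (auto simp: k'_def algebra_simps)
    also have "\<dots> = (\<integral>w. (g w * (of_real (c w) * cnj (w - z0))) * h \<partial>lborel) + (\<integral>w. (g w * (of_real (c w) * (w - z0))) * cnj h \<partial>lborel)"
      by (intro Bochner_Integration.integral_add integrable_mult_left i cm) (auto simp flip: complex_cnj_diff)
    also have "\<dots> = A * h" unfolding integral_mult_left_zero z A_def by simp
    finally show ?thesis .
  qed
  then have D': "((\<lambda>z. \<integral>w. g w * k z w \<partial>lborel) has_field_derivative A) (at z0)"
    using D unfolding has_field_derivative_def by simp
  have "(mollify b \<tau> has_field_derivative A) (at z0)"
  proof (rule has_field_derivative_transform_within_open[OF D', of "ball z0 \<delta>"])
    fix z assume "z \<in> ball z0 \<delta>"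
    then have "cmod z + 1 / \<tau> \<le> r" using norm_triangle_sub[of z z0] unfolding r_def mem_ball dist_norm by (simp add: norm_minus_commute)
    then show "(\<integral>w. g w * k z w \<partial>lborel) = mollify b \<tau> z"
      unfolding g_def k_def using mollify_localize[OF assms(1), of z r b] by simp
  qed (use \<delta> in auto)
  then show ?thesis ..
qed

text \<open>With \<open>q = |w - z|\<^sup>2\<close> and \<open>E = flat_exp 0\<close>, the derivative of \<open>\<tau>\<^sup>2 E(1 - \<tau>\<^sup>2 q)\<close> in \<open>\<tau>\<close> equals
  \<open>2 \<tau> (E - \<tau>\<^sup>2 q E')\<close>, which is \<open>2 \<tau> \<partial>'(cnj (w - z) E(1 - \<tau>\<^sup>2 q))\<close> and integrates to 0 against \<open>b\<close>.\<close>

lemma mollify_deriv_scale: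
  assumes "cmod z < 1" "1 / (1 - cmod z) < \<tau>0"
  shows "((\<lambda>\<tau>. mollify b \<tau> z) has_derivative (\<lambda>h. 0)) (at \<tau>0)"
proof -
  \<comment> \<open>A scale between the threshold and \<open>\<tau>0\<close>: the kernels of all scales above it have support in one disk of radius \<open>r < 1\<close>.\<close>
  define \<tau>m where "\<tau>m = (\<tau>0 + 1 / (1 - cmod z)) / 2"
  have p1: "0 < 1 / (1 - cmod z)" using assms(1) by simp
  have m: "1 / (1 - cmod z) < \<tau>m" "\<tau>m < \<tau>0" "0 < \<tau>0" "0 < \<tau>m"
    using assms(2) p1 less_trans[OF p1 assms(2)] add_pos_pos[OF less_trans[OF p1 assms(2)] p1]
    unfolding \<tau>m_def by simp_all
  have inv: "1 / \<tau> < 1 - cmod z" if "1 / (1 - cmod z) < \<tau>" for \<tau>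
  proof -
    have "0 < \<tau>" using that p1 by linarith
    then show ?thesis using that assms(1) by (simp add: field_simps)
  qed
  define r where "r = cmod z + 1 / \<tau>m"
  have r1: "r < 1" using inv[OF m(1)] by (simp add: r_def)
  define \<delta> where "\<delta> = min 1 (\<tau>0 - \<tau>m)"
  have \<delta>: "0 < \<delta>" using m by (simp add: \<delta>_def)
  define T where "T = \<tau>0 + 1"
  define g where "g w = indicator (cball 0 r) w *\<^sub>R b w" for w
  define q where "q w = (cmod (w - z))\<^sup>2" for w
  define k where "k \<tau> w = complex_of_real (\<tau>\<^sup>2 * flat_exp 0 (1 - \<tau>\<^sup>2 * q w))" for \<tau> w
  define k' where "k' w h = complex_of_real (h * (2 * \<tau>0 * flat_exp 0 (1 - \<tau>0\<^sup>2 * q w) + \<tau>0\<^sup>2 * (flat_exp 2 (1 - \<tau>0\<^sup>2 * q w) * (- 2 * \<tau>0 * q w))))" for w h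
  have gi: "integrable lborel g" unfolding g_def by (rule bi[OF r1])
  have gsupp: "cmod w \<le> r" if "g w \<noteq> 0" for w using that unfolding g_def by (cases "cmod w \<le> r") auto
  have d: "(flat_exp 0 has_real_derivative flat_exp 2 t) (at t)" for t
    using flat_exp_deriv[of 0 t] by (simp add: numeral_2_eq_2)
  have D: "((\<lambda>\<tau>. \<integral>w. g w * k \<tau> w \<partial>lborel) has_derivative (\<lambda>h. \<integral>w. g w * k' w h \<partial>lborel)) (at \<tau>0)"
  proof (rule has_derivative_integral_param[OF gi])
    show "k p \<in> borel_measurable lborel" for p unfolding k_def q_def by measurable
    show "(\<lambda>w. k' w h) \<in> borel_measurable lborel" for h unfolding k'_def q_def by measurable
    show "((\<lambda>p. k p w) has_derivative k' w) (at \<tau>0)" for w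
    proof -
      have "((\<lambda>\<tau>. 1 - \<tau>\<^sup>2 * q w) has_real_derivative (- 2 * \<tau>0 * q w)) (at \<tau>0)"
        by (auto intro!: derivative_eq_intros)
      from DERIV_chain2[OF d this]
      have 1: "((\<lambda>\<tau>. flat_exp 0 (1 - \<tau>\<^sup>2 * q w)) has_real_derivative (flat_exp 2 (1 - \<tau>0\<^sup>2 * q w) * (- 2 * \<tau>0 * q w))) (at \<tau>0)" .
      have 2: "((\<lambda>\<tau>::real. \<tau>\<^sup>2) has_real_derivative 2 * \<tau>0) (at \<tau>0)" by (auto intro!: derivative_eq_intros)
      have "((\<lambda>\<tau>. \<tau>\<^sup>2 * flat_exp 0 (1 - \<tau>\<^sup>2 * q w)) has_real_derivative
         (2 * \<tau>0 * flat_exp 0 (1 - \<tau>0\<^sup>2 * q w) + (flat_exp 2 (1 - \<tau>0\<^sup>2 * q w) * (- 2 * \<tau>0 * q w)) * \<tau>0\<^sup>2)) (at \<tau>0)"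
        by (rule DERIV_mult[OF 2 1])
      then have "((\<lambda>\<tau>. \<tau>\<^sup>2 * flat_exp 0 (1 - \<tau>\<^sup>2 * q w)) has_derivative
         (\<lambda>h. h * (2 * \<tau>0 * flat_exp 0 (1 - \<tau>0\<^sup>2 * q w) + \<tau>0\<^sup>2 * (flat_exp 2 (1 - \<tau>0\<^sup>2 * q w) * (- 2 * \<tau>0 * q w))))) (at \<tau>0)"
        unfolding has_field_derivative_def
        by (rule has_derivative_eq_rhs) (simp add: fun_eq_iff algebra_simps)
      then show ?thesis unfolding k_def k'_def by (rule has_derivative_of_real)
    qed
    show "cmod (k \<tau>0 w) \<le> \<tau>0\<^sup>2" for w
      using flat_exp_le[of 0 "1 - \<tau>0\<^sup>2 * q w"] flat_exp_nonneg[of 0 "1 - \<tau>0\<^sup>2 * q w"]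
      unfolding k_def norm_of_real by (simp add: abs_mult mult_left_le)
    show "0 < \<delta>" by (rule \<delta>)
    show "cmod (k p w - k \<tau>0 w) \<le> ((2 * T) * (1 + 8 * T\<^sup>2)) * norm (p - \<tau>0)" if gw: "g w \<noteq> 0" and p: "dist p \<tau>0 < \<delta>" for p w
    proof -
      have pT: "0 < p" "p \<le> T" "\<tau>0 \<le> T" using p m unfolding \<delta>_def T_def dist_real_def by linarith+
      have "cmod (w - z) \<le> 2" using gsupp[OF gw] r1 assms(1) norm_triangle_ineq4[of w z] by linarith
      then have "(cmod (w - z))\<^sup>2 \<le> 2\<^sup>2" by (intro power_mono) auto
      then have q4: "q w \<le> 4" "0 \<le> q w" by (auto simp: q_def)
      define B where "B t = flat_exp 0 (1 - t\<^sup>2 * q w)" for t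
      have dsq: "\<bar>p\<^sup>2 - \<tau>0\<^sup>2\<bar> \<le> (2 * T) * \<bar>p - \<tau>0\<bar>"
      proof -
        have "p\<^sup>2 - \<tau>0\<^sup>2 = (p + \<tau>0) * (p - \<tau>0)" by (simp add: power2_eq_square algebra_simps)
        then show ?thesis using pT m by (simp add: abs_mult mult_right_mono)
      qed
      have B1: "\<bar>B \<tau>0\<bar> \<le> 1" unfolding B_def
        using flat_exp_le[of 0 "1 - \<tau>0\<^sup>2 * q w"] flat_exp_nonneg[of 0 "1 - \<tau>0\<^sup>2 * q w"] by simp
      have BB: "\<bar>B p - B \<tau>0\<bar> \<le> 8 * \<bar>p\<^sup>2 - \<tau>0\<^sup>2\<bar>"
      proof -
        have "\<bar>B p - B \<tau>0\<bar> \<le> 2 * \<bar>(1 - p\<^sup>2 * q w) - (1 - \<tau>0\<^sup>2 * q w)\<bar>"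
          unfolding B_def by (rule flat_exp0_lipschitz)
        also have "(1 - p\<^sup>2 * q w) - (1 - \<tau>0\<^sup>2 * q w) = (\<tau>0\<^sup>2 - p\<^sup>2) * q w" by (simp add: algebra_simps)
        also have "2 * \<bar>(\<tau>0\<^sup>2 - p\<^sup>2) * q w\<bar> \<le> 2 * (\<bar>\<tau>0\<^sup>2 - p\<^sup>2\<bar> * 4)"
          unfolding abs_mult using q4 by (intro mult_left_mono) auto
        finally show ?thesis by (simp add: abs_minus_commute)
      qed
      have "p\<^sup>2 * B p - \<tau>0\<^sup>2 * B \<tau>0 = (p\<^sup>2 - \<tau>0\<^sup>2) * B \<tau>0 + p\<^sup>2 * (B p - B \<tau>0)" by (simp add: algebra_simps)
      then have "\<bar>p\<^sup>2 * B p - \<tau>0\<^sup>2 * B \<tau>0\<bar> \<le> \<bar>p\<^sup>2 - \<tau>0\<^sup>2\<bar> * \<bar>B \<tau>0\<bar> + p\<^sup>2 * \<bar>B p - B \<tau>0\<bar>"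
        using abs_triangle_ineq[of "(p\<^sup>2 - \<tau>0\<^sup>2) * B \<tau>0" "p\<^sup>2 * (B p - B \<tau>0)"] by (simp add: abs_mult)
      also have "\<dots> \<le> \<bar>p\<^sup>2 - \<tau>0\<^sup>2\<bar> * 1 + T\<^sup>2 * (8 * \<bar>p\<^sup>2 - \<tau>0\<^sup>2\<bar>)"
        using pT by (intro add_mono mult_mono B1 BB power_mono) auto
      also have "\<dots> = \<bar>p\<^sup>2 - \<tau>0\<^sup>2\<bar> * (1 + 8 * T\<^sup>2)" by (simp add: algebra_simps)
      also have "\<dots> \<le> ((2 * T) * \<bar>p - \<tau>0\<bar>) * (1 + 8 * T\<^sup>2)" by (intro mult_right_mono dsq) simp
      finally have "\<bar>p\<^sup>2 * B p - \<tau>0\<^sup>2 * B \<tau>0\<bar> \<le> ((2 * T) * (1 + 8 * T\<^sup>2)) * norm (p - \<tau>0)" by (simp only: mult_ac real_norm_def)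
      then show ?thesis unfolding k_def B_def of_real_diff[symmetric] norm_of_real .
    qed
  qed
  have ct: "(\<lambda>w. cnj (w - z) * of_real (bump 0 (\<tau>0\<^sup>2) z w)) \<in> test_functions"
  proof (rule test_function_bump)
    show "cmod z + 1 / \<tau>0 < 1" using inv[OF assms(2)] by linarith
    have "bump_class (\<tau>0\<^sup>2) z (\<lambda>w. (of_real (Re w) + (- \<i>) * of_real (Im w)) + - cnj z)"
      by (rule bump_class.add[OF bump_class.add[OF bump_class.coord_Re bump_class.mult[OF bump_class.const bump_class.coord_Im]] bump_class.const])
    also have "(\<lambda>w. (of_real (Re w) + (- \<i>) * of_real (Im w)) + - cnj z) = (\<lambda>w. cnj (w - z))"
      by (auto simp: fun_eq_iff complex_eq_iff)
    finally show "bump_class (\<tau>0\<^sup>2) z (\<lambda>w. cnj (w - z))" .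
  qed (use m in simp)
  have "(\<integral>w. g w * k' w h \<partial>lborel) = 0" for h
  proof -
    have "(\<integral>w. g w * k' w h \<partial>lborel)
      = (\<integral>w. of_real (2 * \<tau>0 * h) * (b w * dbar (\<lambda>w. cnj (w - z) * of_real (bump 0 (\<tau>0\<^sup>2) z w)) w) \<partial>lborel)"
    proof (rule Bochner_Integration.integral_cong[OF refl])
      fix w
      have k: "k' w h = of_real (2 * \<tau>0 * h) * dbar (\<lambda>w. cnj (w - z) * of_real (bump 0 (\<tau>0\<^sup>2) z w)) w"
        unfolding dbar_cnj_bump k'_def q_def of_real_mult[symmetric] of_real_eq_iff by (simp add: algebra_simps)
      show "g w * k' w h = of_real (2 * \<tau>0 * h) * (b w * dbar (\<lambda>w. cnj (w - z) * of_real (bump 0 (\<tau>0\<^sup>2) z w)) w)"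
      proof (cases "cmod w \<le> r")
        case True then show ?thesis unfolding k by (simp add: g_def)
      next
        case False
        have "1 / \<tau>0 \<le> 1 / \<tau>m" using m by (simp add: frac_le)
        then have "1 / \<tau>0 \<le> cmod (w - z)" using norm_triangle_sub[of w z] False unfolding r_def by linarith
        then have "k' w h = 0" unfolding k'_def q_def using bump_eq_0[OF m(3)] by simp
        then show ?thesis unfolding k using m by auto
      qed
    qed
    also have "\<dots> = 0" unfolding integral_mult_right_zero weak[OF ct] by simp
    finally show ?thesis .
  qed
  then have D0: "((\<lambda>\<tau>. \<integral>w. g w * k \<tau> w \<partial>lborel) has_derivative (\<lambda>h. 0)) (at \<tau>0)"
    using D by simp
  show ?thesis
  proof (rule has_derivative_transform_within_open[OF D0, of "{\<tau>m<..}"])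
    fix \<tau> assume t: "\<tau> \<in> {\<tau>m<..}"
    then have t0: "0 < \<tau>" using m by auto
    have "1 / \<tau> \<le> 1 / \<tau>m" using m t by (simp add: frac_le)
    then have "cmod z + 1 / \<tau> \<le> r" unfolding r_def by simp
    then show "(\<integral>w. g w * k \<tau> w \<partial>lborel) = mollify b \<tau> z"
      unfolding g_def k_def q_def using mollify_localize[OF t0, of z r b] by simp
  qed (use m in auto)
qed

lemma mollify_const:
  assumes "cmod z < 1" "1 / (1 - cmod z) < \<tau>" "1 / (1 - cmod z) < \<tau>'"
  shows "mollify b \<tau> z = mollify b \<tau>' z"
proof -
  have "\<exists>c. \<forall>x\<in>{1 / (1 - cmod z)<..}. mollify b x z = c"
    by (rule has_derivative_zero_constant[of "{1 / (1 - cmod z)<..}"])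
      (use mollify_deriv_scale[OF assms(1)] in \<open>auto intro: has_derivative_at_withinI\<close>)
  then show ?thesis using assms by auto
qed

end

lemma integrable_mult_bounded:
  fixes g f :: "complex \<Rightarrow> complex"
  assumes g: "integrable M g" and f: "f \<in> borel_measurable M" and b: "\<And>x. cmod (f x) \<le> K"
  shows "integrable M (\<lambda>x. g x * f x)"
proof (rule Bochner_Integration.integrable_bound)
  show "integrable M (\<lambda>x. K * norm (g x))" using g by auto
  show "(\<lambda>x. g x * f x) \<in> borel_measurable M" using g f by auto
  show "AE x in M. norm (g x * f x) \<le> norm (K * norm (g x))"
  proof (rule AE_I2)
    fix x
    have "cmod (f x) \<le> \<bar>K\<bar>" using b by (rule order_trans) simp
    from mult_left_mono[OF this, of "cmod (g x)"] show "norm (g x * f x) \<le> norm (K * norm (g x))"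
      by (simp add: norm_mult abs_mult mult.commute)
  qed
qed

lemma continuous_support_bounded:
  fixes \<psi> :: "complex \<Rightarrow> complex"
  assumes "continuous_on UNIV \<psi>" "\<And>z. r \<le> cmod z \<Longrightarrow> \<psi> z = 0"
  obtains K where "0 \<le> K" "\<And>z. cmod (\<psi> z) \<le> K"
proof -
  have "compact (\<psi> ` cball 0 r)"
    by (rule compact_continuous_image[OF continuous_on_subset[OF assms(1)]]) auto
  then have "bounded (\<psi> ` cball 0 r)" by (rule compact_imp_bounded)
  then obtain K where K: "\<And>z. z \<in> cball 0 r \<Longrightarrow> cmod (\<psi> z) \<le> K"
    unfolding bounded_iff by blast
  have "cmod (\<psi> z) \<le> max K 0" for z
  proof (cases "r \<le> cmod z")
    case True then show ?thesis using assms(2) by simp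
  next
    case False then show ?thesis using K[of z] by simp
  qed
  then show ?thesis using that[of "max K 0"] by auto
qed

lemma continuous_support_integrable:
  fixes \<psi> :: "complex \<Rightarrow> 'b::{banach, second_countable_topology}"
  assumes "continuous_on UNIV \<psi>" "\<And>z. r \<le> cmod z \<Longrightarrow> \<psi> z = 0"
  shows "integrable lborel \<psi>"
proof -
  have "integrable lborel (\<lambda>z. indicator (cball 0 r) z *\<^sub>R \<psi> z)"
    by (rule borel_integrable_compact) (auto intro: continuous_on_subset[OF assms(1)])
  also have "(\<lambda>z. indicator (cball 0 r) z *\<^sub>R \<psi> z) = \<psi>"
  proof
    fix z show "indicator (cball 0 r) z *\<^sub>R \<psi> z = \<psi> z"
      using assms(2)[of z] by (cases "cmod z \<le> r") auto
  qed
  finally show ?thesis .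
qed

lemma lborel_integral_scale_complex:
  fixes f :: "complex \<Rightarrow> complex"
  assumes c: "0 < c" and f [measurable]: "f \<in> borel_measurable borel"
  shows "(\<integral>z. f z \<partial>lborel) = (\<integral>x. of_real (c\<^sup>2) * f (t + c *\<^sub>R x) \<partial>lborel)"
proof -
  have "(\<integral>z. f z \<partial>lborel) = (\<integral>z. f z \<partial>density (distr lborel borel (\<lambda>x. t + c *\<^sub>R x)) (\<lambda>_. ennreal (c\<^sup>2)))"
    using c by (subst lborel_affine[of c t]) auto
  also have "\<dots> = (\<integral>z. c\<^sup>2 *\<^sub>R f z \<partial>distr lborel borel (\<lambda>x. t + c *\<^sub>R x))"
    by (rule integral_density) auto
  also have "\<dots> = (\<integral>x. c\<^sup>2 *\<^sub>R f (t + c *\<^sub>R x) \<partial>lborel)"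
    by (rule integral_distr) measurable
  finally show ?thesis by (simp add: scaleR_conv_of_real)
qed

definition bump_mass :: real where
  "bump_mass = (\<integral>w. flat_exp 0 (1 - (cmod w)\<^sup>2) \<partial>lborel)"

lemma bump_continuous: "continuous_on UNIV (\<lambda>w::complex. flat_exp 0 (1 - (cmod w)\<^sup>2))"
  by (rule continuous_on_compose2[OF continuous_on_flat_exp[of UNIV 0]]) (auto intro!: continuous_intros)

lemma bump_integrable: "integrable lborel (\<lambda>w::complex. flat_exp 0 (1 - (cmod w)\<^sup>2))"
  by (rule continuous_support_integrable[OF bump_continuous, of 1]) (auto simp: flat_exp_def)

lemma bump_mass_pos: "0 < bump_mass"
proof -
  have n: "0 \<le> bump_mass" unfolding bump_mass_def by (rule integral_nonneg_AE) (simp add: flat_exp_nonneg)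
  moreover have "bump_mass \<noteq> 0"
  proof
    assume "bump_mass = 0"
    then have "AE w in lborel. flat_exp 0 (1 - (cmod (w::complex))\<^sup>2) = 0"
      using integral_nonneg_eq_0_iff_AE[OF bump_integrable] by (auto simp: bump_mass_def flat_exp_nonneg)
    then have "AE w in lborel. w \<notin> ball (0::complex) 1"
    proof eventually_elim
      case (elim w)
      then show ?case using flat_exp_pos[of "1 - (cmod w)\<^sup>2" 0] by (auto simp: power_less_one_iff)
    qed
    then have "ball (0::complex) 1 \<in> null_sets lborel" by (subst (asm) AE_iff_null_sets[symmetric]) auto
    then have "negligible (ball (0::complex) 1)"
      by (simp add: negligible_iff_null_sets null_sets_completionI)
    then show False using open_not_negligible[of "ball (0::complex) 1"] by simp
  qed
  ultimately show ?thesis by simp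
qed

text \<open>Substitute \<open>z = w + x / \<tau>\<close>; the weight in \<open>x\<close> is then a fixed bump.\<close>

lemma mollify_test_tendsto:
  assumes \<psi>: "continuous_on UNIV \<psi>" and K: "\<And>z. cmod (\<psi> z) \<le> K"
    and \<tau>: "\<And>n. 0 < \<tau> n" "filterlim \<tau> at_top sequentially"
  shows "(\<lambda>n. \<integral>z. \<psi> z * of_real ((\<tau> n)\<^sup>2 * bump 0 ((\<tau> n)\<^sup>2) z w) \<partial>lborel) \<longlonglongrightarrow> \<psi> w * of_real bump_mass"
    and "cmod (\<integral>z. \<psi> z * of_real ((\<tau> n)\<^sup>2 * bump 0 ((\<tau> n)\<^sup>2) z w) \<partial>lborel) \<le> K * bump_mass"
proof -
  note [measurable] = borel_measurable_continuous_onI[OF \<psi>]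
  define F where "F n = (\<lambda>x. \<psi> (w + (1 / \<tau> n) *\<^sub>R x) * of_real (flat_exp 0 (1 - (cmod x)\<^sup>2)))" for n
  have eq: "(\<integral>z. \<psi> z * of_real ((\<tau> n)\<^sup>2 * bump 0 ((\<tau> n)\<^sup>2) z w) \<partial>lborel) = (\<integral>x. F n x \<partial>lborel)" for n
  proof -
    have "(\<integral>z. \<psi> z * of_real ((\<tau> n)\<^sup>2 * bump 0 ((\<tau> n)\<^sup>2) z w) \<partial>lborel)
      = (\<integral>x. of_real ((1 / \<tau> n)\<^sup>2) * (\<psi> (w + (1 / \<tau> n) *\<^sub>R x) * of_real ((\<tau> n)\<^sup>2 * flat_exp 0 (1 - (\<tau> n)\<^sup>2 * (cmod (w - (w + (1 / \<tau> n) *\<^sub>R x)))\<^sup>2))) \<partial>lborel)"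
      by (rule lborel_integral_scale_complex) (use \<tau>(1) in auto)
    also have "\<dots> = (\<integral>x. F n x \<partial>lborel)"
    proof (rule Bochner_Integration.integral_cong[OF refl])
      fix x :: complex
      have "(\<tau> n)\<^sup>2 * (cmod (w - (w + (1 / \<tau> n) *\<^sub>R x)))\<^sup>2 = (cmod x)\<^sup>2"
        using \<tau>(1)[of n] by (simp add: norm_divide power_mult_distrib field_simps)
      then show "of_real ((1 / \<tau> n)\<^sup>2) * (\<psi> (w + (1 / \<tau> n) *\<^sub>R x) * of_real ((\<tau> n)\<^sup>2 * flat_exp 0 (1 - (\<tau> n)\<^sup>2 * (cmod (w - (w + (1 / \<tau> n) *\<^sub>R x)))\<^sup>2))) = F n x"
        using less_imp_neq[OF \<tau>(1)[of n]] unfolding F_def by (simp add: power_divide)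
    qed
    finally show ?thesis .
  qed
  have bnd: "cmod (F n x) \<le> K * flat_exp 0 (1 - (cmod x)\<^sup>2)" for n x
    unfolding F_def norm_mult norm_of_real using flat_exp_nonneg[of 0 "1 - (cmod x)\<^sup>2"]
    by (simp add: mult_right_mono[OF K])
  have Fm: "F n \<in> borel_measurable lborel" for n unfolding F_def by measurable
  have ib: "integrable lborel (\<lambda>x::complex. K * flat_exp 0 (1 - (cmod x)\<^sup>2))"
    using bump_integrable by auto
  have "(\<lambda>n. \<integral>x. F n x \<partial>lborel) \<longlonglongrightarrow> (\<integral>x. \<psi> w * complex_of_real (flat_exp 0 (1 - (cmod x)\<^sup>2)) \<partial>lborel)"
  proof (rule integral_dominated_convergence[OF _ Fm ib])
    show "AE x in lborel. (\<lambda>n. F n x) \<longlonglongrightarrow> \<psi> w * complex_of_real (flat_exp 0 (1 - (cmod x)\<^sup>2))"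
    proof (rule AE_I2)
      fix x :: complex
      have "(\<lambda>n. 1 / \<tau> n) \<longlonglongrightarrow> 0"
        using tendsto_inverse_0_at_top[OF \<tau>(2)] by (simp add: divide_inverse)
      then have "(\<lambda>n. w + (1 / \<tau> n) *\<^sub>R x) \<longlonglongrightarrow> w + 0 *\<^sub>R x" by (intro tendsto_intros)
      then have "(\<lambda>n. \<psi> (w + (1 / \<tau> n) *\<^sub>R x)) \<longlonglongrightarrow> \<psi> w"
        using continuous_on_tendsto_compose[OF \<psi>, of "\<lambda>n. w + (1 / \<tau> n) *\<^sub>R x" w sequentially] by simp
      then show "(\<lambda>n. F n x) \<longlonglongrightarrow> \<psi> w * complex_of_real (flat_exp 0 (1 - (cmod x)\<^sup>2))"
        unfolding F_def by (intro tendsto_intros)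
    qed
    show "AE x in lborel. cmod (F n x) \<le> K * flat_exp 0 (1 - (cmod x)\<^sup>2)" for n using bnd by simp
  qed measurable
  then show "(\<lambda>n. \<integral>z. \<psi> z * of_real ((\<tau> n)\<^sup>2 * bump 0 ((\<tau> n)\<^sup>2) z w) \<partial>lborel) \<longlonglongrightarrow> \<psi> w * of_real bump_mass"
    unfolding eq integral_mult_right_zero integral_complex_of_real bump_mass_def .
  have "cmod (\<integral>x. F n x \<partial>lborel) \<le> (\<integral>x. cmod (F n x) \<partial>lborel)" by (rule integral_norm_bound)
  also have "\<dots> \<le> (\<integral>x. K * flat_exp 0 (1 - (cmod (x::complex))\<^sup>2) \<partial>lborel)"
  proof (rule integral_mono[OF _ ib])
    have "integrable lborel (F n)"
      by (rule Bochner_Integration.integrable_bound[OF ib Fm]) (use bnd in \<open>auto intro!: AE_I2 order_trans[OF bnd abs_ge_self]\<close>)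
    then show "integrable lborel (\<lambda>x. cmod (F n x))" by auto
  qed (rule bnd)
  also have "\<dots> = K * bump_mass" by (simp add: bump_mass_def)
  finally show "cmod (\<integral>z. \<psi> z * of_real ((\<tau> n)\<^sup>2 * bump 0 ((\<tau> n)\<^sup>2) z w) \<partial>lborel) \<le> K * bump_mass"
    unfolding eq .
qed

lemma Fubini_kernel:
  fixes g \<psi> :: "complex \<Rightarrow> complex"
  assumes g: "integrable lborel g" and \<psi>: "integrable lborel \<psi>"
    and k: "(\<lambda>p. k (fst p) (snd p)) \<in> borel_measurable (borel \<Otimes>\<^sub>M borel)" and kb: "\<And>z w. cmod (k z w) \<le> C"
  shows "(\<integral>z. \<psi> z * (\<integral>w. g w * k z w \<partial>lborel) \<partial>lborel) = (\<integral>w. g w * (\<integral>z. \<psi> z * k z w \<partial>lborel) \<partial>lborel)"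
proof -
  have [measurable]: "g \<in> borel_measurable borel" "\<psi> \<in> borel_measurable borel"
    using borel_measurable_integrable[OF g] borel_measurable_integrable[OF \<psi>] by simp_all
  note [measurable] = k
  have prod: "integrable (lborel \<Otimes>\<^sub>M lborel) (\<lambda>(w, z). g w * \<psi> z)"
  proof (rule lborel_pair.Fubini_integrable)
    show "(\<lambda>(w, z). g w * \<psi> z) \<in> borel_measurable (lborel \<Otimes>\<^sub>M lborel)" by measurable
    show "integrable lborel (\<lambda>x. LINT y|lborel. norm (case (x, y) of (w, z) \<Rightarrow> g w * \<psi> z))"
      using integrable_norm[OF g] by (simp add: norm_mult)
    show "AE x in lborel. integrable lborel (\<lambda>y. case (x, y) of (w, z) \<Rightarrow> g w * \<psi> z)"
      using \<psi> by simp
  qed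
  have int: "integrable (lborel \<Otimes>\<^sub>M lborel) (case_prod (\<lambda>w z. g w * (\<psi> z * k z w)))"
  proof (rule Bochner_Integration.integrable_bound)
    show "integrable (lborel \<Otimes>\<^sub>M lborel) (\<lambda>p. C * norm (case p of (w, z) \<Rightarrow> g w * \<psi> z))"
      using prod by (intro integrable_mult_right integrable_norm)
    have m: "(\<lambda>(w, z). k z w) \<in> borel_measurable (borel \<Otimes>\<^sub>M borel)"
      using measurable_compose[OF measurable_pair_swap' k] by (simp add: case_prod_beta')
    show "case_prod (\<lambda>w z. g w * (\<psi> z * k z w)) \<in> borel_measurable (lborel \<Otimes>\<^sub>M lborel)"
      using m by (simp add: case_prod_beta')
    show "AE p in lborel \<Otimes>\<^sub>M lborel. norm (case p of (w, z) \<Rightarrow> g w * (\<psi> z * k z w)) \<le> norm (C * norm (case p of (w, z) \<Rightarrow> g w * \<psi> z))"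
    proof (rule AE_I2, clarify)
      fix w z
      have "cmod (k z w) \<le> \<bar>C\<bar>" using kb by (rule order_trans) simp
      from mult_left_mono[OF this, of "cmod (g w * \<psi> z)"]
      show "norm (g w * (\<psi> z * k z w)) \<le> norm (C * norm (g w * \<psi> z))"
        by (simp add: norm_mult abs_mult mult_ac)
    qed
  qed
  have "(\<integral>z. \<psi> z * (\<integral>w. g w * k z w \<partial>lborel) \<partial>lborel) = (\<integral>z. (\<integral>w. g w * (\<psi> z * k z w) \<partial>lborel) \<partial>lborel)"
    by (subst integral_mult_right_zero[symmetric]) (simp add: mult_ac)
  also have "\<dots> = (\<integral>w. (\<integral>z. g w * (\<psi> z * k z w) \<partial>lborel) \<partial>lborel)"
    by (rule lborel_pair.Fubini_integral[OF int])
  finally show ?thesis by simp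
qed

text \<open>At the point \<open>z\<close> any scale above \<open>1 / (1 - |z|)\<close> gives the same value \<open>h z\<close>, so \<open>h\<close> is holomorphic near
  each point. For a continuous \<open>\<psi>\<close> with compact support, Fubini moves the mollification from \<open>b\<close> to \<open>\<psi>\<close>, where it
  converges to \<open>\<psi>\<close> as the scale grows; hence \<open>h\<close> and \<open>b\<close> have the same integrals against \<open>\<psi>\<close>.\<close>

lemma weyl_lemma_borel:
  fixes b :: "complex \<Rightarrow> complex"
  assumes bm [measurable]: "b \<in> borel_measurable borel"
    and bi: "\<And>r. r < 1 \<Longrightarrow> integrable lborel (\<lambda>z. indicator (cball 0 r) z *\<^sub>R b z)"
    and weak: "\<And>\<phi>. \<phi> \<in> test_functions \<Longrightarrow> (\<integral>z. b z * dbar \<phi> z \<partial>lborel) = 0"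
  defines "h \<equiv> \<lambda>z. mollify b (2 / (1 - cmod z)) z / of_real bump_mass"
  shows "h holomorphic_on ball 0 1" "AE z in lborel. cmod z < 1 \<longrightarrow> b z = h z"
proof -
  have h_eq: "h z = mollify b \<tau> z / of_real bump_mass" if "cmod z < 1" "1 / (1 - cmod z) < \<tau>" for z \<tau>
    unfolding h_def using mollify_const[OF bm bi weak that(1) _ that(2), of "2 / (1 - cmod z)"] that(1)
    by (simp add: divide_strict_right_mono)
  show hol: "h holomorphic_on ball 0 1"
  proof (rule holomorphic_onI)
    fix z0 :: complex assume z0: "z0 \<in> ball 0 1"
    define d where "d = 1 - cmod z0"
    have d: "0 < d" using z0 by (simp add: d_def)
    have "cmod z0 + 1 / (4 / d) < 1" using d unfolding d_def by (simp add: field_simps)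
    then obtain D where D: "(mollify b (4 / d) has_field_derivative D) (at z0)"
      using mollify_holomorphic[OF bm bi weak, of "4 / d" z0] d by auto
    have "((\<lambda>z. mollify b (4 / d) z / of_real bump_mass) has_field_derivative D / of_real bump_mass) (at z0)"
      by (rule DERIV_cdivide[OF D])
    then have "(h has_field_derivative D / of_real bump_mass) (at z0)"
    proof (rule has_field_derivative_transform_within_open[of _ _ _ "ball z0 (d / 2)"])
      fix z assume z: "z \<in> ball z0 (d / 2)"
      then have dz: "d / 2 < 1 - cmod z"
        using norm_triangle_sub[of z z0] unfolding d_def mem_ball dist_norm by (simp add: norm_minus_commute)
      then have "1 / (1 - cmod z) < 1 / (d / 2)" using d by (intro divide_strict_left_mono) auto
      also have "\<dots> < 4 / d" using d by (simp add: field_simps)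
      finally show "mollify b (4 / d) z / of_real bump_mass = h z"
        using h_eq[of z "4 / d"] dz d by auto
    qed (use d in auto)
    then show "h field_differentiable at z0 within ball 0 1"
      using field_differentiable_def field_differentiable_at_within by blast
  qed
  have hc: "continuous_on (ball 0 1) h" by (rule holomorphic_on_imp_continuous_on[OF hol])
  define H where "H z = indicator (ball 0 1) z *\<^sub>R h z" for z
  have Hm [measurable]: "H \<in> borel_measurable borel"
    unfolding H_def by (rule borel_measurable_continuous_on_indicator[OF _ hc]) simp
  have Hi: "integrable lborel (\<lambda>z. indicator (cball 0 r) z *\<^sub>R H z)" if "r < 1" for r
  proof -
    have "integrable lborel (\<lambda>z. indicator (cball 0 r) z *\<^sub>R h z)"
      by (rule borel_integrable_compact) (use that in \<open>auto intro!: continuous_on_subset[OF hc]\<close>)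
    also have "(\<lambda>z. indicator (cball 0 r) z *\<^sub>R h z) = (\<lambda>z. indicator (cball 0 r) z *\<^sub>R H z)"
      using that by (auto simp: fun_eq_iff H_def indicator_def)
    finally show ?thesis .
  qed
  have main: "(\<integral>z. (b z - H z) * \<psi> z \<partial>lborel) = 0"
    if r: "r < 1" and \<psi>: "continuous_on UNIV \<psi>" and supp: "\<And>z. r \<le> cmod z \<Longrightarrow> \<psi> z = 0" for r \<psi>
  proof -
    obtain K where K: "0 \<le> K" "\<And>z. cmod (\<psi> z) \<le> K" using continuous_support_bounded[OF \<psi> supp] by blast
    have \<psi>m [measurable]: "\<psi> \<in> borel_measurable borel" by (rule borel_measurable_continuous_onI[OF \<psi>])
    have \<psi>i: "integrable lborel \<psi>" by (rule continuous_support_integrable[OF \<psi> supp])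
    \<comment> \<open>At all scales \<open>\<tau> n\<close> the kernels centred in the support of \<open>\<psi>\<close> live in the disk of this radius.\<close>
    define r1 where "r1 = (1 + r) / 2"
    have r1: "r1 < 1" "r < r1" using r by (auto simp: r1_def)
    define g where "g z = indicator (cball 0 r1) z *\<^sub>R b z" for z
    have gi: "integrable lborel g" unfolding g_def by (rule bi[OF r1(1)])
    define \<tau> where "\<tau> n = 2 / (1 - r) + real n" for n
    have \<tau>p: "0 < \<tau> n" for n using r by (simp add: \<tau>_def add_pos_nonneg)
    have \<tau>l: "filterlim \<tau> at_top sequentially"
      unfolding \<tau>_def by (rule filterlim_tendsto_add_at_top[OF tendsto_const filterlim_real_sequentially])
    have \<tau>1: "1 / (1 - cmod z) < \<tau> n" "cmod z + 1 / \<tau> n \<le> r1" if z: "cmod z < r" for z n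
    proof -
      have "1 / (1 - cmod z) < 1 / (1 - r)" using z r by (intro divide_strict_left_mono) auto
      also have "\<dots> \<le> 2 / (1 - r)" using r by (intro divide_right_mono) auto
      also have "\<dots> \<le> \<tau> n" by (simp add: \<tau>_def)
      finally show "1 / (1 - cmod z) < \<tau> n" .
      have "1 / \<tau> n \<le> 1 / (2 / (1 - r))" using r by (intro frac_le) (auto simp: \<tau>_def)
      then show "cmod z + 1 / \<tau> n \<le> r1" using z by (simp add: r1_def field_simps)
    qed
    define k where "k n z w = complex_of_real ((\<tau> n)\<^sup>2 * bump 0 ((\<tau> n)\<^sup>2) z w)" for n z w
    have eqn: "of_real bump_mass * (\<integral>z. H z * \<psi> z \<partial>lborel) = (\<integral>w. g w * (\<integral>z. \<psi> z * k n z w \<partial>lborel) \<partial>lborel)" for n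
    proof -
      have "of_real bump_mass * (\<integral>z. H z * \<psi> z \<partial>lborel) = (\<integral>z. of_real bump_mass * (H z * \<psi> z) \<partial>lborel)" by simp
      also have "\<dots> = (\<integral>z. \<psi> z * (\<integral>w. g w * k n z w \<partial>lborel) \<partial>lborel)"
      proof (rule Bochner_Integration.integral_cong[OF refl])
        fix z
        show "of_real bump_mass * (H z * \<psi> z) = \<psi> z * (\<integral>w. g w * k n z w \<partial>lborel)"
        proof (cases "cmod z < r")
          case True
          then have "H z = mollify b (\<tau> n) z / of_real bump_mass"
            using h_eq[OF _ \<tau>1(1)[OF True]] r by (simp add: H_def)
          moreover have "mollify b (\<tau> n) z = (\<integral>w. g w * k n z w \<partial>lborel)"
            unfolding g_def k_def by (rule mollify_localize[OF \<tau>p \<tau>1(2)[OF True]])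
          ultimately show ?thesis using bump_mass_pos by simp
        next
          case False then show ?thesis using supp by simp
        qed
      qed
      also have "\<dots> = (\<integral>w. g w * (\<integral>z. \<psi> z * k n z w \<partial>lborel) \<partial>lborel)"
      proof (rule Fubini_kernel[OF gi \<psi>i])
        show "(\<lambda>p. k n (fst p) (snd p)) \<in> borel_measurable (borel \<Otimes>\<^sub>M borel)"
          unfolding k_def by measurable
        show "cmod (k n z w) \<le> (\<tau> n)\<^sup>2" for z w
          using flat_exp_le[of 0 "1 - (\<tau> n)\<^sup>2 * (cmod (w - z))\<^sup>2"] flat_exp_nonneg[of 0 "1 - (\<tau> n)\<^sup>2 * (cmod (w - z))\<^sup>2"]
          unfolding k_def norm_of_real by (simp add: abs_mult mult_left_le)
      qed
      finally show ?thesis .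
    qed
    note lim = mollify_test_tendsto[OF \<psi> K(2) \<tau>p \<tau>l]
    have "(\<lambda>n. \<integral>w. g w * (\<integral>z. \<psi> z * k n z w \<partial>lborel) \<partial>lborel) \<longlonglongrightarrow> (\<integral>w. g w * (\<psi> w * of_real bump_mass) \<partial>lborel)"
    proof (rule integral_dominated_convergence)
      show "integrable lborel (\<lambda>w. (K * bump_mass) * norm (g w))" using gi by auto
      show "AE w in lborel. (\<lambda>n. g w * (\<integral>z. \<psi> z * k n z w \<partial>lborel)) \<longlonglongrightarrow> g w * (\<psi> w * of_real bump_mass)"
        unfolding k_def by (intro AE_I2 tendsto_intros lim(1))
      show "AE w in lborel. norm (g w * (\<integral>z. \<psi> z * k n z w \<partial>lborel)) \<le> (K * bump_mass) * norm (g w)" for n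
      proof (rule AE_I2)
        fix w
        show "norm (g w * (\<integral>z. \<psi> z * k n z w \<partial>lborel)) \<le> (K * bump_mass) * norm (g w)"
          using mult_left_mono[OF lim(2)[of n w], of "norm (g w)"]
          unfolding k_def by (simp only: norm_mult mult.commute norm_ge_zero)
      qed
      have [measurable]: "g \<in> borel_measurable borel" using borel_measurable_integrable[OF gi] by simp
      show "(\<lambda>w. g w * (\<psi> w * of_real bump_mass)) \<in> borel_measurable lborel" by measurable
      show "(\<lambda>w. g w * (\<integral>z. \<psi> z * k n z w \<partial>lborel)) \<in> borel_measurable lborel" for n
        unfolding k_def by measurable
    qed
    then have "(\<integral>w. g w * (\<psi> w * of_real bump_mass) \<partial>lborel) = of_real bump_mass * (\<integral>z. H z * \<psi> z \<partial>lborel)"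
      unfolding eqn[symmetric] by (rule LIMSEQ_unique[OF _ tendsto_const])
    moreover have "(\<integral>w. g w * (\<psi> w * of_real bump_mass) \<partial>lborel) = of_real bump_mass * (\<integral>w. b w * \<psi> w \<partial>lborel)"
    proof -
      have "g w * (\<psi> w * of_real bump_mass) = of_real bump_mass * (b w * \<psi> w)" for w
        using supp[of w] r1 by (cases "cmod w \<le> r1") (auto simp: g_def)
      then show ?thesis by (simp only: integral_mult_right_zero)
    qed
    ultimately have e: "(\<integral>w. b w * \<psi> w \<partial>lborel) = (\<integral>z. H z * \<psi> z \<partial>lborel)"
      using bump_mass_pos by simp
    have loc: "(\<lambda>z. (indicator (cball 0 r) z *\<^sub>R f z) * \<psi> z) = (\<lambda>z. f z * \<psi> z)" for f :: "complex \<Rightarrow> complex"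
    proof
      fix z show "(indicator (cball 0 r) z *\<^sub>R f z) * \<psi> z = f z * \<psi> z"
        using supp[of z] by (cases "cmod z \<le> r") auto
    qed
    have "integrable lborel (\<lambda>z. b z * \<psi> z)" "integrable lborel (\<lambda>z. H z * \<psi> z)"
      using integrable_mult_bounded[OF bi[OF r], of \<psi> K] integrable_mult_bounded[OF Hi[OF r], of \<psi> K] K(2)
      unfolding loc by simp_all
    then show ?thesis using e by (simp add: left_diff_distrib)
  qed
  have "AE z in lborel. cmod z < 1 - 1 / real (Suc n) \<longrightarrow> b z - H z = 0" for n
  proof (rule AE_zero_if_integral_continuous_zero)
    have r: "1 - 1 / real (Suc n) < 1" by simp
    show "(\<lambda>z. b z - H z) \<in> borel_measurable borel" by measurable
    show "integrable lborel (\<lambda>z. indicator (cball 0 (1 - 1 / real (Suc n))) z *\<^sub>R (b z - H z))"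
      using Bochner_Integration.integrable_diff[OF bi[OF r] Hi[OF r]] by (simp add: scaleR_diff_right)
    show "(\<integral>z. (b z - H z) * \<psi> z \<partial>lborel) = 0"
      if "continuous_on UNIV \<psi>" "\<And>z. 1 - 1 / real (Suc n) \<le> cmod z \<Longrightarrow> \<psi> z = 0" for \<psi>
      by (rule main[OF r that])
  qed
  then have "AE z in lborel. \<forall>n. cmod z < 1 - 1 / real (Suc n) \<longrightarrow> b z - H z = 0"
    unfolding AE_all_countable by blast
  then show "AE z in lborel. cmod z < 1 \<longrightarrow> b z = h z"
  proof eventually_elim
    case (elim z)
    show ?case
    proof
      assume z: "cmod z < 1"
      obtain n where "inverse (real (Suc n)) < 1 - cmod z" using reals_Archimedean[of "1 - cmod z"] z by auto
      then have "b z - H z = 0" using elim[rule_format, of n] by (simp add: divide_inverse)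
      then show "b z = h z" using z by (simp add: H_def)
    qed
  qed
qed

section \<open>The weighted a priori estimate\<close>

lemma has_partials_line:
  assumes "has_partials u a b z"
  shows "((\<lambda>s::real. u (z + s *\<^sub>R v)) has_vector_derivative (of_real (Re v) * a + of_real (Im v) * b)) (at 0)"
proof -
  have "((\<lambda>s::real. z + s *\<^sub>R v) has_derivative (\<lambda>s. s *\<^sub>R v)) (at 0)"
    by (auto intro!: derivative_eq_intros)
  from has_derivative_compose[OF this, of u "\<lambda>h. of_real (Re h) * a + of_real (Im h) * b"]
  have "((\<lambda>s::real. u (z + s *\<^sub>R v)) has_derivative (\<lambda>s. of_real (Re (s *\<^sub>R v)) * a + of_real (Im (s *\<^sub>R v)) * b)) (at 0)"
    using assms unfolding has_partials_def by simp
  then show ?thesis unfolding has_vector_derivative_def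
    by (rule has_derivative_eq_rhs) (auto simp: fun_eq_iff scaleR_conv_of_real algebra_simps)
qed

text \<open>Two applications of the mean value theorem. The left-hand side does not change when the two directions are
  exchanged.\<close>

lemma double_difference_mvt:
  fixes g gv gvw :: "complex \<Rightarrow> real"
  assumes g: "\<And>z. ((\<lambda>s. g (z + s *\<^sub>R v)) has_real_derivative gv z) (at 0)"
    and gv: "\<And>z. ((\<lambda>s. gv (z + s *\<^sub>R w)) has_real_derivative gvw z) (at 0)"
    and t: "0 < t"
  shows "\<exists>\<zeta>. dist \<zeta> z \<le> t * (cmod v + cmod w) \<and>
      g (z + t *\<^sub>R v + t *\<^sub>R w) - g (z + t *\<^sub>R v) - g (z + t *\<^sub>R w) + g z = t\<^sup>2 * gvw \<zeta>"
proof -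
  have g': "((\<lambda>s. g (z + s *\<^sub>R v)) has_real_derivative gv (z + s *\<^sub>R v)) (at s)" for z s
    using g[of "z + s *\<^sub>R v"] DERIV_shift[of "\<lambda>s. g (z + s *\<^sub>R v)" "gv (z + s *\<^sub>R v)" 0 s]
    by (simp add: algebra_simps)
  have gv': "((\<lambda>s. gv (z + s *\<^sub>R w)) has_real_derivative gvw (z + s *\<^sub>R w)) (at s)" for z s
    using gv[of "z + s *\<^sub>R w"] DERIV_shift[of "\<lambda>s. gv (z + s *\<^sub>R w)" "gvw (z + s *\<^sub>R w)" 0 s]
    by (simp add: algebra_simps)
  define \<phi> where "\<phi> s = g ((z + t *\<^sub>R w) + s *\<^sub>R v) - g (z + s *\<^sub>R v)" for s
  have "(\<phi> has_real_derivative gv ((z + t *\<^sub>R w) + s *\<^sub>R v) - gv (z + s *\<^sub>R v)) (at s)" for s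
    unfolding \<phi>_def by (intro DERIV_diff g')
  then obtain \<xi> where \<xi>: "0 < \<xi>" "\<xi> < t" "\<phi> t - \<phi> 0 = (t - 0) * (gv ((z + t *\<^sub>R w) + \<xi> *\<^sub>R v) - gv (z + \<xi> *\<^sub>R v))"
    using MVT2[OF t, of \<phi> "\<lambda>s. gv ((z + t *\<^sub>R w) + s *\<^sub>R v) - gv (z + s *\<^sub>R v)"] by blast
  obtain \<eta> where \<eta>: "0 < \<eta>" "\<eta> < t" "gv ((z + \<xi> *\<^sub>R v) + t *\<^sub>R w) - gv ((z + \<xi> *\<^sub>R v) + 0 *\<^sub>R w) = (t - 0) * gvw ((z + \<xi> *\<^sub>R v) + \<eta> *\<^sub>R w)"
    using MVT2[OF t, of "\<lambda>s. gv ((z + \<xi> *\<^sub>R v) + s *\<^sub>R w)" "\<lambda>s. gvw ((z + \<xi> *\<^sub>R v) + s *\<^sub>R w)"] gv' by blast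
  show ?thesis
  proof (intro exI conjI)
    have "dist ((z + \<xi> *\<^sub>R v) + \<eta> *\<^sub>R w) z \<le> cmod (\<xi> *\<^sub>R v) + cmod (\<eta> *\<^sub>R w)"
      using norm_triangle_ineq[of "\<xi> *\<^sub>R v" "\<eta> *\<^sub>R w"] by (simp add: dist_norm algebra_simps)
    also have "\<dots> \<le> t * cmod v + t * cmod w"
      using \<xi> \<eta> by (intro add_mono) (auto simp: mult_right_mono)
    finally show "dist ((z + \<xi> *\<^sub>R v) + \<eta> *\<^sub>R w) z \<le> t * (cmod v + cmod w)" by (simp add: algebra_simps)
    have "g (z + t *\<^sub>R v + t *\<^sub>R w) - g (z + t *\<^sub>R v) - g (z + t *\<^sub>R w) + g z = \<phi> t - \<phi> 0"
      unfolding \<phi>_def by (simp add: add.assoc add.commute[of "t *\<^sub>R v"])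
    also have "\<dots> = t\<^sup>2 * gvw ((z + \<xi> *\<^sub>R v) + \<eta> *\<^sub>R w)"
      using \<xi>(3) \<eta>(3) by (simp add: power2_eq_square algebra_simps)
    finally show "g (z + t *\<^sub>R v + t *\<^sub>R w) - g (z + t *\<^sub>R v) - g (z + t *\<^sub>R w) + g z = t\<^sup>2 * gvw ((z + \<xi> *\<^sub>R v) + \<eta> *\<^sub>R w)" .
  qed
qed

lemma mixed_derivative_symmetric:
  fixes g gv gw gvw gwv :: "complex \<Rightarrow> real"
  assumes g: "\<And>z. ((\<lambda>s. g (z + s *\<^sub>R v)) has_real_derivative gv z) (at 0)" "\<And>z. ((\<lambda>s. g (z + s *\<^sub>R w)) has_real_derivative gw z) (at 0)"
    and gvw: "\<And>z. ((\<lambda>s. gv (z + s *\<^sub>R w)) has_real_derivative gvw z) (at 0)"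
    and gwv: "\<And>z. ((\<lambda>s. gw (z + s *\<^sub>R v)) has_real_derivative gwv z) (at 0)"
    and c: "isCont gvw z" "isCont gwv z"
  shows "gvw z = gwv z"
proof -
  define \<tau> where "\<tau> n = 1 / real (Suc n)" for n
  have \<tau>: "0 < \<tau> n" for n by (simp add: \<tau>_def)
  have "\<forall>n. \<exists>\<zeta>. dist \<zeta> z \<le> \<tau> n * (cmod v + cmod w) \<and>
      g (z + \<tau> n *\<^sub>R v + \<tau> n *\<^sub>R w) - g (z + \<tau> n *\<^sub>R v) - g (z + \<tau> n *\<^sub>R w) + g z = (\<tau> n)\<^sup>2 * gvw \<zeta>"
    using double_difference_mvt[OF g(1) gvw \<tau>] by blast
  then obtain a where a: "\<And>n. dist (a n) z \<le> \<tau> n * (cmod v + cmod w)"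
    "\<And>n. g (z + \<tau> n *\<^sub>R v + \<tau> n *\<^sub>R w) - g (z + \<tau> n *\<^sub>R v) - g (z + \<tau> n *\<^sub>R w) + g z = (\<tau> n)\<^sup>2 * gvw (a n)"
    by metis
  have "\<forall>n. \<exists>\<zeta>. dist \<zeta> z \<le> \<tau> n * (cmod w + cmod v) \<and>
      g (z + \<tau> n *\<^sub>R w + \<tau> n *\<^sub>R v) - g (z + \<tau> n *\<^sub>R w) - g (z + \<tau> n *\<^sub>R v) + g z = (\<tau> n)\<^sup>2 * gwv \<zeta>"
    using double_difference_mvt[OF g(2) gwv \<tau>] by blast
  then obtain b where b: "\<And>n. dist (b n) z \<le> \<tau> n * (cmod w + cmod v)"
    "\<And>n. g (z + \<tau> n *\<^sub>R w + \<tau> n *\<^sub>R v) - g (z + \<tau> n *\<^sub>R w) - g (z + \<tau> n *\<^sub>R v) + g z = (\<tau> n)\<^sup>2 * gwv (b n)"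
    by metis
  have eq0: "(\<tau> n)\<^sup>2 * gvw (a n) = (\<tau> n)\<^sup>2 * gwv (b n)" for n
  proof -
    have p: "z + \<tau> n *\<^sub>R v + \<tau> n *\<^sub>R w = z + \<tau> n *\<^sub>R w + \<tau> n *\<^sub>R v" by (simp add: algebra_simps)
    show ?thesis using a(2)[of n] b(2)[of n] unfolding p by linarith
  qed
  have eq: "gvw (a n) = gwv (b n)" for n
    using eq0[of n] \<tau>[of n] by auto
  have \<tau>0: "(\<lambda>n. \<tau> n * c) \<longlonglongrightarrow> 0" for c
    unfolding \<tau>_def using tendsto_mult_left_zero[OF LIMSEQ_inverse_real_of_nat, of c] by (simp add: divide_inverse)
  have "(\<lambda>n. dist (a n) z) \<longlonglongrightarrow> 0"
  proof (rule Lim_null_comparison[OF _ \<tau>0[of "cmod v + cmod w"]])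
    show "\<forall>\<^sub>F n in sequentially. norm (dist (a n) z) \<le> \<tau> n * (cmod v + cmod w)"
      using a(1) by (intro always_eventually allI) simp
  qed
  then have "a \<longlonglongrightarrow> z" by (rule tendsto_dist_iff[THEN iffD2])
  then have 1: "(\<lambda>n. gvw (a n)) \<longlonglongrightarrow> gvw z" by (rule isCont_tendsto_compose[OF c(1)])
  have "(\<lambda>n. dist (b n) z) \<longlonglongrightarrow> 0"
  proof (rule Lim_null_comparison[OF _ \<tau>0[of "cmod w + cmod v"]])
    show "\<forall>\<^sub>F n in sequentially. norm (dist (b n) z) \<le> \<tau> n * (cmod w + cmod v)"
      using b(1) by (intro always_eventually allI) simp
  qed
  then have "b \<longlonglongrightarrow> z" by (rule tendsto_dist_iff[THEN iffD2])
  then have 2: "(\<lambda>n. gwv (b n)) \<longlonglongrightarrow> gwv z" by (rule isCont_tendsto_compose[OF c(2)])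
  show ?thesis using LIMSEQ_unique[OF 1] 2 unfolding eq by simp
qed

lemma smooth_partial_commute:
  assumes u: "smooth u" shows "partial CX (partial CY u) z = partial CY (partial CX u) z"
proof -
  have d: "((\<lambda>s::real. f (z + s *\<^sub>R 1)) has_vector_derivative partial CX f z) (at 0)"
    "((\<lambda>s::real. f (z + s *\<^sub>R \<i>)) has_vector_derivative partial CY f z) (at 0)" if "smooth f" for f z
    using has_partials_line[OF smooth_has_partials[OF that, of z], of 1]
      has_partials_line[OF smooth_has_partials[OF that, of z], of \<i>] by simp_all
  have RI: "(f has_vector_derivative f') (at x) \<Longrightarrow> ((\<lambda>s. Re (f s)) has_real_derivative Re f') (at x)"
    "(f has_vector_derivative f') (at x) \<Longrightarrow> ((\<lambda>s. Im (f s)) has_real_derivative Im f') (at x)" for f f' x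
    unfolding has_real_derivative_iff_has_vector_derivative
    by (auto dest: bounded_linear.has_vector_derivative[OF bounded_linear_Re] bounded_linear.has_vector_derivative[OF bounded_linear_Im])
  have s: "smooth (partial CX u)" "smooth (partial CY u)" by (intro smooth_partial u)+
  have c: "isCont (partial i (partial j u)) z" for i j z
    using smooth_continuous[OF smooth_partial[OF smooth_partial[OF u]], of UNIV i j]
    by (simp add: continuous_on_eq_continuous_at)
  have "Re (partial CX (partial CY u) z) = Re (partial CY (partial CX u) z)"
    by (rule mixed_derivative_symmetric[where v = \<i> and w = 1, OF RI(1)[OF d(2)[OF u]] RI(1)[OF d(1)[OF u]] RI(1)[OF d(1)[OF s(2)]] RI(1)[OF d(2)[OF s(1)]]])
      (rule bounded_linear.isCont[OF bounded_linear_Re c])+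
  moreover have "Im (partial CX (partial CY u) z) = Im (partial CY (partial CX u) z)"
    by (rule mixed_derivative_symmetric[where v = \<i> and w = 1, OF RI(2)[OF d(2)[OF u]] RI(2)[OF d(1)[OF u]] RI(2)[OF d(1)[OF s(2)]] RI(2)[OF d(2)[OF s(1)]]])
      (rule bounded_linear.isCont[OF bounded_linear_Im c])+
  ultimately show ?thesis by (rule complex_eqI)
qed

lemma dhol_dbar_commute:
  assumes u: "u \<in> test_functions" shows "dhol (dbar u) z = dbar (dhol u) z"
proof -
  have s: "smooth u" using u by (simp add: test_functions_iff)
  have t: "partial i u \<in> test_functions" for i by (rule test_functions_partial[OF u])
  have 1: "partial j (\<lambda>z. 1/2 * (partial CX u z + c * partial CY u z)) z
      = 1/2 * (partial j (partial CX u) z + c * partial j (partial CY u) z)" for j c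
    using partial_cmult_test[OF test_functions_add[OF t test_functions_cmult[OF t]], of j "1/2" CX c CY z]
      partial_add_test[OF t test_functions_cmult[OF t], of j CX c CY z] partial_cmult_test[OF t, of j c CY z] by simp
  have 2: "dbar u = (\<lambda>z. 1/2 * (partial CX u z + \<i> * partial CY u z))" "dhol u = (\<lambda>z. 1/2 * (partial CX u z + (- \<i>) * partial CY u z))"
    by (auto simp: fun_eq_iff dbar_def dhol_def)
  show ?thesis unfolding dhol_def[of "dbar u"] dbar_def[of "dhol u"] unfolding 2 1
    using smooth_partial_commute[OF s, of z] by (simp add: field_simps)
qed

text \<open>The numbers \<open>p\<close> and \<open>q\<close> are the values of \<open>\<partial>u\<close> and \<open>\<partial>'u\<close>.\<close>

definition has_wirtinger :: "(complex \<Rightarrow> complex) \<Rightarrow> complex \<Rightarrow> complex \<Rightarrow> complex \<Rightarrow> bool" where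
  "has_wirtinger u p q z \<longleftrightarrow> has_partials u (p + q) (\<i> * (p - q)) z"

lemma has_wirtinger_mult:
  assumes "has_wirtinger u p q z" "has_wirtinger v p' q' z"
  shows "has_wirtinger (\<lambda>z. u z * v z) (p * v z + u z * p') (q * v z + u z * q') z"
  using has_partials_mult[OF assms[unfolded has_wirtinger_def]] unfolding has_wirtinger_def
  by (simp add: algebra_simps)

lemma has_wirtinger_cnj:
  assumes "has_wirtinger u p q z" shows "has_wirtinger (\<lambda>z. cnj (u z)) (cnj q) (cnj p) z"
  using has_partials_cnj[OF assms[unfolded has_wirtinger_def]] unfolding has_wirtinger_def
  by (simp add: algebra_simps)

lemma has_wirtinger_id: "has_wirtinger (\<lambda>z. z) 1 0 z"
  using has_partials_id unfolding has_wirtinger_def by simp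

lemma has_wirtinger_cnj_id: "has_wirtinger (\<lambda>z. cnj z) 0 1 z"
  using has_wirtinger_cnj[OF has_wirtinger_id] by simp

lemma has_wirtinger_test:
  assumes "u \<in> test_functions" shows "has_wirtinger u (dhol u z) (dbar u z) z"
  using test_functions_has_partials[OF assms, of z] unfolding has_wirtinger_def dhol_def dbar_def
  by (simp add: field_simps)

lemma has_wirtinger_holomorphic:
  assumes "(f has_field_derivative D) (at z)" shows "has_wirtinger f D 0 z"
proof -
  have "(\<lambda>h. of_real (Re h) * D + of_real (Im h) * (\<i> * D)) = (*) D"
  proof
    fix h
    have "h = of_real (Re h) + \<i> * of_real (Im h)" by (rule complex_eq)
    then have "D * h = D * (of_real (Re h) + \<i> * of_real (Im h))" by simp
    then show "of_real (Re h) * D + of_real (Im h) * (\<i> * D) = D * h" by (simp add: algebra_simps)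
  qed
  then show ?thesis using assms unfolding has_wirtinger_def has_partials_def has_field_derivative_def by simp
qed

text \<open>By translation invariance all difference quotients have integral 0; they converge boundedly with uniformly
  bounded supports.\<close>

lemma integral_directional_derivative_zero:
  fixes F D :: "complex \<Rightarrow> complex"
  assumes F: "\<And>z. ((\<lambda>s::real. F (z + s *\<^sub>R v)) has_vector_derivative D z) (at 0)"
    and Fc: "continuous_on UNIV F" and Dc: "continuous_on UNIV D"
    and supp: "\<And>z. r \<le> cmod z \<Longrightarrow> F z = 0" "\<And>z. r \<le> cmod z \<Longrightarrow> D z = 0" and v: "cmod v \<le> 1"
  shows "(\<integral>z. D z \<partial>lborel) = 0"
proof -
  obtain K where K: "0 \<le> K" "\<And>z. cmod (D z) \<le> K" using continuous_support_bounded[OF Dc supp(2)] by blast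
  have Fi: "integrable lborel F" by (rule continuous_support_integrable[OF Fc supp(1)])
  have [measurable]: "F \<in> borel_measurable borel" "D \<in> borel_measurable borel"
    by (intro borel_measurable_continuous_onI Fc Dc)+
  define \<tau> where "\<tau> n = 1 / real (Suc n)" for n
  have \<tau>: "0 < \<tau> n" "\<tau> n \<le> 1" for n by (auto simp: \<tau>_def)
  have \<tau>ne: "\<tau> n \<noteq> 0" for n using \<tau>(1)[of n] by simp
  have F': "((\<lambda>s. F (z + s *\<^sub>R v)) has_vector_derivative D (z + s *\<^sub>R v)) (at s)" for z s
  proof -
    have "((\<lambda>s::real. s - s0) has_vector_derivative 1) (at s0)" for s0
      by (auto intro!: derivative_eq_intros)
    from vector_diff_chain_at[OF this[of s], of "\<lambda>t. F ((z + s *\<^sub>R v) + t *\<^sub>R v)" "D (z + s *\<^sub>R v)"] F[of "z + s *\<^sub>R v"]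
    show ?thesis by (simp add: o_def algebra_simps)
  qed
  have lip: "cmod (F (z + t *\<^sub>R v) - F z) \<le> K * t" if "0 \<le> t" for z t
  proof -
    have on: "onorm (\<lambda>h::real. h *\<^sub>R D y) \<le> K" for y
    proof (rule onorm_le)
      fix h :: real
      show "norm (h *\<^sub>R D y) \<le> K * norm h"
        using mult_left_mono[OF K(2)[of y] abs_ge_zero[of h]] by (simp add: mult.commute)
    qed
    have "norm (F (z + t *\<^sub>R v) - F (z + 0 *\<^sub>R v)) \<le> K * norm (t - 0)"
      by (rule differentiable_bound[of UNIV "\<lambda>s. F (z + s *\<^sub>R v)" "\<lambda>s h. h *\<^sub>R D (z + s *\<^sub>R v)"])
        (use F' on in \<open>auto simp: has_vector_derivative_def\<close>)
    then show ?thesis using that by simp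
  qed
  define q where "q n z = (F (z + \<tau> n *\<^sub>R v) - F z) /\<^sub>R \<tau> n" for n z
  have 0: "(\<integral>z. q n z \<partial>lborel) = 0" for n
  proof -
    have i: "integrable lborel (\<lambda>z. F (\<tau> n *\<^sub>R v + z))" "(\<integral>z. F (\<tau> n *\<^sub>R v + z) \<partial>lborel) = (\<integral>z. F z \<partial>lborel)"
      using Fi integrable_distr_eq[of "(+) (\<tau> n *\<^sub>R v)" lborel borel F] integral_distr[of "(+) (\<tau> n *\<^sub>R v)" lborel borel F]
      by (simp_all add: lborel_distr_plus)
    have "(\<integral>z. q n z \<partial>lborel) = (\<integral>z. F (\<tau> n *\<^sub>R v + z) - F z \<partial>lborel) /\<^sub>R \<tau> n"
      unfolding q_def by (simp add: add.commute)
    also have "\<dots> = 0" using i Fi by simp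
    finally show ?thesis .
  qed
  have "(\<lambda>n. \<integral>z. q n z \<partial>lborel) \<longlonglongrightarrow> (\<integral>z. D z \<partial>lborel)"
  proof (rule integral_dominated_convergence)
    show "integrable lborel (\<lambda>z::complex. indicator (cball 0 (r + 1)) z * K)"
      using emeasure_lborel_cball_finite[of "0::complex" "r + 1"]
      by (intro integrable_mult_left integrable_real_indicator) auto
    show "AE z in lborel. (\<lambda>n. q n z) \<longlonglongrightarrow> D z"
    proof (rule AE_I2)
      fix z
      have "\<tau> \<longlonglongrightarrow> 0" unfolding \<tau>_def using LIMSEQ_inverse_real_of_nat by (simp add: divide_inverse)
      moreover have "(\<lambda>t. (F (z + t *\<^sub>R v) - F z) /\<^sub>R t) \<midarrow>0\<rightarrow> D z"
      proof -
        have "(\<lambda>t. cmod (F (z + t *\<^sub>R v) - F z - t *\<^sub>R D z) / norm t) \<midarrow>0\<rightarrow> 0"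
          using F[of z] unfolding has_vector_derivative_def has_derivative_at by simp
        moreover have "\<forall>\<^sub>F t in at 0. cmod (F (z + t *\<^sub>R v) - F z - t *\<^sub>R D z) / norm t
            = cmod ((F (z + t *\<^sub>R v) - F z) /\<^sub>R t - D z)"
          unfolding eventually_at
        proof (intro exI[of _ 1] conjI ballI impI zero_less_one)
          fix t :: real assume "t \<noteq> 0 \<and> dist t 0 < 1"
          then have "(F (z + t *\<^sub>R v) - F z) /\<^sub>R t - D z = (F (z + t *\<^sub>R v) - F z - t *\<^sub>R D z) /\<^sub>R t"
            by (simp add: algebra_simps)
          then show "cmod (F (z + t *\<^sub>R v) - F z - t *\<^sub>R D z) / norm t = cmod ((F (z + t *\<^sub>R v) - F z) /\<^sub>R t - D z)"
            by (simp add: divide_inverse mult.commute)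
        qed
        ultimately have "(\<lambda>t. cmod ((F (z + t *\<^sub>R v) - F z) /\<^sub>R t - D z)) \<midarrow>0\<rightarrow> 0"
          by (rule Lim_transform_eventually)
        then show ?thesis unfolding tendsto_norm_zero_iff by (rule LIM_zero_cancel)
      qed
      ultimately show "(\<lambda>n. q n z) \<longlonglongrightarrow> D z"
        unfolding q_def tendsto_at_iff_sequentially comp_def using \<tau>ne by simp
    qed
    show "AE z in lborel. norm (q n z) \<le> indicator (cball 0 (r + 1)) z * K" for n
    proof (rule AE_I2)
      fix z
      show "norm (q n z) \<le> indicator (cball 0 (r + 1)) z * K"
      proof (cases "cmod z \<le> r + 1")
        case True
        have "cmod (F (z + \<tau> n *\<^sub>R v) - F z) / \<tau> n \<le> K"
          using lip[of "\<tau> n" z] \<tau>(1)[of n] by (simp add: pos_divide_le_eq)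
        then show ?thesis using True \<tau>(1)[of n] by (simp add: q_def divide_inverse mult.commute)
      next
        case False
        have "cmod (\<tau> n *\<^sub>R v) \<le> 1 * 1" unfolding norm_scaleR using \<tau>[of n] v by (intro mult_mono) auto
        then have "r \<le> cmod (z + \<tau> n *\<^sub>R v)"
          using False norm_triangle_ineq2[of z "- (\<tau> n *\<^sub>R v)"] by simp
        then show ?thesis using supp(1) False by (simp add: q_def)
      qed
    qed
    show "q n \<in> borel_measurable lborel" for n unfolding q_def by measurable
  qed measurable
  then show ?thesis unfolding 0 by (simp add: LIMSEQ_const_iff)
qed

lemma integral_wirtinger_zero:
  assumes F: "\<And>z. has_wirtinger F (p z) (q z) z"
    and c: "continuous_on UNIV p" "continuous_on UNIV q"
    and supp: "\<And>z. r \<le> cmod z \<Longrightarrow> F z = 0 \<and> p z = 0 \<and> q z = 0"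
  shows "(\<integral>z. p z \<partial>lborel) = 0" "(\<integral>z. q z \<partial>lborel) = 0"
proof -
  have Fc: "continuous_on UNIV F"
    using F has_derivative_continuous unfolding has_wirtinger_def has_partials_def
    by (blast intro: continuous_at_imp_continuous_on)
  have 1: "(\<integral>z. p z + q z \<partial>lborel) = 0"
    by (rule integral_directional_derivative_zero[where F = F and v = 1 and r = r])
      (use has_partials_line[OF F[unfolded has_wirtinger_def], of _ 1] supp Fc continuous_on_add[OF c] in simp_all)
  have 2: "(\<integral>z. \<i> * (p z - q z) \<partial>lborel) = 0"
    by (rule integral_directional_derivative_zero[where F = F and v = \<i> and r = r])
      (use has_partials_line[OF F[unfolded has_wirtinger_def], of _ \<i>] supp Fc continuous_on_mult_left[OF continuous_on_diff[OF c]] in simp_all)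
  have i: "integrable lborel p" "integrable lborel q"
    using continuous_support_integrable[OF c(1), of r] continuous_support_integrable[OF c(2), of r] supp by auto
  have "(\<integral>z. p z \<partial>lborel) + (\<integral>z. q z \<partial>lborel) = 0" "(\<integral>z. p z \<partial>lborel) - (\<integral>z. q z \<partial>lborel) = 0"
    using 1 2 i by simp_all
  then have "(\<integral>z. p z \<partial>lborel) = (\<integral>z. q z \<partial>lborel)" "(\<integral>z. q z \<partial>lborel) + (\<integral>z. q z \<partial>lborel) = 0"
    by (simp_all only: right_minus_eq)
  then show "(\<integral>z. p z \<partial>lborel) = 0" "(\<integral>z. q z \<partial>lborel) = 0" by (simp_all flip: mult_2)
qed

lemma dfun_pos: "cmod z < 1 \<Longrightarrow> 0 < dfun z"
  by (simp add: dfun_def power_less_one_iff)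

lemma has_wirtinger_weight:
  assumes "cmod z < 1"
  shows "has_wirtinger (\<lambda>z. of_real (dfun z powr s)) (- of_real s * cnj z * of_real (dfun z powr (s - 1)))
    (- of_real s * z * of_real (dfun z powr (s - 1))) z"
proof -
  have "((\<lambda>t. t powr s) has_real_derivative s * (1 - 1 * (cmod (z - 0))\<^sup>2) powr (s - 1)) (at (1 - 1 * (cmod (z - 0))\<^sup>2))"
    by (rule has_real_derivative_powr) (use dfun_pos[OF assms] in \<open>simp add: dfun_def\<close>)
  from has_partials_cmod_sq[OF this]
  have "has_partials (\<lambda>z. of_real (dfun z powr s)) (of_real (s * dfun z powr (s - 1) * (- 2 * Re z)))
      (of_real (s * dfun z powr (s - 1) * (- 2 * Im z))) z"
    by (simp add: dfun_def)
  moreover have "complex_of_real (s * dfun z powr (s - 1) * (- 2 * Re z))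
      = - of_real s * cnj z * of_real (dfun z powr (s - 1)) + - of_real s * z * of_real (dfun z powr (s - 1))"
    "complex_of_real (s * dfun z powr (s - 1) * (- 2 * Im z))
      = \<i> * (- of_real s * cnj z * of_real (dfun z powr (s - 1)) - - of_real s * z * of_real (dfun z powr (s - 1)))"
    by (simp_all add: complex_eq_iff)
  ultimately show ?thesis unfolding has_wirtinger_def by (simp only:)
qed

lemma continuous_weight_mult:
  fixes F :: "complex \<Rightarrow> complex"
  assumes F: "continuous_on UNIV F" and r: "r < 1" and supp: "\<And>z. r \<le> cmod z \<Longrightarrow> F z = 0"
  shows "continuous_on UNIV (\<lambda>z. of_real (dfun z powr s) * F z)"
proof -
  have "continuous_on (ball 0 1 \<union> - cball 0 r) (\<lambda>z. of_real (dfun z powr s) * F z)"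
  proof (rule continuous_on_open_Un)
    have d: "dfun z \<noteq> 0" if "z \<in> ball 0 1" for z using dfun_pos[of z] that by auto
    have dc: "continuous_on (ball 0 1) dfun" unfolding dfun_def by (intro continuous_intros)
    show "continuous_on (ball 0 1) (\<lambda>z. of_real (dfun z powr s) * F z)"
      by (intro continuous_intros dc continuous_on_subset[OF F] continuous_on_powr) (use d in auto)
    have "continuous_on (- cball 0 r) (\<lambda>z::complex. 0 :: complex)" by simp
    then show "continuous_on (- cball 0 r) (\<lambda>z. of_real (dfun z powr s) * F z)"
      by (rule continuous_on_eq) (use supp in auto)
  qed auto
  moreover have "ball 0 1 \<union> - cball 0 r = (UNIV :: complex set)" using r by auto
  ultimately show ?thesis by simp
qed

text \<open>The weight is smooth only inside the disk, which suffices because \<open>F\<close> vanishes near the boundary. Its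
  derivatives are \<open>\<partial> d^s = - s cnj z d^(s-1)\<close> and \<open>\<partial>' d^s = - s z d^(s-1)\<close>.\<close>

lemma weighted_divergence:
  assumes F: "\<And>z. has_wirtinger F (p z) (q z) z"
    and c: "continuous_on UNIV p" "continuous_on UNIV q"
    and r: "r < 1" and supp: "\<And>z. r \<le> cmod z \<Longrightarrow> F z = 0 \<and> p z = 0 \<and> q z = 0"
  shows "(\<integral>z. of_real (dfun z powr s) * p z - of_real s * (of_real (dfun z powr (s - 1)) * (cnj z * F z)) \<partial>lborel) = 0"
    and "(\<integral>z. of_real (dfun z powr s) * q z - of_real s * (of_real (dfun z powr (s - 1)) * (z * F z)) \<partial>lborel) = 0"
proof -
  have Fc: "continuous_on UNIV F"
    using F has_derivative_continuous unfolding has_wirtinger_def has_partials_def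
    by (blast intro: continuous_at_imp_continuous_on)
  let ?P = "\<lambda>z. of_real (dfun z powr s) * p z - of_real s * (of_real (dfun z powr (s - 1)) * (cnj z * F z))"
  let ?Q = "\<lambda>z. of_real (dfun z powr s) * q z - of_real s * (of_real (dfun z powr (s - 1)) * (z * F z))"
  have W: "has_wirtinger (\<lambda>z. of_real (dfun z powr s) * F z) (?P z) (?Q z) z" for z
  proof (cases "cmod z < 1")
    case True
    from has_wirtinger_mult[OF has_wirtinger_weight[OF this] F]
    show ?thesis by (simp add: algebra_simps)
  next
    case False
    have "has_partials (\<lambda>z. of_real (dfun z powr s) * F z) 0 0 z"
      by (rule has_partials_transform[OF has_partials_const, of "- cball 0 r"]) (use False r supp in auto)
    then show ?thesis using False r supp[of z] by (simp add: has_wirtinger_def)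
  qed
  have cP: "continuous_on UNIV ?P"
    by (intro continuous_on_diff continuous_on_mult_left continuous_weight_mult c(1) r)
      (use supp r in \<open>auto intro!: continuous_intros Fc\<close>)
  have cQ: "continuous_on UNIV ?Q"
    by (intro continuous_on_diff continuous_on_mult_left continuous_weight_mult c(2) r)
      (use supp r in \<open>auto intro!: continuous_intros Fc\<close>)
  show "(\<integral>z. ?P z \<partial>lborel) = 0" "(\<integral>z. ?Q z \<partial>lborel) = 0"
    by (rule integral_wirtinger_zero[OF W cP cQ, of r], use supp in simp)+
qed

definition weighted_integral :: "real \<Rightarrow> (complex \<Rightarrow> complex) \<Rightarrow> complex" where
  "weighted_integral s f = (\<integral>z. of_real (dfun z powr s) * f z \<partial>lborel)"

lemma weighted_integral_integrable:
  assumes "continuous_on UNIV F" "r < 1" "\<And>z. r \<le> cmod z \<Longrightarrow> F z = 0"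
  shows "integrable lborel (\<lambda>z. complex_of_real (dfun z powr s) * F z)"
  by (rule continuous_support_integrable[OF continuous_weight_mult[OF assms], of r]) (use assms in auto)

text \<open>The first identity is the difference of the integrals of \<open>\<partial>'(d^s u cnj Q)\<close> and \<open>\<partial>(d^s u cnj P)\<close>, in which the
  second derivatives cancel because \<open>\<partial>Q = \<partial>'P\<close>. The second one is the integral of \<open>\<partial>'(d^s |u|\<^sup>2 cnj z)\<close>.\<close>

lemma estimate_identities:
  fixes u :: "complex \<Rightarrow> complex"
  assumes u: "u \<in> test_functions"
  defines "P \<equiv> dhol u" and "Q \<equiv> dbar u"
  shows "weighted_integral s (\<lambda>z. Q z * cnj (Q z)) - weighted_integral s (\<lambda>z. P z * cnj (P z))
      = of_real s * (weighted_integral (s - 1) (\<lambda>z. z * u z * cnj (Q z)) - weighted_integral (s - 1) (\<lambda>z. cnj z * u z * cnj (P z)))"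
    and "weighted_integral s (\<lambda>z. cnj z * cnj (u z) * Q z) + weighted_integral s (\<lambda>z. cnj z * u z * cnj (P z)) + weighted_integral s (\<lambda>z. u z * cnj (u z))
      = of_real s * weighted_integral (s - 1) (\<lambda>z. z * cnj z * (u z * cnj (u z)))"
proof -
  have PQ: "P \<in> test_functions" "Q \<in> test_functions" unfolding P_def Q_def by (intro dhol_test dbar_test u)+
  obtain r where r: "0 < r" "r < 1" "\<And>z. r \<le> cmod z \<Longrightarrow> u z = 0 \<and> P z = 0 \<and> Q z = 0"
  proof -
    obtain a where a: "0 < a" "a < 1" "\<And>z. a \<le> cmod z \<Longrightarrow> u z = 0" using u test_functionsE by blast
    obtain b where b: "0 < b" "b < 1" "\<And>z. b \<le> cmod z \<Longrightarrow> P z = 0" using PQ(1) test_functionsE by blast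
    obtain c where c: "0 < c" "c < 1" "\<And>z. c \<le> cmod z \<Longrightarrow> Q z = 0" using PQ(2) test_functionsE by blast
    show ?thesis by (rule that[of "max a (max b c)"]) (use a b c in auto)
  qed
  have c: "continuous_on UNIV u" "continuous_on UNIV P" "continuous_on UNIV Q"
    using u PQ smooth_continuous unfolding test_functions_iff by blast+
  define R where "R = dbar P"
  have RQ: "dhol Q z = R z" for z unfolding R_def P_def Q_def by (rule dhol_dbar_commute[OF u])
  have cR: "continuous_on UNIV R" "continuous_on UNIV (dhol P)" "continuous_on UNIV (dbar Q)"
    unfolding R_def using dbar_test dhol_test PQ smooth_continuous unfolding test_functions_iff by blast+
  note wt = has_wirtinger_test[OF u, folded P_def Q_def] has_wirtinger_test[OF PQ(1), folded R_def]
    has_wirtinger_test[OF PQ(2), unfolded RQ]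
  note wi = weighted_integral_integrable[OF _ r(2)]
  note ci = continuous_on_mult continuous_on_add continuous_on_cnj c cR continuous_on_id continuous_on_const
  have A: "weighted_integral s (\<lambda>z. P z * cnj (P z)) + weighted_integral s (\<lambda>z. u z * cnj (R z)) = of_real s * weighted_integral (s - 1) (\<lambda>z. cnj z * u z * cnj (P z))"
  proof -
    have "(\<integral>z. of_real (dfun z powr s) * (P z * cnj (P z) + u z * cnj (R z))
       - of_real s * (of_real (dfun z powr (s - 1)) * (cnj z * (u z * cnj (P z)))) \<partial>lborel) = 0"
      by (rule weighted_divergence(1)[OF has_wirtinger_mult[OF wt(1) has_wirtinger_cnj[OF wt(2)]] _ _ r(2)])
        (use r(3) in \<open>auto intro!: ci\<close>)
    moreover have "integrable lborel (\<lambda>z. complex_of_real (dfun z powr s) * (P z * cnj (P z)))"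
      "integrable lborel (\<lambda>z. complex_of_real (dfun z powr s) * (u z * cnj (R z)))"
      "integrable lborel (\<lambda>z. complex_of_real (dfun z powr (s - 1)) * (cnj z * (u z * cnj (P z))))"
      by (intro wi ci; use r(3) in simp)+
    ultimately show ?thesis unfolding weighted_integral_def by (simp add: ring_distribs mult.assoc)
  qed
  have B: "weighted_integral s (\<lambda>z. Q z * cnj (Q z)) + weighted_integral s (\<lambda>z. u z * cnj (R z)) = of_real s * weighted_integral (s - 1) (\<lambda>z. z * u z * cnj (Q z))"
  proof -
    have "(\<integral>z. of_real (dfun z powr s) * (Q z * cnj (Q z) + u z * cnj (R z))
       - of_real s * (of_real (dfun z powr (s - 1)) * (z * (u z * cnj (Q z)))) \<partial>lborel) = 0"
      by (rule weighted_divergence(2)[OF has_wirtinger_mult[OF wt(1) has_wirtinger_cnj[OF wt(3)]] _ _ r(2)])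
        (use r(3) in \<open>auto intro!: ci\<close>)
    moreover have "integrable lborel (\<lambda>z. complex_of_real (dfun z powr s) * (Q z * cnj (Q z)))"
      "integrable lborel (\<lambda>z. complex_of_real (dfun z powr s) * (u z * cnj (R z)))"
      "integrable lborel (\<lambda>z. complex_of_real (dfun z powr (s - 1)) * (z * (u z * cnj (Q z))))"
      by (intro wi ci; use r(3) in simp)+
    ultimately show ?thesis unfolding weighted_integral_def by (simp add: ring_distribs mult.assoc)
  qed
  show "weighted_integral s (\<lambda>z. Q z * cnj (Q z)) - weighted_integral s (\<lambda>z. P z * cnj (P z))
      = of_real s * (weighted_integral (s - 1) (\<lambda>z. z * u z * cnj (Q z)) - weighted_integral (s - 1) (\<lambda>z. cnj z * u z * cnj (P z)))"
    using arg_cong2[OF B A, of "(-)"] by (simp only: add_diff_cancel_right right_diff_distrib)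
  have "(\<integral>z. of_real (dfun z powr s) * (1 * (u z * cnj (u z)) + cnj z * (Q z * cnj (u z) + u z * cnj (P z)))
       - of_real s * (of_real (dfun z powr (s - 1)) * (z * (cnj z * (u z * cnj (u z))))) \<partial>lborel) = 0"
    by (rule weighted_divergence(2)[OF has_wirtinger_mult[OF has_wirtinger_cnj_id has_wirtinger_mult[OF wt(1) has_wirtinger_cnj[OF wt(1)]]] _ _ r(2)])
      (use r(3) in \<open>auto intro!: ci\<close>)
  moreover have "integrable lborel (\<lambda>z. complex_of_real (dfun z powr s) * (cnj z * (cnj (u z) * Q z)))"
    "integrable lborel (\<lambda>z. complex_of_real (dfun z powr s) * (cnj z * (u z * cnj (P z))))"
    "integrable lborel (\<lambda>z. complex_of_real (dfun z powr s) * (u z * cnj (u z)))"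
    "integrable lborel (\<lambda>z. complex_of_real (dfun z powr (s - 1)) * (z * (cnj z * (u z * cnj (u z)))))"
    by (intro wi ci; use r(3) in simp)+
  ultimately show "weighted_integral s (\<lambda>z. cnj z * cnj (u z) * Q z) + weighted_integral s (\<lambda>z. cnj z * u z * cnj (P z)) + weighted_integral s (\<lambda>z. u z * cnj (u z))
      = of_real s * weighted_integral (s - 1) (\<lambda>z. z * cnj z * (u z * cnj (u z)))"
    unfolding weighted_integral_def by (simp add: ring_distribs mult.assoc mult.commute[of "Q _"] add.assoc add.commute add.left_commute)
qed

definition weighted_sqnorm :: "real \<Rightarrow> (complex \<Rightarrow> complex) \<Rightarrow> real" where
  "weighted_sqnorm s f = (\<integral>z. dfun z powr s * (cmod (f z))\<^sup>2 \<partial>lborel)"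

text \<open>Continuous functions that vanish near the boundary of the disk can be multiplied by any power of \<open>d\<close> and
  integrated over the plane.\<close>

definition disk_supported :: "(complex \<Rightarrow> complex) \<Rightarrow> bool" where
  "disk_supported f \<longleftrightarrow> continuous_on UNIV f \<and> (\<exists>r<1. \<forall>z. r \<le> cmod z \<longrightarrow> f z = 0)"

lemma test_functions_disk_supported: "u \<in> test_functions \<Longrightarrow> disk_supported u"
  unfolding disk_supported_def test_functions_iff using smooth_continuous by blast

lemma disk_supported_mult:
  assumes "disk_supported f" "continuous_on UNIV g" shows "disk_supported (\<lambda>z. g z * f z)"
  using assms unfolding disk_supported_def by (auto intro!: continuous_on_mult)

lemma disk_supported_cnj: assumes "disk_supported f" shows "disk_supported (\<lambda>z. cnj (f z))"
  using assms unfolding disk_supported_def by (auto intro!: continuous_on_cnj)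

lemma disk_supported_weighted_integral_integrable:
  assumes "disk_supported f" shows "integrable lborel (\<lambda>z. complex_of_real (dfun z powr s) * f z)"
  using assms weighted_integral_integrable unfolding disk_supported_def by blast

lemma disk_supported_weighted_sqnorm_integrable:
  assumes f: "disk_supported f" shows "integrable lborel (\<lambda>z. dfun z powr s * (cmod (f z))\<^sup>2)"
proof -
  have "continuous_on UNIV (\<lambda>z. cnj (f z))" using f unfolding disk_supported_def by (auto intro: continuous_on_cnj)
  from integrable_Re[OF disk_supported_weighted_integral_integrable[OF disk_supported_mult[OF f this]], of s]
  show ?thesis by (simp add: mult.commute[of "cnj _"] complex_mult_cnj cmod_power2)
qed

lemma weighted_integral_weighted_sqnorm:
  assumes f: "disk_supported f" shows "weighted_integral s (\<lambda>z. f z * cnj (f z)) = of_real (weighted_sqnorm s f)"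
  unfolding weighted_integral_def weighted_sqnorm_def integral_complex_of_real[symmetric]
  by (intro Bochner_Integration.integral_cong) (auto simp: complex_norm_square[symmetric])

lemma weighted_sqnorm_nonneg: "0 \<le> weighted_sqnorm s f"
  unfolding weighted_sqnorm_def by (rule integral_nonneg_AE) simp

lemma weighted_integral_young:
  assumes f: "disk_supported f" and g: "disk_supported g" and r: "2 * r = p + q" and t: "0 < t"
  shows "2 * cmod (weighted_integral r (\<lambda>z. f z * g z)) \<le> t * weighted_sqnorm p f + weighted_sqnorm q g / t"
proof -
  have fg: "disk_supported (\<lambda>z. f z * g z)"
    using disk_supported_mult[OF g, of f] f unfolding disk_supported_def by blast
  have "2 * cmod (weighted_integral r (\<lambda>z. f z * g z)) \<le> 2 * (\<integral>z. cmod (of_real (dfun z powr r) * (f z * g z)) \<partial>lborel)"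
    unfolding weighted_integral_def by simp
  also have "\<dots> = (\<integral>z. 2 * cmod (of_real (dfun z powr r) * (f z * g z)) \<partial>lborel)" by simp
  also have "\<dots> \<le> (\<integral>z. t * (dfun z powr p * (cmod (f z))\<^sup>2) + (dfun z powr q * (cmod (g z))\<^sup>2) / t \<partial>lborel)"
  proof (rule integral_mono)
    show "integrable lborel (\<lambda>z. 2 * cmod (of_real (dfun z powr r) * (f z * g z)))"
      using disk_supported_weighted_integral_integrable[OF fg, of r] by auto
    show "integrable lborel (\<lambda>z. t * (dfun z powr p * (cmod (f z))\<^sup>2) + (dfun z powr q * (cmod (g z))\<^sup>2) / t)"
      using disk_supported_weighted_sqnorm_integrable[OF f, of p] disk_supported_weighted_sqnorm_integrable[OF g, of q] by auto
    fix z
    define a b where "a = dfun z powr (p / 2) * cmod (f z)" and "b = dfun z powr (q / 2) * cmod (g z)"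
    have "2 * (t * a) * b \<le> (t * a)\<^sup>2 + b\<^sup>2" by (rule sum_squares_bound)
    then have "t * (2 * (a * b)) \<le> t * (t * a\<^sup>2 + b\<^sup>2 / t)"
      using t by (simp add: power2_eq_square algebra_simps)
    then have "2 * (a * b) \<le> t * a\<^sup>2 + b\<^sup>2 / t" using t by (simp only: mult_le_cancel_left_pos)
    moreover have "a * b = cmod (of_real (dfun z powr r) * (f z * g z))"
    proof -
      have "r = p / 2 + q / 2" using r by simp
      then have "dfun z powr r = dfun z powr (p / 2) * dfun z powr (q / 2)" by (simp add: powr_add)
      then show ?thesis by (simp add: a_def b_def norm_mult)
    qed
    moreover have "a\<^sup>2 = dfun z powr p * (cmod (f z))\<^sup>2" "b\<^sup>2 = dfun z powr q * (cmod (g z))\<^sup>2"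
      by (simp_all add: a_def b_def power_mult_distrib power2_eq_square powr_add[symmetric])
    ultimately show "2 * cmod (of_real (dfun z powr r) * (f z * g z))
       \<le> t * (dfun z powr p * (cmod (f z))\<^sup>2) + (dfun z powr q * (cmod (g z))\<^sup>2) / t" by simp
  qed
  also have "\<dots> = t * weighted_sqnorm p f + weighted_sqnorm q g / t"
    using disk_supported_weighted_sqnorm_integrable[OF f, of p] disk_supported_weighted_sqnorm_integrable[OF g, of q]
    by (simp add: weighted_sqnorm_def)
  finally show ?thesis .
qed

lemma weighted_sqnorm_mono:
  assumes f: "disk_supported f" and g: "disk_supported g"
    and le: "\<And>z. cmod z < 1 \<Longrightarrow> dfun z powr s * (cmod (f z))\<^sup>2 \<le> dfun z powr s' * (cmod (g z))\<^sup>2"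
  shows "weighted_sqnorm s f \<le> weighted_sqnorm s' g"
  unfolding weighted_sqnorm_def
proof (rule integral_mono)
  fix z show "dfun z powr s * (cmod (f z))\<^sup>2 \<le> dfun z powr s' * (cmod (g z))\<^sup>2"
  proof (cases "cmod z < 1")
    case False
    then have "f z = 0" using f unfolding disk_supported_def by (metis less_le_trans linorder_not_less less_imp_le)
    then show ?thesis by simp
  qed (rule le)
qed (intro disk_supported_weighted_sqnorm_integrable f g)+

text \<open>Let \<open>P = \<partial>u\<close>, \<open>Q = \<partial>'u\<close>, let \<open>X\<close> and \<open>Z\<close> be the real parts of the integrals of \<open>d^(s-1) cnj z u cnj P\<close> and
  \<open>d^(s-1) z u cnj Q\<close>, let \<open>A\<close> be the integral of \<open>d^(s-1) |u|\<^sup>2\<close> and \<open>B\<close> that of \<open>d^(s-2) |z u|\<^sup>2\<close>, and write \<open>NP\<close> and \<open>NQ\<close>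
  for the squared norms of \<open>P\<close> and \<open>Q\<close> with weight \<open>d^s\<close>. The two identities read \<open>NQ - NP = s (Z - X)\<close> and
  \<open>Z + X + A = (s - 1) B\<close>. Eliminating \<open>Z\<close> gives \<open>NQ + 2 s X + s A + s (1 - s) B = NP\<close>, and for \<open>0 < s < 1\<close> Young's inequality
  absorbs \<open>X\<close> into \<open>NP\<close> and the term with \<open>B\<close>. For \<open>s = 0\<close> the two norms agree, and the second identity with exponent 0 is a
  Poincare inequality. For \<open>s < 0\<close> eliminating \<open>X\<close> instead and absorbing \<open>Z\<close> into \<open>NQ\<close> gives \<open>|s| (A + B) \<le> NP\<close>, which
  controls all remaining terms.\<close>

lemma a_priori_estimate:
  assumes s: "s < 1"
  obtains C where "0 \<le> C" "\<And>u. u \<in> test_functions \<Longrightarrow> weighted_sqnorm s (dbar u) + weighted_sqnorm s u \<le> C * weighted_sqnorm s (dhol u)"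
proof -
  have facts: "\<exists>X Z B. weighted_sqnorm s (dbar u) - weighted_sqnorm s (dhol u) = s * (Z - X)
       \<and> Z + X + weighted_sqnorm (s - 1) u = (s - 1) * B \<and> 0 \<le> B \<and> weighted_sqnorm s u \<le> weighted_sqnorm (s - 1) u
       \<and> (\<forall>t>0. 2 * \<bar>X\<bar> \<le> t * weighted_sqnorm s (dhol u) + B / t) \<and> (\<forall>t>0. 2 * \<bar>Z\<bar> \<le> t * weighted_sqnorm s (dbar u) + B / t)"
    if u: "u \<in> test_functions" for u
  proof -
    define P Q where "P = dhol u" and "Q = dbar u"
    have sup: "disk_supported u" "disk_supported P" "disk_supported Q"
      unfolding P_def Q_def using u dhol_test dbar_test test_functions_disk_supported by blast+
    have zu: "disk_supported (\<lambda>z. z * u z)" "disk_supported (\<lambda>z. cnj z * u z)"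
      by (intro disk_supported_mult sup continuous_intros)+
    define X Z where "X = weighted_integral (s - 1) (\<lambda>z. cnj z * u z * cnj (P z))" and "Z = weighted_integral (s - 1) (\<lambda>z. z * u z * cnj (Q z))"
    define B where "B = weighted_sqnorm (s - 2) (\<lambda>z. z * u z)"
    have "weighted_integral s (\<lambda>z. Q z * cnj (Q z)) - weighted_integral s (\<lambda>z. P z * cnj (P z)) = of_real s * (Z - X)"
      unfolding X_def Z_def P_def Q_def by (rule estimate_identities(1)[OF u])
    then have "complex_of_real (weighted_sqnorm s Q - weighted_sqnorm s P) = of_real s * (Z - X)"
      unfolding weighted_integral_weighted_sqnorm[OF sup(2)] weighted_integral_weighted_sqnorm[OF sup(3)] by simp
    then have "Re (complex_of_real (weighted_sqnorm s Q - weighted_sqnorm s P)) = Re (of_real s * (Z - X))" by (rule arg_cong)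
    then have 1: "weighted_sqnorm s Q - weighted_sqnorm s P = s * (Re Z - Re X)" by simp
    have cZ: "weighted_integral (s - 1) (\<lambda>z. cnj z * cnj (u z) * Q z) = cnj Z"
    proof -
      have "cnj Z = (\<integral>z. cnj (of_real (dfun z powr (s - 1)) * (z * u z * cnj (Q z))) \<partial>lborel)"
        unfolding Z_def weighted_integral_def by (simp only: Bochner_Integration.integral_cnj)
      also have "\<dots> = weighted_integral (s - 1) (\<lambda>z. cnj z * cnj (u z) * Q z)"
        unfolding weighted_integral_def by (intro Bochner_Integration.integral_cong) simp_all
      finally show ?thesis ..
    qed
    have Bi: "weighted_integral (s - 1 - 1) (\<lambda>z. z * cnj z * (u z * cnj (u z))) = of_real B"
      unfolding B_def weighted_integral_weighted_sqnorm[OF zu(1), symmetric] by (simp add: mult_ac)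
    have "cnj Z + X + of_real (weighted_sqnorm (s - 1) u) = of_real (s - 1) * of_real B"
      using estimate_identities(2)[OF u, of "s - 1", folded P_def Q_def]
      unfolding cZ Bi weighted_integral_weighted_sqnorm[OF sup(1)] X_def[symmetric] .
    then have "Re (cnj Z + X + of_real (weighted_sqnorm (s - 1) u)) = Re (of_real (s - 1) * of_real B)" by (rule arg_cong)
    then have 2: "Re Z + Re X + weighted_sqnorm (s - 1) u = (s - 1) * B" by simp
    have B0: "0 \<le> B" unfolding B_def by (rule weighted_sqnorm_nonneg)
    have B': "weighted_sqnorm (s - 2) (\<lambda>z. cnj z * u z) = B" unfolding B_def weighted_sqnorm_def by (simp add: norm_mult)
    have cn: "weighted_sqnorm a (\<lambda>z. cnj (f z)) = weighted_sqnorm a f" for a f unfolding weighted_sqnorm_def by simp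
    have 3: "weighted_sqnorm s u \<le> weighted_sqnorm (s - 1) u"
    proof (rule weighted_sqnorm_mono[OF sup(1) sup(1)])
      fix z :: complex assume z: "cmod z < 1"
      have d: "0 < dfun z" "dfun z \<le> 1" using dfun_pos[OF z] by (auto simp: dfun_def)
      have "dfun z powr s \<le> dfun z powr (s - 1)" by (rule powr_mono') (use d in auto)
      then show "dfun z powr s * (cmod (u z))\<^sup>2 \<le> dfun z powr (s - 1) * (cmod (u z))\<^sup>2"
        by (rule mult_right_mono) simp
    qed
    have 4: "2 * \<bar>Re X\<bar> \<le> t * weighted_sqnorm s P + B / t" if t: "t > 0" for t
    proof -
      have "2 * cmod (weighted_integral (s - 1) (\<lambda>z. cnj (P z) * (cnj z * u z))) \<le> t * weighted_sqnorm s (\<lambda>z. cnj (P z)) + weighted_sqnorm (s - 2) (\<lambda>z. cnj z * u z) / t"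
        by (rule weighted_integral_young[OF disk_supported_cnj[OF sup(2)] zu(2) _ t]) simp
      then have "2 * cmod X \<le> t * weighted_sqnorm s P + B / t" unfolding cn B' X_def by (simp only: mult.commute)
      then show ?thesis using abs_Re_le_cmod[of X] by linarith
    qed
    have 5: "2 * \<bar>Re Z\<bar> \<le> t * weighted_sqnorm s Q + B / t" if t: "t > 0" for t
    proof -
      have "2 * cmod (weighted_integral (s - 1) (\<lambda>z. cnj (Q z) * (z * u z))) \<le> t * weighted_sqnorm s (\<lambda>z. cnj (Q z)) + weighted_sqnorm (s - 2) (\<lambda>z. z * u z) / t"
        by (rule weighted_integral_young[OF disk_supported_cnj[OF sup(3)] zu(1) _ t]) simp
      then have "2 * cmod Z \<le> t * weighted_sqnorm s Q + B / t" unfolding cn B_def Z_def by (simp only: mult.commute)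
      then show ?thesis using abs_Re_le_cmod[of Z] by linarith
    qed
    show ?thesis using 1 2 3 4 5 B0 unfolding P_def Q_def by blast
  qed
  consider "0 < s" | "s = 0" | "s < 0" by linarith
  then show ?thesis
  proof cases
    case 1
    define C where "C = (1 + s / (1 - s)) * (1 + 1 / s)"
    show ?thesis
    proof (rule that[of C])
      show "0 \<le> C" using 1 s unfolding C_def by (intro mult_nonneg_nonneg add_nonneg_nonneg) auto
      fix u assume u: "u \<in> test_functions"
      obtain X Z B where f: "weighted_sqnorm s (dbar u) - weighted_sqnorm s (dhol u) = s * (Z - X)"
        "Z + X + weighted_sqnorm (s - 1) u = (s - 1) * B" "0 \<le> B" "weighted_sqnorm s u \<le> weighted_sqnorm (s - 1) u"
        "\<And>t. t>0 \<Longrightarrow> 2 * \<bar>X\<bar> \<le> t * weighted_sqnorm s (dhol u) + B / t" using facts[OF u] by blast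
      define NP NQ U A where "NP = weighted_sqnorm s (dhol u)" and "NQ = weighted_sqnorm s (dbar u)" and "U = weighted_sqnorm s u" and "A = weighted_sqnorm (s - 1) u"
      have Z: "Z = (s - 1) * B - X - A" using f(2) by (simp add: A_def)
      have NQ: "NQ = NP - 2 * s * X - s * A - s * (1 - s) * B"
        using f(1) unfolding NQ_def[symmetric] NP_def[symmetric] Z by (simp add: algebra_simps)
      \<comment> \<open>Young's inequality with \<open>t = 1 / (1 - s)\<close>, chosen so that \<open>s\<close> times the last term is the term \<open>s (1 - s) B\<close> of the identity.\<close>
      have "2 * \<bar>X\<bar> \<le> NP / (1 - s) + B * (1 - s)"
        using f(5)[of "1 / (1 - s)"] s by (simp add: NP_def)
      then have "s * (2 * \<bar>X\<bar>) \<le> s * (NP / (1 - s) + B * (1 - s))" using 1 by (intro mult_left_mono) auto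
      moreover have "- (2 * s * X) \<le> s * (2 * \<bar>X\<bar>)" using 1 abs_ge_minus_self[of X] mult_left_mono[of "- X" "\<bar>X\<bar>" "2 * s"] by simp
      moreover have "s * U \<le> s * A" using 1 f(4) unfolding U_def A_def by (intro mult_left_mono) auto
      ultimately have key: "NQ + s * U \<le> (1 + s / (1 - s)) * NP" unfolding NQ by (simp add: algebra_simps)
      have pos: "0 \<le> NQ" "0 \<le> U" "0 \<le> NP" by (auto simp: NQ_def U_def NP_def weighted_sqnorm_nonneg)
      have "U \<le> (1 / s) * ((1 + s / (1 - s)) * NP)" using key pos 1 by (simp add: field_simps)
      moreover have "NQ \<le> (1 + s / (1 - s)) * NP" using key pos 1 mult_nonneg_nonneg[of s U] by linarith
      ultimately have "NQ + U \<le> (1 + s / (1 - s)) * NP + (1 / s) * ((1 + s / (1 - s)) * NP)" by linarith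
      also have "\<dots> = C * NP"
      proof -
        have "K * N + a * (K * N) = K * (1 + a) * N" for K N a :: real by (simp add: algebra_simps)
        then show ?thesis unfolding C_def .
      qed
      finally show "weighted_sqnorm s (dbar u) + weighted_sqnorm s u \<le> C * weighted_sqnorm s (dhol u)" unfolding NQ_def U_def NP_def .
    qed
  next
    case 2
    show ?thesis
    proof (rule that[of 5])
      fix u assume u: "u \<in> test_functions"
      have eq: "weighted_sqnorm 0 (dbar u) = weighted_sqnorm 0 (dhol u)" using facts[OF u] unfolding 2 by auto
      define P Q where "P = dhol u" and "Q = dbar u"
      have sup: "disk_supported u" "disk_supported P" "disk_supported Q"
        unfolding P_def Q_def using u dhol_test dbar_test test_functions_disk_supported by blast+
      have zu: "disk_supported (\<lambda>z. cnj z * cnj (u z))" "disk_supported (\<lambda>z. cnj z * u z)"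
        by (intro disk_supported_mult disk_supported_cnj sup continuous_intros)+
      have le: "weighted_sqnorm 0 (\<lambda>z. cnj z * cnj (u z)) \<le> weighted_sqnorm 0 u" "weighted_sqnorm 0 (\<lambda>z. cnj z * u z) \<le> weighted_sqnorm 0 u"
        by (rule weighted_sqnorm_mono[OF zu(1) sup(1)] weighted_sqnorm_mono[OF zu(2) sup(1)],
          auto simp: norm_mult power_mult_distrib power_le_one intro!: mult_left_mono mult_left_le_one_le)+
      have cn: "weighted_sqnorm a (\<lambda>z. cnj (f z)) = weighted_sqnorm a f" for a f unfolding weighted_sqnorm_def by simp
      have "weighted_integral 0 (\<lambda>z. cnj z * cnj (u z) * Q z) + weighted_integral 0 (\<lambda>z. cnj z * u z * cnj (P z)) + of_real (weighted_sqnorm 0 u) = 0"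
        using estimate_identities(2)[OF u, of 0, folded P_def Q_def] unfolding weighted_integral_weighted_sqnorm[OF sup(1)] by simp
      then have "cmod (complex_of_real (weighted_sqnorm 0 u)) = cmod (weighted_integral 0 (\<lambda>z. cnj z * cnj (u z) * Q z) + weighted_integral 0 (\<lambda>z. cnj z * u z * cnj (P z)))"
        by (metis add.commute add_eq_0_iff norm_minus_cancel)
      also have "\<dots> \<le> cmod (weighted_integral 0 (\<lambda>z. cnj z * cnj (u z) * Q z)) + cmod (weighted_integral 0 (\<lambda>z. cnj z * u z * cnj (P z)))"
        by (rule norm_triangle_ineq)
      finally have "2 * weighted_sqnorm 0 u \<le> 2 * cmod (weighted_integral 0 (\<lambda>z. cnj z * cnj (u z) * Q z)) + 2 * cmod (weighted_integral 0 (\<lambda>z. cnj z * u z * cnj (P z)))"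
        using weighted_sqnorm_nonneg[of 0 u] by simp
      also have "2 * cmod (weighted_integral 0 (\<lambda>z. cnj z * cnj (u z) * Q z)) \<le> 1/2 * weighted_sqnorm 0 (\<lambda>z. cnj z * cnj (u z)) + weighted_sqnorm 0 Q / (1/2)"
        by (rule weighted_integral_young[OF zu(1) sup(3)]) auto
      also have "2 * cmod (weighted_integral 0 (\<lambda>z. cnj z * u z * cnj (P z))) \<le> 1/2 * weighted_sqnorm 0 (\<lambda>z. cnj z * u z) + weighted_sqnorm 0 (\<lambda>z. cnj (P z)) / (1/2)"
        by (rule weighted_integral_young[OF zu(2) disk_supported_cnj[OF sup(2)]]) auto
      finally have "weighted_sqnorm 0 u \<le> 4 * weighted_sqnorm 0 P" using le eq unfolding cn P_def Q_def by simp
      then show "weighted_sqnorm s (dbar u) + weighted_sqnorm s u \<le> 5 * weighted_sqnorm s (dhol u)" using eq unfolding 2 P_def by simp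
    qed simp
  next
    case 3
    define \<sigma> where "\<sigma> = - s"
    have \<sigma>: "0 < \<sigma>" using 3 by (simp add: \<sigma>_def)
    define C where "C = 3 + 2 * \<sigma> + 1 / \<sigma>"
    show ?thesis
    proof (rule that[of C])
      show "0 \<le> C" using \<sigma> unfolding C_def by (simp add: add_nonneg_nonneg)
      fix u assume u: "u \<in> test_functions"
      obtain X Z B where f: "weighted_sqnorm s (dbar u) - weighted_sqnorm s (dhol u) = s * (Z - X)"
        "Z + X + weighted_sqnorm (s - 1) u = (s - 1) * B" "0 \<le> B" "weighted_sqnorm s u \<le> weighted_sqnorm (s - 1) u"
        "\<And>t. t>0 \<Longrightarrow> 2 * \<bar>X\<bar> \<le> t * weighted_sqnorm s (dhol u) + B / t"
        "\<And>t. t>0 \<Longrightarrow> 2 * \<bar>Z\<bar> \<le> t * weighted_sqnorm s (dbar u) + B / t" using facts[OF u] by blast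
      define NP NQ U A where "NP = weighted_sqnorm s (dhol u)" and "NQ = weighted_sqnorm s (dbar u)" and "U = weighted_sqnorm s u" and "A = weighted_sqnorm (s - 1) u"
      have pos: "0 \<le> NQ" "0 \<le> U" "0 \<le> NP" "0 \<le> A" by (auto simp: NQ_def U_def NP_def A_def weighted_sqnorm_nonneg)
      have s\<sigma>: "s = - \<sigma>" by (simp add: \<sigma>_def)
      have Z: "Z = - (1 + \<sigma>) * B - X - A" using f(2) by (simp add: A_def s\<sigma> algebra_simps)
      have "NQ - NP = s * (Z - X)" using f(1) by (simp add: NQ_def NP_def)
      then have NQ: "NQ = NP + 2 * \<sigma> * X + \<sigma> * A + \<sigma> * (1 + \<sigma>) * B"
        unfolding Z s\<sigma> by (simp add: algebra_simps)
      have X: "X = - (1 + \<sigma>) * B - Z - A" using Z by simp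
      have NQ2: "NQ = NP - 2 * \<sigma> * Z - \<sigma> * A - \<sigma> * (1 + \<sigma>) * B"
        unfolding NQ X by (simp add: algebra_simps)
      \<comment> \<open>Young's inequality with \<open>t = 1 / \<sigma>\<close>, so that \<open>NQ\<close> cancels and \<open>\<sigma> (1 + \<sigma>) B - \<sigma>\<^sup>2 B = \<sigma> B\<close> remains.\<close>
      have "\<sigma> * (2 * \<bar>Z\<bar>) \<le> \<sigma> * (1 / \<sigma> * NQ + B / (1 / \<sigma>))"
        using f(6)[of "1 / \<sigma>"] \<sigma> unfolding NQ_def by (intro mult_left_mono) auto
      then have "2 * \<sigma> * \<bar>Z\<bar> \<le> NQ + \<sigma> * \<sigma> * B" using \<sigma> by (simp add: algebra_simps)
      moreover have "- (2 * \<sigma> * Z) \<le> 2 * \<sigma> * \<bar>Z\<bar>" using \<sigma> mult_left_mono[of "- Z" "\<bar>Z\<bar>" "2 * \<sigma>"] by simp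
      ultimately have key: "\<sigma> * A + \<sigma> * B \<le> NP" using NQ2 by (simp add: algebra_simps)
      have \<sigma>A: "\<sigma> * A \<le> NP" "\<sigma> * B \<le> NP" using key \<sigma> pos f(3) mult_nonneg_nonneg[of \<sigma> A] mult_nonneg_nonneg[of \<sigma> B] by linarith+
      have "2 * \<bar>X\<bar> \<le> NP + B" using f(5)[of 1] by (simp add: NP_def)
      then have "\<sigma> * (2 * \<bar>X\<bar>) \<le> \<sigma> * (NP + B)" using \<sigma> by (intro mult_left_mono) auto
      moreover have "2 * \<sigma> * X \<le> \<sigma> * (2 * \<bar>X\<bar>)" using \<sigma> mult_left_mono[of X "\<bar>X\<bar>" "2 * \<sigma>"] by simp
      moreover have "\<sigma> * (\<sigma> * B) \<le> \<sigma> * NP" using \<sigma>A \<sigma> by (intro mult_left_mono) auto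
      ultimately have "NQ \<le> (3 + 2 * \<sigma>) * NP" using key \<sigma>A unfolding NQ by (simp add: algebra_simps)
      moreover have "U \<le> 1 / \<sigma> * NP"
      proof -
        have "\<sigma> * U \<le> \<sigma> * A" using f(4) \<sigma> unfolding U_def A_def by (intro mult_left_mono) auto
        then have "\<sigma> * U \<le> NP" using \<sigma>A(1) by linarith
        then show ?thesis using \<sigma> by (simp add: field_simps)
      qed
      ultimately show "weighted_sqnorm s (dbar u) + weighted_sqnorm s u \<le> C * weighted_sqnorm s (dhol u)"
        unfolding C_def NQ_def[symmetric] NP_def[symmetric] U_def[symmetric] by (simp add: algebra_simps)
    qed
  qed
qed

section \<open>Weighted spaces on the disk\<close>

lemma L2_eq_sq_integrable: "L2 s = sq_integrable (disk_measure s)"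
  by (simp add: L2_def sq_integrable_def)

lemma L2norm_eq_sqnorm: "L2norm s u = sqrt (sqnorm (disk_measure s) u)"
  by (simp add: L2norm_def sqnorm_def)

lemma disk_sets: "disk \<in> sets lebesgue" "disk \<inter> space lebesgue \<in> sets lebesgue"
  by (simp_all add: disk_def)

lemma dfun_powr_measurable [measurable]: "(\<lambda>z. dfun z powr s) \<in> borel_measurable borel"
  unfolding dfun_def by measurable

lemma dfun_powr_measurable_disk: "(\<lambda>z. dfun z powr s) \<in> borel_measurable (lebesgue_on disk)"
  by (intro measurable_restrict_space1 measurable_completion) simp

lemma borel_measurable_disk_measure: "borel_measurable (disk_measure s) = borel_measurable (lebesgue_on disk)"
  unfolding disk_measure_def by (rule measurable_cong_sets) simp_all

lemma borel_measurable_disk_measureI: "f \<in> borel_measurable borel \<Longrightarrow> f \<in> borel_measurable (disk_measure s)"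
  unfolding borel_measurable_disk_measure by (intro measurable_restrict_space1 measurable_completion) simp

lemma AE_lebesgue_on_disk: "(AE z in lebesgue_on disk. P z) \<longleftrightarrow> (AE z in lebesgue. cmod z < 1 \<longrightarrow> P z)"
proof -
  have "negligible (sphere (0::complex) 1)" by (rule negligible_sphere)
  then have "sphere (0::complex) 1 \<in> null_sets lebesgue" by (simp add: negligible_iff_null_sets)
  then have n: "AE z in lebesgue. cmod z \<noteq> 1" using AE_not_in by fastforce
  have "(AE z in lebesgue_on disk. P z) \<longleftrightarrow> (AE z in lebesgue. z \<in> disk \<longrightarrow> P z)"
    by (rule AE_restrict_space_iff[OF disk_sets(2)])
  also have "\<dots> \<longleftrightarrow> (AE z in lebesgue. cmod z < 1 \<longrightarrow> P z)"
  proof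
    assume "AE z in lebesgue. z \<in> disk \<longrightarrow> P z"
    then show "AE z in lebesgue. cmod z < 1 \<longrightarrow> P z" by eventually_elim (simp add: disk_def)
  next
    assume "AE z in lebesgue. cmod z < 1 \<longrightarrow> P z"
    with n show "AE z in lebesgue. z \<in> disk \<longrightarrow> P z" by eventually_elim (auto simp: disk_def)
  qed
  finally show ?thesis .
qed

text \<open>The weight vanishes only on the boundary circle, a null set, so all the measures \<open>disk_measure s\<close> have the
  same null sets.\<close>

lemma AE_disk_measure: "(AE z in disk_measure s. P z) \<longleftrightarrow> (AE z in lebesgue_on disk. P z)"
proof -
  have m: "(\<lambda>z. ennreal (dfun z powr s)) \<in> borel_measurable (lebesgue_on disk)"
    using dfun_powr_measurable_disk by measurable
  have "(AE z in disk_measure s. P z) \<longleftrightarrow> (AE z in lebesgue. cmod z < 1 \<longrightarrow> 0 < dfun z powr s \<longrightarrow> P z)"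
    unfolding disk_measure_def AE_density[OF m] AE_lebesgue_on_disk by simp
  also have "\<dots> \<longleftrightarrow> (AE z in lebesgue. cmod z < 1 \<longrightarrow> P z)"
  proof (rule AE_cong)
    fix z :: complex
    show "(cmod z < 1 \<longrightarrow> 0 < dfun z powr s \<longrightarrow> P z) = (cmod z < 1 \<longrightarrow> P z)"
      using dfun_pos[of z] by auto
  qed
  finally show ?thesis by (simp only: AE_lebesgue_on_disk)
qed

lemma disk_measure_integrable_iff:
  fixes f :: "complex \<Rightarrow> 'b::{banach, second_countable_topology}"
  assumes "f \<in> borel_measurable (disk_measure s)"
  shows "integrable (disk_measure s) f \<longleftrightarrow> integrable (lebesgue_on disk) (\<lambda>z. dfun z powr s *\<^sub>R f z)"
  unfolding disk_measure_def
  by (rule integrable_density) (use assms dfun_powr_measurable_disk in \<open>auto simp: borel_measurable_disk_measure\<close>)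

lemma disk_measure_integral:
  fixes f :: "complex \<Rightarrow> 'b::{banach, second_countable_topology}"
  assumes "f \<in> borel_measurable (disk_measure s)"
  shows "integral\<^sup>L (disk_measure s) f = (\<integral>z. dfun z powr s *\<^sub>R f z \<partial>lebesgue_on disk)"
  unfolding disk_measure_def
  by (rule integral_density) (use assms dfun_powr_measurable_disk in \<open>auto simp: borel_measurable_disk_measure\<close>)

lemma disk_measure_borel:
  fixes f :: "complex \<Rightarrow> 'b::{banach, second_countable_topology}"
  assumes f [measurable]: "f \<in> borel_measurable borel"
  shows "integrable (disk_measure s) f \<longleftrightarrow> integrable lborel (\<lambda>z. indicator disk z *\<^sub>R (dfun z powr s *\<^sub>R f z))"
    and "integral\<^sup>L (disk_measure s) f = (\<integral>z. indicator disk z *\<^sub>R (dfun z powr s *\<^sub>R f z) \<partial>lborel)"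
proof -
  have [measurable]: "disk \<in> sets borel" by (simp add: disk_def)
  have m: "(\<lambda>z. indicator disk z *\<^sub>R (dfun z powr s *\<^sub>R f z)) \<in> borel_measurable lborel" by measurable
  show "integrable (disk_measure s) f \<longleftrightarrow> integrable lborel (\<lambda>z. indicator disk z *\<^sub>R (dfun z powr s *\<^sub>R f z))"
    unfolding disk_measure_integrable_iff[OF borel_measurable_disk_measureI[OF f]]
      integrable_restrict_space[OF disk_sets(2)] integrable_completion[OF m] ..
  show "integral\<^sup>L (disk_measure s) f = (\<integral>z. indicator disk z *\<^sub>R (dfun z powr s *\<^sub>R f z) \<partial>lborel)"
    unfolding disk_measure_integral[OF borel_measurable_disk_measureI[OF f]]
      integral_restrict_space[OF disk_sets(2)] integral_completion[OF m] ..
qed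

text \<open>Multiplication by \<open>d^(-s)\<close> is isometric from \<open>L2 (- s)\<close> to \<open>L2 s\<close>, because \<open>d^s (d^(-s))\<^sup>2 = d^(-s)\<close>.\<close>

lemma L2_weight_iff:
  assumes "u \<in> borel_measurable (lebesgue_on disk)"
  shows "(\<lambda>z. of_real (dfun z powr (- s)) * u z) \<in> L2 s \<longleftrightarrow> u \<in> L2 (- s)"
    and "sqnorm (disk_measure s) (\<lambda>z. of_real (dfun z powr (- s)) * u z) = sqnorm (disk_measure (- s)) u"
proof -
  have m: "(\<lambda>z. of_real (dfun z powr (- s)) * u z) \<in> borel_measurable (lebesgue_on disk)"
    using assms dfun_powr_measurable_disk[of "- s"] by measurable
  have m2: "(\<lambda>z. (cmod (of_real (dfun z powr (- s)) * u z))\<^sup>2) \<in> borel_measurable (disk_measure s)"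
    "(\<lambda>z. (cmod (u z))\<^sup>2) \<in> borel_measurable (disk_measure (- s))"
    unfolding borel_measurable_disk_measure using m assms by measurable
  have eq: "dfun z powr s *\<^sub>R (cmod (of_real (dfun z powr (- s)) * u z))\<^sup>2 = dfun z powr (- s) *\<^sub>R (cmod (u z))\<^sup>2" for z
  proof -
    have "dfun z powr s * (dfun z powr (- s) * dfun z powr (- s)) = dfun z powr (- s)"
      by (simp flip: powr_add)
    then show ?thesis by (auto simp: norm_mult power_mult_distrib power2_eq_square mult.assoc[symmetric])
  qed
  show "(\<lambda>z. of_real (dfun z powr (- s)) * u z) \<in> L2 s \<longleftrightarrow> u \<in> L2 (- s)"
    unfolding L2_def mem_Collect_eq disk_measure_integrable_iff[OF m2(1)] disk_measure_integrable_iff[OF m2(2)] eq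
    using m assms by (simp add: borel_measurable_disk_measure)
  show "sqnorm (disk_measure s) (\<lambda>z. of_real (dfun z powr (- s)) * u z) = sqnorm (disk_measure (- s)) u"
    unfolding sqnorm_def disk_measure_integral[OF m2(1)] disk_measure_integral[OF m2(2)] eq ..
qed

lemma disk_supported_borel: "disk_supported f \<Longrightarrow> f \<in> borel_measurable borel"
  unfolding disk_supported_def by (blast intro: borel_measurable_continuous_onI)

lemma disk_supported_outside:
  assumes "disk_supported f" "1 \<le> cmod z" shows "f z = 0"
proof -
  obtain r where "r < 1" "\<forall>z. r \<le> cmod z \<longrightarrow> f z = 0" using assms(1) unfolding disk_supported_def by blast
  then show ?thesis using assms(2) by simp
qed

lemma disk_supported_L2:
  assumes f: "disk_supported f"
  shows "f \<in> L2 s" "sqnorm (disk_measure s) f = weighted_sqnorm s f"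
proof -
  have [measurable]: "f \<in> borel_measurable borel" by (rule disk_supported_borel[OF f])
  have eq: "indicator disk z *\<^sub>R (dfun z powr s *\<^sub>R (cmod (f z))\<^sup>2) = dfun z powr s * (cmod (f z))\<^sup>2" for z
    using disk_supported_outside[OF f, of z] by (cases "z \<in> disk") (auto simp: disk_def)
  have m: "(\<lambda>z. (cmod (f z))\<^sup>2) \<in> borel_measurable borel" by measurable
  show "f \<in> L2 s"
    unfolding L2_def mem_Collect_eq disk_measure_borel(1)[OF m] eq
    by (intro conjI disk_supported_weighted_sqnorm_integrable[OF f] borel_measurable_disk_measureI) measurable
  show "sqnorm (disk_measure s) f = weighted_sqnorm s f"
    unfolding sqnorm_def disk_measure_borel(2)[OF m] eq weighted_sqnorm_def ..
qed

lemma borel_representative: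
  fixes v :: "complex \<Rightarrow> complex"
  assumes v: "v \<in> borel_measurable (lebesgue_on disk)"
  obtains b where "b \<in> borel_measurable borel" "AE z in lebesgue_on disk. v z = b z"
proof -
  have d: "disk \<in> sets lebesgue" by (rule disk_sets)
  have w: "(\<lambda>z. if z \<in> disk then v z else 0) \<in> borel_measurable lebesgue"
    using borel_measurable_if[OF d] v by blast
  have re: "(\<lambda>z. Re (if z \<in> disk then v z else 0)) \<in> borel_measurable lebesgue"
    and im: "(\<lambda>z. Im (if z \<in> disk then v z else 0)) \<in> borel_measurable lebesgue"
    using w by measurable
  obtain x where x: "x \<in> borel_measurable lborel" "AE z in lborel. Re (if z \<in> disk then v z else 0) = x z"
    using completion_ex_borel_measurable_real[OF re] by blast
  obtain y where y: "y \<in> borel_measurable lborel" "AE z in lborel. Im (if z \<in> disk then v z else 0) = y z"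
    using completion_ex_borel_measurable_real[OF im] by blast
  have "(\<lambda>z. complex_of_real (x z) + \<i> * complex_of_real (y z)) \<in> borel_measurable borel"
    using x(1) y(1) by simp
  moreover have "AE z in lborel. z \<in> disk \<longrightarrow> v z = complex_of_real (x z) + \<i> * complex_of_real (y z)"
    using x(2) y(2)
  proof eventually_elim
    case (elim z) then show ?case by (auto simp: complex_eq_iff)
  qed
  then have "AE z in lebesgue_on disk. v z = complex_of_real (x z) + \<i> * complex_of_real (y z)"
    unfolding AE_restrict_space_iff[OF disk_sets(2)] AE_completion_iff .
  ultimately show ?thesis using that by blast
qed

lemma L2_borel_representative:
  assumes v: "v \<in> L2 s"
  obtains b where "b \<in> borel_measurable borel" "b \<in> L2 s" "AE z in lebesgue_on disk. v z = b z"
proof -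
  obtain b where b: "b \<in> borel_measurable borel" "AE z in lebesgue_on disk. v z = b z"
    using borel_representative v unfolding L2_def borel_measurable_disk_measure by blast
  have "b \<in> L2 s" unfolding L2_eq_sq_integrable
    by (rule sq_integrable_cong_AE[OF v[unfolded L2_eq_sq_integrable]])
      (use b borel_measurable_disk_measureI AE_disk_measure in \<open>auto\<close>)
  then show ?thesis using that b by blast
qed

lemma L2_locally_integrable:
  assumes b: "b \<in> borel_measurable borel" "b \<in> L2 s" and r: "r < 1"
  shows "integrable lborel (\<lambda>z. indicator (cball 0 r) z *\<^sub>R b z)"
proof -
  have rm: "cball (0::complex) r \<in> sets borel" by simp
  note [measurable] = b(1) rm
  define w where "w z = indicator (cball 0 r) z *\<^sub>R complex_of_real (dfun z powr (- s))" for z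
  have wm [measurable]: "w \<in> borel_measurable borel" unfolding w_def by measurable
  have d: "dfun z \<noteq> 0" if "z \<in> cball 0 r" for z
    using dfun_pos[of z] that r by auto
  have "w \<in> L2 s"
  proof -
    have "integrable lborel (\<lambda>z. indicator (cball 0 r) z *\<^sub>R dfun z powr (- s))"
    proof (rule borel_integrable_compact)
      have "continuous_on (cball 0 r) dfun" unfolding dfun_def by (intro continuous_intros)
      then show "continuous_on (cball 0 r) (\<lambda>z. dfun z powr (- s))"
        by (intro continuous_on_powr continuous_on_const) (use d in auto)
    qed simp
    also have "(\<lambda>z. indicator (cball 0 r) z *\<^sub>R dfun z powr (- s)) = (\<lambda>z. indicator disk z *\<^sub>R (dfun z powr s *\<^sub>R (cmod (w z))\<^sup>2))"
    proof
      fix z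
      have "dfun z powr s * (dfun z powr (- s) * dfun z powr (- s)) = dfun z powr (- s)"
        by (simp flip: powr_add)
      then show "indicator (cball 0 r) z *\<^sub>R dfun z powr (- s) = indicator disk z *\<^sub>R (dfun z powr s *\<^sub>R (cmod (w z))\<^sup>2)"
        using r by (auto simp: w_def indicator_def disk_def power2_eq_square)
    qed
    finally have "integrable lborel (\<lambda>z. indicator disk z *\<^sub>R (dfun z powr s *\<^sub>R (cmod (w z))\<^sup>2))" .
    moreover have m: "(\<lambda>z. (cmod (w z))\<^sup>2) \<in> borel_measurable borel" by measurable
    ultimately show ?thesis unfolding L2_def mem_Collect_eq disk_measure_borel(1)[OF m]
      using borel_measurable_disk_measureI[OF wm] by blast
  qed
  then have "integrable (disk_measure s) (\<lambda>z. b z * w z)"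
    using sq_integrable_mult_integrable[of b _ w] b(2) unfolding L2_eq_sq_integrable by blast
  moreover have m: "(\<lambda>z. b z * w z) \<in> borel_measurable borel" by measurable
  ultimately have "integrable lborel (\<lambda>z. indicator disk z *\<^sub>R (dfun z powr s *\<^sub>R (b z * w z)))"
    using disk_measure_borel(1) by blast
  also have "(\<lambda>z. indicator disk z *\<^sub>R (dfun z powr s *\<^sub>R (b z * w z))) = (\<lambda>z. indicator (cball 0 r) z *\<^sub>R b z)"
  proof
    fix z
    have "complex_of_real (dfun z powr s) * complex_of_real (dfun z powr (- s)) = 1" if "z \<in> cball 0 r"
      unfolding of_real_mult[symmetric] using d[OF that] by (simp flip: powr_add)
    then show "indicator disk z *\<^sub>R (dfun z powr s *\<^sub>R (b z * w z)) = indicator (cball 0 r) z *\<^sub>R b z"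
      using r by (auto simp: w_def indicator_def disk_def scaleR_conv_of_real)
  qed
  finally show ?thesis .
qed

lemma pairing_lborel:
  assumes b: "b \<in> borel_measurable borel" and \<theta>: "disk_supported \<theta>"
  shows "(\<integral>z. b z * (of_real (dfun z powr (- s)) * \<theta> z) \<partial>disk_measure s) = (\<integral>z. b z * \<theta> z \<partial>lborel)"
proof -
  note [measurable] = b disk_supported_borel[OF \<theta>]
  have m: "(\<lambda>z. b z * (of_real (dfun z powr (- s)) * \<theta> z)) \<in> borel_measurable borel" by measurable
  show ?thesis unfolding disk_measure_borel(2)[OF m]
  proof (rule Bochner_Integration.integral_cong[OF refl])
    fix z
    obtain r where r: "r < 1" "\<And>z. r \<le> cmod z \<Longrightarrow> \<theta> z = 0" using \<theta> unfolding disk_supported_def by blast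
    show "indicator disk z *\<^sub>R (dfun z powr s *\<^sub>R (b z * (of_real (dfun z powr (- s)) * \<theta> z))) = b z * \<theta> z"
    proof (cases "cmod z < 1")
      case True
      then have "complex_of_real (dfun z powr s) * complex_of_real (dfun z powr (- s)) = 1"
        unfolding of_real_mult[symmetric] using dfun_pos[OF True] by (simp flip: powr_add)
      then have "complex_of_real (dfun z powr s) * (b z * (of_real (dfun z powr (- s)) * \<theta> z)) = b z * \<theta> z"
        by (simp add: mult.left_commute[of "b z"] mult.assoc[symmetric])
      then show ?thesis using True by (simp add: disk_def scaleR_conv_of_real)
    next
      case False
      then have "\<theta> z = 0" using r by simp
      then show ?thesis by simp
    qed
  qed
qed

lemma weighted_disk_supported_L2:
  assumes \<theta>: "disk_supported \<theta>" shows "(\<lambda>z. of_real (dfun z powr a) * \<theta> z) \<in> L2 s"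
proof -
  obtain r where r: "continuous_on UNIV \<theta>" "r < 1" "\<And>z. r \<le> cmod z \<Longrightarrow> \<theta> z = 0" using \<theta> unfolding disk_supported_def by blast
  have "disk_supported (\<lambda>z. of_real (dfun z powr a) * \<theta> z)"
    unfolding disk_supported_def using continuous_weight_mult[OF r] r(2,3) by auto
  then show ?thesis by (rule disk_supported_L2)
qed

lemma scale_fits:
  fixes z :: complex assumes "cmod z < 1"
  shows "0 < 2 / (1 - cmod z)" "cmod z + 1 / (2 / (1 - cmod z)) < 1"
  using assms by (simp_all add: field_simps)

text \<open>The last clause exhibits the values of \<open>h\<close> as pairings of \<open>a\<close> with test functions. It makes the fundamental
  lemma of the calculus of variations, stated next, a special case.\<close>

lemma weyl_lemma:
  assumes a: "a \<in> L2 s"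
    and weak: "\<And>\<phi>. \<phi> \<in> test_functions \<Longrightarrow> (\<integral>z. a z * (of_real (dfun z powr (- s)) * dbar \<phi> z) \<partial>disk_measure s) = 0"
  obtains h where "h \<in> L2 s" "h holomorphic_on ball 0 1" "AE z in lebesgue_on disk. a z = h z"
    "\<forall>z\<in>ball 0 1. \<exists>\<phi>\<in>test_functions. h z = (\<integral>w. a w * (of_real (dfun w powr (- s)) * \<phi> w) \<partial>disk_measure s)"
proof -
  obtain b where b: "b \<in> borel_measurable borel" "b \<in> L2 s" "AE z in lebesgue_on disk. a z = b z"
    using L2_borel_representative[OF a] by blast
  have ab: "(\<integral>z. a z * (of_real (dfun z powr (- s)) * \<theta> z) \<partial>disk_measure s) = (\<integral>z. b z * \<theta> z \<partial>lborel)"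
    if \<theta>: "disk_supported \<theta>" for \<theta>
  proof -
    have bm: "b \<in> borel_measurable (disk_measure s)" by (rule borel_measurable_disk_measureI[OF b(1)])
    have am: "a \<in> borel_measurable (disk_measure s)" using a by (simp add: L2_def)
    have wm: "(\<lambda>z. of_real (dfun z powr (- s)) * \<theta> z) \<in> borel_measurable (disk_measure s)"
      using weighted_disk_supported_L2[OF \<theta>] by (simp add: L2_def)
    have "(\<integral>z. a z * (of_real (dfun z powr (- s)) * \<theta> z) \<partial>disk_measure s) = (\<integral>z. b z * (of_real (dfun z powr (- s)) * \<theta> z) \<partial>disk_measure s)"
      by (rule integral_cong_AE) (use am bm wm b(3) in \<open>auto simp: AE_disk_measure\<close>)
    then show ?thesis unfolding pairing_lborel[OF b(1) \<theta>] .
  qed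
  define h where "h z = (if cmod z < 1 then mollify b (2 / (1 - cmod z)) z / of_real bump_mass else 0)" for z
  note w = weyl_lemma_borel[OF b(1) L2_locally_integrable[OF b(1,2)]]
  have weak': "(\<integral>z. b z * dbar \<phi> z \<partial>lborel) = 0" if "\<phi> \<in> test_functions" for \<phi>
    using weak[OF that] ab[OF test_functions_disk_supported[OF dbar_test[OF that]]] by simp
  have hol: "h holomorphic_on ball 0 1"
    by (rule holomorphic_transform[OF w(1)[OF _ weak']]) (auto simp: h_def)
  have "AE z in lborel. cmod z < 1 \<longrightarrow> b z = h z"
    using w(2)[OF _ weak'] by (auto simp: h_def elim!: eventually_mono)
  then have bh: "AE z in lebesgue_on disk. b z = h z"
    unfolding AE_lebesgue_on_disk AE_completion_iff .
  have hm: "h \<in> borel_measurable borel"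
  proof -
    have "(\<lambda>z. indicator (ball 0 1) z *\<^sub>R h z) \<in> borel_measurable borel"
      by (rule borel_measurable_continuous_on_indicator[OF _ holomorphic_on_imp_continuous_on[OF hol]]) simp
    also have "(\<lambda>z. indicator (ball 0 1) z *\<^sub>R h z) = h" by (auto simp: fun_eq_iff h_def indicator_def)
    finally show ?thesis .
  qed
  have hL: "h \<in> L2 s" unfolding L2_eq_sq_integrable
    by (rule sq_integrable_cong_AE[OF b(2)[unfolded L2_eq_sq_integrable] _ borel_measurable_disk_measureI[OF hm]])
      (use bh in \<open>simp add: AE_disk_measure\<close>)
  show ?thesis
  proof (rule that[OF hL hol])
    show "AE z in lebesgue_on disk. a z = h z" using b(3) bh by eventually_elim simp
    show "\<forall>z\<in>ball 0 1. \<exists>\<phi>\<in>test_functions. h z = (\<integral>w. a w * (of_real (dfun w powr (- s)) * \<phi> w) \<partial>disk_measure s)"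
    proof
      fix z :: complex assume "z \<in> ball 0 1"
      then have z: "cmod z < 1" by simp
      define \<tau> where "\<tau> = 2 / (1 - cmod z)"
      define \<phi> where "\<phi> w = complex_of_real (\<tau>\<^sup>2 / bump_mass) * of_real (bump 0 (\<tau>\<^sup>2) z w)" for w
      have t: "0 < \<tau>" "cmod z + 1 / \<tau> < 1" using scale_fits[OF z] unfolding \<tau>_def by simp_all
      have tf: "\<phi> \<in> test_functions"
        unfolding \<phi>_def by (rule test_function_bump[OF t bump_class.const])
      have "h z = mollify b \<tau> z / of_real bump_mass" using z by (simp add: h_def \<tau>_def)
      also have "\<dots> = (\<integral>w. b w * of_real (\<tau>\<^sup>2 * bump 0 (\<tau>\<^sup>2) z w) / of_real bump_mass \<partial>lborel)"
        unfolding mollify_def by (rule integral_divide_zero[symmetric])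
      also have "\<dots> = (\<integral>w. b w * \<phi> w \<partial>lborel)" by (simp add: \<phi>_def)
      also have "\<dots> = (\<integral>w. a w * (of_real (dfun w powr (- s)) * \<phi> w) \<partial>disk_measure s)"
        by (rule ab[OF test_functions_disk_supported[OF tf], symmetric])
      finally show "\<exists>\<phi>\<in>test_functions. h z = (\<integral>w. a w * (of_real (dfun w powr (- s)) * \<phi> w) \<partial>disk_measure s)"
        using tf by blast
    qed
  qed
qed

lemma L2_zero_if_orthogonal_to_tests:
  assumes a: "a \<in> L2 s"
    and orth: "\<And>\<phi>. \<phi> \<in> test_functions \<Longrightarrow> (\<integral>z. a z * (of_real (dfun z powr (- s)) * \<phi> z) \<partial>disk_measure s) = 0"
  shows "AE z in lebesgue_on disk. a z = 0"
proof -
  obtain h where h: "AE z in lebesgue_on disk. a z = h z"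
    "\<forall>z\<in>ball 0 1. \<exists>\<phi>\<in>test_functions. h z = (\<integral>w. a w * (of_real (dfun w powr (- s)) * \<phi> w) \<partial>disk_measure s)"
    using weyl_lemma[OF a orth[OF dbar_test]] by blast
  have "h z = 0" if z: "cmod z < 1" for z
    using h(2) orth z by auto
  then show ?thesis using h(1) unfolding AE_lebesgue_on_disk by (auto elim: eventually_mono)
qed

lemma test_functions_L2: "u \<in> test_functions \<Longrightarrow> u \<in> sq_integrable (disk_measure s)"
  using disk_supported_L2(1)[OF test_functions_disk_supported] by (simp add: L2_eq_sq_integrable)

lemma test_functions_partial_L2: "u \<in> test_functions \<Longrightarrow> partial i u \<in> sq_integrable (disk_measure s)"
  by (intro test_functions_L2 test_functions_partial)

lemma H1norm_eq:
  "H1norm s u = sqrt (sqnorm (disk_measure s) u + sqnorm (disk_measure s) (partial CX u) + sqnorm (disk_measure s) (partial CY u))"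
  by (simp add: H1norm_def L2norm_eq_sqnorm)

lemma H1norm_estimate:
  assumes "s < 1"
  obtains C where "0 \<le> C" "\<And>u. u \<in> test_functions \<Longrightarrow> (H1norm s u)\<^sup>2 \<le> C * sqnorm (disk_measure s) (dhol u)"
proof -
  obtain C where C: "0 \<le> C" "\<And>u. u \<in> test_functions \<Longrightarrow> weighted_sqnorm s (dbar u) + weighted_sqnorm s u \<le> C * weighted_sqnorm s (dhol u)"
    using a_priori_estimate[OF assms] by blast
  have "(H1norm s u)\<^sup>2 \<le> (4 + 5 * C) * sqnorm (disk_measure s) (dhol u)" if u: "u \<in> test_functions" for u
  proof -
    define P Q where "P = dhol u" and "Q = dbar u"
    have t: "P \<in> test_functions" "Q \<in> test_functions" unfolding P_def Q_def using dhol_test[OF u] dbar_test[OF u] by simp_all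
    have w: "weighted_sqnorm s f = sqnorm (disk_measure s) f" if "f \<in> test_functions" for f
      by (rule disk_supported_L2(2)[OF test_functions_disk_supported[OF that], symmetric])
    have x: "partial CX u = (\<lambda>z. P z + Q z)" "partial CY u = (\<lambda>z. \<i> * (P z - Q z))"
      by (auto simp: P_def Q_def dhol_def dbar_def fun_eq_iff field_simps)
    have "sqnorm (disk_measure s) (partial CX u) \<le> 2 * sqnorm (disk_measure s) P + 2 * sqnorm (disk_measure s) Q"
      unfolding x by (rule sqnorm_add_le[OF t[THEN test_functions_L2]])
    moreover have "sqnorm (disk_measure s) (partial CY u) \<le> 2 * sqnorm (disk_measure s) P + 2 * sqnorm (disk_measure s) Q"
      unfolding x sqnorm_cmult using sqnorm_diff_le[OF t[THEN test_functions_L2]] by simp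
    moreover have "sqnorm (disk_measure s) Q + sqnorm (disk_measure s) u \<le> C * sqnorm (disk_measure s) P"
      using C(2)[OF u] unfolding P_def[symmetric] Q_def[symmetric] w[OF t(1)] w[OF t(2)] w[OF u] .
    moreover have "0 \<le> sqnorm (disk_measure s) u" "0 \<le> sqnorm (disk_measure s) P" by simp_all
    ultimately have "sqnorm (disk_measure s) u + sqnorm (disk_measure s) (partial CX u) + sqnorm (disk_measure s) (partial CY u)
        \<le> 4 * sqnorm (disk_measure s) P + 5 * (C * sqnorm (disk_measure s) P)"
      using sqnorm_nonneg[of "disk_measure s" Q] by linarith
    then show ?thesis unfolding H1norm_eq P_def by (simp add: add_nonneg_nonneg algebra_simps)
  qed
  then show ?thesis using that[of "4 + 5 * C"] C(1) by simp
qed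

text \<open>A sequence of test functions approximates \<open>u\<close> together with a candidate \<open>V\<close> for its gradient. Working with
  such pairs avoids the choice operator in \<open>ext_partial\<close> until \<open>V\<close> is known to be unique up to null sets.\<close>

definition H10_limit :: "real \<Rightarrow> (nat \<Rightarrow> complex \<Rightarrow> complex) \<Rightarrow> (complex \<Rightarrow> complex) \<Rightarrow> (coord \<Rightarrow> complex \<Rightarrow> complex) \<Rightarrow> bool" where
  "H10_limit s \<phi> u V \<longleftrightarrow> (\<forall>n. \<phi> n \<in> test_functions) \<and> u \<in> sq_integrable (disk_measure s) \<and> (\<forall>i. V i \<in> sq_integrable (disk_measure s)) \<and>
     (\<lambda>n. sqnorm (disk_measure s) (\<lambda>z. \<phi> n z - u z)) \<longlonglongrightarrow> 0 \<and>
     (\<forall>i. (\<lambda>n. sqnorm (disk_measure s) (\<lambda>z. partial i (\<phi> n) z - V i z)) \<longlonglongrightarrow> 0)"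

lemma sqnorm_Cauchy:
  assumes "\<And>n. u n \<in> sq_integrable M" "v \<in> sq_integrable M" "(\<lambda>n. sqnorm M (\<lambda>x. u n x - v x)) \<longlonglongrightarrow> 0" "0 < e"
  shows "\<exists>N. \<forall>j\<ge>N. \<forall>k\<ge>N. sqnorm M (\<lambda>x. u j x - u k x) < e"
proof -
  obtain N where N: "\<And>n. n \<ge> N \<Longrightarrow> sqnorm M (\<lambda>x. u n x - v x) < e / 4"
    using LIMSEQ_D[OF assms(3), of "e / 4"] assms(4) by auto
  have "sqnorm M (\<lambda>x. u j x - u k x) < e" if "j \<ge> N" "k \<ge> N" for j k
    using sqnorm_diff_le[OF sq_integrable_diff[OF assms(1,2)] sq_integrable_diff[OF assms(1,2)], of j k] N[OF that(1)] N[OF that(2)] by simp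
  then show ?thesis by blast
qed

lemma sqnorm_tendsto_lin:
  assumes u: "\<And>n. u n \<in> sq_integrable M" "u' \<in> sq_integrable M" "(\<lambda>n. sqnorm M (\<lambda>x. u n x - u' x)) \<longlonglongrightarrow> 0"
    and v: "\<And>n. v n \<in> sq_integrable M" "v' \<in> sq_integrable M" "(\<lambda>n. sqnorm M (\<lambda>x. v n x - v' x)) \<longlonglongrightarrow> 0"
  shows "(\<lambda>n. sqnorm M (\<lambda>x. (a * u n x + b * v n x) - (a * u' x + b * v' x))) \<longlonglongrightarrow> 0"
proof (rule Lim_null_comparison[OF always_eventually[OF allI]])
  fix n
  have "(\<lambda>x. (a * u n x + b * v n x) - (a * u' x + b * v' x)) = (\<lambda>x. a * (u n x - u' x) + b * (v n x - v' x))"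
    by (auto simp: algebra_simps)
  then show "norm (sqnorm M (\<lambda>x. (a * u n x + b * v n x) - (a * u' x + b * v' x)))
     \<le> 2 * ((cmod a)\<^sup>2 * sqnorm M (\<lambda>x. u n x - u' x)) + 2 * ((cmod b)\<^sup>2 * sqnorm M (\<lambda>x. v n x - v' x))"
    using sqnorm_add_le[OF sq_integrable_cmult[OF sq_integrable_diff[OF u(1,2)]] sq_integrable_cmult[OF sq_integrable_diff[OF v(1,2)]], of a n b n]
    unfolding sqnorm_cmult by simp
next
  show "(\<lambda>n. 2 * ((cmod a)\<^sup>2 * sqnorm M (\<lambda>x. u n x - u' x)) + 2 * ((cmod b)\<^sup>2 * sqnorm M (\<lambda>x. v n x - v' x))) \<longlonglongrightarrow> 0"
    using u(3) v(3) by (auto intro!: tendsto_eq_intros)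
qed

lemma H10_limit_lin:
  assumes "H10_limit s \<phi> u V" "H10_limit s \<psi> w W"
  shows "H10_limit s (\<lambda>n z. a * \<phi> n z + b * \<psi> n z) (\<lambda>z. a * u z + b * w z) (\<lambda>i z. a * V i z + b * W i z)"
proof -
  have t: "\<And>n. \<phi> n \<in> test_functions" "\<And>n. \<psi> n \<in> test_functions" using assms by (auto simp: H10_limit_def)
  have p: "partial i (\<lambda>z. a * \<phi> n z + b * \<psi> n z) = (\<lambda>z. a * partial i (\<phi> n) z + b * partial i (\<psi> n) z)" for i n
    using partial_add_test[OF test_functions_cmult[OF t(1)] test_functions_cmult[OF t(2)]]
      partial_cmult_test[OF t(1)] partial_cmult_test[OF t(2)] by (auto simp: fun_eq_iff)
  note S = assms[unfolded H10_limit_def]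
  show ?thesis unfolding H10_limit_def p
  proof (intro conjI allI)
    show "(\<lambda>z. a * \<phi> n z + b * \<psi> n z) \<in> test_functions" for n
      by (rule test_functions_add[OF test_functions_cmult[OF t(1)] test_functions_cmult[OF t(2)]])
    show "(\<lambda>z. a * u z + b * w z) \<in> sq_integrable (disk_measure s)" using S by (intro sq_integrable_add sq_integrable_cmult) simp_all
    show "(\<lambda>z. a * V i z + b * W i z) \<in> sq_integrable (disk_measure s)" for i using S by (intro sq_integrable_add sq_integrable_cmult) simp_all
    show "(\<lambda>n. sqnorm (disk_measure s) (\<lambda>z. a * \<phi> n z + b * \<psi> n z - (a * u z + b * w z))) \<longlonglongrightarrow> 0"
      by (rule sqnorm_tendsto_lin) (use S t in \<open>simp_all add: test_functions_L2\<close>)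
    show "(\<lambda>n. sqnorm (disk_measure s) (\<lambda>z. a * partial i (\<phi> n) z + b * partial i (\<psi> n) z - (a * V i z + b * W i z))) \<longlonglongrightarrow> 0" for i
      by (rule sqnorm_tendsto_lin) (use S t in \<open>simp_all add: test_functions_partial_L2\<close>)
  qed
qed

lemma sqnorm_cnj_diff: "sqnorm M (\<lambda>x. cnj (u x) - cnj (v x)) = sqnorm M (\<lambda>x. u x - v x)"
  unfolding sqnorm_def by (simp only: complex_cnj_diff[symmetric] complex_mod_cnj)

lemma H10_limit_cnj:
  assumes "H10_limit s \<phi> u V"
  shows "H10_limit s (\<lambda>n z. cnj (\<phi> n z)) (\<lambda>z. cnj (u z)) (\<lambda>i z. cnj (V i z))"
proof -
  have t: "\<And>n. \<phi> n \<in> test_functions" using assms by (auto simp: H10_limit_def)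
  have p: "partial i (\<lambda>z. cnj (\<phi> n z)) = (\<lambda>z. cnj (partial i (\<phi> n) z))" for i n
    using partial_cnj_test[OF t] by (auto simp: fun_eq_iff)
  show ?thesis
    using assms unfolding H10_limit_def p sqnorm_cnj_diff by (auto intro: test_functions_cnj sq_integrable_cnj)
qed

lemma test_integration_by_parts:
  assumes u: "u \<in> test_functions" and v: "v \<in> test_functions"
  shows "(\<integral>z. partial i u z * v z \<partial>lborel) = - (\<integral>z. u z * partial i v z \<partial>lborel)"
proof -
  obtain r where r: "r < 1" "\<And>z. r \<le> cmod z \<Longrightarrow> u z = 0"
    using u test_functionsE by blast
  obtain r' where r': "r' < 1" "\<And>z. r' \<le> cmod z \<Longrightarrow> v z = 0"
    using v test_functionsE by blast
  have c: "continuous_on UNIV f" if "f \<in> test_functions" for f using that smooth_continuous by (auto simp: test_functions_iff)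
  note c' = c[OF u] c[OF v] c[OF test_functions_partial[OF u]] c[OF test_functions_partial[OF v]]
  have hp: "has_partials (\<lambda>z. u z * v z) (partial CX u z * v z + u z * partial CX v z) (partial CY u z * v z + u z * partial CY v z) z" for z
    by (rule has_partials_mult[OF u[THEN test_functions_has_partials] v[THEN test_functions_has_partials]])
  have line: "((\<lambda>s::real. u (z + s *\<^sub>R coord_vec i) * v (z + s *\<^sub>R coord_vec i)) has_vector_derivative (partial i u z * v z + u z * partial i v z)) (at 0)" for z
    using has_partials_line[OF hp, of z "coord_vec i"] by (cases i) simp_all
  have "(\<integral>z. partial i u z * v z + u z * partial i v z \<partial>lborel) = 0"
    by (rule integral_directional_derivative_zero[where F = "\<lambda>z. u z * v z" and r = "max r r'", OF line])
      (use r r' c' in \<open>auto intro!: continuous_on_mult continuous_on_add, cases i, auto\<close>)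
  moreover have "integrable lborel (\<lambda>z. partial i u z * v z)" "integrable lborel (\<lambda>z. u z * partial i v z)"
    by (rule continuous_support_integrable[of _ r'] continuous_support_integrable[of _ r],
       use r r' c' in \<open>auto intro!: continuous_on_mult\<close>)+
  ultimately show ?thesis by (simp add: add_eq_0_iff)
qed

text \<open>The limit \<open>V\<close> is the gradient of \<open>u\<close> in the weak sense; the weight \<open>d^(-s)\<close> turns the pairing in \<open>L2 s\<close> into
  the unweighted one.\<close>

lemma H10_limit_integral:
  assumes H: "H10_limit s \<phi> u V" and \<theta>: "\<theta> \<in> test_functions"
  shows "(\<integral>z. V i z * (of_real (dfun z powr (- s)) * \<theta> z) \<partial>disk_measure s)
    = - (\<integral>z. u z * (of_real (dfun z powr (- s)) * partial i \<theta> z) \<partial>disk_measure s)"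
proof -
  have t: "\<And>n. \<phi> n \<in> test_functions" and S: "u \<in> sq_integrable (disk_measure s)" "V i \<in> sq_integrable (disk_measure s)"
    and lim: "(\<lambda>n. sqnorm (disk_measure s) (\<lambda>z. \<phi> n z - u z)) \<longlonglongrightarrow> 0" "(\<lambda>n. sqnorm (disk_measure s) (\<lambda>z. partial i (\<phi> n) z - V i z)) \<longlonglongrightarrow> 0"
    using H by (auto simp: H10_limit_def)
  have w: "(\<lambda>z. of_real (dfun z powr (- s)) * \<theta> z) \<in> sq_integrable (disk_measure s)" if "\<theta> \<in> test_functions" for \<theta>
    using weighted_disk_supported_L2[OF test_functions_disk_supported[OF that]] by (simp add: L2_eq_sq_integrable)
  have p\<theta>: "partial i \<theta> \<in> test_functions" by (rule test_functions_partial[OF \<theta>])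
  have 1: "(\<lambda>n. \<integral>z. partial i (\<phi> n) z * (of_real (dfun z powr (- s)) * \<theta> z) \<partial>disk_measure s)
     \<longlonglongrightarrow> (\<integral>z. V i z * (of_real (dfun z powr (- s)) * \<theta> z) \<partial>disk_measure s)"
    by (rule sq_integrable_tendsto_integral_mult[OF test_functions_partial_L2[OF t] S(2) w[OF \<theta>] lim(2)])
  have 2: "(\<lambda>n. \<integral>z. \<phi> n z * (of_real (dfun z powr (- s)) * partial i \<theta> z) \<partial>disk_measure s)
     \<longlonglongrightarrow> (\<integral>z. u z * (of_real (dfun z powr (- s)) * partial i \<theta> z) \<partial>disk_measure s)"
    by (rule sq_integrable_tendsto_integral_mult[OF test_functions_L2[OF t] S(1) w[OF p\<theta>] lim(1)])
  have eq: "(\<integral>z. partial i (\<phi> n) z * (of_real (dfun z powr (- s)) * \<theta> z) \<partial>disk_measure s)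
     = - (\<integral>z. \<phi> n z * (of_real (dfun z powr (- s)) * partial i \<theta> z) \<partial>disk_measure s)" for n
    unfolding pairing_lborel[OF disk_supported_borel[OF test_functions_disk_supported[OF test_functions_partial[OF t]]] test_functions_disk_supported[OF \<theta>]]
      pairing_lborel[OF disk_supported_borel[OF test_functions_disk_supported[OF t]] test_functions_disk_supported[OF p\<theta>]]
    by (rule test_integration_by_parts[OF t \<theta>])
  show ?thesis using LIMSEQ_unique[OF 1[unfolded eq] tendsto_minus[OF 2]] .
qed

text \<open>Closability of the gradient: the difference of two candidates is orthogonal to all test functions, since
  both are weak gradients of the same function.\<close>

lemma H10_limit_unique:
  assumes H: "H10_limit s \<phi> u V" "H10_limit s \<psi> u' W" and u: "AE z in disk_measure s. u z = u' z"
  shows "AE z in disk_measure s. V i z = W i z"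
proof -
  have S: "V i \<in> sq_integrable (disk_measure s)" "W i \<in> sq_integrable (disk_measure s)" "u \<in> sq_integrable (disk_measure s)" "u' \<in> sq_integrable (disk_measure s)" using H by (auto simp: H10_limit_def)
  have "AE z in lebesgue_on disk. V i z - W i z = 0"
  proof (rule L2_zero_if_orthogonal_to_tests)
    show "(\<lambda>z. V i z - W i z) \<in> L2 s" unfolding L2_eq_sq_integrable by (rule sq_integrable_diff[OF S(1,2)])
    fix \<theta> assume \<theta>: "\<theta> \<in> test_functions"
    have w: "(\<lambda>z. of_real (dfun z powr (- s)) * \<theta> z) \<in> sq_integrable (disk_measure s)" if "\<theta> \<in> test_functions" for \<theta>
      using weighted_disk_supported_L2[OF test_functions_disk_supported[OF that]] by (simp add: L2_eq_sq_integrable)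
    have "(\<integral>z. u z * (of_real (dfun z powr (- s)) * partial i \<theta> z) \<partial>disk_measure s) = (\<integral>z. u' z * (of_real (dfun z powr (- s)) * partial i \<theta> z) \<partial>disk_measure s)"
      by (rule integral_cong_AE)
        (use u borel_measurable_integrable[OF sq_integrable_mult_integrable[OF S(3) w[OF test_functions_partial[OF \<theta>, of i]]]]
          borel_measurable_integrable[OF sq_integrable_mult_integrable[OF S(4) w[OF test_functions_partial[OF \<theta>, of i]]]] in auto)
    then show "(\<integral>z. (V i z - W i z) * (of_real (dfun z powr (- s)) * \<theta> z) \<partial>disk_measure s) = 0"
      using sq_integrable_mult_integrable[OF S(1) w[OF \<theta>]] sq_integrable_mult_integrable[OF S(2) w[OF \<theta>]]
        H10_limit_integral[OF H(1) \<theta>, of i] H10_limit_integral[OF H(2) \<theta>, of i]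
      by (simp add: left_diff_distrib)
  qed
  then show ?thesis unfolding AE_disk_measure by eventually_elim simp
qed

lemma H1norm_ge:
  "sqnorm (disk_measure s) u \<le> (H1norm s u)\<^sup>2" "sqnorm (disk_measure s) (partial i u) \<le> (H1norm s u)\<^sup>2"
  unfolding H1norm_eq by (cases i; simp add: add_nonneg_nonneg)+

lemma L2norm_tendsto_0_iff: "(\<lambda>n. L2norm s (f n)) \<longlonglongrightarrow> 0 \<longleftrightarrow> (\<lambda>n. sqnorm (disk_measure s) (f n)) \<longlonglongrightarrow> 0"
proof
  assume "(\<lambda>n. L2norm s (f n)) \<longlonglongrightarrow> 0"
  from tendsto_power[OF this, of 2] show "(\<lambda>n. sqnorm (disk_measure s) (f n)) \<longlonglongrightarrow> 0" by (simp add: L2norm_eq_sqnorm)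
next
  assume "(\<lambda>n. sqnorm (disk_measure s) (f n)) \<longlonglongrightarrow> 0"
  from tendsto_real_sqrt[OF this] show "(\<lambda>n. L2norm s (f n)) \<longlonglongrightarrow> 0" by (simp add: L2norm_eq_sqnorm)
qed

lemma H10_limit_imp_approx:
  assumes H: "H10_limit s \<phi> u V" shows "H10_approx s \<phi> u"
proof -
  have t: "\<And>n. \<phi> n \<in> test_functions" and S: "u \<in> sq_integrable (disk_measure s)" "\<And>i. V i \<in> sq_integrable (disk_measure s)"
    and lim: "(\<lambda>n. sqnorm (disk_measure s) (\<lambda>z. \<phi> n z - u z)) \<longlonglongrightarrow> 0" "\<And>i. (\<lambda>n. sqnorm (disk_measure s) (\<lambda>z. partial i (\<phi> n) z - V i z)) \<longlonglongrightarrow> 0"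
    using H by (auto simp: H10_limit_def)
  have "\<exists>N. \<forall>j\<ge>N. \<forall>k\<ge>N. H1norm s (\<lambda>z. \<phi> j z - \<phi> k z) < e" if e: "e > 0" for e
  proof -
    have e': "0 < e\<^sup>2 / 3" using e by simp
    obtain N1 where N1: "\<And>j k. j \<ge> N1 \<Longrightarrow> k \<ge> N1 \<Longrightarrow> sqnorm (disk_measure s) (\<lambda>z. \<phi> j z - \<phi> k z) < e\<^sup>2 / 3"
      using sqnorm_Cauchy[OF test_functions_L2[OF t] S(1) lim(1) e'] by blast
    obtain N2 where N2: "\<And>j k. j \<ge> N2 \<Longrightarrow> k \<ge> N2 \<Longrightarrow> sqnorm (disk_measure s) (\<lambda>z. partial CX (\<phi> j) z - partial CX (\<phi> k) z) < e\<^sup>2 / 3"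
      using sqnorm_Cauchy[OF test_functions_partial_L2[OF t] S(2) lim(2) e', of CX] by blast
    obtain N3 where N3: "\<And>j k. j \<ge> N3 \<Longrightarrow> k \<ge> N3 \<Longrightarrow> sqnorm (disk_measure s) (\<lambda>z. partial CY (\<phi> j) z - partial CY (\<phi> k) z) < e\<^sup>2 / 3"
      using sqnorm_Cauchy[OF test_functions_partial_L2[OF t] S(2) lim(2) e', of CY] by blast
    have p: "partial i (\<lambda>z. \<phi> j z - \<phi> k z) = (\<lambda>z. partial i (\<phi> j) z - partial i (\<phi> k) z)" for i j k
      using partial_diff_test[OF t t] by (auto simp: fun_eq_iff)
    have "H1norm s (\<lambda>z. \<phi> j z - \<phi> k z) < e" if "j \<ge> max N1 (max N2 N3)" "k \<ge> max N1 (max N2 N3)" for j k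
    proof -
      have "sqnorm (disk_measure s) (\<lambda>z. \<phi> j z - \<phi> k z) + sqnorm (disk_measure s) (\<lambda>z. partial CX (\<phi> j) z - partial CX (\<phi> k) z)
         + sqnorm (disk_measure s) (\<lambda>z. partial CY (\<phi> j) z - partial CY (\<phi> k) z) < e\<^sup>2"
        using N1[of j k] N2[of j k] N3[of j k] that by simp
      then show ?thesis unfolding H1norm_eq p using e real_sqrt_less_iff real_sqrt_abs[of e] by (metis abs_of_pos)
    qed
    then show ?thesis by blast
  qed
  then show ?thesis unfolding H10_approx_def L2norm_tendsto_0_iff using t lim(1) by blast
qed

lemma H10_approx_imp_limit:
  assumes H: "H10_approx s \<phi> u" and u: "u \<in> L2 s" obtains V where "H10_limit s \<phi> u V"
proof -
  have t: "\<And>n. \<phi> n \<in> test_functions" and cau: "\<And>e. e > 0 \<Longrightarrow> \<exists>N. \<forall>j\<ge>N. \<forall>k\<ge>N. H1norm s (\<lambda>z. \<phi> j z - \<phi> k z) < e"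
    and lim: "(\<lambda>n. sqnorm (disk_measure s) (\<lambda>z. \<phi> n z - u z)) \<longlonglongrightarrow> 0"
    using H unfolding H10_approx_def L2norm_tendsto_0_iff by auto
  have "\<exists>v. v \<in> sq_integrable (disk_measure s) \<and> (\<lambda>n. sqnorm (disk_measure s) (\<lambda>z. partial i (\<phi> n) z - v z)) \<longlonglongrightarrow> 0" for i
  proof -
    have cp: "\<exists>N. \<forall>j\<ge>N. \<forall>k\<ge>N. sqnorm (disk_measure s) (\<lambda>z. partial i (\<phi> j) z - partial i (\<phi> k) z) < e" if e: "e > 0" for e
    proof -
      obtain N where N: "\<And>j k. j \<ge> N \<Longrightarrow> k \<ge> N \<Longrightarrow> H1norm s (\<lambda>z. \<phi> j z - \<phi> k z) < sqrt e"
        using cau[of "sqrt e"] e by auto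
      have "sqnorm (disk_measure s) (\<lambda>z. partial i (\<phi> j) z - partial i (\<phi> k) z) < e" if jk: "j \<ge> N" "k \<ge> N" for j k
      proof -
        have p: "partial i (\<lambda>z. \<phi> j z - \<phi> k z) = (\<lambda>z. partial i (\<phi> j) z - partial i (\<phi> k) z)"
          using partial_diff_test[OF t t] by (auto simp: fun_eq_iff)
        have "0 \<le> H1norm s (\<lambda>z. \<phi> j z - \<phi> k z)" unfolding H1norm_eq by (simp add: add_nonneg_nonneg)
        then have "(H1norm s (\<lambda>z. \<phi> j z - \<phi> k z))\<^sup>2 < (sqrt e)\<^sup>2"
          using N[OF jk] by (intro power_strict_mono) auto
        then show ?thesis using H1norm_ge(2)[of s i "\<lambda>z. \<phi> j z - \<phi> k z"] e unfolding p by simp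
      qed
      then show ?thesis by blast
    qed
    obtain v where "v \<in> sq_integrable (disk_measure s)" "(\<lambda>n. sqnorm (disk_measure s) (\<lambda>z. partial i (\<phi> n) z - v z)) \<longlonglongrightarrow> 0"
      using sq_integrable_complete[of "\<lambda>n. partial i (\<phi> n)", OF test_functions_partial_L2[OF t] cp] by blast
    then show ?thesis by blast
  qed
  then obtain V where "\<And>i. V i \<in> sq_integrable (disk_measure s) \<and> (\<lambda>n. sqnorm (disk_measure s) (\<lambda>z. partial i (\<phi> n) z - V i z)) \<longlonglongrightarrow> 0"
    by metis
  then have "H10_limit s \<phi> u V" unfolding H10_limit_def using t lim u by (simp add: L2_eq_sq_integrable)
  then show ?thesis using that by blast
qed

text \<open>Whatever representative the choice operator picks comes from some approximating sequence, so it agrees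
  almost everywhere with every other limit of this kind.\<close>

lemma ext_partial_AE:
  assumes H: "H10_limit s \<phi> u V"
  shows "u \<in> H10 s" "ext_partial s i u \<in> L2 s" "AE z in disk_measure s. ext_partial s i u z = V i z"
proof -
  have uL: "u \<in> L2 s" using H by (simp add: H10_limit_def L2_eq_sq_integrable)
  show "u \<in> H10 s" unfolding H10_def using uL H10_limit_imp_approx[OF H] by blast
  define P where "P v \<longleftrightarrow> v \<in> L2 s \<and> (\<exists>\<phi>. H10_approx s \<phi> u \<and> (\<lambda>n. L2norm s (\<lambda>z. partial i (\<phi> n) z - v z)) \<longlonglongrightarrow> 0)" for v
  have "P (V i)" unfolding P_def L2norm_tendsto_0_iff using H H10_limit_imp_approx[OF H]
    by (auto simp: H10_limit_def L2_eq_sq_integrable)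
  then have "P (ext_partial s i u)" unfolding ext_partial_def P_def[symmetric] by (rule someI[of P "V i"])
  then obtain \<psi> where \<psi>: "ext_partial s i u \<in> L2 s" "H10_approx s \<psi> u" "(\<lambda>n. sqnorm (disk_measure s) (\<lambda>z. partial i (\<psi> n) z - ext_partial s i u z)) \<longlonglongrightarrow> 0"
    unfolding P_def L2norm_tendsto_0_iff by blast
  show "ext_partial s i u \<in> L2 s" by (rule \<psi>(1))
  obtain W where W: "H10_limit s \<psi> u W" using H10_approx_imp_limit[OF \<psi>(2) uL] .
  have W': "\<And>n. partial i (\<psi> n) \<in> sq_integrable (disk_measure s)" "W i \<in> sq_integrable (disk_measure s)" "(\<lambda>n. sqnorm (disk_measure s) (\<lambda>z. partial i (\<psi> n) z - W i z)) \<longlonglongrightarrow> 0"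
    using W test_functions_partial_L2 by (auto simp: H10_limit_def)
  have "AE z in disk_measure s. ext_partial s i u z = W i z"
    by (rule sq_integrable_limit_unique[OF W'(1) \<psi>(1)[unfolded L2_eq_sq_integrable] W'(2) \<psi>(3) W'(3)])
  moreover have "AE z in disk_measure s. W i z = V i z"
    by (rule H10_limit_unique[OF W H]) simp
  ultimately show "AE z in disk_measure s. ext_partial s i u z = V i z" by eventually_elim simp
qed

lemma H10_limit_cong_AE:
  assumes H: "H10_limit s \<phi> u V"
    and u': "u' \<in> sq_integrable (disk_measure s)" "AE z in disk_measure s. u z = u' z"
    and V': "\<And>i. V' i \<in> sq_integrable (disk_measure s)" "\<And>i. AE z in disk_measure s. V i z = V' i z"
  shows "H10_limit s \<phi> u' V'"
proof -
  have c: "sqnorm (disk_measure s) (\<lambda>z. f z - v z) = sqnorm (disk_measure s) (\<lambda>z. f z - v' z)"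
    if "f \<in> sq_integrable (disk_measure s)" "v \<in> sq_integrable (disk_measure s)" "v' \<in> sq_integrable (disk_measure s)" "AE z in disk_measure s. v z = v' z" for f v v'
    unfolding sqnorm_def
  proof (rule integral_cong_AE)
    show "AE z in disk_measure s. (cmod (f z - v z))\<^sup>2 = (cmod (f z - v' z))\<^sup>2" using that(4) by eventually_elim simp
  qed (use sq_integrableD(2)[OF sq_integrable_diff[OF that(1,2)]] sq_integrableD(2)[OF sq_integrable_diff[OF that(1,3)]] in auto)
  note S = H[unfolded H10_limit_def]
  have "sqnorm (disk_measure s) (\<lambda>z. \<phi> n z - u' z) = sqnorm (disk_measure s) (\<lambda>z. \<phi> n z - u z)" for n
    by (rule c[symmetric]) (use S u' in \<open>simp_all add: test_functions_L2\<close>)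
  moreover have "sqnorm (disk_measure s) (\<lambda>z. partial i (\<phi> n) z - V' i z) = sqnorm (disk_measure s) (\<lambda>z. partial i (\<phi> n) z - V i z)" for i n
    by (rule c[symmetric]) (use S V' in \<open>simp_all add: test_functions_partial_L2\<close>)
  ultimately show ?thesis using S u'(1) V'(1) unfolding H10_limit_def by simp
qed

lemma H10E:
  assumes "u \<in> H10 s" obtains \<phi> where "H10_limit s \<phi> u (\<lambda>i. ext_partial s i u)"
proof -
  obtain \<phi> where \<phi>: "H10_approx s \<phi> u" "u \<in> L2 s" using assms unfolding H10_def by blast
  obtain V where V: "H10_limit s \<phi> u V" using H10_approx_imp_limit[OF \<phi>] .
  have "H10_limit s \<phi> u (\<lambda>i. ext_partial s i u)"
  proof (rule H10_limit_cong_AE[OF V])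
    show "u \<in> sq_integrable (disk_measure s)" using \<phi>(2) by (simp add: L2_eq_sq_integrable)
    show "ext_partial s i u \<in> sq_integrable (disk_measure s)" for i using ext_partial_AE(2)[OF V] by (simp add: L2_eq_sq_integrable)
    show "AE z in disk_measure s. V i z = ext_partial s i u z" for i using ext_partial_AE(3)[OF V, of i] by eventually_elim simp
  qed simp
  then show ?thesis using that by blast
qed

lemma H10_lin: assumes "u \<in> H10 s" "v \<in> H10 s" shows "(\<lambda>z. a * u z + b * v z) \<in> H10 s"
proof -
  obtain \<phi> where \<phi>: "H10_limit s \<phi> u (\<lambda>i. ext_partial s i u)" using H10E[OF assms(1)] .
  obtain \<psi> where \<psi>: "H10_limit s \<psi> v (\<lambda>i. ext_partial s i v)" using H10E[OF assms(2)] .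
  show ?thesis by (rule ext_partial_AE(1)[OF H10_limit_lin[OF \<phi> \<psi>]])
qed

lemma ext_partial_lin_AE:
  assumes "u \<in> H10 s" "v \<in> H10 s" and w: "w \<in> H10 s" "AE z in disk_measure s. w z = a * u z + b * v z"
  shows "AE z in disk_measure s. ext_partial s i w z = a * ext_partial s i u z + b * ext_partial s i v z"
proof -
  obtain \<phi> where \<phi>: "H10_limit s \<phi> u (\<lambda>i. ext_partial s i u)" using H10E[OF assms(1)] .
  obtain \<psi> where \<psi>: "H10_limit s \<psi> v (\<lambda>i. ext_partial s i v)" using H10E[OF assms(2)] .
  obtain \<eta> where \<eta>: "H10_limit s \<eta> w (\<lambda>i. ext_partial s i w)" using H10E[OF w(1)] .
  show ?thesis by (rule H10_limit_unique[OF \<eta> H10_limit_lin[OF \<phi> \<psi>] w(2)])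
qed

lemma H10_cnj: assumes "u \<in> H10 s" shows "(\<lambda>z. cnj (u z)) \<in> H10 s"
proof -
  obtain \<phi> where \<phi>: "H10_limit s \<phi> u (\<lambda>i. ext_partial s i u)" using H10E[OF assms(1)] .
  show ?thesis by (rule ext_partial_AE(1)[OF H10_limit_cnj[OF \<phi>]])
qed

lemma ext_partial_cnj_AE:
  assumes "u \<in> H10 s" shows "AE z in disk_measure s. ext_partial s i (\<lambda>z. cnj (u z)) z = cnj (ext_partial s i u z)"
proof -
  obtain \<phi> where \<phi>: "H10_limit s \<phi> u (\<lambda>i. ext_partial s i u)" using H10E[OF assms] .
  show ?thesis by (rule ext_partial_AE(3)[OF H10_limit_cnj[OF \<phi>]])
qed

section \<open>The scalar decomposition\<close>

text \<open>The integrand is \<open>\<partial>(\<phi> cnj A)\<close>, as \<open>\<partial>\<close> annihilates antiholomorphic functions.\<close>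

lemma dhol_orthogonal_to_holomorphic:
  assumes \<phi>: "\<phi> \<in> test_functions" and A: "A holomorphic_on ball 0 1"
  shows "(\<integral>z. dhol \<phi> z * cnj (A z) \<partial>lborel) = 0"
proof -
  obtain r1 where r1: "r1 < 1" "\<And>z. r1 \<le> cmod z \<Longrightarrow> \<phi> z = 0" using \<phi> test_functionsE by blast
  obtain r2 where r2: "r2 < 1" "\<And>z. r2 \<le> cmod z \<Longrightarrow> dhol \<phi> z = 0" using dhol_test[OF \<phi>] test_functionsE by blast
  obtain r3 where r3: "r3 < 1" "\<And>z. r3 \<le> cmod z \<Longrightarrow> dbar \<phi> z = 0" using dbar_test[OF \<phi>] test_functionsE by blast
  define r where "r = max r1 (max r2 r3)"
  have r: "r < 1" "\<And>z. r \<le> cmod z \<Longrightarrow> \<phi> z = 0 \<and> dhol \<phi> z = 0 \<and> dbar \<phi> z = 0"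
    using r1 r2 r3 by (auto simp: r_def)
  have c: "continuous_on UNIV f" if "f \<in> test_functions" for f using that smooth_continuous by (auto simp: test_functions_iff)
  have Ac: "continuous_on (ball 0 1) A" "continuous_on (ball 0 1) (deriv A)"
    using A holomorphic_deriv[OF A] holomorphic_on_imp_continuous_on by auto
  have prod: "continuous_on UNIV (\<lambda>z. f z * cnj (B z))"
    if f: "f \<in> test_functions" "\<And>z. r \<le> cmod z \<Longrightarrow> f z = 0" and B: "continuous_on (ball 0 1) B" for f B
  proof -
    have "continuous_on (ball 0 1 \<union> - cball 0 r) (\<lambda>z. f z * cnj (B z))"
    proof (rule continuous_on_open_Un)
      show "continuous_on (ball 0 1) (\<lambda>z. f z * cnj (B z))"
        by (intro continuous_on_mult continuous_on_cnj B continuous_on_subset[OF c[OF f(1)]]) auto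
      have "continuous_on (- cball 0 r) (\<lambda>z::complex. 0 :: complex)" by simp
      then show "continuous_on (- cball 0 r) (\<lambda>z. f z * cnj (B z))"
        by (rule continuous_on_eq) (use f(2) in auto)
    qed auto
    moreover have "ball 0 1 \<union> - cball 0 r = (UNIV :: complex set)" using r(1) by auto
    ultimately show ?thesis by simp
  qed
  have W: "has_wirtinger (\<lambda>z. \<phi> z * cnj (A z)) (dhol \<phi> z * cnj (A z)) (dbar \<phi> z * cnj (A z) + \<phi> z * cnj (deriv A z)) z" for z
  proof (cases "cmod z < 1")
    case True
    then have "(A has_field_derivative deriv A z) (at z)" using holomorphic_derivI[OF A] by auto
    from has_wirtinger_mult[OF has_wirtinger_test[OF \<phi>] has_wirtinger_cnj[OF has_wirtinger_holomorphic[OF this]]]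
    show ?thesis by simp
  next
    case False
    have "has_partials (\<lambda>z. \<phi> z * cnj (A z)) 0 0 z"
      by (rule has_partials_transform[OF has_partials_const, of "- cball 0 r"]) (use False r in auto)
    then show ?thesis using False r by (simp add: has_wirtinger_def)
  qed
  show ?thesis
  proof (rule integral_wirtinger_zero(1)[OF W])
    show "continuous_on UNIV (\<lambda>z. dhol \<phi> z * cnj (A z))" by (rule prod[OF dhol_test[OF \<phi>] _ Ac(1)]) (use r in blast)
    show "continuous_on UNIV (\<lambda>z. dbar \<phi> z * cnj (A z) + \<phi> z * cnj (deriv A z))"
      by (intro continuous_on_add prod[OF dbar_test[OF \<phi>] _ Ac(1)] prod[OF \<phi> _ Ac(2)]) (use r in blast)+
    show "\<phi> z * cnj (A z) = 0 \<and> dhol \<phi> z * cnj (A z) = 0 \<and> dbar \<phi> z * cnj (A z) + \<phi> z * cnj (deriv A z) = 0"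
      if "r \<le> cmod z" for z using r(2)[OF that] by simp
  qed
qed

definition ext_dhol :: "real \<Rightarrow> (complex \<Rightarrow> complex) \<Rightarrow> complex \<Rightarrow> complex" where
  "ext_dhol s u z = (ext_partial s CX u z - \<i> * ext_partial s CY u z) / 2"

lemma ext_dhol_limit:
  assumes H: "H10_limit s \<phi> u V"
  shows "(\<lambda>z. (V CX z - \<i> * V CY z) / 2) \<in> sq_integrable (disk_measure s)"
    and "(\<lambda>n. sqnorm (disk_measure s) (\<lambda>z. dhol (\<phi> n) z - (V CX z - \<i> * V CY z) / 2)) \<longlonglongrightarrow> 0"
proof -
  note S = H[unfolded H10_limit_def]
  have "(\<lambda>z. (1/2) * V CX z + (- \<i> / 2) * V CY z) \<in> sq_integrable (disk_measure s)" using S by (intro sq_integrable_add sq_integrable_cmult) simp_all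
  then show "(\<lambda>z. (V CX z - \<i> * V CY z) / 2) \<in> sq_integrable (disk_measure s)" by (simp add: diff_divide_distrib)
  have "(\<lambda>n. sqnorm (disk_measure s) (\<lambda>z. ((1/2) * partial CX (\<phi> n) z + (- \<i> / 2) * partial CY (\<phi> n) z) - ((1/2) * V CX z + (- \<i> / 2) * V CY z))) \<longlonglongrightarrow> 0"
    by (rule sqnorm_tendsto_lin) (use S in \<open>simp_all add: test_functions_partial_L2\<close>)
  then show "(\<lambda>n. sqnorm (disk_measure s) (\<lambda>z. dhol (\<phi> n) z - (V CX z - \<i> * V CY z) / 2)) \<longlonglongrightarrow> 0"
    by (simp add: dhol_def diff_divide_distrib)
qed

lemma sqnorm_weight_diff:
  assumes "u \<in> sq_integrable (disk_measure (- \<gamma>))" "v \<in> sq_integrable (disk_measure (- \<gamma>))"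
  shows "sqnorm (disk_measure \<gamma>) (\<lambda>z. of_real (dfun z powr (- \<gamma>)) * u z - of_real (dfun z powr (- \<gamma>)) * v z)
    = sqnorm (disk_measure (- \<gamma>)) (\<lambda>z. u z - v z)"
  using L2_weight_iff(2)[of "\<lambda>z. u z - v z" \<gamma>] sq_integrableD(1)[OF sq_integrable_diff[OF assms]]
  unfolding borel_measurable_disk_measure by (simp add: right_diff_distrib)

lemma sq_integrable_weight: assumes "u \<in> sq_integrable (disk_measure (- \<gamma>))" shows "(\<lambda>z. of_real (dfun z powr (- \<gamma>)) * u z) \<in> sq_integrable (disk_measure \<gamma>)"
  using L2_weight_iff(1)[of u \<gamma>] sq_integrableD(1)[OF assms] assms unfolding borel_measurable_disk_measure L2_eq_sq_integrable by simp

text \<open>Project onto the closure of the functions \<open>d^(-\<gamma>) \<partial>\<phi>\<close>. By \<open>H1norm_estimate\<close> the potentials of the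
  approximating sequence converge in \<open>H10 (- \<gamma>)\<close>, and the residual is holomorphic by Weyl's lemma.\<close>

lemma scalar_decomposition_exists:
  assumes \<gamma>: "-1 < \<gamma>" and f: "f \<in> L2 \<gamma>"
  obtains u a where "u \<in> H10 (- \<gamma>)" "a \<in> L2 \<gamma>" "a holomorphic_on ball 0 1"
    "AE z in lebesgue_on disk. f z = of_real (dfun z powr (- \<gamma>)) * ext_dhol (- \<gamma>) u z + a z"
proof -
  define w where "w z = complex_of_real (dfun z powr (- \<gamma>))" for z
  define V where "V = (\<lambda>\<phi> z. w z * dhol \<phi> z) ` test_functions"
  have dS: "dhol \<phi> \<in> sq_integrable (disk_measure s)" if "\<phi> \<in> test_functions" for \<phi> s by (rule test_functions_L2[OF dhol_test[OF that]])
  have fS: "f \<in> sq_integrable (disk_measure \<gamma>)" using f by (simp add: L2_eq_sq_integrable)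
  have dadd: "dhol (\<lambda>z. \<phi> z + \<psi> z) = (\<lambda>z. dhol \<phi> z + dhol \<psi> z)" if "\<phi> \<in> test_functions" "\<psi> \<in> test_functions" for \<phi> \<psi>
    by (rule ext) (simp add: dhol_def partial_add_test[OF that] add_divide_distrib diff_divide_distrib ring_distribs mult_ac)
  have dscl: "dhol (\<lambda>z. c * \<phi> z) = (\<lambda>z. c * dhol \<phi> z)" if "\<phi> \<in> test_functions" for \<phi> c
    by (rule ext) (simp add: dhol_def partial_cmult_test[OF that] add_divide_distrib diff_divide_distrib ring_distribs mult_ac)
  have ddiff: "dhol (\<lambda>z. \<phi> z - \<psi> z) = (\<lambda>z. dhol \<phi> z - dhol \<psi> z)" if "\<phi> \<in> test_functions" "\<psi> \<in> test_functions" for \<phi> \<psi>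
    by (rule ext) (simp add: dhol_def partial_diff_test[OF that] add_divide_distrib diff_divide_distrib ring_distribs mult_ac)
  obtain g p where g: "\<And>n::nat. g n \<in> V" and p: "p \<in> sq_integrable (disk_measure \<gamma>)" "(\<lambda>n. sqnorm (disk_measure \<gamma>) (\<lambda>x. g n x - p x)) \<longlonglongrightarrow> 0"
    and orth: "\<And>v. v \<in> V \<Longrightarrow> (\<integral>x. (f x - p x) * cnj (v x) \<partial>disk_measure \<gamma>) = 0"
  proof (rule sq_integrable_projection[OF fS, of V])
    show "V \<subseteq> sq_integrable (disk_measure \<gamma>)" unfolding V_def w_def using sq_integrable_weight dS by blast
    show "V \<noteq> {}" unfolding V_def using test_functions_zero by blast
    show "(\<lambda>x. u x + v x) \<in> V" if uv: "u \<in> V" "v \<in> V" for u v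
    proof -
      obtain \<phi> \<psi> where t: "\<phi> \<in> test_functions" "\<psi> \<in> test_functions" and uv: "u = (\<lambda>z. w z * dhol \<phi> z)" "v = (\<lambda>z. w z * dhol \<psi> z)"
        using uv unfolding V_def by blast
      have "(\<lambda>x. u x + v x) = (\<lambda>z. w z * dhol (\<lambda>z. \<phi> z + \<psi> z) z)"
        unfolding uv dadd[OF t] by (simp add: distrib_left)
      then show ?thesis unfolding V_def using test_functions_add[OF t] by blast
    qed
    show "(\<lambda>x. c * u x) \<in> V" if u: "u \<in> V" for c u
    proof -
      obtain \<phi> where t: "\<phi> \<in> test_functions" and u: "u = (\<lambda>z. w z * dhol \<phi> z)" using u unfolding V_def by blast
      have "(\<lambda>x. c * u x) = (\<lambda>z. w z * dhol (\<lambda>z. c * \<phi> z) z)"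
        unfolding u dscl[OF t] by (simp add: mult.left_commute)
      then show ?thesis unfolding V_def using test_functions_cmult[OF t] by blast
    qed
  qed blast
  have "\<forall>n. \<exists>\<phi>. \<phi> \<in> test_functions \<and> g n = (\<lambda>z. w z * dhol \<phi> z)" using g unfolding V_def by blast
  then obtain \<phi> where t: "\<And>n. \<phi> n \<in> test_functions" and g\<phi>: "\<And>n. g n = (\<lambda>z. w z * dhol (\<phi> n) z)" by metis
  have gS: "g n \<in> sq_integrable (disk_measure \<gamma>)" for n unfolding g\<phi> w_def by (rule sq_integrable_weight[OF dS[OF t]])
  obtain C where C: "0 \<le> C" "\<And>u. u \<in> test_functions \<Longrightarrow> (H1norm (- \<gamma>) u)\<^sup>2 \<le> C * sqnorm (disk_measure (- \<gamma>)) (dhol u)"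
    using H1norm_estimate[of "- \<gamma>"] \<gamma> by auto
  have Hc: "(H1norm (- \<gamma>) (\<lambda>z. \<phi> j z - \<phi> k z))\<^sup>2 \<le> C * sqnorm (disk_measure \<gamma>) (\<lambda>z. g j z - g k z)" for j k
    using C(2)[OF test_functions_diff[OF t t], of j k]
    unfolding ddiff[OF t t] g\<phi> w_def sqnorm_weight_diff[OF dS[OF t] dS[OF t]] .
  have cau: "\<exists>N. \<forall>j\<ge>N. \<forall>k\<ge>N. (H1norm (- \<gamma>) (\<lambda>z. \<phi> j z - \<phi> k z))\<^sup>2 < e" if e: "0 < e" for e
  proof -
    have "0 < e / (C + 1)" using e C(1) by simp
    then obtain N where N: "\<And>j k. j \<ge> N \<Longrightarrow> k \<ge> N \<Longrightarrow> sqnorm (disk_measure \<gamma>) (\<lambda>z. g j z - g k z) < e / (C + 1)"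
      using sqnorm_Cauchy[OF gS p] by blast
    have "(H1norm (- \<gamma>) (\<lambda>z. \<phi> j z - \<phi> k z))\<^sup>2 < e" if "j \<ge> N" "k \<ge> N" for j k
    proof -
      have "(H1norm (- \<gamma>) (\<lambda>z. \<phi> j z - \<phi> k z))\<^sup>2 \<le> (C + 1) * sqnorm (disk_measure \<gamma>) (\<lambda>z. g j z - g k z)"
        using Hc[of j k] by (rule order_trans) (simp add: mult_right_mono)
      also have "\<dots> < (C + 1) * (e / (C + 1))" using N[OF that] C(1) by (intro mult_strict_left_mono) auto
      also have "\<dots> = e" using C(1) by simp
      finally show ?thesis .
    qed
    then show ?thesis by blast
  qed
  have cu: "\<exists>N. \<forall>j\<ge>N. \<forall>k\<ge>N. sqnorm (disk_measure (- \<gamma>)) (\<lambda>z. \<phi> j z - \<phi> k z) < e" if e: "0 < e" for e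
    using cau[OF e] H1norm_ge(1) by (meson le_less_trans)
  obtain u where u: "u \<in> sq_integrable (disk_measure (- \<gamma>))" "(\<lambda>n. sqnorm (disk_measure (- \<gamma>)) (\<lambda>z. \<phi> n z - u z)) \<longlonglongrightarrow> 0"
    using sq_integrable_complete[of \<phi>, OF test_functions_L2[OF t] cu] by blast
  have "H10_approx (- \<gamma>) \<phi> u"
    unfolding H10_approx_def L2norm_tendsto_0_iff
  proof (intro conjI allI impI t u(2))
    fix e :: real assume e: "0 < e"
    then obtain N where N: "\<And>j k. j \<ge> N \<Longrightarrow> k \<ge> N \<Longrightarrow> (H1norm (- \<gamma>) (\<lambda>z. \<phi> j z - \<phi> k z))\<^sup>2 < e\<^sup>2"
      using cau[of "e\<^sup>2"] by auto
    have "H1norm (- \<gamma>) (\<lambda>z. \<phi> j z - \<phi> k z) < e" if "j \<ge> N" "k \<ge> N" for j k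
      by (rule power_less_imp_less_base[OF N[OF that]]) (use e in simp)
    then show "\<exists>N. \<forall>j\<ge>N. \<forall>k\<ge>N. H1norm (- \<gamma>) (\<lambda>z. \<phi> j z - \<phi> k z) < e" by blast
  qed
  then obtain V' where "H10_limit (- \<gamma>) \<phi> u V'" using H10_approx_imp_limit u(1) unfolding L2_eq_sq_integrable[symmetric] by metis
  then have uH: "u \<in> H10 (- \<gamma>)" and H: "H10_limit (- \<gamma>) \<phi> u (\<lambda>i. ext_partial (- \<gamma>) i u)"
  proof -
    assume L: "H10_limit (- \<gamma>) \<phi> u V'"
    show "u \<in> H10 (- \<gamma>)" by (rule ext_partial_AE(1)[OF L])
    show "H10_limit (- \<gamma>) \<phi> u (\<lambda>i. ext_partial (- \<gamma>) i u)"
    proof (rule H10_limit_cong_AE[OF L u(1)])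
      show "ext_partial (- \<gamma>) i u \<in> sq_integrable (disk_measure (- \<gamma>))" for i using ext_partial_AE(2)[OF L] by (simp add: L2_eq_sq_integrable)
      show "AE z in disk_measure (- \<gamma>). V' i z = ext_partial (- \<gamma>) i u z" for i using ext_partial_AE(3)[OF L, of i] by eventually_elim simp
    qed simp
  qed
  note E = ext_dhol_limit[OF H, folded ext_dhol_def]
  have wE: "(\<lambda>z. w z * ext_dhol (- \<gamma>) u z) \<in> sq_integrable (disk_measure \<gamma>)" unfolding w_def by (rule sq_integrable_weight[OF E(1)])
  have "(\<lambda>n. sqnorm (disk_measure \<gamma>) (\<lambda>z. g n z - w z * ext_dhol (- \<gamma>) u z)) \<longlonglongrightarrow> 0"
    unfolding g\<phi> w_def sqnorm_weight_diff[OF dS[OF t] E(1)] by (rule E(2))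
  then have pe: "AE z in disk_measure \<gamma>. p z = w z * ext_dhol (- \<gamma>) u z"
    by (rule sq_integrable_limit_unique[OF gS p(1) wE p(2)])
  have rS: "(\<lambda>z. f z - p z) \<in> L2 \<gamma>" unfolding L2_eq_sq_integrable by (rule sq_integrable_diff[OF fS p(1)])
  have weak: "(\<integral>z. (f z - p z) * (of_real (dfun z powr (- \<gamma>)) * dbar \<theta> z) \<partial>disk_measure \<gamma>) = 0" if \<theta>: "\<theta> \<in> test_functions" for \<theta>
  proof -
    have ct: "(\<lambda>z. cnj (\<theta> z)) \<in> test_functions" by (rule test_functions_cnj[OF \<theta>])
    have "dbar \<theta> z = cnj (dhol (\<lambda>z. cnj (\<theta> z)) z)" for z using dbar_cnj[OF ct, of z] by simp
    then have e: "of_real (dfun z powr (- \<gamma>)) * dbar \<theta> z = cnj (w z * dhol (\<lambda>z. cnj (\<theta> z)) z)" for z by (simp add: w_def)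
    have "(\<lambda>z. w z * dhol (\<lambda>z. cnj (\<theta> z)) z) \<in> V" unfolding V_def using ct by blast
    then show ?thesis unfolding e by (rule orth)
  qed
  obtain a where a: "a \<in> L2 \<gamma>" "a holomorphic_on ball 0 1" "AE z in lebesgue_on disk. f z - p z = a z"
    using weyl_lemma[OF rS weak] by blast
  have "AE z in lebesgue_on disk. f z = of_real (dfun z powr (- \<gamma>)) * ext_dhol (- \<gamma>) u z + a z"
    using a(3) pe[unfolded AE_disk_measure] by eventually_elim (simp add: w_def algebra_simps)
  then show ?thesis using that[OF uH a(1,2)] by blast
qed

text \<open>The holomorphic function \<open>A = a' - a\<close> equals \<open>d^(-\<gamma>) \<partial>w\<close> for \<open>w = u - u'\<close>. It is orthogonal to all \<open>d^(-\<gamma>) \<partial>\<phi>\<close>,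
  hence to their limit, which is \<open>A\<close> itself. So \<open>A\<close> and \<open>\<partial>w\<close> vanish, and \<open>H1norm_estimate\<close> forces \<open>w = 0\<close>.\<close>

lemma scalar_decomposition_unique:
  assumes \<gamma>: "-1 < \<gamma>"
    and u: "u \<in> H10 (- \<gamma>)" "u' \<in> H10 (- \<gamma>)"
    and a: "a \<in> L2 \<gamma>" "a holomorphic_on ball 0 1" "a' \<in> L2 \<gamma>" "a' holomorphic_on ball 0 1"
    and eq: "AE z in lebesgue_on disk. of_real (dfun z powr (- \<gamma>)) * ext_dhol (- \<gamma>) u z + a z
      = of_real (dfun z powr (- \<gamma>)) * ext_dhol (- \<gamma>) u' z + a' z"
  shows "AE z in lebesgue_on disk. u z = u' z" "AE z in lebesgue_on disk. a z = a' z"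
proof -
  define w where "w z = u z - u' z" for z
  have w': "w = (\<lambda>z. 1 * u z + (- 1) * u' z)" by (auto simp: w_def)
  have wH: "w \<in> H10 (- \<gamma>)" unfolding w' by (rule H10_lin[OF u])
  obtain \<phi> where H: "H10_limit (- \<gamma>) \<phi> w (\<lambda>i. ext_partial (- \<gamma>) i w)" using H10E[OF wH] .
  have t: "\<And>n. \<phi> n \<in> test_functions" and wS: "w \<in> sq_integrable (disk_measure (- \<gamma>))"
    and lim: "(\<lambda>n. sqnorm (disk_measure (- \<gamma>)) (\<lambda>z. \<phi> n z - w z)) \<longlonglongrightarrow> 0" using H by (auto simp: H10_limit_def)
  note E = ext_dhol_limit[OF H, folded ext_dhol_def]
  have dS: "dhol (\<phi> n) \<in> sq_integrable (disk_measure s)" for n s by (rule test_functions_L2[OF dhol_test[OF t]])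
  define A where "A z = a' z - a z" for z
  have AS: "A \<in> sq_integrable (disk_measure \<gamma>)" using sq_integrable_diff[OF a(3)[unfolded L2_eq_sq_integrable] a(1)[unfolded L2_eq_sq_integrable]] by (simp add: A_def[abs_def])
  have Ahol: "A holomorphic_on ball 0 1" unfolding A_def[abs_def] by (intro holomorphic_intros a)
  have ep: "AE z in disk_measure (- \<gamma>). ext_partial (- \<gamma>) i w z = 1 * ext_partial (- \<gamma>) i u z + (- 1) * ext_partial (- \<gamma>) i u' z" for i
    by (rule ext_partial_lin_AE[OF u wH]) (simp add: w')
  have wA: "AE z in disk_measure \<gamma>. of_real (dfun z powr (- \<gamma>)) * ext_dhol (- \<gamma>) w z = A z"
    unfolding AE_disk_measure using eq ep[of CX, unfolded AE_disk_measure] ep[of CY, unfolded AE_disk_measure]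
  proof eventually_elim
    case (elim z)
    have "ext_dhol (- \<gamma>) w z = ext_dhol (- \<gamma>) u z - ext_dhol (- \<gamma>) u' z"
      unfolding ext_dhol_def elim(2,3) by (simp add: field_simps)
    then have e: "of_real (dfun z powr (- \<gamma>)) * ext_dhol (- \<gamma>) w z
        = of_real (dfun z powr (- \<gamma>)) * ext_dhol (- \<gamma>) u z - of_real (dfun z powr (- \<gamma>)) * ext_dhol (- \<gamma>) u' z"
      by (simp only: right_diff_distrib)
    have "x - y = a'' - a'" if "x + a' = y + a''" for x y a' a'' :: complex using that by (simp add: algebra_simps)
    from this[OF elim(1)] show ?case unfolding e A_def .
  qed
  define B where "B z = indicator (ball 0 1) z *\<^sub>R A z" for z
  have Bm: "B \<in> borel_measurable borel"
    unfolding B_def by (rule borel_measurable_continuous_on_indicator[OF _ holomorphic_on_imp_continuous_on[OF Ahol]]) simp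
  have Bc: "(\<lambda>z. cnj (B z)) \<in> borel_measurable borel"
    by (rule measurable_compose[OF Bm borel_measurable_continuous_onI]) (intro continuous_intros)
  have AB: "AE z in disk_measure \<gamma>. A z = B z"
    unfolding AE_disk_measure AE_lebesgue_on_disk by (auto simp: B_def)
  have BS: "B \<in> sq_integrable (disk_measure \<gamma>)"
    by (rule sq_integrable_cong_AE[OF AS AB borel_measurable_disk_measureI[OF Bm]])
  have wE: "(\<lambda>z. of_real (dfun z powr (- \<gamma>)) * ext_dhol (- \<gamma>) w z) \<in> sq_integrable (disk_measure \<gamma>)" by (rule sq_integrable_weight[OF E(1)])
  have "(\<lambda>n. sqnorm (disk_measure \<gamma>) (\<lambda>z. of_real (dfun z powr (- \<gamma>)) * dhol (\<phi> n) z - of_real (dfun z powr (- \<gamma>)) * ext_dhol (- \<gamma>) w z)) \<longlonglongrightarrow> 0"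
    unfolding sqnorm_weight_diff[OF dS E(1)] by (rule E(2))
  from sq_integrable_tendsto_integral_mult[OF sq_integrable_weight[OF dS] wE sq_integrable_cnj[OF BS] this]
  have 1: "(\<lambda>n. \<integral>z. of_real (dfun z powr (- \<gamma>)) * dhol (\<phi> n) z * cnj (B z) \<partial>disk_measure \<gamma>)
     \<longlonglongrightarrow> (\<integral>z. of_real (dfun z powr (- \<gamma>)) * ext_dhol (- \<gamma>) w z * cnj (B z) \<partial>disk_measure \<gamma>)" .
  have 0: "(\<integral>z. of_real (dfun z powr (- \<gamma>)) * dhol (\<phi> n) z * cnj (B z) \<partial>disk_measure \<gamma>) = 0" for n
  proof -
    have "(\<integral>z. of_real (dfun z powr (- \<gamma>)) * dhol (\<phi> n) z * cnj (B z) \<partial>disk_measure \<gamma>)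
      = (\<integral>z. cnj (B z) * (of_real (dfun z powr (- \<gamma>)) * dhol (\<phi> n) z) \<partial>disk_measure \<gamma>)" by (simp add: mult.commute)
    also have "\<dots> = (\<integral>z. cnj (B z) * dhol (\<phi> n) z \<partial>lborel)"
      by (rule pairing_lborel[OF Bc test_functions_disk_supported[OF dhol_test[OF t]]])
    also have "\<dots> = (\<integral>z. dhol (\<phi> n) z * cnj (A z) \<partial>lborel)"
    proof (rule Bochner_Integration.integral_cong[OF refl])
      fix z
      show "cnj (B z) * dhol (\<phi> n) z = dhol (\<phi> n) z * cnj (A z)"
        using disk_supported_outside[OF test_functions_disk_supported[OF dhol_test[OF t]], of z n]
        by (cases "cmod z < 1") (auto simp: B_def)
    qed
    also have "\<dots> = 0" by (rule dhol_orthogonal_to_holomorphic[OF t Ahol])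
    finally show ?thesis .
  qed
  have "(\<integral>z. of_real (dfun z powr (- \<gamma>)) * ext_dhol (- \<gamma>) w z * cnj (B z) \<partial>disk_measure \<gamma>) = 0"
    using LIMSEQ_unique[OF 1[unfolded 0] tendsto_const] .
  also have "(\<integral>z. of_real (dfun z powr (- \<gamma>)) * ext_dhol (- \<gamma>) w z * cnj (B z) \<partial>disk_measure \<gamma>) = (\<integral>z. complex_of_real ((cmod (B z))\<^sup>2) \<partial>disk_measure \<gamma>)"
  proof (rule integral_cong_AE)
    show "(\<lambda>z. of_real (dfun z powr (- \<gamma>)) * ext_dhol (- \<gamma>) w z * cnj (B z)) \<in> borel_measurable (disk_measure \<gamma>)"
      by (rule borel_measurable_integrable[OF sq_integrable_mult_integrable[OF wE sq_integrable_cnj[OF BS]]])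
    show "(\<lambda>z. complex_of_real ((cmod (B z))\<^sup>2)) \<in> borel_measurable (disk_measure \<gamma>)"
      using sq_integrableD(1)[OF BS] by measurable
    show "AE z in disk_measure \<gamma>. of_real (dfun z powr (- \<gamma>)) * ext_dhol (- \<gamma>) w z * cnj (B z) = complex_of_real ((cmod (B z))\<^sup>2)"
      using wA AB
    proof eventually_elim
      case (elim z)
      show ?case unfolding elim by (rule complex_norm_square[symmetric])
    qed
  qed
  also have "\<dots> = of_real (sqnorm (disk_measure \<gamma>) B)" unfolding sqnorm_def by (rule integral_complex_of_real)
  finally have "sqnorm (disk_measure \<gamma>) B = 0" by simp
  then have B0: "AE z in disk_measure \<gamma>. B z = 0" by (rule sqnorm_eq_0_AE[OF BS])
  then have A0: "AE z in disk_measure \<gamma>. A z = 0" using AB by eventually_elim simp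
  then show "AE z in lebesgue_on disk. a z = a' z" unfolding AE_disk_measure by eventually_elim (simp add: A_def)
  have e0: "AE z in disk_measure (- \<gamma>). ext_dhol (- \<gamma>) w z = 0"
  proof -
    have "AE z in lebesgue_on disk. of_real (dfun z powr (- \<gamma>)) * ext_dhol (- \<gamma>) w z = 0"
      using wA[unfolded AE_disk_measure] A0[unfolded AE_disk_measure] by eventually_elim simp
    then have "AE z in lebesgue. cmod z < 1 \<longrightarrow> of_real (dfun z powr (- \<gamma>)) * ext_dhol (- \<gamma>) w z = 0"
      unfolding AE_lebesgue_on_disk .
    then have "AE z in lebesgue. cmod z < 1 \<longrightarrow> ext_dhol (- \<gamma>) w z = 0"
    proof eventually_elim
      case (elim z)
      then show ?case using dfun_pos[of z] by auto
    qed
    then show ?thesis unfolding AE_disk_measure AE_lebesgue_on_disk .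
  qed
  have "sqnorm (disk_measure (- \<gamma>)) (ext_dhol (- \<gamma>) w) = 0"
  proof -
    have "sqnorm (disk_measure (- \<gamma>)) (ext_dhol (- \<gamma>) w) = (\<integral>z. 0 \<partial>disk_measure (- \<gamma>))" unfolding sqnorm_def
      by (rule integral_cong_AE) (use sq_integrableD(2)[OF E(1)] e0 in auto)
    then show ?thesis by simp
  qed
  with sqnorm_tendsto[OF dS E] have d0: "(\<lambda>n. sqnorm (disk_measure (- \<gamma>)) (dhol (\<phi> n))) \<longlonglongrightarrow> 0" by simp
  obtain C where C: "0 \<le> C" "\<And>u. u \<in> test_functions \<Longrightarrow> (H1norm (- \<gamma>) u)\<^sup>2 \<le> C * sqnorm (disk_measure (- \<gamma>)) (dhol u)"
    using H1norm_estimate[of "- \<gamma>"] \<gamma> by auto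
  have "(\<lambda>n. sqnorm (disk_measure (- \<gamma>)) (\<phi> n)) \<longlonglongrightarrow> 0"
  proof (rule Lim_null_comparison[OF always_eventually[OF allI]])
    fix n
    show "norm (sqnorm (disk_measure (- \<gamma>)) (\<phi> n)) \<le> C * sqnorm (disk_measure (- \<gamma>)) (dhol (\<phi> n))"
      using order_trans[OF H1norm_ge(1) C(2)[OF t[of n]]] by simp
    show "(\<lambda>n. C * sqnorm (disk_measure (- \<gamma>)) (dhol (\<phi> n))) \<longlonglongrightarrow> 0"
      using tendsto_mult_right_zero[OF d0] .
  qed
  with sqnorm_tendsto[OF test_functions_L2[OF t] wS lim] have "sqnorm (disk_measure (- \<gamma>)) w = 0"
    using LIMSEQ_unique by blast
  then have "AE z in disk_measure (- \<gamma>). w z = 0" by (rule sqnorm_eq_0_AE[OF wS])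
  then show "AE z in lebesgue_on disk. u z = u' z" unfolding AE_disk_measure by eventually_elim (simp add: w_def)
qed

section \<open>The tensor decomposition\<close>

lemma L2_add: "u \<in> L2 s \<Longrightarrow> v \<in> L2 s \<Longrightarrow> (\<lambda>z. u z + v z) \<in> L2 s"
  unfolding L2_eq_sq_integrable by (rule sq_integrable_add)

lemma L2_cmult: "u \<in> L2 s \<Longrightarrow> (\<lambda>z. c * u z) \<in> L2 s"
  unfolding L2_eq_sq_integrable by (rule sq_integrable_cmult)

lemma H10_add: "u \<in> H10 s \<Longrightarrow> v \<in> H10 s \<Longrightarrow> (\<lambda>z. u z + v z) \<in> H10 s"
  using H10_lin[of u s v 1 1] by simp

lemma H10_cmult: "u \<in> H10 s \<Longrightarrow> (\<lambda>z. c * u z) \<in> H10 s"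
  using H10_lin[of u s u c 0] by simp

lemma H10_ext_partial_L2: assumes "u \<in> H10 s" shows "ext_partial s i u \<in> L2 s"
proof -
  obtain \<phi> where "H10_limit s \<phi> u (\<lambda>i. ext_partial s i u)" using H10E[OF assms] .
  then show ?thesis by (rule ext_partial_AE(2))
qed

lemma ext_partial_cong_AE:
  assumes "u \<in> H10 s" "u' \<in> H10 s" "AE z in lebesgue_on disk. u z = u' z"
  shows "AE z in lebesgue_on disk. ext_partial s i u z = ext_partial s i u' z"
proof -
  have "AE z in disk_measure s. ext_partial s i u z = 1 * ext_partial s i u' z + 0 * ext_partial s i u' z"
    by (rule ext_partial_lin_AE[OF assms(2,2,1)]) (use assms(3) in \<open>simp add: AE_disk_measure\<close>)
  then show ?thesis unfolding AE_disk_measure by simp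
qed

lemma AE_nabla:
  assumes H: "\<And>J. length J = n \<Longrightarrow> (\<lambda>z. q z J) \<in> H10 s" and uv: "u \<in> H10 s" "v \<in> H10 s"
    and q: "\<And>J. length J = n \<Longrightarrow> AE z in lebesgue_on disk. q z J = u z * covector_power n dz J + v z * covector_power n dzbar J"
  shows "AE z in lebesgue_on disk. \<forall>i J. length J = n \<longrightarrow>
    nabla s q z (i # J) = ext_partial s i u z * covector_power n dz J + ext_partial s i v z * covector_power n dzbar J"
proof -
  have "AE z in lebesgue_on disk. \<forall>J\<in>{J. length J = n}.
    nabla s q z (i # J) = ext_partial s i u z * covector_power n dz J + ext_partial s i v z * covector_power n dzbar J" for i
  proof (rule AE_finite_allI)
    show "finite {J :: coord list. length J = n}" by simp
    fix J :: "coord list" assume "J \<in> {J. length J = n}"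
    then have J: "length J = n" by simp
    have "AE z in disk_measure s. ext_partial s i (\<lambda>w. q w J) z = covector_power n dz J * ext_partial s i u z + covector_power n dzbar J * ext_partial s i v z"
      by (rule ext_partial_lin_AE[OF uv H[OF J]]) (use q[OF J] in \<open>simp add: AE_disk_measure mult.commute\<close>)
    then show "AE z in lebesgue_on disk. nabla s q z (i # J) = ext_partial s i u z * covector_power n dz J + ext_partial s i v z * covector_power n dzbar J"
      unfolding AE_disk_measure by eventually_elim (simp add: nabla_def mult.commute)
  qed
  from this[of CX] this[of CY] show ?thesis
  proof eventually_elim
    case (elim z)
    show ?case
    proof (intro allI impI)
      fix i and J :: "coord list" assume "length J = n"
      then show "nabla s q z (i # J) = ext_partial s i u z * covector_power n dz J + ext_partial s i v z * covector_power n dzbar J"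
        using elim by (cases i) auto
    qed
  qed
qed

lemma covector_combination:
  "x * covector_power n dz J + y * covector_power n dzbar J
    = tensor_of_coefs n (\<lambda>k. x * (if k = 0 then 1 else 0) + y * (if k = n then 1 else 0)) J"
  unfolding covector_power_dz covector_power_dzbar by (rule tensor_of_coefs_lin[symmetric])

text \<open>Being trace-free kills all coefficients but the two extreme ones; for \<open>n = 1\<close> there are no others.\<close>

lemma trace_free_potential:
  assumes n: "1 \<le> n" and q: "q \<in> H10_sym s n \<inter> ker_tr n"
  defines "u \<equiv> \<lambda>z. coefs_of_tensor n (q z) 0" and "v \<equiv> \<lambda>z. coefs_of_tensor n (q z) n"
  shows "u \<in> H10 s" "v \<in> H10 s"
    "AE z in lebesgue_on disk. \<forall>J. q z J = u z * covector_power n dz J + v z * covector_power n dzbar J"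
proof -
  have H: "\<And>J. length J = n \<Longrightarrow> (\<lambda>z. q z J) \<in> H10 s" and S: "\<And>z. z \<in> disk \<Longrightarrow> q z \<in> sym_tensors n"
    using q by (auto simp: H10_sym_def)
  show "u \<in> H10 s" "v \<in> H10 s" unfolding u_def v_def
    by (rule coefs_of_tensor_closed[OF H10_add H10_cmult H]; simp)+
  have mid: "AE z in lebesgue_on disk. \<forall>k. 1 \<le> k \<and> k < n \<longrightarrow> coefs_of_tensor n (q z) k = 0"
  proof (cases "n \<ge> 2")
    case True
    have "AE z in lebesgue_on disk. \<forall>I. length I = n - 2 \<longrightarrow> tr (q z) I = 0"
      using q True by (auto simp: ker_tr_def)
    moreover have "AE z in lebesgue_on disk. z \<in> disk" using AE_space[of "lebesgue_on disk"] by simp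
    ultimately show ?thesis
    proof eventually_elim
      case (elim z)
      then show ?case using ker_tr_iff[OF True, of "coefs_of_tensor n (q z)"] sym_eq_tensor_of_coefs[OF S[OF elim(2)]] by metis
    qed
  qed auto
  moreover have "AE z in lebesgue_on disk. z \<in> disk" using AE_space[of "lebesgue_on disk"] by simp
  ultimately show "AE z in lebesgue_on disk. \<forall>J. q z J = u z * covector_power n dz J + v z * covector_power n dzbar J"
  proof eventually_elim
    case (elim z)
    have "tensor_of_coefs n (coefs_of_tensor n (q z)) = tensor_of_coefs n (\<lambda>k. u z * (if k = 0 then 1 else 0) + v z * (if k = n then 1 else 0))"
    proof (rule tensor_of_coefs_cong)
      fix k assume "k \<le> n"
      then consider "k = 0" | "k = n" | "1 \<le> k \<and> k < n" by linarith
      then show "coefs_of_tensor n (q z) k = u z * (if k = 0 then 1 else 0) + v z * (if k = n then 1 else 0)"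
        using n elim(1) by cases (auto simp: u_def v_def)
    qed
    then show ?case unfolding covector_combination using sym_eq_tensor_of_coefs[OF S[OF elim(2)]] by metis
  qed
qed

text \<open>The tensor equation is equivalent to scalar equations for the coefficients. For a suitable \<open>c\<close> this applies to every
  admissible \<open>q\<close>, \<open>\<lambda>\<close> and \<open>h\<close>, so it serves existence and uniqueness.\<close>

lemma decomposition_AE_iff:
  assumes m: "m \<ge> 2" and f: "f \<in> L2_sym \<gamma> m"
    and H: "\<And>J. length J = m - 1 \<Longrightarrow> (\<lambda>z. q z J) \<in> H10 (- \<gamma>)" and uv: "u \<in> H10 (- \<gamma>)" "v \<in> H10 (- \<gamma>)"
    and q: "AE z in lebesgue_on disk. \<forall>J. q z J = u z * covector_power (m - 1) dz J + v z * covector_power (m - 1) dzbar J"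
    and l: "AE z in lebesgue_on disk. l z = tensor_of_coefs (m - 2) (c z)"
    and h: "\<And>z I. h z I = a z * covector_power m dz I + b z * covector_power m dzbar I"
  shows "(AE z in lebesgue_on disk. \<forall>I. length I = m \<longrightarrow>
        f z I = of_real (dfun z powr (-\<gamma>)) * ds (-\<gamma>) q z I + Lop (l z) I + h z I)
    \<longleftrightarrow> (AE z in lebesgue_on disk. \<forall>k\<le>m. coefs_of_tensor m (f z) k =
        decomposition_coef m (of_real (dfun z powr (-\<gamma>))) (\<lambda>i. ext_partial (- \<gamma>) i u z) (\<lambda>i. ext_partial (- \<gamma>) i v z) (a z) (b z) (c z) k)"
    (is "(AE z in _. ?L z) \<longleftrightarrow> (AE z in _. ?R z)")
proof -
  have N: "AE z in lebesgue_on disk. \<forall>i J. length J = m - 1 \<longrightarrow>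
    nabla (- \<gamma>) q z (i # J) = ext_partial (- \<gamma>) i u z * covector_power (m - 1) dz J + ext_partial (- \<gamma>) i v z * covector_power (m - 1) dzbar J"
    by (rule AE_nabla[OF H uv]) (use q in \<open>auto elim: eventually_mono\<close>)
  have D: "AE z in lebesgue_on disk. z \<in> disk" using AE_space[of "lebesgue_on disk"] by simp
  have "AE z in lebesgue_on disk. ?L z \<longleftrightarrow> ?R z"
    using N D l
  proof eventually_elim
    case (elim z)
    have F: "f z \<in> sym_tensors m" using f elim(2) by (auto simp: L2_sym_def)
    show ?case unfolding ds_def elim(3) h
      by (rule decomposition_iff_coefs[OF m F]) (use elim(1) in blast)
  qed
  then show ?thesis by (auto elim: eventually_elim2)
qed

lemma decomposition_coef_ends:
  assumes "m \<ge> 2"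
  shows "decomposition_coef m \<delta> A B a b c 0 = \<delta> * ((A CX - \<i> * A CY) / 2) + a"
    "decomposition_coef m \<delta> A B a b c m = \<delta> * ((B CX + \<i> * B CY) / 2) + b"
  using assms unfolding decomposition_coef_def by auto

lemma decomposition_coef_middle:
  assumes "1 \<le> k" "k < m"
  shows "decomposition_coef m \<delta> A B a b c k = decomposition_coef m \<delta> A B 0 0 (\<lambda>_. 0) k + of_nat (k * (m - k)) / of_nat (m * (m - 1)) * c (k - 1)"
  using assms unfolding decomposition_coef_def by auto

theorem theorem5:
  fixes \<gamma> :: real and m :: nat and f :: tensor_field
  assumes "-1 < \<gamma>" and "\<gamma> < 1" and "m \<ge> 2"
    and "f \<in> L2_sym \<gamma> m"
  shows "\<exists>q l h. tt_decomposition \<gamma> m f q l h \<and>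
    (\<forall>q' l' h'. tt_decomposition \<gamma> m f q' l' h' \<longrightarrow>
      (AE z in lebesgue_on disk. q' z = q z) \<and>
      (AE z in lebesgue_on disk. l' z = l z) \<and>
      (AE z in lebesgue_on disk. h' z = h z))"
proof -
  define \<delta> where "\<delta> z = complex_of_real (dfun z powr (- \<gamma>))" for z
  note m = assms(3)
  have fI: "\<And>I. length I = m \<Longrightarrow> (\<lambda>z. f z I) \<in> L2 \<gamma>" using assms(4) by (simp add: L2_sym_def)
  have F: "(\<lambda>z. coefs_of_tensor m (f z) k) \<in> L2 \<gamma>" if "k \<le> m" for k
    by (rule coefs_of_tensor_closed[OF L2_add L2_cmult fI that])
  have \<delta>L: "(\<lambda>z. \<delta> z * e z) \<in> L2 \<gamma>" if "e \<in> L2 (- \<gamma>)" for e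
    unfolding \<delta>_def L2_eq_sq_integrable by (rule sq_integrable_weight) (use that in \<open>simp add: L2_eq_sq_integrable\<close>)
  have D: "AE z in lebesgue_on disk. z \<in> disk" using AE_space[of "lebesgue_on disk"] by simp
  have cnj_dhol: "AE z in lebesgue_on disk. cnj (ext_dhol (- \<gamma>) (\<lambda>z. cnj (u z)) z)
      = (ext_partial (- \<gamma>) CX u z + \<i> * ext_partial (- \<gamma>) CY u z) / 2" if u: "u \<in> H10 (- \<gamma>)" for u
    using ext_partial_cnj_AE[OF u, of CX, unfolded AE_disk_measure] ext_partial_cnj_AE[OF u, of CY, unfolded AE_disk_measure]
    by eventually_elim (simp add: ext_dhol_def)
  have \<delta>_cnj: "cnj (\<delta> z) = \<delta> z" for z by (simp add: \<delta>_def)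

  obtain u a where u: "u \<in> H10 (- \<gamma>)" and a: "a \<in> L2 \<gamma>" "a holomorphic_on ball 0 1"
    and ua: "AE z in lebesgue_on disk. coefs_of_tensor m (f z) 0 = \<delta> z * ext_dhol (- \<gamma>) u z + a z"
    using scalar_decomposition_exists[OF assms(1) F[of 0]] unfolding \<delta>_def by blast
  have "(\<lambda>z. cnj (coefs_of_tensor m (f z) m)) \<in> L2 \<gamma>" using sq_integrable_cnj F[of m] unfolding L2_eq_sq_integrable by blast
  then obtain v' b' where v': "v' \<in> H10 (- \<gamma>)" and b': "b' \<in> L2 \<gamma>" "b' holomorphic_on ball 0 1"
    and vb': "AE z in lebesgue_on disk. cnj (coefs_of_tensor m (f z) m) = \<delta> z * ext_dhol (- \<gamma>) v' z + b' z"
    using scalar_decomposition_exists[OF assms(1)] unfolding \<delta>_def by blast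
  \<comment> \<open>Conjugation turns the holomorphic problem for \<open>cnj f\<^sub>m\<close> into the antiholomorphic one for \<open>f\<^sub>m\<close>.\<close>
  define v b where "v = (\<lambda>z. cnj (v' z))" and "b = (\<lambda>z. cnj (b' z))"
  have v: "v \<in> H10 (- \<gamma>)" unfolding v_def by (rule H10_cnj[OF v'])
  have b: "b \<in> L2 \<gamma>" "(\<lambda>z. cnj (b z)) holomorphic_on ball 0 1"
    unfolding b_def using sq_integrable_cnj b' unfolding L2_eq_sq_integrable by auto
  have vb: "AE z in lebesgue_on disk. coefs_of_tensor m (f z) m = \<delta> z * ((ext_partial (- \<gamma>) CX v z + \<i> * ext_partial (- \<gamma>) CY v z) / 2) + b z"
    using vb' cnj_dhol[OF v]
  proof eventually_elim
    case (elim z)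
    have "coefs_of_tensor m (f z) m = cnj (\<delta> z * ext_dhol (- \<gamma>) v' z + b' z)" unfolding elim(1)[symmetric] by simp
    then show ?case unfolding elim(2)[symmetric] by (simp add: v_def b_def \<delta>_cnj)
  qed

  have solve: "x = y + p / r * w \<longleftrightarrow> w = r / p * (x - y)" if "p \<noteq> 0" "r \<noteq> 0" for x y p r w :: complex
    using that by (auto simp: field_simps)
  define Z where "Z z k = decomposition_coef m (\<delta> z) (\<lambda>i. ext_partial (- \<gamma>) i u z) (\<lambda>i. ext_partial (- \<gamma>) i v z) 0 0 (\<lambda>_. 0) k" for z k
  \<comment> \<open>The equations at \<open>k = j + 1\<close> solved for the coefficients of \<open>\<lambda>\<close>; the index shifts because \<open>L\<close> multiplies by \<open>t\<close>.\<close>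
  define c where "c z j = of_nat (m * (m - 1)) / of_nat (Suc j * (m - Suc j)) * (coefs_of_tensor m (f z) (Suc j) - Z z (Suc j))" for z j
  define q where "q z J = u z * covector_power (m - 1) dz J + v z * covector_power (m - 1) dzbar J" for z J
  define l where "l z = tensor_of_coefs (m - 2) (c z)" for z
  define h where "h = (\<lambda>z I. a z * covector_power m dz I + b z * covector_power m dzbar I)"

  have qH: "(\<lambda>z. q z J) \<in> H10 (- \<gamma>)" for J
    using H10_lin[OF u v, of "covector_power (m - 1) dz J" "covector_power (m - 1) dzbar J"]
    by (simp add: q_def mult.commute)
  have qz: "q z = tensor_of_coefs (m - 1) (\<lambda>k. u z * (if k = 0 then 1 else 0) + v z * (if k = m - 1 then 1 else 0))" for z
    unfolding q_def covector_combination by (rule ext) simp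
  have q_mem: "q \<in> H10_sym (- \<gamma>) (m - 1) \<inter> ker_tr (m - 1)"
  proof
    show "q \<in> H10_sym (- \<gamma>) (m - 1)" unfolding H10_sym_def using qH qz tensor_of_coefs_sym by simp
    show "q \<in> ker_tr (m - 1)" unfolding ker_tr_def qz using ker_tr_iff[of "m - 1"] by simp
  qed
  have cL: "(\<lambda>z. c z j) \<in> L2 \<gamma>" if "j \<le> m - 2" for j
  proof -
    have e: "(\<lambda>z. \<delta> z * ((ext_partial (- \<gamma>) CX w z + x * ext_partial (- \<gamma>) CY w z) / 2) / of_nat m) \<in> L2 \<gamma>" if w: "w \<in> H10 (- \<gamma>)" for w x
    proof -
      have "(\<lambda>z. (1 / of_nat m) * (\<delta> z * ((1/2) * ext_partial (- \<gamma>) CX w z + (x/2) * ext_partial (- \<gamma>) CY w z))) \<in> L2 \<gamma>"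
        by (intro L2_cmult \<delta>L L2_add H10_ext_partial_L2 w)
      then show ?thesis by (simp add: add_divide_distrib)
    qed
    have "(\<lambda>z. Z z (Suc j)) \<in> L2 \<gamma>"
    proof -
      have "(\<lambda>z. (if Suc j = 1 then 1 else 0) * (\<delta> z * ((ext_partial (- \<gamma>) CX u z + \<i> * ext_partial (- \<gamma>) CY u z) / 2) / of_nat m)
          + (if Suc j = m - 1 then 1 else 0) * (\<delta> z * ((ext_partial (- \<gamma>) CX v z + (- \<i>) * ext_partial (- \<gamma>) CY v z) / 2) / of_nat m)) \<in> L2 \<gamma>"
        by (intro L2_add L2_cmult e u v)
      also have "(\<lambda>z. (if Suc j = 1 then 1 else 0) * (\<delta> z * ((ext_partial (- \<gamma>) CX u z + \<i> * ext_partial (- \<gamma>) CY u z) / 2) / of_nat m)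
          + (if Suc j = m - 1 then 1 else 0) * (\<delta> z * ((ext_partial (- \<gamma>) CX v z + (- \<i>) * ext_partial (- \<gamma>) CY v z) / 2) / of_nat m))
          = (\<lambda>z. Z z (Suc j))"
        using that m unfolding Z_def decomposition_coef_def by (auto simp: fun_eq_iff)
      finally show ?thesis .
    qed
    from L2_cmult[OF L2_add[OF F[of "Suc j"] L2_cmult[OF this, of "-1"]], of "of_nat (m * (m - 1)) / of_nat (Suc j * (m - Suc j))"]
    show ?thesis using that m unfolding c_def by simp
  qed
  have l_mem: "l \<in> L2_sym \<gamma> (m - 2)"
    unfolding L2_sym_def l_def
  proof (intro CollectI conjI ballI allI impI tensor_of_coefs_sym)
    fix I :: "coord list" assume I: "length I = m - 2"
    show "(\<lambda>z. tensor_of_coefs (m - 2) (c z) I) \<in> L2 \<gamma>"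
      unfolding I[symmetric] by (rule tensor_of_coefs_closed[OF L2_add L2_cmult]) (use cL I in auto)
  qed
  have h_mem: "h \<in> L2_tt \<gamma> m" unfolding L2_tt_def h_def using a b by blast
  have dec: "tt_decomposition \<gamma> m f q l h"
    unfolding tt_decomposition_def
  proof (intro conjI q_mem l_mem h_mem)
    show "AE z in lebesgue_on disk. \<forall>I. length I = m \<longrightarrow>
        f z I = of_real (dfun z powr (-\<gamma>)) * ds (-\<gamma>) q z I + Lop (l z) I + h z I"
    proof (rule decomposition_AE_iff[where c = c and a = a and b = b, THEN iffD2, OF m assms(4) qH u v])
      show "AE z in lebesgue_on disk. \<forall>k\<le>m. coefs_of_tensor m (f z) k =
        decomposition_coef m (of_real (dfun z powr (-\<gamma>))) (\<lambda>i. ext_partial (- \<gamma>) i u z) (\<lambda>i. ext_partial (- \<gamma>) i v z) (a z) (b z) (c z) k"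
        using ua vb
      proof eventually_elim
        case (elim z)
        show ?case
        proof (intro allI impI)
          fix k assume "k \<le> m"
          then consider "k = 0" | "k = m" | "1 \<le> k" "k < m" by linarith
          then show "coefs_of_tensor m (f z) k =
            decomposition_coef m (of_real (dfun z powr (-\<gamma>))) (\<lambda>i. ext_partial (- \<gamma>) i u z) (\<lambda>i. ext_partial (- \<gamma>) i v z) (a z) (b z) (c z) k"
          proof cases
            case 1 then show ?thesis using elim(1) unfolding 1 decomposition_coef_ends(1)[OF m] \<delta>_def ext_dhol_def by simp
          next
            case 2 then show ?thesis using elim(2) unfolding 2 decomposition_coef_ends(2)[OF m] \<delta>_def by simp
          next
            case 3
            then obtain j where j: "k = Suc j" by (cases k) simp_all
            have n0: "of_nat (k * (m - k)) \<noteq> (0::complex)" "of_nat (m * (m - 1)) \<noteq> (0::complex)"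
              using 3 m unfolding of_nat_eq_0_iff by simp_all
            show ?thesis
              by (subst decomposition_coef_middle[OF 3], unfold \<delta>_def[symmetric] Z_def[symmetric] j c_def diff_Suc_1)
                (rule solve[OF n0[unfolded j], THEN iffD2, OF refl])
          qed
        qed
      qed
    qed (simp_all add: q_def l_def h_def)
  qed
  have uniq: "(AE z in lebesgue_on disk. q' z = q z) \<and> (AE z in lebesgue_on disk. l' z = l z) \<and> (AE z in lebesgue_on disk. h' z = h z)"
    if dec': "tt_decomposition \<gamma> m f q' l' h'" for q' l' h'
  proof -
    have q': "q' \<in> H10_sym (- \<gamma>) (m - 1) \<inter> ker_tr (m - 1)" and l': "l' \<in> L2_sym \<gamma> (m - 2)" and h': "h' \<in> L2_tt \<gamma> m"
      and eq': "AE z in lebesgue_on disk. \<forall>I. length I = m \<longrightarrow>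
        f z I = of_real (dfun z powr (-\<gamma>)) * ds (-\<gamma>) q' z I + Lop (l' z) I + h' z I"
      using dec' by (auto simp: tt_decomposition_def)
    define u2 v2 where "u2 = (\<lambda>z. coefs_of_tensor (m - 1) (q' z) 0)" and "v2 = (\<lambda>z. coefs_of_tensor (m - 1) (q' z) (m - 1))"
    have m1: "1 \<le> m - 1" using m by simp
    note tp = trace_free_potential(1,2)[OF m1 q', folded u2_def v2_def]
    have tp3: "AE z in lebesgue_on disk. \<forall>J. q' z J = u2 z * covector_power (m - 1) dz J + v2 z * covector_power (m - 1) dzbar J"
      using trace_free_potential(3)[OF m1 q'] by (simp only: u2_def v2_def)
    define c2 where "c2 z = coefs_of_tensor (m - 2) (l' z)" for z
    have lz: "AE z in lebesgue_on disk. l' z = tensor_of_coefs (m - 2) (c2 z)"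
      using D
    proof eventually_elim
      case (elim z)
      then have "l' z \<in> sym_tensors (m - 2)" using l' by (auto simp: L2_sym_def)
      then show ?case unfolding c2_def by (rule sym_eq_tensor_of_coefs)
    qed
    obtain a2 b2 where a2: "a2 \<in> L2 \<gamma>" "a2 holomorphic_on ball 0 1" and b2: "b2 \<in> L2 \<gamma>" "(\<lambda>z. cnj (b2 z)) holomorphic_on ball 0 1"
      and h2: "h' = (\<lambda>z I. a2 z * covector_power m dz I + b2 z * covector_power m dzbar I)"
      using h' unfolding L2_tt_def by blast
    have qH': "\<And>J. length J = m - 1 \<Longrightarrow> (\<lambda>z. q' z J) \<in> H10 (- \<gamma>)" using q' by (simp add: H10_sym_def)
    have R2: "AE z in lebesgue_on disk. \<forall>k\<le>m. coefs_of_tensor m (f z) k =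
        decomposition_coef m (\<delta> z) (\<lambda>i. ext_partial (- \<gamma>) i u2 z) (\<lambda>i. ext_partial (- \<gamma>) i v2 z) (a2 z) (b2 z) (c2 z) k"
      unfolding \<delta>_def
      by (rule decomposition_AE_iff[THEN iffD1, OF m assms(4) qH' tp tp3 lz fun_cong[OF fun_cong[OF h2]] eq'])
    have ue: "AE z in lebesgue_on disk. u z = u2 z" "AE z in lebesgue_on disk. a z = a2 z"
    proof -
      have "AE z in lebesgue_on disk. complex_of_real (dfun z powr (- \<gamma>)) * ext_dhol (- \<gamma>) u z + a z
          = complex_of_real (dfun z powr (- \<gamma>)) * ext_dhol (- \<gamma>) u2 z + a2 z"
        using ua R2
      proof eventually_elim
        case (elim z)
        have "coefs_of_tensor m (f z) 0 = \<delta> z * ext_dhol (- \<gamma>) u2 z + a2 z"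
          using elim(2)[rule_format, of 0] unfolding decomposition_coef_ends(1)[OF m] ext_dhol_def by simp
        then show ?case using elim(1) unfolding \<delta>_def by simp
      qed
      from scalar_decomposition_unique[OF assms(1) u tp(1) a a2 this]
      show "AE z in lebesgue_on disk. u z = u2 z" "AE z in lebesgue_on disk. a z = a2 z" .
    qed
    have ve: "AE z in lebesgue_on disk. cnj (v z) = cnj (v2 z)" "AE z in lebesgue_on disk. cnj (b z) = cnj (b2 z)"
    proof -
      have "AE z in lebesgue_on disk. complex_of_real (dfun z powr (- \<gamma>)) * ext_dhol (- \<gamma>) (\<lambda>z. cnj (v z)) z + cnj (b z)
          = complex_of_real (dfun z powr (- \<gamma>)) * ext_dhol (- \<gamma>) (\<lambda>z. cnj (v2 z)) z + cnj (b2 z)"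
        using vb R2 cnj_dhol[OF v] cnj_dhol[OF tp(2)]
      proof eventually_elim
        case (elim z)
        have "coefs_of_tensor m (f z) m = \<delta> z * cnj (ext_dhol (- \<gamma>) (\<lambda>z. cnj (v2 z)) z) + b2 z"
          using elim(2)[rule_format, of m] unfolding decomposition_coef_ends(2)[OF m] elim(4) by simp
        moreover have "coefs_of_tensor m (f z) m = \<delta> z * cnj (ext_dhol (- \<gamma>) (\<lambda>z. cnj (v z)) z) + b z"
          using elim(1) unfolding elim(3) .
        ultimately have "cnj (\<delta> z * cnj (ext_dhol (- \<gamma>) (\<lambda>z. cnj (v z)) z) + b z) = cnj (\<delta> z * cnj (ext_dhol (- \<gamma>) (\<lambda>z. cnj (v2 z)) z) + b2 z)"
          by simp
        then show ?case unfolding complex_cnj_add complex_cnj_mult complex_cnj_cnj \<delta>_cnj unfolding \<delta>_def .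
      qed
      moreover have "(\<lambda>z. cnj (b z)) \<in> L2 \<gamma>" "(\<lambda>z. cnj (b2 z)) \<in> L2 \<gamma>" using sq_integrable_cnj b(1) b2(1) unfolding L2_eq_sq_integrable by blast+
      ultimately show "AE z in lebesgue_on disk. cnj (v z) = cnj (v2 z)" "AE z in lebesgue_on disk. cnj (b z) = cnj (b2 z)"
        using scalar_decomposition_unique[OF assms(1) H10_cnj[OF v] H10_cnj[OF tp(2)] _ b(2) _ b2(2)] by blast+
    qed
    have ve': "AE z in lebesgue_on disk. v z = v2 z" using ve(1) by simp
    have be: "AE z in lebesgue_on disk. b z = b2 z" using ve(2) by simp
    have 1: "AE z in lebesgue_on disk. q' z = q z"
      using tp3 ue(1) ve'
    proof eventually_elim
      case (elim z) then show ?case by (simp add: fun_eq_iff q_def)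
    qed
    have 3: "AE z in lebesgue_on disk. h' z = h z"
      using ue(2) be by eventually_elim (simp add: h2 h_def)
    have 2: "AE z in lebesgue_on disk. l' z = l z"
      using R2 lz ext_partial_cong_AE[OF u tp(1) ue(1), of CX] ext_partial_cong_AE[OF u tp(1) ue(1), of CY]
        ext_partial_cong_AE[OF v tp(2) ve', of CX] ext_partial_cong_AE[OF v tp(2) ve', of CY]
    proof eventually_elim
      case (elim z)
      have "(\<lambda>i. ext_partial (- \<gamma>) i u2 z) = (\<lambda>i. ext_partial (- \<gamma>) i u z)" "(\<lambda>i. ext_partial (- \<gamma>) i v2 z) = (\<lambda>i. ext_partial (- \<gamma>) i v z)"
        by (rule ext, case_tac i, use elim in simp_all)+
      note R = elim(1)[unfolded this]
      have "c2 z j = c z j" if j: "j \<le> m - 2" for j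
      proof -
        have k: "1 \<le> Suc j" "Suc j < m" using j m by auto
        have n0: "of_nat (Suc j * (m - Suc j)) \<noteq> (0::complex)" "of_nat (m * (m - 1)) \<noteq> (0::complex)"
          using k m unfolding of_nat_eq_0_iff by auto
        have "coefs_of_tensor m (f z) (Suc j) = Z z (Suc j) + of_nat (Suc j * (m - Suc j)) / of_nat (m * (m - 1)) * c2 z j"
          unfolding Z_def R[rule_format, OF less_imp_le[OF k(2)]]
          by (subst decomposition_coef_middle[OF k], unfold diff_Suc_1) (rule refl)
        then show ?thesis unfolding c_def by (rule solve[OF n0, THEN iffD1])
      qed
      then have "tensor_of_coefs (m - 2) (c2 z) = tensor_of_coefs (m - 2) (c z)" by (rule tensor_of_coefs_cong)
      then show ?case unfolding elim(2) l_def .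
    qed
    show ?thesis using 1 2 3 by blast
  qed
  show ?thesis using dec uniq by blast
qed

end
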